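(* Let $d,k$ be positive integers with $(d,k)\neq(1,1)$, and put $s_c:=\frac d2-\frac1k\ (\ge 0)$, $s_e:=\frac{d(2k-1)}{2(2k+1)}$. Let $\mathcal{A}\subset(\mathbb{Z}^d)^{2k+1}$, $\Phi$ and $\varepsilon(k)$ be as defined in the context, and let $\mathcal{A}^c$ be the complement of $\mathcal{A}$. All sums below run over $(n_1,\dots,n_{2k+1})\in(\mathbb{Z}^d)^{2k+1}$ with $n=n_1-n_2+n_3-\dots-n_{2k}+n_{2k+1}$ (abbreviated $\sum_{(n)}$), and norms on the left are taken with respect to $n\in\mathbb{Z}^d$. (i) For any $s_1>s_c$ and $s_2>d/2$, $$\text{(B1)}\quad \sup_{\mu\in\mathbb{Z}}\Big\|\sum_{(n)}\mathbf{1}_{\{\Phi=\mu\}}\prod_{l=1}^{2k+1}\omega_l(n_l)\Big\|_{\ell^2_{s_1}}\lesssim\prod_{l=1}^{2k+1}\|\omega_l\|_{\ell^2_{s_1}},$$ $$\text{(B1)'}\quad \Big\|\sum_{(n)}\prod_{l=1}^{2k+1}\omega_l(n_l)\Big\|_{\ell^2_{s_2}}\lesssim\prod_{l=1}^{2k+1}\|\omega_l\|_{\ell^2_{s_2}}.$$ (ii) Let $s>s_c$ satisfy: $s>\frac{3d-2}{10}$ if $k=1$ and $d\in\{2,3\}$; and $s\ge s_e$ if $k\ge2$ or $d\ge4$. Define $s_2:=\max\{\frac d2,s\}+1$, and $s_1\in(s_c,s)$, $r\in[2,\infty]$, $\sigma\in[-s,0]$ by $$[s_1,r,\sigma]:=\begin{cases}\big[\frac{s+s_c}{2},\,2,\,-s_c\big]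 & \text{if } d\ge2+\frac2k,\\[3pt] \big[\max\{\frac{s+s_c}{2},\,s_e-\frac12\varepsilon(k)\},\,\infty,\,0\big] & \text{if } d\in\{1,2\}\text{ and }k\ge2,\\[3pt] \big[\frac12\big(s+\frac{3d-2}{10}\big),\,\frac{10}{2d-3},\,-\frac{(2d-3)(d-2)}{10}\big] & \text{if } d\in\{2,3\}\text{ and }k=1.\end{cases}$$ Then $$\text{(R)}\quad \Big\|\sum_{(n)}\mathbf{1}_{\mathcal{A}}\prod_{l=1}^{2k+1}\omega_l(n_l)\Big\|_{\ell^2_s}\lesssim\prod_{l=1}^{2k+1}\|\omega_l\|_{\ell^2_s},$$ $$\text{(B2)}\quad \sup_{\mu\in\mathbb{Z}}\Big\|\sum_{(n)}\mathbf{1}_{\mathcal{A}^c\cap\{\Phi=\mu\}}\prod_{l=1}^{2k+1}\omega_l(n_l)\Big\|_{\ell^r_\sigma}\lesssim\min_{1\le q\le2k+1}\|\omega_q\|_{\ell^r_\sigma}\prod_{\substack{l=1\\ l\ne q}}^{2k+1}\|\omega_l\|_{\ell^2_{s_1}},$$ $$\text{(B2)'}\quad \Big\|\sum_{(n)}\mathbf{1}_{\mathcal{A}^c}\prod_{l=1}^{2k+1}\omega_l(n_l)\Big\|_{\ell^r_\sigma}\lesssim\min_{1\le q\le2k+1}\|\omega_q\|_{\ell^r_\sigma}\prod_{\substack{l=1\\ l\ne q}}^{2k+1}\|\omega_l\|_{\ell^2_{s_2}},$$ $$\text{(B3)}\quad \Big\|\sum_{(n)}\mathbf{1}_{\ma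thcal{A}^c}\prod_{l=1}^{2k+1}\omega_l(n_l)\Big\|_{\ell^r_\sigma}\lesssim\prod_{l=1}^{2k+1}\|\omega_l\|_{\ell^2_s}.$$
   Context: Notation. $\langle n\rangle:=(1+|n|^2)^{1/2}$; for $p\in[1,\infty]$ and $s\in\mathbb{R}$, $\|\omega\|_{\ell^p_s}:=\|\langle\cdot\rangle^s\omega(\cdot)\|_{\ell^p(\mathbb{Z}^d)}$. The phase is $$\Phi=\Phi(n,n_1,\dots,n_{2k+1}):=|n|^2-|n_1|^2+|n_2|^2-\dots+|n_{2k}|^2-|n_{2k+1}|^2.$$ $\mathbf{1}_E$ is the indicator of the set (or condition) $E$ on $(n_1,\dots,n_{2k+1})$. The notation $X\lesssim Y$ means $X\le CY$ with a constant $C$ depending only on $d,k$ and the regularity exponents involved, uniform in all functions $\omega_1,\dots,\omega_{2k+1}:\mathbb{Z}^d\to\mathbb{C}$ for which the right-hand side is finite. The constant: $\varepsilon(k):=\frac12\min\{\frac{1}{k(2k+1)},\ \frac35-\frac{9}{16},\ \frac{2k+3}{4k(2k+1)},\ \frac{3}{10}-\frac16\}>0$. The set $\mathcal{A}\subset(\mathbb{Z}^d)^{2k+1}$: - If $d\ge2+\frac2k$ (i.e. $d\ge4$, or $d=3$ and $k\ge2$), $\mathcal{A}:=\emptyset$. - If $k=1$ and $d\in\{2,3\}$, $\mathcal{A}:=\{(n_1,n_2,n_3)\in(\mathbb{Z}^d)^3: n_2=n_1\text{ or }n_2=n_3\}$. - If $k\ge2$ and $d\in\{1,2\}$, fix a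 linear order $\succeq$ on $\mathbb{Z}^d$ such that $n_1\succeq n_2$ implies $|n_1|\ge|n_2|$ (for instance $n_1\succeq n_2$ iff $|n_1|>|n_2|$, or $|n_1|=|n_2|$ and $n_1\ge n_2$ lexicographically). For $(n_l)_{l=1}^{2k+1}\in(\mathbb{Z}^d)^{2k+1}$ let $n_{[m]}$ be the $m$-th largest (counted with multiplicity) among $n_1,\dots,n_{2k+1}$ in the order $\succeq$. Let $\mathcal{A}_1:=\{(n_l)_{l=1}^{2k+1}: n_{[1]}=n_{[2]}\}$, $\mathcal{A}_2:=\{(n_l)_{l=1}^{2k+1}: n_{[2]}=n_{[3]}\}$, $\mathcal{A}_3:=\{(n_l)_{l=1}^{2k+1}: n_{[3]}=n_{[4]}\text{ and }\langle n_{[2]}\rangle\le\langle n_{[3]}\rangle^{3/2}\}$. Then $\mathcal{A}:=\mathcal{A}_1\cup\mathcal{A}_2$ if $k\ge3$ or $d=1$, and $\mathcal{A}:=\mathcal{A}_1\cup\mathcal{A}_2\cup\mathcal{A}_3$ if $k=2$ and $d=2$. *)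

theory Defs
  imports "HOL-Analysis.Analysis" "HOL-Library.Multiset"
begin

text \<open>
  The lattice \<open>\<int>\<^sup>d\<close> is the type \<open>int ^ 'd\<close> with \<open>d = CARD('d)\<close>. A tuple \<open>(n\<^sub>1, \<dots>, n\<^sub>2\<^sub>k\<^sub>+\<^sub>1)\<close>
  is an extensional function on \<open>{1..2*k+1}\<close>.
\<close>

definition zabs :: "int ^ 'd \<Rightarrow> real" where
  "zabs n = norm (\<chi> i. real_of_int (n $ i))"

definition bracket :: "int ^ 'd \<Rightarrow> real" where
  "bracket n = sqrt (1 + (zabs n)\<^sup>2)"

text \<open>
  The value \<open>\<infinity>\<close> means that \<open>\<omega>\<close> does not belong to the space. The definition is meant for
  \<open>1 \<le> p \<le> \<infinity>\<close>.
\<close>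

definition lnorm :: "ennreal \<Rightarrow> real \<Rightarrow> (int ^ 'd \<Rightarrow> complex) \<Rightarrow> ennreal" where
  "lnorm p s \<omega> =
     (if p = \<infinity> then (SUP n. ennreal (bracket n powr s * cmod (\<omega> n)))
      else
        (let q = enn2real p;
             I = (\<integral>\<^sup>+ n. ennreal ((bracket n powr s * cmod (\<omega> n)) powr q) \<partial>count_space UNIV)
         in if I = \<infinity> then \<infinity> else ennreal (enn2real I powr (1 / q))))"

definition tuples :: "nat \<Rightarrow> (nat \<Rightarrow> int ^ 'd) set" where
  "tuples k = {1..2*k+1} \<rightarrow>\<^sub>E UNIV"

definition altsum :: "nat \<Rightarrow> (nat \<Rightarrow> int ^ 'd) \<Rightarrow> int ^ 'd" where
  "altsum k m = (\<Sum>l=1..2*k+1. (-1) ^ (l + 1) *s m l)"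

definition phase :: "nat \<Rightarrow> int ^ 'd \<Rightarrow> (nat \<Rightarrow> int ^ 'd) \<Rightarrow> real" where
  "phase k n m = (zabs n)\<^sup>2 + (\<Sum>l=1..2*k+1. (-1) ^ l * (zabs (m l))\<^sup>2)"

text \<open>
  The phase is only ever evaluated on \<open>n = n\<^sub>1 - n\<^sub>2 + \<dots> + n\<^sub>2\<^sub>k\<^sub>+\<^sub>1\<close>, so that \<open>\<Phi> = \<mu>\<close> is a condition on
  the tuple alone.
\<close>

definition phase_set :: "nat \<Rightarrow> int \<Rightarrow> (nat \<Rightarrow> int ^ 'd) set" where
  "phase_set k \<mu> = {m. phase k (altsum k m) m = of_int \<mu>}"

definition summand :: "nat \<Rightarrow> (nat \<Rightarrow> int ^ 'd) set \<Rightarrow> (nat \<Rightarrow> int ^ 'd \<Rightarrow> complex) \<Rightarrow>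
    (nat \<Rightarrow> int ^ 'd) \<Rightarrow> complex" where
  "summand k E \<omega> m = indicator E m * (\<Prod>l=1..2*k+1. \<omega> l (m l))"

definition multisum :: "nat \<Rightarrow> (nat \<Rightarrow> int ^ 'd) set \<Rightarrow> (nat \<Rightarrow> int ^ 'd \<Rightarrow> complex) \<Rightarrow>
    int ^ 'd \<Rightarrow> complex" where
  "multisum k E \<omega> n = (\<Sum>\<^sub>\<infinity>m\<in>{m \<in> tuples k. altsum k m = n}. summand k E \<omega> m)"

text \<open>
  \<open>infsum\<close> returns \<open>0\<close> for families that are not summable; estimates for \<^const>\<open>multisum\<close> are
  therefore stated together with absolute convergence of the sums.
\<close>

definition converges :: "nat \<Rightarrow> (nat \<Rightarrow> int ^ 'd) set \<Rightarrow> (nat \<Rightarrow> int ^ 'd \<Rightarrow> complex) \<Rightarrow> bool" where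
  "converges k E \<omega> \<longleftrightarrow>
     (\<forall>n. (\<lambda>m. norm (summand k E \<omega> m)) summable_on {m \<in> tuples k. altsum k m = n})"

text \<open>Here \<open>(a, b) \<in> R\<close> stands for \<open>a \<succeq> b\<close>.\<close>

definition size_order :: "(int ^ 'd) rel \<Rightarrow> bool" where
  "size_order R \<longleftrightarrow> linear_order R \<and> (\<forall>a b. (a, b) \<in> R \<longrightarrow> zabs a \<ge> zabs b)"

lemma size_order_exists: "\<exists>R :: (int ^ 'd) rel. size_order R"
proof -
  obtain L :: "(int ^ 'd) rel" where "well_order_on UNIV L"
    using well_order_on[of UNIV] by (rule exE)
  then have L: "linear_order L"
    unfolding well_order_on_def by (rule conjunct1)
  let ?R = "{(a, b). zabs a > zabs b \<or> (zabs a = zabs b \<and> (a, b) \<in> L)}"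
  have tL: "(a, c) \<in> L" if "(a, b) \<in> L" "(b, c) \<in> L" for a b c
    using L that unfolding linear_order_on_def partial_order_on_def preorder_on_def
    by (meson transD)
  have aL: "a = b" if "(a, b) \<in> L" "(b, a) \<in> L" for a b
    using L that unfolding linear_order_on_def partial_order_on_def by (meson antisymD)
  have rL: "(a, a) \<in> L" for a
    using L unfolding linear_order_on_def partial_order_on_def preorder_on_def
    by (meson UNIV_I refl_onD)
  have totL: "(a, b) \<in> L \<or> (b, a) \<in> L" for a b
    using L rL unfolding linear_order_on_def total_on_def by (metis UNIV_I)
  have "refl ?R"
    by (rule refl_onI) (simp add: rL)
  moreover have "trans ?R"
  proof (rule transI)
    fix a b c assume "(a, b) \<in> ?R" "(b, c) \<in> ?R"
    then show "(a, c) \<in> ?R"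
      using tL[of a b c] by force
  qed
  moreover have "antisym ?R"
  proof (rule antisymI)
    fix a b assume "(a, b) \<in> ?R" "(b, a) \<in> ?R"
    then show "a = b"
      using aL[of a b] by force
  qed
  moreover have "total ?R"
  proof (rule total_onI)
    fix a b show "(a, b) \<in> ?R \<or> (b, a) \<in> ?R"
      using totL[of a b] by force
  qed
  ultimately have "linear_order ?R"
    by (simp add: linear_order_on_def partial_order_on_def preorder_on_def)
  then have "size_order ?R"
    by (auto simp: size_order_def)
  then show ?thesis by blast
qed

definition decreasing_list :: "(int ^ 'd) rel \<Rightarrow> nat \<Rightarrow> (nat \<Rightarrow> int ^ 'd) \<Rightarrow> (int ^ 'd) list" where
  "decreasing_list R k m =
     (THE xs. mset xs = image_mset m (mset_set {1..2*k+1}) \<and> sorted_wrt (\<lambda>a b. (a, b) \<in> R) xs)"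

lemma decreasing_list_ex1:
  assumes "linear_order R"
  shows "\<exists>!xs. mset xs = M \<and> sorted_wrt (\<lambda>a b. (a, b) \<in> R) xs"
proof -
  have trans: "(a, c) \<in> R" if "(a, b) \<in> R" "(b, c) \<in> R" for a b c
    using assms that unfolding linear_order_on_def partial_order_on_def preorder_on_def trans_def
    by blast
  have antisym: "a = b" if "(a, b) \<in> R" "(b, a) \<in> R" for a b
    using assms that unfolding linear_order_on_def partial_order_on_def antisym_def by blast
  have total: "(a, b) \<in> R \<or> (b, a) \<in> R" for a b
    using assms unfolding linear_order_on_def partial_order_on_def preorder_on_def
      total_on_def refl_on_def by (metis UNIV_I)
  interpret linorder "\<lambda>a b. (a, b) \<in> R" "\<lambda>a b. (a, b) \<in> R \<and> (b, a) \<notin> R"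
  proof
    show "((a, b) \<in> R \<and> (b, a) \<notin> R) \<longleftrightarrow> ((a, b) \<in> R \<and> (b, a) \<notin> R)" for a b
      by (rule refl)
    show "(a, a) \<in> R" for a
      using total[of a a] by simp
  qed (fact trans antisym total)+
  obtain ys where ys: "mset ys = M"
    using ex_mset by blast
  show ?thesis
  proof (rule ex1I)
    show "mset (sort_key (\<lambda>x. x) ys) = M \<and> sorted_wrt (\<lambda>a b. (a, b) \<in> R) (sort_key (\<lambda>x. x) ys)"
      using mset_sort[of "\<lambda>x. x" ys] sorted_sort[of ys] ys by simp
    fix xs assume "mset xs = M \<and> sorted_wrt (\<lambda>a b. (a, b) \<in> R) xs"
    then show "xs = sort_key (\<lambda>x. x) ys"
      using properties_for_sort[of xs ys] ys by simp
  qed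
qed

definition nth_largest :: "(int ^ 'd) rel \<Rightarrow> nat \<Rightarrow> nat \<Rightarrow> (nat \<Rightarrow> int ^ 'd) \<Rightarrow> int ^ 'd" where
  "nth_largest R k j m = decreasing_list R k m ! (j - 1)"

definition res1 :: "(int ^ 'd) rel \<Rightarrow> nat \<Rightarrow> (nat \<Rightarrow> int ^ 'd) set" where
  "res1 R k = {m \<in> tuples k. nth_largest R k 1 m = nth_largest R k 2 m}"

definition res2 :: "(int ^ 'd) rel \<Rightarrow> nat \<Rightarrow> (nat \<Rightarrow> int ^ 'd) set" where
  "res2 R k = {m \<in> tuples k. nth_largest R k 2 m = nth_largest R k 3 m}"

definition res3 :: "(int ^ 'd) rel \<Rightarrow> nat \<Rightarrow> (nat \<Rightarrow> int ^ 'd) set" where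
  "res3 R k = {m \<in> tuples k. nth_largest R k 3 m = nth_largest R k 4 m \<and>
     bracket (nth_largest R k 2 m) \<le> bracket (nth_largest R k 3 m) powr (3/2)}"

text \<open>The set \<open>\<A>\<close>; it is not specified in the excluded case \<open>d = k = 1\<close>.\<close>

definition res_set :: "(int ^ 'd) rel \<Rightarrow> nat \<Rightarrow> (nat \<Rightarrow> int ^ 'd) set" where
  "res_set R k =
     (let d = CARD('d) in
      if real d \<ge> 2 + 2 / real k then {}
      else if k = 1 \<and> d \<in> {2, 3} then {m \<in> tuples k. m 2 = m 1 \<or> m 2 = m 3}
      else if k \<ge> 2 \<and> d \<in> {1, 2} then
        (if k \<ge> 3 \<or> d = 1 then res1 R k \<union> res2 R k else res1 R k \<union> res2 R k \<union> res3 R k)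
      else undefined)"

definition eps :: "nat \<Rightarrow> real" where
  "eps k = 1/2 * Min {1 / (real k * (2 * real k + 1)), 3/5 - 9/16,
     (2 * real k + 3) / (4 * real k * (2 * real k + 1)), 3/10 - 1/6}"

definition s_crit :: "nat \<Rightarrow> nat \<Rightarrow> real" where
  "s_crit d k = real d / 2 - 1 / real k"

definition s_e :: "nat \<Rightarrow> nat \<Rightarrow> real" where
  "s_e d k = real d * (2 * real k - 1) / (2 * (2 * real k + 1))"

text \<open>The triple \<open>[s\<^sub>1, r, \<sigma>]\<close>; it is not specified in the excluded case \<open>d = k = 1\<close>.\<close>

definition exponents :: "nat \<Rightarrow> nat \<Rightarrow> real \<Rightarrow> real \<times> ennreal \<times> real" where
  "exponents d k s =
     (if real d \<ge> 2 + 2 / real k then ((s + s_crit d k) / 2, 2, - s_crit d k)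
      else if d \<in> {1, 2} \<and> k \<ge> 2 then
        (max ((s + s_crit d k) / 2) (s_e d k - 1/2 * eps k), \<infinity>, 0)
      else if d \<in> {2, 3} \<and> k = 1 then
        (1/2 * (s + (3 * real d - 2) / 10), ennreal (10 / (2 * real d - 3)),
         - ((2 * real d - 3) * (real d - 2) / 10))
      else undefined)"

end

theory Submission
  imports Defs "HOL-Computational_Algebra.Primes"
begin

text \<open>
  By duality, every \<open>\<ell>\<^sup>2\<close> estimate is a bound for a form \<open>\<Sum> \<Prod>\<^sub>l f\<^sub>l(n\<^sub>l)\<close> over tuples subject to one linear
  constraint and, if the phase is fixed, one quadratic constraint. The Cauchy-Schwarz inequality reduces
  such a form to counting: two variables with a fixed sum and a fixed phase lie on a sphere or a
  hyperplane, three variables in dimension one on an ellipse, and the divisor bound leaves at most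
  \<open>C\<^sub>\<epsilon> N\<^sup>\<epsilon>\<close> lattice points on a conic of size \<open>N\<close>. The other variables are summed absolutely with weights
  \<open>\<langle>n\<^sub>l\<rangle>\<^sup>-\<^sup>\<beta>\<close>, \<open>\<beta> > d/2\<close>. Weights are moved between variables by two observations: the largest variable is
  comparable to the second largest, and in a product of weights exponents may be shifted from larger to
  smaller variables.

  In the \<open>\<ell>\<^sup>\<infinity>\<close> estimates the distinguished variable \<open>n\<^sub>q\<close> enters only through its supremum. Outside \<open>\<A>\<close> the
  two largest of the other variables differ from \<open>n\<^sub>q\<close>, so the conics which they span together with \<open>n\<^sub>q\<close>
  are nondegenerate and Schur's test applies. The cubic case follows by interpolation between
  \<open>\<ell>\<^sup>2\<close> with weight exponent \<open>- s\<^sub>c\<close> and \<open>\<ell>\<^sup>\<infinity>\<close>.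
\<close>

section \<open>Lattice points on conics\<close>

text \<open>With a fixed phase, two variables of opposite sign lie on a hyperplane, which can carry
  about N times as many points as a sphere of size N and may degenerate to the whole space when the
  two variables coincide. The \<open>\<ell>^2\<close> bounds with fixed phase never meet this case.
  Both halves of a form enter only through the \<open>\<ell>^2\<close> norm of a convolution, and
  this norm does not change when the sign of a variable is reversed, provided that momentum and
  phase are reversed together. So all signs may be taken positive. For this reason a constraint is a
  sum in an arbitrary abelian group, with the phase as one more coordinate. In the
  \<open>\<ell>^\<infinity>\<close> bounds no square-summable function sits at \<open>n_q\<close>,
  the signs stay as they are, and \<A> has to remove the harmful coincidences. Every estimate is
  proved for a whole family of sets of tuples with one constant; this yields the supremum over \<mu>
  and uniformity in the order. At \<open>s = s_e\<close> estimate (B3) has no room left for shifting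
  exponents to values above \<open>d / 2\<close>; it rests on ordered sums over balls whose powers
  cancel.\<close>

lemma card_le_fibres:
  assumes "finite A" "finite B" "f ` A \<subseteq> B"
    and "\<And>b. b \<in> B \<Longrightarrow> card {a \<in> A. f a = b} \<le> c"
  shows "card A \<le> c * card B"
proof -
  have "card A = (\<Sum>b\<in>B. card {a \<in> A. f a = b})"
    using sum.group[OF assms(1-3), of "\<lambda>_. 1::nat"] by simp
  also have "\<dots> \<le> (\<Sum>b\<in>B. c)"
    by (intro sum_mono assms)
  finally show ?thesis by (simp add: mult.commute)
qed

section \<open>The divisor bound\<close>

lemma card_divisors_mult_le:
  fixes a b :: nat
  assumes "a > 0" "b > 0"
  shows "card {d. d dvd a * b} \<le> card {d. d dvd a} * card {d. d dvd b}"
proof -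
  have fin: "finite {d. d dvd a}" "finite {d. d dvd b}"
    using assms by simp_all
  have "{d. d dvd a * b} \<subseteq> (\<lambda>(u, v). u * v) ` ({d. d dvd a} \<times> {d. d dvd b})"
  proof
    fix d assume "d \<in> {d. d dvd a * b}"
    then obtain u v where "d = u * v" "u dvd a" "v dvd b"
      using division_decomp[of d a b] by blast
    then show "d \<in> (\<lambda>(u, v). u * v) ` ({d. d dvd a} \<times> {d. d dvd b})"
      by force
  qed
  then have "card {d. d dvd a * b} \<le> card ((\<lambda>(u, v). u * v) ` ({d. d dvd a} \<times> {d. d dvd b}))"
    using fin by (intro card_mono) auto
  also have "\<dots> \<le> card ({d. d dvd a} \<times> {d. d dvd b})"
    using fin by (intro card_image_le) auto
  finally show ?thesis by (simp add: card_cartesian_product)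
qed

lemma card_divisors_prime_power_le:
  fixes p :: nat
  assumes "prime p"
  shows "card {d. d dvd p ^ a} \<le> a + 1"
proof -
  have "{d. d dvd p ^ a} \<subseteq> (\<lambda>i. p ^ i) ` {..a}"
    using divides_primepow_nat[OF assms] by auto
  then have "card {d. d dvd p ^ a} \<le> card ((\<lambda>i. p ^ i) ` {..a})"
    by (intro card_mono) auto
  also have "\<dots> \<le> card {..a}"
    by (intro card_image_le) auto
  finally show ?thesis by simp
qed

text \<open>Prime powers \<open>p ^ a\<close> are split off one at a time, and the factor
  \<open>a + 1\<close> is compared with \<open>p powr (e * a)\<close>. From
  \<open>p \<ge> 2 powr (1 / e)\<close> on it costs nothing, since \<open>a + 1 \<le> 2 ^ a\<close>.
  Each of the finitely many smaller primes costs one factor \<open>K\<close>, and their number is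
  bounded crudely by \<open>P + 1\<close>.\<close>

lemma divisor_bound:
  fixes e :: real
  assumes e: "e > 0"
  obtains C where "C > 0" "\<And>n. n > 0 \<Longrightarrow> real (card {d. d dvd n}) \<le> C * real n powr e"
proof -
  \<comment> \<open>This value makes \<open>K * (e * ln 2) \<ge> 1\<close>, so that
    \<open>1 + x \<le> exp x\<close> at \<open>x = e * a * ln 2\<close> yields
    \<open>K2\<close>.\<close>
  define K where "K = max 1 (1 / (e * ln 2))"
  define P where "P = nat \<lceil>2 powr (1 / e)\<rceil>"
  have K1: "K \<ge> 1" by (simp add: K_def)
  have K2: "real a + 1 \<le> K * 2 powr (e * a)" for a :: nat
  proof -
    have l: "e * ln 2 > 0" using e by simp
    have "K * (e * ln 2) \<ge> 1 / (e * ln 2) * (e * ln 2)"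
      by (intro mult_right_mono) (use l in \<open>auto simp: K_def\<close>)
    then have K3: "K * (e * ln 2) \<ge> 1" using e by simp
    have "real a + 1 \<le> a * (K * (e * ln 2)) + K"
      using K1 mult_left_mono[OF K3, of "real a"] by simp
    also have "\<dots> = K * (1 + e * a * ln 2)" by (simp add: algebra_simps)
    also have "\<dots> \<le> K * exp (e * a * ln 2)"
      using K1 exp_ge_add_one_self[of "e * a * ln 2"] by (intro mult_left_mono) auto
    finally show ?thesis by (simp add: powr_def mult.commute)
  qed
  define S where "S n = {p. prime p \<and> p \<le> P \<and> p dvd n}" for n
  have finS: "finite (S n)" for n by (auto simp: S_def intro: finite_subset[of _ "{..P}"])
  have *: "real (card {d. d dvd n}) \<le> K ^ card (S n) * real n powr e" if "n > 0" for n
    using that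
  proof (induction n rule: less_induct)
    case (less n)
    show ?case
    proof (cases "n = 1")
      case True
      then have "S n = {}" by (auto simp: S_def)
      then show ?thesis using True by simp
    next
      case False
      then obtain p where p: "prime p" "p dvd n" using prime_factor_nat by blast
      define a where "a = multiplicity p n"
      obtain m where m: "n = p ^ a * m" "\<not> p dvd m"
        using multiplicity_decompose'[of n p] p less.prems not_prime_unit[of p] unfolding a_def
        by (metis neq0_conv)
      have a0: "a > 0" using p less.prems by (simp add: a_def prime_multiplicity_gt_zero_iff)
      have m0: "m > 0" using m less.prems by (cases m) auto
      have pp: "p ^ a > 1" by (rule one_less_power[OF prime_gt_1_nat[OF p(1)] a0])
      have mn: "m < n" using m m0 pp by simp
      have IH: "real (card {d. d dvd m}) \<le> K ^ card (S m) * real m powr e"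
        using less.IH[OF mn m0] .
      have "real (card {d. d dvd n}) \<le> real (card {d. d dvd p ^ a} * card {d. d dvd m})"
        unfolding m(1) of_nat_le_iff using p m0 by (intro card_divisors_mult_le) (auto simp: prime_gt_0_nat)
      also have "\<dots> \<le> real ((a + 1) * card {d. d dvd m})"
        unfolding of_nat_le_iff using card_divisors_prime_power_le[OF p(1), of a] by (intro mult_right_mono) auto
      also have "\<dots> \<le> (real a + 1) * (K ^ card (S m) * real m powr e)"
        unfolding of_nat_mult of_nat_add of_nat_1 by (intro mult_left_mono IH) auto
      finally have step: "real (card {d. d dvd n}) \<le> (real a + 1) * (K ^ card (S m) * real m powr e)" .
      have np: "real n powr e = real p powr (e * a) * real m powr e"
        using p prime_gt_0_nat[of p] by (simp add: m(1) powr_mult powr_powr mult.commute powr_realpow[symmetric])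
      have Sm: "S m \<subseteq> S n" using m by (auto simp: S_def)
      show ?thesis
      proof (cases "p \<le> P")
        case True
        have "insert p (S m) \<subseteq> S n" "p \<notin> S m"
          using Sm True p m(2) by (auto simp: S_def)
        then have "Suc (card (S m)) \<le> card (S n)"
          using finS by (metis card_insert_disjoint card_mono)
        then have "K * K ^ card (S m) \<le> K ^ card (S n)"
          using K1 power_increasing[of "Suc (card (S m))" "card (S n)" K] by simp
        moreover have rle: "real a + 1 \<le> K * real p powr (e * a)"
        proof -
          have "2 powr (e * a) \<le> real p powr (e * a)"
            using prime_ge_2_nat[OF p(1)] e by (intro powr_mono2) auto
          then show ?thesis using K2[of a] K1 by (smt (verit) mult_left_mono)
        qed
        ultimately have "(real a + 1) * K ^ card (S m) \<le> K ^ card (S n) * real p powr (e * a)"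
        proof -
          have "(real a + 1) * K ^ card (S m) \<le> (K * real p powr (e * a)) * K ^ card (S m)"
            using rle K1 by (intro mult_right_mono) auto
          also have "\<dots> = (K * K ^ card (S m)) * real p powr (e * a)" by simp
          also have "\<dots> \<le> K ^ card (S n) * real p powr (e * a)"
            using \<open>K * K ^ card (S m) \<le> _\<close> by (intro mult_right_mono) auto
          finally show ?thesis .
        qed
        then have "(real a + 1) * K ^ card (S m) * real m powr e \<le> K ^ card (S n) * real p powr (e * a) * real m powr e"
          by (intro mult_right_mono) auto
        with step show ?thesis by (simp add: np mult.assoc)
      next
        case False
        have "2 powr (1 / e) \<le> real P"
          by (simp add: P_def)
        then have "2 powr (1 / e) \<le> real p" using False by linarith
        then have "(2 powr (1 / e)) powr (e * a) \<le> real p powr (e * a)"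
          using e by (intro powr_mono2) auto
        then have "2 ^ a \<le> real p powr (e * a)"
          using e by (simp add: powr_powr powr_realpow)
        moreover have "real a + 1 \<le> 2 ^ a"
        proof -
          have "a + 1 \<le> 2 ^ a" by (simp add: Suc_leI)
          then have "real (a + 1) \<le> real (2 ^ a)" by (simp only: of_nat_le_iff)
          then show ?thesis by simp
        qed
        ultimately have A: "real a + 1 \<le> real p powr (e * a)" by simp
        have B: "K ^ card (S m) \<le> K ^ card (S n)"
          using K1 Sm finS by (intro power_increasing card_mono) auto
        have "(real a + 1) * (K ^ card (S m) * real m powr e) \<le> real p powr (e * a) * (K ^ card (S n) * real m powr e)"
          using A B K1 by (intro mult_mono) auto
        with step show ?thesis by (simp add: np mult_ac)
      qed
    qed
  qed
  have "card (S n) \<le> P + 1" for n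
    using card_mono[of "{..P}" "S n"] by (auto simp: S_def)
  then have "K ^ card (S n) \<le> K ^ (P + 1)" for n
    using K1 by (intro power_increasing) auto
  then have "real (card {d. d dvd n}) \<le> K ^ (P + 1) * real n powr e" if "n > 0" for n
    using *[OF that] by (smt (verit) mult_right_mono powr_ge_zero)
  moreover have "K ^ (P + 1) > 0" using K1 by simp
  ultimately show ?thesis using that by blast
qed

section \<open>Square roots modulo M and representations by \<open>x^2 + D * y^2\<close>\<close>

text \<open>All products \<open>N * z\<close> leave the same remainder modulo \<open>M\<close>, so
  \<open>z\<close> is recovered from the quotient \<open>N * z div M\<close>, which takes at most
  \<open>N\<close> values.\<close>

lemma card_linear_congruence_le:
  fixes M c :: int and N :: nat
  assumes "M > 0" "N > 0" and S: "S \<subseteq> {0..<M}"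
    and cong: "\<And>z z'. z \<in> S \<Longrightarrow> z' \<in> S \<Longrightarrow> M dvd int N * (z - z')"
  shows "card S \<le> N"
proof (cases "S = {}")
  case False
  then obtain z0 where z0: "z0 \<in> S" by blast
  have fin: "finite S" using S finite_subset by blast
  have inj: "inj_on (\<lambda>z. (int N * z) div M) S"
  proof (rule inj_onI)
    fix z z' assume z: "z \<in> S" "z' \<in> S" and eq: "(int N * z) div M = (int N * z') div M"
    have "(int N * z) mod M = (int N * z') mod M"
      using cong[OF z] by (simp add: mod_eq_dvd_iff right_diff_distrib)
    then have "int N * z = int N * z'"
      using eq by (metis div_mult_mod_eq)
    then show "z = z'" using assms(2) by simp
  qed
  have "(\<lambda>z. (int N * z) div M) ` S \<subseteq> {0..<int N}"
  proof
    fix t assume "t \<in> (\<lambda>z. (int N * z) div M) ` S"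
    then obtain z where z: "z \<in> S" "t = (int N * z) div M" by blast
    then have "0 \<le> z" "z < M" using S by auto
    then have "0 \<le> int N * z" "int N * z < int N * M"
      using assms(2) by auto
    then have "0 \<le> t" using z(2) assms(1) by (simp add: pos_imp_zdiv_nonneg_iff)
    moreover have "t * M \<le> int N * z"
      using z(2) assms(1) by (simp add: minus_mod_eq_div_mult [symmetric])
    then have "t * M < int N * M" using \<open>int N * z < int N * M\<close> by linarith
    then have "t < int N" using assms(1) by (simp add: mult_less_cancel_right_pos)
    ultimately show "t \<in> {0..<int N}" by simp
  qed
  then have "card ((\<lambda>z. (int N * z) div M) ` S) \<le> card {0..<int N}"
    by (intro card_mono) auto
  then show ?thesis using card_image[OF inj] by simp
qed simp

text \<open>
  For two roots \<open>z, z\<^sub>0\<close> the modulus divides \<open>(z - z\<^sub>0) (z + z\<^sub>0)\<close>, and \<open>gcd (z - z\<^sub>0) M\<close> determines \<open>z\<close> up to \<open>4 D\<close>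
  possibilities.
\<close>

lemma card_sqrt_mod_le:
  fixes M :: int and D :: nat
  assumes M: "M > 0" and D: "D > 0"
  shows "card {z \<in> {0..<M}. M dvd z\<^sup>2 + int D} \<le> 4 * D * card {d. d dvd nat M}"
proof (cases "{z \<in> {0..<M}. M dvd z\<^sup>2 + int D} = {}")
  case False
  then obtain z0 where z0: "M dvd z0\<^sup>2 + int D" by blast
  let ?A = "{z \<in> {0..<M}. M dvd z\<^sup>2 + int D}"
  show ?thesis
  proof (rule card_le_fibres[where f = "\<lambda>z. nat (gcd (z - z0) M)"])
    show "finite ?A" by (rule finite_subset[of _ "{0..<M}"]) auto
    show "finite {d. d dvd nat M}" using M by simp
    show "(\<lambda>z. nat (gcd (z - z0) M)) ` ?A \<subseteq> {d. d dvd nat M}"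
      using M by (auto simp: nat_dvd_iff)
    fix b assume "b \<in> {d. d dvd nat M}"
    then have b: "int b dvd M" using M by (metis int_dvd_int_iff int_nat_eq mem_Collect_eq order_less_imp_le)
    have bM: "b > 0" using b M by (intro Nat.gr0I) auto
    define c where "c = M div int b"
    have Mbc: "M = int b * c" using b by (simp add: c_def)
    show "card {a \<in> ?A. nat (gcd (a - z0) M) = b} \<le> 4 * D"
    proof (rule card_linear_congruence_le[OF M])
      show "4 * D > 0" using D by simp
      show "{a \<in> ?A. nat (gcd (a - z0) M) = b} \<subseteq> {0..<M}" by auto
      have bc: "int b dvd z - z0 \<and> c dvd z + z0"
        if z: "z \<in> {a \<in> ?A. nat (gcd (a - z0) M) = b}" for z
      proof
        have g: "gcd (z - z0) M = int b" using z by auto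
        then show "int b dvd z - z0" by (metis gcd_dvd1)
        have "M dvd (z\<^sup>2 + int D) - (z0\<^sup>2 + int D)" using z z0 by (intro dvd_diff) auto
        then have "M dvd (z - z0) * (z + z0)" by (simp add: power2_eq_square algebra_simps)
        moreover obtain u v where uv: "z - z0 = int b * u" "M = int b * v" "coprime u v"
          using gcd_coprime_exists[of "z - z0" M] g bM by (auto simp: mult.commute)
        have "v = c" using uv(2) Mbc bM by simp
        ultimately have "int b * c dvd int b * (u * (z + z0))" using uv Mbc by (simp add: mult.assoc)
        then have "c dvd u * (z + z0)" using bM by simp
        then show "c dvd z + z0" using uv(3) \<open>v = c\<close>
          by (simp add: coprime_commute coprime_dvd_mult_right_iff)
      qed
      fix z z' assume z: "z \<in> {a \<in> ?A. nat (gcd (a - z0) M) = b}" and z': "z' \<in> {a \<in> ?A. nat (gcd (a - z0) M) = b}"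
      define w where "w = z - z'"
      have "int b dvd (z - z0) - (z' - z0)" using bc[OF z] bc[OF z'] dvd_diff by blast
      moreover have "c dvd (z + z0) - (z' + z0)" using bc[OF z] bc[OF z'] dvd_diff by blast
      ultimately have bw: "int b dvd w" and cw: "c dvd w" by (simp_all add: w_def)
      \<comment> \<open>Both \<open>b\<close> and \<open>c\<close> divide the difference
        \<open>w\<close> of two roots, but they need not be coprime; \<open>g\<close> measures the
        failure.\<close>
      define g where "g = gcd (int b) c"
      have "int b * c dvd g * w"
      proof -
        obtain u v where "g = u * int b + v * c" unfolding g_def by (metis bezout_int)
        then have "g * w = int b * (u * w) + c * (v * w)" by (simp add: algebra_simps)
        moreover have "int b * c dvd int b * (u * w)" using cw by simp
        moreover have "int b * c dvd c * (v * w)" using bw by (simp add: mult.commute)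
        ultimately show ?thesis by simp
      qed
      \<comment> \<open>\<open>g\<close> divides \<open>z - z0\<close> and \<open>z + z0\<close>,
        hence \<open>4 * z0^2\<close>; it also divides \<open>M\<close>, hence
        \<open>4 * (z0^2 + D)\<close>.\<close>
      moreover have "g dvd 4 * int D"
      proof -
        have gz: "g dvd z - z0" "g dvd z + z0"
          using bc[OF z] by (auto simp: g_def intro: dvd_trans[OF gcd_dvd1] dvd_trans[OF gcd_dvd2])
        have "g dvd (z + z0) - (z - z0)" using gz(2,1) by (rule dvd_diff)
        also have "(z + z0) - (z - z0) = 2 * z0" by simp
        finally have "g dvd 2 * z0" .
        then have "g dvd (2 * z0) * (2 * z0)" by (rule dvd_mult)
        then have 1: "g dvd 4 * z0\<^sup>2" by (simp add: power2_eq_square algebra_simps)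
        have "g dvd M" unfolding Mbc g_def by (simp add: dvd_mult)
        then have "g dvd 4 * (z0\<^sup>2 + int D)" using z0 by (meson dvd_mult dvd_trans)
        then have "g dvd 4 * (z0\<^sup>2 + int D) - 4 * z0\<^sup>2" using 1 by (rule dvd_diff)
        then show ?thesis by simp
      qed
      ultimately have "int b * c dvd 4 * int D * w"
        by (meson dvd_trans mult_dvd_mono dvd_refl)
      then show "M dvd int (4 * D) * (z - z')" by (simp add: Mbc w_def)
    qed
  qed
next
  case True
  show ?thesis unfolding True by simp
qed

text \<open>A primitive solution determines the root \<open>x / y\<close> of \<open>- D\<close> modulo \<open>M\<close>, and each root arises from boundedly many solutions.\<close>

lemma card_primitive_representations_le:
  fixes M :: int and D :: nat
  assumes M: "M > 0" and D: "D > 0"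
  shows "finite {(x, y). x\<^sup>2 + int D * y\<^sup>2 = M}"
    and "card {(x, y). x\<^sup>2 + int D * y\<^sup>2 = M \<and> coprime x y} \<le> 36 * D * card {d. d dvd nat M}"
proof -
  have sq: "\<bar>x\<bar> \<le> M" if "x\<^sup>2 \<le> M" for x :: int
  proof -
    have "\<bar>x\<bar> \<le> \<bar>x\<bar> * \<bar>x\<bar>"
    proof (cases "x = 0")
      case False
      then show ?thesis using mult_left_mono[of 1 "\<bar>x\<bar>" "\<bar>x\<bar>"] by linarith
    qed simp
    also have "\<dots> = x\<^sup>2" by (simp add: power2_eq_square)
    finally show ?thesis using that by linarith
  qed
  have Dge: "y\<^sup>2 \<le> int D * y\<^sup>2" for y
    using D mult_right_mono[of 1 "int D" "y\<^sup>2"] by simp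
  have "{(x, y). x\<^sup>2 + int D * y\<^sup>2 = M} \<subseteq> {-M..M} \<times> {-M..M}"
  proof
    fix p assume "p \<in> {(x, y). x\<^sup>2 + int D * y\<^sup>2 = M}"
    then obtain x y where p: "p = (x, y)" "x\<^sup>2 + int D * y\<^sup>2 = M" by (cases p) auto
    have "x\<^sup>2 \<le> M" "y\<^sup>2 \<le> M"
      using p(2) Dge[of y] zero_le_power2[of x] zero_le_power2[of y] by linarith+
    then show "p \<in> {-M..M} \<times> {-M..M}"
      using sq[of x] sq[of y] p(1) by (simp add: abs_le_iff)
  qed
  then show fin: "finite {(x, y). x\<^sup>2 + int D * y\<^sup>2 = M}"
    by (rule finite_subset) simp
  let ?R = "{(x, y). x\<^sup>2 + int D * y\<^sup>2 = M \<and> coprime x y}"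
  have finR: "finite ?R" by (rule finite_subset[OF _ fin]) auto
  have "\<exists>z. z \<in> {0..<M} \<and> M dvd z\<^sup>2 + int D \<and> M dvd fst p - z * snd p" if pR: "p \<in> ?R" for p
  proof -
    obtain x y where p: "p = (x, y)" "x\<^sup>2 + int D * y\<^sup>2 = M" "coprime x y"
      using pR by (cases p) auto
    have "M = int D * y * y + x\<^sup>2" using p(2) by (simp add: power2_eq_square)
    then have "gcd y M = gcd y (x\<^sup>2)" by (metis gcd_add_mult)
    moreover have "coprime y (x\<^sup>2)" using p(3) by (simp add: coprime_commute)
    ultimately have cop: "coprime y M" by (simp add: coprime_iff_gcd_eq_1)
    then obtain u v where uv: "u * y + v * M = 1"
      using bezout_int[of y M] coprime_imp_gcd_eq_1[OF cop] by metis
    define z where "z = (x * u) mod M"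
    define q where "q = (x * u) div M"
    have z: "z = x * u - M * q" by (simp add: z_def q_def minus_mult_div_eq_mod)
    have "x - z * y = x * (u * y + v * M) - z * y" by (simp only: uv mult_1_right)
    also have "\<dots> = M * (x * v + q * y)" unfolding z by (simp add: algebra_simps)
    finally have 1: "M dvd x - z * y" by simp
    then have "M dvd (x - z * y) * (x + z * y)" by (rule dvd_mult2)
    with dvd_refl have "M dvd M - (x - z * y) * (x + z * y)" by (rule dvd_diff)
    also have "M - (x - z * y) * (x + z * y) = (x\<^sup>2 + int D * y\<^sup>2) - (x - z * y) * (x + z * y)"
      by (simp only: p(2))
    also have "\<dots> = y\<^sup>2 * (z\<^sup>2 + int D)"
      by (simp add: power2_eq_square algebra_simps)
    finally have "M dvd y\<^sup>2 * (z\<^sup>2 + int D)" .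
    moreover have "coprime M (y\<^sup>2)" using cop by (simp add: coprime_commute)
    ultimately have "M dvd z\<^sup>2 + int D" using coprime_dvd_mult_right_iff by blast
    moreover have "z \<in> {0..<M}" using M by (simp add: z_def)
    ultimately show ?thesis using 1 unfolding p(1) fst_conv snd_conv by blast
  qed
  then have "\<forall>p\<in>?R. \<exists>z. z \<in> {0..<M} \<and> M dvd z\<^sup>2 + int D \<and> M dvd fst p - z * snd p"
    by (intro ballI)
  from bchoice[OF this] obtain f
    where f': "\<forall>p\<in>?R. f p \<in> {0..<M} \<and> M dvd (f p)\<^sup>2 + int D \<and> M dvd fst p - f p * snd p" ..
  have f: "f p \<in> {0..<M} \<and> M dvd (f p)\<^sup>2 + int D \<and> M dvd fst p - f p * snd p" if "p \<in> ?R" for p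
    using bspec[OF f' that] .
  have "card ?R \<le> 9 * card {z \<in> {0..<M}. M dvd z\<^sup>2 + int D}"
  proof (rule card_le_fibres[OF finR, where f = f])
    show "finite {z \<in> {0..<M}. M dvd z\<^sup>2 + int D}" by (rule finite_subset[of _ "{0..<M}"]) auto
    show "f ` ?R \<subseteq> {z \<in> {0..<M}. M dvd z\<^sup>2 + int D}" using f by blast
    fix z
    let ?F = "{p \<in> ?R. f p = z}"
    show "card ?F \<le> 9"
    proof (cases "?F = {}")
      case False
      then obtain p0 where p0: "p0 \<in> ?F" by blast
      obtain x0 y0 where xy0: "p0 = (x0, y0)" by (cases p0)
      have e0: "x0\<^sup>2 + int D * y0\<^sup>2 = M" using p0 unfolding xy0 by simp
      have d0: "M dvd x0 - z * y0" using f[of p0] p0 unfolding xy0 by simp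
      \<comment> \<open>Up to sign these are the coordinates of
        \<open>(x + y * sqrt (- D)) * (x0 - y0 * sqrt (- D))\<close>. Multiplicativity of the norm
        gives \<open>w^2 + D * t^2 = M^2\<close>. As both points belong to the same root,
        \<open>M\<close> divides \<open>t\<close>, and only nine pairs \<open>(t, w)\<close>
        survive.\<close>
      define h where "h = (\<lambda>(x, y). (x * y0 - x0 * y, x * x0 + int D * y * y0))"
      have "h ` ?F \<subseteq> {-M, 0, M} \<times> {-M, 0, M}"
      proof
        fix q assume "q \<in> h ` ?F"
        then obtain x y where p: "(x, y) \<in> ?F" "q = h (x, y)" by (metis (no_types, lifting) imageE surj_pair)
        have e: "x\<^sup>2 + int D * y\<^sup>2 = M" using p(1) by simp
        have d: "M dvd x - z * y" using f[of "(x, y)"] p(1) by simp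
        define t where "t = x * y0 - x0 * y"
        define w where "w = x * x0 + int D * y * y0"
        have "M dvd (x - z * y) * y0 - (x0 - z * y0) * y" by (rule dvd_diff[OF dvd_mult2[OF d] dvd_mult2[OF d0]])
        then have "M dvd t" by (simp add: t_def algebra_simps)
        then obtain j where j: "t = M * j" by blast
        have "w\<^sup>2 + int D * t\<^sup>2 = (x\<^sup>2 + int D * y\<^sup>2) * (x0\<^sup>2 + int D * y0\<^sup>2)"
          by (simp add: t_def w_def power2_eq_square algebra_simps)
        then have w: "w\<^sup>2 + int D * t\<^sup>2 = M\<^sup>2" unfolding e e0 by (simp add: power2_eq_square)
        have "M\<^sup>2 * j\<^sup>2 \<le> M\<^sup>2 * 1" using w Dge[of t] zero_le_power2[of w] unfolding j power_mult_distrib by linarith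
        then have "j\<^sup>2 \<le> 1" using M by simp
        then have "\<bar>j\<bar> \<le> 1" by (simp add: abs_square_le_1)
        then have jj: "j = -1 \<or> j = 0 \<or> j = 1" by linarith
        have "w = -M \<or> w = 0 \<or> w = M"
        proof (cases "j = 0")
          case True
          with w have "w\<^sup>2 = M\<^sup>2" unfolding j by simp
          then show ?thesis by (auto simp: power2_eq_iff)
        next
          case False
          with jj have "j = -1 \<or> j = 1" by blast
          then have "t\<^sup>2 = M\<^sup>2" unfolding j by (elim disjE) simp_all
          then have "w\<^sup>2 \<le> 0" using w Dge[of t] by linarith
          then show ?thesis by simp
        qed
        then show "q \<in> {-M, 0, M} \<times> {-M, 0, M}"
          using jj unfolding p(2) h_def prod.case t_def[symmetric] w_def[symmetric] j by auto
      qed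
      then have "card (h ` ?F) \<le> card ({-M, 0, M} \<times> {-M, 0, M})"
        by (intro card_mono) auto
      also have "\<dots> \<le> 9" using M by (simp add: card_cartesian_product card_insert_if)
      finally have "card (h ` ?F) \<le> 9" .
      moreover have "inj_on h ?F"
      proof (rule inj_onI)
        fix p q assume pq: "p \<in> ?F" "q \<in> ?F" "h p = h q"
        obtain x y x' y' where xy: "p = (x, y)" "q = (x', y')" by (cases p, cases q)
        have t: "x * y0 - x0 * y = x' * y0 - x0 * y'" and w: "x * x0 + int D * y * y0 = x' * x0 + int D * y' * y0"
          using pq(3) unfolding xy h_def by simp_all
        have i1: "a * M = x0 * (a * x0 + int D * b * y0) + int D * y0 * (a * y0 - x0 * b)" for a b
          unfolding e0[symmetric] by (simp add: power2_eq_square algebra_simps)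
        have i2: "b * M = y0 * (a * x0 + int D * b * y0) - x0 * (a * y0 - x0 * b)" for a b
          unfolding e0[symmetric] by (simp add: power2_eq_square algebra_simps)
        have "x * M = x' * M" using i1[of x y] i1[of x' y'] by (simp only: t w)
        moreover have "y * M = y' * M" using i2[of y x] i2[of y' x'] by (simp only: t w)
        ultimately have "x = x'" "y = y'" using M by simp_all
        then show "p = q" using xy by simp
      qed
      ultimately show ?thesis by (simp add: card_image)
    next
      case True
      then show ?thesis by (simp only: card.empty)
    qed
  qed
  also have "\<dots> \<le> 9 * (4 * D * card {d. d dvd nat M})"
    using card_sqrt_mod_le[OF M D] by simp
  finally show "card ?R \<le> 36 * D * card {d. d dvd nat M}" by simp
qed

text \<open>Dividing by the gcd \<open>g\<close> leaves a primitive representation of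
  \<open>M / g^2\<close>. There are at most as many values of \<open>g\<close> as divisors of
  \<open>M\<close>, and \<open>M / g^2\<close> has no more divisors than \<open>M\<close>; hence the
  square.\<close>

lemma card_representations_le:
  fixes M :: int and D :: nat
  assumes M: "M > 0" and D: "D > 0"
  shows "card {(x, y). x\<^sup>2 + int D * y\<^sup>2 = M} \<le> 36 * D * (card {d. d dvd nat M})\<^sup>2"
proof -
  let ?R = "{(x, y). x\<^sup>2 + int D * y\<^sup>2 = M}"
  have "card ?R \<le> (36 * D * card {d. d dvd nat M}) * card {d. d dvd nat M}"
  proof (rule card_le_fibres[where f = "\<lambda>(x, y). nat (gcd x y)"])
    show "finite ?R" by (rule card_primitive_representations_le[OF M D])
    show "finite {d. d dvd nat M}" using M by simp
    have gd: "(gcd x y)\<^sup>2 dvd x\<^sup>2 + int D * y\<^sup>2" for x y :: int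
      by (intro dvd_add dvd_mult dvd_power_same) auto
    show "(\<lambda>(x, y). nat (gcd x y)) ` ?R \<subseteq> {d. d dvd nat M}"
    proof
      fix d assume "d \<in> (\<lambda>(x, y). nat (gcd x y)) ` ?R"
      then obtain x y where xy: "x\<^sup>2 + int D * y\<^sup>2 = M" "d = nat (gcd x y)" by auto
      then have "gcd x y dvd M" using gd[of x y] by (metis dvd_trans dvd_triv_left power2_eq_square)
      then show "d \<in> {d. d dvd nat M}" using M xy by (simp add: nat_dvd_iff)
    qed
    fix g
    let ?F = "{p \<in> ?R. (case p of (x, y) \<Rightarrow> nat (gcd x y)) = g}"
    show "card ?F \<le> 36 * D * card {d. d dvd nat M}"
    proof (cases "?F = {}")
      case False
      then obtain x1 y1 where xy1: "x1\<^sup>2 + int D * y1\<^sup>2 = M" "nat (gcd x1 y1) = g" by auto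
      have "gcd x1 y1 \<noteq> 0" using xy1 M by auto
      then have g0: "g > 0" using xy1(2) by (metis gcd_ge_0_int int_nat_eq neq0_conv of_nat_0)
      have "(int g)\<^sup>2 dvd M" using gd[of x1 y1] xy1 by auto
      then obtain M' where M': "M = (int g)\<^sup>2 * M'" by blast
      have M'0: "M' > 0" using M M' by (simp add: zero_less_mult_iff)
      let ?R' = "{(x, y). x\<^sup>2 + int D * y\<^sup>2 = M' \<and> coprime x y}"
      have "?F \<subseteq> (\<lambda>(x, y). (int g * x, int g * y)) ` ?R'"
      proof
        fix p assume p: "p \<in> ?F"
        obtain x y where xy: "p = (x, y)" by (cases p)
        have e: "x\<^sup>2 + int D * y\<^sup>2 = M" and gg: "gcd x y = int g" using p xy by auto
        obtain u v where uv: "x = u * int g" "y = v * int g" "coprime u v"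
          using gcd_coprime_exists[of x y] gg g0 by auto
        have "(int g)\<^sup>2 * (u\<^sup>2 + int D * v\<^sup>2) = (int g)\<^sup>2 * M'"
          using e unfolding M' uv by (simp add: power2_eq_square algebra_simps)
        then have "u\<^sup>2 + int D * v\<^sup>2 = M'" using g0 by simp
        then show "p \<in> (\<lambda>(x, y). (int g * x, int g * y)) ` ?R'"
          using uv xy by (force simp: mult.commute)
      qed
      moreover have finR': "finite ?R'"
        by (rule finite_subset[OF _ card_primitive_representations_le(1)[OF M'0 D]]) auto
      ultimately have "card ?F \<le> card ?R'"
        by (meson card_image_le card_mono finite_imageI le_trans)
      also have "\<dots> \<le> 36 * D * card {d. d dvd nat M'}"
        by (rule card_primitive_representations_le[OF M'0 D])
      also have "\<dots> \<le> 36 * D * card {d. d dvd nat M}"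
      proof -
        have "nat M' dvd nat M" using M' M'0 M by (simp add: nat_dvd_iff)
        then show ?thesis using M by (intro mult_left_mono card_mono) (auto intro: dvd_trans)
      qed
      finally show ?thesis .
    next
      case True
      then show ?thesis by (simp only: card.empty)
    qed
  qed
  then show ?thesis by (simp add: power2_eq_square)
qed

section \<open>Points of a conic in a box, uniformly in its coefficients\<close>

lemma subset_interval2_finite:
  fixes S :: "(int \<times> int) set"
  assumes "\<And>x y. (x, y) \<in> S \<Longrightarrow> \<bar>x - a\<bar> \<le> L \<and> \<bar>y - b\<bar> \<le> L"
  shows "finite S"
proof (rule finite_subset)
  show "S \<subseteq> {a - L..a + L} \<times> {b - L..b + L}"
    using assms by (force simp: abs_le_iff)
qed simp

lemma three_points:
  assumes "card S > 2"
  obtains p q r where "p \<in> S" "q \<in> S" "r \<in> S" "p \<noteq> q" "p \<noteq> r" "q \<noteq> r"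
proof -
  obtain T where "T \<subseteq> S" "card T = 3"
    by (rule obtain_subset_with_card_n[of 3 S]) (use assms in auto)
  then show ?thesis using that by (metis card_3_iff insert_subset)
qed

text \<open>
  The bound has to be uniform in \<open>\<alpha>, \<beta>\<close>. Three solutions determine these coefficients by Cramer's rule,
  so after completing the square one represents a number which is polynomial in \<open>L\<close>.
\<close>

lemma conic_card_bound:
  fixes e :: real and b :: int
  assumes e: "e > 0" and b: "b \<in> {0, 1}"
  shows "\<exists>C>0. \<forall>S L \<alpha> \<beta>. L \<ge> 1 \<longrightarrow> (\<forall>x y. (x, y) \<in> S \<longrightarrow> \<bar>x\<bar> \<le> L \<and> \<bar>y\<bar> \<le> L) \<longrightarrow>
       (\<forall>x y x' y'. (x, y) \<in> S \<longrightarrow> (x', y') \<in> S \<longrightarrow>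
         x\<^sup>2 + b * x * y + y\<^sup>2 + \<alpha> * x + \<beta> * y = x'\<^sup>2 + b * x' * y' + y'\<^sup>2 + \<alpha> * x' + \<beta> * y') \<longrightarrow>
       finite S \<and> real (card S) \<le> C * real_of_int L powr e"
proof -
  \<comment> \<open>The number of divisors enters squared and is evaluated at some
    \<open>M \<le> 30000 * L ^ 6\<close>, so the exponent \<open>e / 12\<close> becomes
    \<open>e\<close>.\<close>
  obtain C0 where C0: "C0 > 0" "\<And>n. n > 0 \<Longrightarrow> real (card {d. d dvd n}) \<le> C0 * real n powr (e / 12)"
    using divisor_bound[of "e / 12"] e by auto
  \<comment> \<open>Minus the discriminant of \<open>x^2 + b * x * y + y^2\<close>;
    \<open>4 - b\<close> equals \<open>4 - b^2\<close> because \<open>b\<close> is 0 or 1. The value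
    0 serves circles, the value 1 the ellipse formed by three variables in dimension one.\<close>
  define D where "D = nat (4 - b)"
  have D: "D > 0" "int D = 4 - b * b" "D \<le> 4" using b by (auto simp: D_def)
  define Q where "Q x y = x\<^sup>2 + b * x * y + y\<^sup>2" for x y :: int
  define C where "C = 2 + 144 * C0\<^sup>2 * 30000 powr (e / 6)"
  have Q4: "4 * Q x y = (2 * x + b * y)\<^sup>2 + int D * y\<^sup>2" for x y
    unfolding D Q_def by (simp add: power2_eq_square algebra_simps)
  have Qpos: "Q x y \<ge> 0" for x y
  proof -
    have "4 * Q x y \<ge> 0" unfolding Q4 by simp
    then show ?thesis by linarith
  qed
  have Q0: "x = 0 \<and> y = 0" if "Q x y = 0" for x y
  proof -
    have "(2 * x + b * y)\<^sup>2 + int D * y\<^sup>2 = 0" using Q4[of x y] that by simp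
    moreover have "(2 * x + b * y)\<^sup>2 \<ge> 0" "int D * y\<^sup>2 \<ge> 0" by simp_all
    ultimately have "(2 * x + b * y)\<^sup>2 = 0" "int D * y\<^sup>2 = 0" by linarith+
    then show ?thesis using D by auto
  qed
  show ?thesis
  proof (intro exI[of _ C] conjI[of "C > 0"] allI impI)
    show "C > 0" using C0 by (simp add: C_def add_pos_nonneg)
    fix S :: "(int \<times> int) set" and L \<alpha> \<beta> :: int
    assume L: "L \<ge> 1" and SL': "\<forall>x y. (x, y) \<in> S \<longrightarrow> \<bar>x\<bar> \<le> L \<and> \<bar>y\<bar> \<le> L"
      and eq': "\<forall>x y x' y'. (x, y) \<in> S \<longrightarrow> (x', y') \<in> S \<longrightarrow>
         x\<^sup>2 + b * x * y + y\<^sup>2 + \<alpha> * x + \<beta> * y = x'\<^sup>2 + b * x' * y' + y'\<^sup>2 + \<alpha> * x' + \<beta> * y'"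
    note SL = SL'[rule_format] and eq = eq'[rule_format]
    have fin: "finite S" using SL by (intro subset_interval2_finite[of S 0 L 0]) auto
    have L1: "real_of_int L powr e \<ge> 1" using L e by (intro ge_one_powr_ge_zero) auto
    show "finite S \<and> real (card S) \<le> C * real_of_int L powr e"
    proof (cases "card S > 2")
      case False
      then have "real (card S) \<le> 2 * 1" by simp
      also have "\<dots> \<le> C * real_of_int L powr e"
        using L1 C0 by (intro mult_mono) (auto simp: C_def)
      finally show ?thesis using fin by simp
    next
      case True
      obtain p0 p1 p2 where p: "p0 \<in> S" "p1 \<in> S" "p2 \<in> S" "p0 \<noteq> p1" "p0 \<noteq> p2" "p1 \<noteq> p2"
        using three_points[OF True] .
      obtain x0 y0 where p0: "p0 = (x0, y0)" by (cases p0)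
      define A where "A = 2 * x0 + b * y0 + \<alpha>"
      define B where "B = b * x0 + 2 * y0 + \<beta>"
      have rel: "Q (x - x0) (y - y0) + A * (x - x0) + B * (y - y0) = 0" if "(x, y) \<in> S" for x y
        using eq[of x y x0 y0] that p p0 unfolding Q_def A_def B_def by (simp add: power2_eq_square algebra_simps)
      obtain u1 v1 where 1: "p1 = (x0 + u1, y0 + v1)"
        by (metis add.commute diff_add_cancel prod.exhaust)
      obtain u2 v2 where 2: "p2 = (x0 + u2, y0 + v2)"
        by (metis add.commute diff_add_cancel prod.exhaust)
      define Q1 where "Q1 = Q u1 v1"
      define Q2 where "Q2 = Q u2 v2"
      have r1: "Q1 + A * u1 + B * v1 = 0" and r2: "Q2 + A * u2 + B * v2 = 0"
        using rel[of "x0 + u1" "y0 + v1"] rel[of "x0 + u2" "y0 + v2"] p 1 2 by (simp_all add: Q1_def Q2_def)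
      define c where "c = u1 * v2 - u2 * v1"
      have Ac: "A * c = Q2 * v1 - Q1 * v2"
      proof -
        have "A * c = v2 * (Q1 + A * u1 + B * v1) - v1 * (Q2 + A * u2 + B * v2) + Q2 * v1 - Q1 * v2"
          by (simp add: c_def algebra_simps)
        then show ?thesis unfolding r1 r2 by simp
      qed
      have Bc: "B * c = Q1 * u2 - Q2 * u1"
      proof -
        have "B * c = u1 * (Q2 + A * u2 + B * v2) - u2 * (Q1 + A * u1 + B * v1) + Q1 * u2 - Q2 * u1"
          by (simp add: c_def algebra_simps)
        then show ?thesis unfolding r1 r2 by simp
      qed
      \<comment> \<open>Otherwise three distinct points of an ellipse would be collinear. In
        formulas, the vectors \<open>Q1 * (u2, v2)\<close> and \<open>Q2 * (u1, v1)\<close> would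
        agree; comparing their values under the quadratic form gives \<open>Q1 = Q2\<close> and
        hence equal points.\<close>
      have c0: "c \<noteq> 0"
      proof
        assume "c = 0"
        then have e1: "Q1 * v2 = Q2 * v1" and e2: "Q1 * u2 = Q2 * u1" using Ac Bc by simp_all
        have "Q1\<^sup>2 * Q2 = (Q1 * u2)\<^sup>2 + b * (Q1 * u2) * (Q1 * v2) + (Q1 * v2)\<^sup>2"
          unfolding Q2_def by (simp add: Q_def power2_eq_square algebra_simps)
        also have "\<dots> = Q2\<^sup>2 * Q1"
          unfolding e1 e2 unfolding Q1_def by (simp add: Q_def power2_eq_square algebra_simps)
        finally have "Q1 * Q2 * (Q1 - Q2) = 0" by (simp add: power2_eq_square algebra_simps)
        moreover have "Q1 \<noteq> 0" using Q0[of u1 v1] p 1 p0 by (auto simp: Q1_def)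
        moreover have "Q2 \<noteq> 0" using Q0[of u2 v2] p 2 p0 by (auto simp: Q2_def)
        ultimately have "Q1 = Q2" "Q1 \<noteq> 0" by auto
        then have "u1 = u2" "v1 = v2" using e1 e2 by auto
        then show False using 1 2 p by simp
      qed
      have x0L: "\<bar>x0\<bar> \<le> L" "\<bar>y0\<bar> \<le> L" using SL[of x0 y0] p p0 by auto
      have uv: "\<bar>u1\<bar> \<le> 2 * L" "\<bar>v1\<bar> \<le> 2 * L" "\<bar>u2\<bar> \<le> 2 * L" "\<bar>v2\<bar> \<le> 2 * L"
        using SL[OF p(2)[unfolded 1]] SL[OF p(3)[unfolded 2]] x0L by linarith+
      have m4: "\<bar>x * y\<bar> \<le> 4 * L\<^sup>2" if "\<bar>x\<bar> \<le> 2 * L" "\<bar>y\<bar> \<le> 2 * L" for x y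
        using mult_mono[OF that] L by (simp add: abs_mult power2_eq_square)
      have Qb: "\<bar>Q u v\<bar> \<le> 12 * L\<^sup>2" if "\<bar>u\<bar> \<le> 2 * L" "\<bar>v\<bar> \<le> 2 * L" for u v
      proof -
        have "\<bar>b * u * v\<bar> \<le> \<bar>u * v\<bar>" using b by auto
        then show ?thesis
          using m4[OF that] m4[OF that(1,1)] m4[OF that(2,2)] unfolding Q_def power2_eq_square[of u] power2_eq_square[of v]
          by linarith
      qed
      have mb: "\<bar>q * v\<bar> \<le> 24 * L ^ 3" if "\<bar>q\<bar> \<le> 12 * L\<^sup>2" "\<bar>v\<bar> \<le> 2 * L" for q v
        using mult_mono[OF that] L by (simp add: abs_mult power2_eq_square power3_eq_cube)
      have dc: "\<bar>X\<bar> \<le> 48 * L ^ 3" if "\<bar>X * c\<bar> \<le> 48 * L ^ 3" for X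
      proof -
        have "\<bar>X\<bar> * 1 \<le> \<bar>X\<bar> * \<bar>c\<bar>" using c0 by (intro mult_left_mono) auto
        then show ?thesis using that by (simp add: abs_mult)
      qed
      have Q12: "\<bar>Q1\<bar> \<le> 12 * L\<^sup>2" "\<bar>Q2\<bar> \<le> 12 * L\<^sup>2" using Qb uv by (auto simp: Q1_def Q2_def)
      have "\<bar>A * c\<bar> \<le> 48 * L ^ 3"
        unfolding Ac using mb[OF Q12(2) uv(2)] mb[OF Q12(1) uv(4)] by linarith
      then have AL: "\<bar>A\<bar> \<le> 48 * L ^ 3" by (rule dc)
      have "\<bar>B * c\<bar> \<le> 48 * L ^ 3"
        unfolding Bc using mb[OF Q12(1) uv(3)] mb[OF Q12(2) uv(1)] by linarith
      then have BL: "\<bar>B\<bar> \<le> 48 * L ^ 3" by (rule dc)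
      \<comment> \<open>The equation \<open>Q u v + A * u + B * v = 0\<close> is multiplied by
        \<open>4 * D\<close> before the square is completed. This keeps all quantities integral and
        leads to a representation of \<open>M\<close> by \<open>X^2 + D * Y^2\<close>.\<close>
      define M where "M = int D * A\<^sup>2 + (2 * B - A * b)\<^sup>2"
      define h where "h = (\<lambda>(x, y). (int D * (y - y0) + 2 * B - A * b, 2 * (x - x0) + b * (y - y0) + A))"
      have hS: "h ` S \<subseteq> {(X, Y). X\<^sup>2 + int D * Y\<^sup>2 = M}"
      proof
        fix q assume "q \<in> h ` S"
        then obtain x y where xy: "(x, y) \<in> S" "q = h (x, y)" by (metis imageE surj_pair)
        define u v where "u = x - x0" and "v = y - y0"
        have "(int D * v + 2 * B - A * b)\<^sup>2 + int D * (2 * u + b * v + A)\<^sup>2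
            = 4 * int D * (Q u v + A * u + B * v) + M"
          unfolding M_def Q_def D by (simp add: power2_eq_square algebra_simps)
        also have "\<dots> = M" using rel[OF xy(1)] by (simp add: u_def v_def)
        finally show "q \<in> {(X, Y). X\<^sup>2 + int D * Y\<^sup>2 = M}"
          unfolding xy(2) h_def u_def v_def by simp
      qed
      have inj: "inj_on h S" using D by (intro inj_onI) (auto simp: h_def)
      have "M \<noteq> 0"
      proof
        assume "M = 0"
        have "X = 0 \<and> Y = 0" if "X\<^sup>2 + int D * Y\<^sup>2 = M" for X Y :: int
        proof -
          have "X\<^sup>2 \<ge> 0" "int D * Y\<^sup>2 \<ge> 0" by simp_all
          then have "X\<^sup>2 = 0" "int D * Y\<^sup>2 = 0" using that \<open>M = 0\<close> by linarith+
          then show ?thesis using D by auto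
        qed
        then have "h p0 = (0, 0)" "h p1 = (0, 0)" using hS p by blast+
        then show False using inj p by (metis inj_onD)
      qed
      moreover have "M \<ge> 0" by (simp add: M_def)
      ultimately have M: "M > 0" by simp
      have "card S \<le> 36 * D * (card {d. d dvd nat M})\<^sup>2"
        using card_inj_on_le[OF inj hS card_primitive_representations_le(1)[OF M D(1)]]
          card_representations_le[OF M D(1)] by simp
      also have "\<dots> \<le> 36 * 4 * (card {d. d dvd nat M})\<^sup>2" using D by (intro mult_right_mono) auto
      finally have "real (card S) \<le> real (36 * 4 * (card {d. d dvd nat M})\<^sup>2)"
        by (simp only: of_nat_le_iff)
      then have "real (card S) \<le> 144 * (real (card {d. d dvd nat M}))\<^sup>2" by simp
      also have "\<dots> \<le> 144 * (C0 * real_of_int M powr (e / 12))\<^sup>2"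
        using C0(2)[of "nat M"] M by (intro mult_left_mono power_mono) auto
      also have "(C0 * real_of_int M powr (e / 12))\<^sup>2 = C0\<^sup>2 * real_of_int M powr (e / 6)"
        using M by (simp add: power_mult_distrib power2_eq_square flip: powr_add)
      also have "real_of_int M powr (e / 6) \<le> (30000 * real_of_int L ^ 6) powr (e / 6)"
      proof (intro powr_mono2)
        have "\<bar>A\<bar>\<^sup>2 \<le> (48 * L ^ 3)\<^sup>2" using AL by (intro power_mono) auto
        moreover have "\<bar>2 * B - A * b\<bar>\<^sup>2 \<le> (3 * (48 * L ^ 3))\<^sup>2"
          using AL BL b by (intro power_mono) auto
        moreover have "int D * A\<^sup>2 \<le> 4 * A\<^sup>2" using D by (intro mult_right_mono) auto
        ultimately have "M \<le> 4 * (48 * L ^ 3)\<^sup>2 + (3 * (48 * L ^ 3))\<^sup>2"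
          unfolding M_def by (simp only: power2_abs)
        \<comment> \<open>\<open>4 * 48^2 + 9 * 48^2 = 29952\<close>.\<close>
        also have "\<dots> \<le> 30000 * L ^ 6" using L by (simp add: power_mult_distrib flip: power_mult)
        finally have "real_of_int M \<le> real_of_int (30000 * L ^ 6)" by (simp only: of_int_le_iff)
        then show "real_of_int M \<le> 30000 * real_of_int L ^ 6" by simp
      qed (use e M in auto)
      also have "(30000 * real_of_int L ^ 6) powr (e / 6) = 30000 powr (e / 6) * real_of_int L powr e"
        using L by (simp add: powr_mult powr_powr flip: powr_numeral)
      finally have "real (card S) \<le> 144 * (C0\<^sup>2 * (30000 powr (e / 6) * real_of_int L powr e))"
        using C0 by (simp add: mult_left_mono)
      also have "\<dots> \<le> C * real_of_int L powr e"
        by (simp add: C_def distrib_right)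
      finally show ?thesis using fin by simp
    qed
  qed
qed

text \<open>A point of \<open>x * y = c\<close> is determined by the divisor
  \<open>\<bar>x\<bar>\<close> of \<open>c\<close> and a sign. The number \<open>c\<close> is not
  bounded in terms of \<open>L\<close>, since the box may lie anywhere; but as soon as there are
  three points, elimination bounds the coordinates of one of them, and hence \<open>c\<close>, by
  powers of \<open>L\<close>.\<close>

lemma hyperbola_card_bound:
  fixes e :: real
  assumes e: "e > 0"
  shows "\<exists>C>0. \<forall>S L a b c. L \<ge> 1 \<longrightarrow> c \<noteq> 0 \<longrightarrow>
       (\<forall>x y. (x, y) \<in> S \<longrightarrow> \<bar>x - a\<bar> \<le> L \<and> \<bar>y - b\<bar> \<le> L \<and> x * y = c) \<longrightarrow>
       finite S \<and> real (card S) \<le> C * real_of_int L powr e"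
proof -
  obtain C0 where C0: "C0 > 0" "\<And>n. n > 0 \<Longrightarrow> real (card {d. d dvd n}) \<le> C0 * real n powr (e / 6)"
    using divisor_bound[of "e / 6"] e by auto
  define C where "C = 2 + 2 * C0 * 256 powr (e / 6)"
  show ?thesis
  proof (intro exI[of _ C] conjI[of "C > 0"] allI impI)
    show "C > 0" using C0 by (simp add: C_def add_pos_nonneg)
    fix S :: "(int \<times> int) set" and L a b c :: int
    assume L: "L \<ge> 1" and c: "c \<noteq> 0"
      and S': "\<forall>x y. (x, y) \<in> S \<longrightarrow> \<bar>x - a\<bar> \<le> L \<and> \<bar>y - b\<bar> \<le> L \<and> x * y = c"
    note S = S'[rule_format]
    have fin: "finite S" using S by (intro subset_interval2_finite[of S a L b]) auto
    have L1: "real_of_int L powr e \<ge> 1" using L e by (intro ge_one_powr_ge_zero) auto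
    show "finite S \<and> real (card S) \<le> C * real_of_int L powr e"
    proof (cases "card S > 2")
      case False
      then have "real (card S) \<le> 2 * 1" by simp
      also have "\<dots> \<le> C * real_of_int L powr e"
        using L1 C0 by (intro mult_mono) (auto simp: C_def)
      finally show ?thesis using fin by simp
    next
      case True
      obtain p0 p1 p2 where p: "p0 \<in> S" "p1 \<in> S" "p2 \<in> S" "p0 \<noteq> p1" "p0 \<noteq> p2" "p1 \<noteq> p2"
        using three_points[OF True] .
      obtain P Z where p0: "p0 = (P, Z)" by (cases p0)
      obtain u1 v1 where 1: "p1 = (P + u1, Z + v1)"
        by (metis add.commute diff_add_cancel prod.exhaust)
      obtain u2 v2 where 2: "p2 = (P + u2, Z + v2)"
        by (metis add.commute diff_add_cancel prod.exhaust)
      have c0: "P * Z = c" using S[of P Z] p p0 by auto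
      have c1: "(P + u1) * (Z + v1) = c" and c2: "(P + u2) * (Z + v2) = c"
        using S[of "P + u1" "Z + v1"] S[of "P + u2" "Z + v2"] p 1 2 by auto
      have r1: "u1 * Z + v1 * P + u1 * v1 = 0" and r2: "u2 * Z + v2 * P + u2 * v2 = 0"
        using c0 c1 c2 by (simp_all add: algebra_simps)
      have PZ: "P \<noteq> 0" "Z \<noteq> 0" using c c0 by auto
      have u0: "u1 \<noteq> 0" "u2 \<noteq> 0"
        using r1 r2 PZ p 1 2 p0 by auto
      define d where "d = u1 * v2 - u2 * v1"
      have Pd: "P * d = u1 * u2 * (v1 - v2)"
      proof -
        have "P * d = u1 * (u2 * Z + v2 * P + u2 * v2) - u2 * (u1 * Z + v1 * P + u1 * v1) + u1 * u2 * (v1 - v2)"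
          by (simp add: d_def algebra_simps)
        then show ?thesis unfolding r1 r2 by simp
      qed
      have Zd: "Z * d = v1 * v2 * (u2 - u1)"
      proof -
        have "Z * d = v2 * (u1 * Z + v1 * P + u1 * v1) - v1 * (u2 * Z + v2 * P + u2 * v2) + v1 * v2 * (u2 - u1)"
          by (simp add: d_def algebra_simps)
        then show ?thesis unfolding r1 r2 by simp
      qed
      \<comment> \<open>No line contains three points of the hyperbola.\<close>
      have d0: "d \<noteq> 0"
      proof
        assume "d = 0"
        then have "v1 = v2" using Pd u0 by simp
        then have "(Z + v1) * (u1 - u2) = 0" using c1 c2 by (simp add: algebra_simps)
        moreover have "Z + v1 \<noteq> 0" using c1 c by auto
        ultimately show False using \<open>v1 = v2\<close> 1 2 p by auto
      qed
      have uv: "\<bar>u1\<bar> \<le> 2 * L" "\<bar>v1\<bar> \<le> 2 * L" "\<bar>u2\<bar> \<le> 2 * L" "\<bar>v2\<bar> \<le> 2 * L"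
        using S[OF p(1)[unfolded p0]] S[OF p(2)[unfolded 1]] S[OF p(3)[unfolded 2]] by linarith+
      have m3: "\<bar>x * y * z\<bar> \<le> 16 * L ^ 3" if "\<bar>x\<bar> \<le> 2 * L" "\<bar>y\<bar> \<le> 2 * L" "\<bar>z\<bar> \<le> 4 * L" for x y z
        using mult_mono[OF mult_mono[OF that(1,2)] that(3)] L by (simp add: abs_mult power3_eq_cube)
      have dc: "\<bar>X\<bar> \<le> 16 * L ^ 3" if "\<bar>X * d\<bar> \<le> 16 * L ^ 3" for X
      proof -
        have "\<bar>X\<bar> * 1 \<le> \<bar>X\<bar> * \<bar>d\<bar>" using d0 by (intro mult_left_mono) auto
        then show ?thesis using that by (simp add: abs_mult)
      qed
      have "\<bar>P\<bar> \<le> 16 * L ^ 3" by (rule dc, unfold Pd, rule m3) (use uv in auto)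
      moreover have "\<bar>Z\<bar> \<le> 16 * L ^ 3" by (rule dc, unfold Zd, rule m3) (use uv in auto)
      ultimately have "\<bar>P\<bar> * \<bar>Z\<bar> \<le> (16 * L ^ 3) * (16 * L ^ 3)"
        using L by (intro mult_mono) auto
      then have cL: "\<bar>c\<bar> \<le> 256 * L ^ 6" by (simp add: c0[symmetric] abs_mult flip: power_add)
      define g where "g = (\<lambda>(x::int, y::int). (nat \<bar>x\<bar>, x > 0))"
      have "g ` S \<subseteq> {d. d dvd nat \<bar>c\<bar>} \<times> UNIV"
      proof
        fix q assume "q \<in> g ` S"
        then obtain x y where xy: "(x, y) \<in> S" "q = g (x, y)" by (metis imageE surj_pair)
        then have "x dvd c" using S[OF xy(1)] by (metis dvd_triv_left)
        then show "q \<in> {d. d dvd nat \<bar>c\<bar>} \<times> UNIV" unfolding xy(2) g_def by (simp add: nat_abs_dvd_iff)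
      qed
      moreover have "inj_on g S"
      proof (rule inj_onI)
        fix p q assume pq: "p \<in> S" "q \<in> S" "g p = g q"
        obtain x y x' y' where xy: "p = (x, y)" "q = (x', y')" by (cases p, cases q)
        have "x * y = c" "x' * y' = c" using S pq xy by auto
        moreover have "x = x'" using pq(3) xy by (auto simp: g_def)
        ultimately show "p = q" using xy c by auto
      qed
      moreover have "finite {d. d dvd nat \<bar>c\<bar>}" using c by (intro finite_divisors_nat) simp
      ultimately have "card S \<le> card ({d. d dvd nat \<bar>c\<bar>} \<times> (UNIV :: bool set))"
        by (intro card_inj_on_le) auto
      then have "real (card S) \<le> 2 * real (card {d. d dvd nat \<bar>c\<bar>})"
        by (simp add: card_cartesian_product)
      also have "\<dots> \<le> 2 * (C0 * real_of_int \<bar>c\<bar> powr (e / 6))"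
        using C0(2)[of "nat \<bar>c\<bar>"] c by (intro mult_left_mono) auto
      also have "real_of_int \<bar>c\<bar> powr (e / 6) \<le> (256 * real_of_int L ^ 6) powr (e / 6)"
      proof (intro powr_mono2)
        have "real_of_int \<bar>c\<bar> \<le> real_of_int (256 * L ^ 6)" using cL by (simp only: of_int_le_iff)
        then show "real_of_int \<bar>c\<bar> \<le> 256 * real_of_int L ^ 6" by simp
      qed (use e in auto)
      also have "(256 * real_of_int L ^ 6) powr (e / 6) = 256 powr (e / 6) * real_of_int L powr e"
        using L by (simp add: powr_mult powr_powr flip: powr_numeral)
      finally have "real (card S) \<le> 2 * (C0 * (256 powr (e / 6) * real_of_int L powr e))"
        using C0 by (simp add: mult_left_mono)
      also have "\<dots> \<le> C * real_of_int L powr e"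
        by (simp add: C_def distrib_right)
      finally show ?thesis using fin by simp
    qed
  qed
qed

section \<open>Weighted sums over quadrics\<close>

definition sq :: "int ^ 'd \<Rightarrow> int" where
  "sq x = (\<Sum>i\<in>UNIV. (x $ i)\<^sup>2)"

definition wt :: "real \<Rightarrow> int ^ 'd \<Rightarrow> ennreal" where
  "wt s x = ennreal (bracket x powr s)"

abbreviation esum :: "'a set \<Rightarrow> ('a \<Rightarrow> ennreal) \<Rightarrow> ennreal" where
  "esum A f \<equiv> integral\<^sup>N (count_space A) f"

lemma sq_nonneg [simp]: "sq x \<ge> 0"
  by (simp add: sq_def sum_nonneg)

lemma zabs_sq: "(zabs x)\<^sup>2 = of_int (sq x)"
  by (simp add: zabs_def sq_def norm_vec_def L2_set_def sum_nonneg)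

lemma zabs_nonneg [simp]: "zabs x \<ge> 0"
  by (simp add: zabs_def)

lemma zabs_triangle: "zabs (x + y) \<le> zabs x + zabs y"
proof -
  have "(\<chi> i. real_of_int ((x + y) $ i)) = (\<chi> i. real_of_int (x $ i)) + (\<chi> i. real_of_int (y $ i))"
    by (simp add: vec_eq_iff)
  then show ?thesis by (simp only: zabs_def norm_triangle_ineq)
qed

lemma zabs_uminus [simp]: "zabs (- x) = zabs x"
proof -
  have "(\<chi> i. real_of_int ((- x) $ i)) = - (\<chi> i. real_of_int (x $ i))"
    by (simp add: vec_eq_iff)
  then show ?thesis by (simp only: zabs_def norm_minus_cancel)
qed

lemma zabs_sum: "zabs (\<Sum>i\<in>I. f i) \<le> (\<Sum>i\<in>I. zabs (f i))"
proof (induction I rule: infinite_finite_induct)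
  case (insert i I)
  then show ?case using zabs_triangle[of "f i" "sum f I"] by simp
qed (simp_all add: zabs_def norm_vec_def L2_set_def)

lemma bracket_sq: "(bracket x)\<^sup>2 = 1 + of_int (sq x)"
  by (simp add: bracket_def zabs_sq add_nonneg_nonneg)

lemma bracket_ge_1 [simp]: "bracket x \<ge> 1"
  by (simp add: bracket_def)

lemma bracket_pos [simp]: "bracket x > 0"
  using bracket_ge_1[of x] by linarith

lemma bracket_nonneg [simp]: "bracket x \<ge> 0"
  using bracket_ge_1[of x] by linarith

lemma bracket_le_iff: "bracket x \<le> bracket y \<longleftrightarrow> zabs x \<le> zabs y"
  by (simp add: bracket_def)

lemma bracket_le_1_zabs: "bracket x \<le> 1 + zabs x"
  by (rule power2_le_imp_le) (simp_all add: bracket_def power2_eq_square algebra_simps)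

lemma zabs_le_bracket: "zabs x \<le> bracket x"
  by (rule power2_le_imp_le) (simp_all add: bracket_sq zabs_sq)

lemma coord_le_bracket: "\<bar>real_of_int (x $ i)\<bar> \<le> bracket x"
proof -
  have "\<bar>(\<chi> i. real_of_int (x $ i)) $ i\<bar> \<le> norm (\<chi> i. real_of_int (x $ i))"
    by (rule component_le_norm_cart)
  then show ?thesis using zabs_le_bracket[of x] by (simp add: zabs_def)
qed

lemma wt_mult: "wt s x * wt t x = wt (s + t) x"
  by (simp add: wt_def powr_add flip: ennreal_mult)

lemma wt_0 [simp]: "wt 0 x = 1"
  using bracket_pos[of x] by (simp add: wt_def del: bracket_pos)

lemma wt_mono: "s \<le> t \<Longrightarrow> wt s x \<le> wt t x"
  unfolding wt_def by (intro ennreal_leI powr_mono) auto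

lemma wt_neq_top [simp]: "wt s x \<noteq> top" "wt s x < top"
  by (simp_all add: wt_def)

lemma wt_pos [simp]: "wt s x > 0" "wt s x \<noteq> 0"
  using bracket_pos[of x] by (simp_all add: wt_def del: bracket_pos)

text \<open>\<open>S\<close> is cut into blocks on which \<open>w1\<close> and \<open>w2\<close>
  have dyadic sizes \<open>2 ^ i\<close> and \<open>2 ^ j\<close>. The margin
  \<open>\<delta>\<close> between the exponents of the weights and those of the count leaves a
  double geometric series. Sums with a single weight take the constant 1 for
  \<open>w2\<close>.\<close>

lemma dyadic_sum_bound:
  fixes w1 w2 :: "'a \<Rightarrow> real" and S :: "'a set"
  assumes "C \<ge> 0" "\<kappa> \<ge> 0" "\<eta> \<ge> 0" "\<delta> > 0" "\<kappa> + \<delta> \<le> p1" "\<eta> + \<delta> \<le> p2"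
    and w: "\<And>x. x \<in> S \<Longrightarrow> w1 x \<ge> 1 \<and> w2 x \<ge> 1"
    and fin: "\<And>A B. A \<ge> 1 \<Longrightarrow> B \<ge> 1 \<Longrightarrow> finite {x \<in> S. w1 x \<le> A \<and> w2 x \<le> B}"
    and card: "\<And>A B. A \<ge> 1 \<Longrightarrow> B \<ge> 1 \<Longrightarrow>
      real (card {x \<in> S. w1 x \<le> A \<and> w2 x \<le> B}) \<le> C * A powr \<kappa> * B powr \<eta>"
  shows "esum S (\<lambda>x. ennreal (w1 x powr - p1 * w2 x powr - p2))
    \<le> ennreal (C * 2 powr \<kappa> * 2 powr \<eta> * (1 / (1 - 2 powr - \<delta>))\<^sup>2)"
proof -
  define q where "q = (2::real) powr - \<delta>"
  have q: "0 < q" "q < 1" using assms(4) by (simp_all add: q_def powr_less_one)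
  define K where "K = C * 2 powr \<kappa> * 2 powr \<eta>"
  have K: "K \<ge> 0" using assms by (simp add: K_def)
  define n where "n t = nat \<lfloor>log 2 t\<rfloor>" for t :: real
  have n: "2 ^ n t \<le> t" "t \<le> 2 ^ (n t + 1)" if "t \<ge> 1" for t
  proof -
    have l: "log 2 t \<ge> 0" using that by simp
    have t: "t = 2 powr (log 2 t)" using that by simp
    have "real (n t) \<le> log 2 t" using l by (simp add: n_def)
    then have "2 powr real (n t) \<le> 2 powr (log 2 t)" by (intro powr_mono) auto
    then show "2 ^ n t \<le> t" using t by (simp add: powr_realpow)
    have "log 2 t \<le> real (n t + 1)" using l unfolding n_def by linarith
    then have "2 powr (log 2 t) \<le> 2 powr real (n t + 1)" by (intro powr_mono) auto
    then show "t \<le> 2 ^ (n t + 1)" using t by (simp only: powr_realpow)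
  qed
  define g where "g x = ennreal (w1 x powr - p1 * w2 x powr - p2)" for x
  have "esum S g = esum S (\<lambda>x. \<integral>\<^sup>+p. g x * indicator {(n (w1 x), n (w2 x))} p \<partial>count_space UNIV)"
    by (intro nn_integral_cong) simp
  also have "\<dots> = (\<integral>\<^sup>+p. esum S (\<lambda>x. g x * indicator {(n (w1 x), n (w2 x))} p) \<partial>count_space UNIV)"
    by (intro nn_integral_count_space_nn_integral) auto
  also have "\<dots> \<le> (\<integral>\<^sup>+p. ennreal (K * (q ^ fst p * q ^ snd p)) \<partial>count_space UNIV)"
  proof (intro nn_integral_mono)
    fix p :: "nat \<times> nat"
    obtain i j where p: "p = (i, j)" by (cases p)
    define T where "T = {x \<in> S. w1 x \<le> 2 ^ (i + 1) \<and> w2 x \<le> 2 ^ (j + 1)}"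
    have T: "finite T" "real (card T) \<le> C * (2 ^ (i + 1)) powr \<kappa> * (2 ^ (j + 1)) powr \<eta>"
      using fin[of "2 ^ (i + 1)" "2 ^ (j + 1)"] card[of "2 ^ (i + 1)" "2 ^ (j + 1)"]
      by (auto simp: T_def one_le_power simp del: power_Suc)
    define c where "c = 2 powr - (real i * p1) * 2 powr - (real j * p2)"
    have "esum S (\<lambda>x. g x * indicator {(n (w1 x), n (w2 x))} p) \<le> esum S (\<lambda>x. ennreal c * indicator T x)"
    proof (intro nn_integral_mono)
      fix x assume "x \<in> space (count_space S)"
      then have x: "x \<in> S" by simp
      show "g x * indicator {(n (w1 x), n (w2 x))} p \<le> ennreal c * indicator T x"
      proof (cases "p = (n (w1 x), n (w2 x))")
        case True
        then have ij: "i = n (w1 x)" "j = n (w2 x)" using p by auto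
        have xT: "x \<in> T" using w[OF x] n ij x by (auto simp: T_def)
        have le: "t powr - r \<le> 2 powr - (real (n t) * r)" if "t \<ge> 1" "r \<ge> 0" for t r :: real
        proof -
          have "t powr - r \<le> (2 ^ n t) powr - r"
            using n(1)[OF that(1)] that by (intro powr_mono2') auto
          also have "\<dots> = 2 powr - (real (n t) * r)"
            by (simp add: powr_powr flip: powr_realpow)
          finally show ?thesis .
        qed
        have "w1 x powr - p1 * w2 x powr - p2 \<le> c"
          unfolding c_def ij using w[OF x] assms(2-6) by (intro mult_mono le) auto
        then have "g x \<le> ennreal c" unfolding g_def by (rule ennreal_leI)
        then show ?thesis using xT True by simp
      qed simp
    qed
    also have "\<dots> = ennreal c * esum S (indicator T)"
      by (rule nn_integral_cmult) simp
    also have "esum S (indicator T) = ennreal (real (card T))"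
      using T by (subst nn_integral_indicator) (auto simp: T_def emeasure_count_space ennreal_of_nat_eq_real_of_nat)
    also have "ennreal c * \<dots> \<le> ennreal c * ennreal (C * (2 ^ (i + 1)) powr \<kappa> * (2 ^ (j + 1)) powr \<eta>)"
      by (intro mult_left_mono ennreal_leI T) auto
    also have "\<dots> = ennreal (c * (C * (2 ^ (i + 1)) powr \<kappa> * (2 ^ (j + 1)) powr \<eta>))"
      by (rule ennreal_mult[symmetric]) (use assms(1) in \<open>auto simp: c_def\<close>)
    also have "\<dots> \<le> ennreal (K * (q ^ i * q ^ j))"
    proof (intro ennreal_leI)
      have e: "2 powr - (real i * r) * (2 ^ (i + 1)) powr k \<le> 2 powr k * q ^ i"
        if "k + \<delta> \<le> r" for i :: nat and r k :: real
      proof -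
        have "2 powr - (real i * r) * (2 ^ (i + 1)) powr k = 2 powr (- (real i * r) + real (i + 1) * k)"
          unfolding powr_add by (simp only: powr_powr powr_realpow[symmetric] zero_less_numeral)
        also have "\<dots> \<le> 2 powr (k + - \<delta> * real i)"
        proof (intro powr_mono)
          have "real i * (k + \<delta>) \<le> real i * r" using that by (intro mult_left_mono) auto
          then show "- (real i * r) + real (i + 1) * k \<le> k + - \<delta> * real i" by (simp add: algebra_simps)
        qed auto
        also have "\<dots> = 2 powr k * q ^ i"
          unfolding powr_add q_def by (simp only: powr_powr[symmetric] powr_realpow powr_gt_zero zero_neq_numeral not_False_eq_True simp_thms)
        finally show ?thesis .
      qed
      have "c * (C * (2 ^ (i + 1)) powr \<kappa> * (2 ^ (j + 1)) powr \<eta>)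
        = C * ((2 powr - (real i * p1) * (2 ^ (i + 1)) powr \<kappa>) * (2 powr - (real j * p2) * (2 ^ (j + 1)) powr \<eta>))"
        by (simp add: c_def mult_ac)
      also have "\<dots> \<le> C * ((2 powr \<kappa> * q ^ i) * (2 powr \<eta> * q ^ j))"
        using assms(1) q by (intro mult_left_mono mult_mono[OF e[OF assms(5)] e[OF assms(6)]]) auto
      finally show "c * (C * (2 ^ (i + 1)) powr \<kappa> * (2 ^ (j + 1)) powr \<eta>) \<le> K * (q ^ i * q ^ j)"
        by (simp add: K_def mult_ac)
    qed
    finally show "esum S (\<lambda>x. g x * indicator {(n (w1 x), n (w2 x))} p) \<le> ennreal (K * (q ^ fst p * q ^ snd p))"
      by (simp add: p)
  qed
  also have "\<dots> = (\<integral>\<^sup>+i. \<integral>\<^sup>+j. ennreal (K * (q ^ i * q ^ j)) \<partial>count_space UNIV \<partial>count_space UNIV)"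
    by (subst nn_integral_fst_count_space[symmetric]) simp
  also have "\<dots> = (\<integral>\<^sup>+i. \<integral>\<^sup>+j. (ennreal K * ennreal (q ^ i)) * ennreal (q ^ j) \<partial>count_space UNIV \<partial>count_space UNIV)"
    using K q by (simp add: ennreal_mult mult.assoc)
  also have "\<dots> = ennreal K * (\<integral>\<^sup>+i. ennreal (q ^ i) \<partial>count_space UNIV) * (\<integral>\<^sup>+j. ennreal (q ^ j) \<partial>count_space UNIV)"
    by (simp add: nn_integral_cmult nn_integral_multc)
  also have "(\<integral>\<^sup>+i. ennreal (q ^ i) \<partial>count_space UNIV) = ennreal (1 / (1 - q))"
    using q by (simp add: nn_integral_count_space_nat suminf_ennreal2 summable_geometric suminf_geometric)
  also have "ennreal K * ennreal (1 / (1 - q)) * ennreal (1 / (1 - q)) = ennreal (K * (1 / (1 - q))\<^sup>2)"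
    using K q by (simp add: ennreal_mult[symmetric] power2_eq_square mult.assoc)
  finally show ?thesis by (simp add: g_def K_def q_def)
qed

lemma card_coords_le:
  fixes S :: "(int ^ 'd) set" and J :: "'d set"
  assumes "finite S" "A \<ge> 1" and A: "\<And>y j. y \<in> S \<Longrightarrow> j \<in> J \<Longrightarrow> \<bar>real_of_int (y $ j)\<bar> \<le> A"
    and c: "\<And>z. z \<in> S \<Longrightarrow> card {y \<in> S. \<forall>j\<in>J. y $ j = z $ j} \<le> c"
  shows "real (card S) \<le> real c * (3 * A) ^ card J"
proof -
  let ?B = "PiE J (\<lambda>_. {-\<lfloor>A\<rfloor>..\<lfloor>A\<rfloor>})"
  have "card S \<le> c * card ?B"
  proof (rule card_le_fibres[where f = "\<lambda>y. restrict (($) y) J"])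
    show "finite ?B" by (intro finite_PiE) auto
    show "(\<lambda>y. restrict (($) y) J) ` S \<subseteq> ?B"
    proof (intro image_subsetI PiE_I)
      fix y j assume "y \<in> S" "j \<in> J"
      then have "real_of_int (y $ j) \<le> A" "- A \<le> real_of_int (y $ j)" using A[of y j] by linarith+
      then have "y $ j \<le> \<lfloor>A\<rfloor>" "- (y $ j) \<le> \<lfloor>A\<rfloor>" by (simp_all add: le_floor_iff)
      then show "restrict (($) y) J j \<in> {-\<lfloor>A\<rfloor>..\<lfloor>A\<rfloor>}"
        using \<open>j \<in> J\<close> by auto
    qed simp
    fix b assume "b \<in> ?B"
    show "card {a \<in> S. restrict (($) a) J = b} \<le> c"
    proof (cases "{a \<in> S. restrict (($) a) J = b} = {}")
      case False
      then obtain z where z: "z \<in> S" "restrict (($) z) J = b" by blast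
      have "{a \<in> S. restrict (($) a) J = b} \<subseteq> {y \<in> S. \<forall>j\<in>J. y $ j = z $ j}"
        using z(2) by (auto simp: restrict_def fun_eq_iff) metis
      then have "card {a \<in> S. restrict (($) a) J = b} \<le> card {y \<in> S. \<forall>j\<in>J. y $ j = z $ j}"
        using assms(1) by (intro card_mono) auto
      then show ?thesis using c[OF z(1)] by simp
    qed (simp only: card.empty)
  qed fact
  also have "card ?B = (card {-\<lfloor>A\<rfloor>..\<lfloor>A\<rfloor>}) ^ card J"
    by (simp add: card_PiE)
  finally have "real (card S) \<le> real c * real (card {-\<lfloor>A\<rfloor>..\<lfloor>A\<rfloor>}) ^ card J"
    by (metis of_nat_le_iff of_nat_mult of_nat_power)
  also have "\<dots> \<le> real c * (3 * A) ^ card J"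
  proof (intro mult_left_mono power_mono)
    have "real (card {-\<lfloor>A\<rfloor>..\<lfloor>A\<rfloor>}) = 2 * of_int \<lfloor>A\<rfloor> + 1" using assms(2) by simp
    then show "real (card {-\<lfloor>A\<rfloor>..\<lfloor>A\<rfloor>}) \<le> 3 * A" using assms(2) by linarith
  qed auto
  finally show ?thesis .
qed

lemma finite_bracket_le: "finite {y :: int ^ 'd. bracket y \<le> A}"
proof (rule finite_subset)
  let ?B = "PiE (UNIV :: 'd set) (\<lambda>_. {-\<lceil>A\<rceil>..\<lceil>A\<rceil>})"
  show "{y :: int ^ 'd. bracket y \<le> A} \<subseteq> vec_lambda ` ?B"
  proof
    fix y :: "int ^ 'd" assume "y \<in> {y. bracket y \<le> A}"
    then have "\<bar>real_of_int (y $ i)\<bar> \<le> A" for i using coord_le_bracket[of y i] by auto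
    then have "real_of_int (y $ i) \<le> A" "real_of_int (- (y $ i)) \<le> A" for i
      by (simp_all add: abs_le_iff)
    then have "y $ i \<le> \<lceil>A\<rceil>" "- (y $ i) \<le> \<lceil>A\<rceil>" for i
      by (meson le_of_int_ceiling of_int_le_iff order_trans)+
    then have "($) y \<in> ?B" by (auto simp: minus_le_iff)
    then show "y \<in> vec_lambda ` ?B" by (metis imageI vec_lambda_eta)
  qed
  show "finite (vec_lambda ` ?B)" by (intro finite_imageI finite_PiE) auto
qed

lemma card_bracket_le:
  assumes "A \<ge> 1"
  shows "real (card {y :: int ^ 'd. bracket y \<le> A}) \<le> (3 * A) ^ CARD('d)"
proof -
  have "real (card {y :: int ^ 'd. bracket y \<le> A}) \<le> real 1 * (3 * A) ^ card (UNIV :: 'd set)"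
  proof (rule card_coords_le[OF finite_bracket_le assms])
    fix y :: "int ^ 'd" and j assume "y \<in> {y. bracket y \<le> A}"
    then show "\<bar>real_of_int (y $ j)\<bar> \<le> A" using coord_le_bracket[of y j] by simp
  next
    fix z :: "int ^ 'd"
    have "{y \<in> {y. bracket y \<le> A}. \<forall>j\<in>UNIV. y $ j = z $ j} \<subseteq> {z}" by (auto simp: vec_eq_iff)
    then show "card {y \<in> {y. bracket y \<le> A}. \<forall>j\<in>UNIV. y $ j = z $ j} \<le> 1"
      using card_mono[of "{z}"] by fastforce
  qed
  then show ?thesis by simp
qed

lemma sum_wt_finite:
  assumes "2 * \<beta> > real CARD('d)"
  obtains K where "K \<ge> 0" "esum (UNIV :: (int ^ 'd) set) (wt (- 2 * \<beta>)) \<le> ennreal K"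
proof -
  define d where "d = CARD('d)"
  have 1: "real (card {x \<in> (UNIV :: (int ^ 'd) set). bracket x \<le> A \<and> 1 \<le> B}) \<le> 3 ^ d * A powr real d * B powr 0"
    if "A \<ge> 1" "B \<ge> 1" for A B
    using card_bracket_le[OF that(1), where 'd = 'd] that by (simp add: d_def power_mult_distrib powr_realpow)
  have "esum (UNIV :: (int ^ 'd) set) (\<lambda>x. ennreal (bracket x powr - (2 * \<beta>) * 1 powr - (2 * \<beta>)))
     \<le> ennreal (3 ^ d * 2 powr real d * 2 powr 0 * (1 / (1 - 2 powr - (2 * \<beta> - real d)))\<^sup>2)"
    by (rule dyadic_sum_bound[OF _ _ _ _ _ _ _ _ 1])
      (use assms in \<open>auto simp: d_def intro: finite_subset[OF _ finite_bracket_le]\<close>)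
  then show ?thesis
    by (intro that[of "3 ^ d * 2 powr real d * 2 powr 0 * (1 / (1 - 2 powr - (2 * \<beta> - real d)))\<^sup>2"])
      (auto simp: wt_def[abs_def])
qed

lemma sum_agree_except:
  fixes g g' :: "'d::finite \<Rightarrow> int"
  assumes "sum g UNIV = sum g' UNIV" "\<And>j. j \<notin> I \<Longrightarrow> g j = g' j"
  shows "sum g I = sum g' I"
proof -
  have "sum h UNIV = sum h I + sum h (UNIV - I)" for h :: "'d \<Rightarrow> int"
    by (subst sum.union_disjoint[symmetric]) auto
  moreover have "sum g (UNIV - I) = sum g' (UNIV - I)" by (intro sum.cong assms) auto
  ultimately show ?thesis using assms(1) by (metis add_right_cancel)
qed

section \<open>Spheres, hyperplanes and ellipses\<close>

definition sphere_set :: "int ^ 'd \<Rightarrow> int \<Rightarrow> (int ^ 'd) set" where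
  "sphere_set Q \<tau> = {x. sq (Q - x) + sq x = \<tau>}"

definition plane_set :: "int ^ 'd \<Rightarrow> int \<Rightarrow> (int ^ 'd) set" where
  "plane_set Q \<tau> = {x. sq (Q + x) - sq x = \<tau>}"

text \<open>With all coordinates but one frozen, the last one solves a quadratic equation whose two
  roots add up to \<open>Q $ i\<close>.\<close>

lemma card_sphere_crude:
  assumes "A \<ge> 1"
  shows "real (card {x \<in> sphere_set (Q :: int ^ 'd) \<tau>. bracket x \<le> A}) \<le> 2 * (3 * A) ^ (CARD('d) - 1)"
proof -
  obtain i :: 'd where True by blast
  have "real (card {x \<in> sphere_set Q \<tau>. bracket x \<le> A}) \<le> real 2 * (3 * A) ^ card (UNIV - {i})"
  proof (rule card_coords_le[OF _ assms])
    show "finite {x \<in> sphere_set Q \<tau>. bracket x \<le> A}"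
      by (rule finite_subset[OF _ finite_bracket_le]) auto
    show "\<bar>real_of_int (y $ j)\<bar> \<le> A" if "y \<in> {x \<in> sphere_set Q \<tau>. bracket x \<le> A}" for y j
      using coord_le_bracket[of y j] that by simp
    fix z assume z: "z \<in> {x \<in> sphere_set Q \<tau>. bracket x \<le> A}"
    let ?z' = "\<chi> j. if j = i then Q $ i - z $ i else z $ j"
    have "{y \<in> {x \<in> sphere_set Q \<tau>. bracket x \<le> A}. \<forall>j\<in>UNIV - {i}. y $ j = z $ j} \<subseteq> {z, ?z'}"
    proof
      fix y assume y: "y \<in> {y \<in> {x \<in> sphere_set Q \<tau>. bracket x \<le> A}. \<forall>j\<in>UNIV - {i}. y $ j = z $ j}"
      have "sum (\<lambda>j. ((Q - y) $ j)\<^sup>2 + (y $ j)\<^sup>2) UNIV = sum (\<lambda>j. ((Q - z) $ j)\<^sup>2 + (z $ j)\<^sup>2) UNIV"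
        using y z unfolding sphere_set_def sq_def sum.distrib by simp
      then have "sum (\<lambda>j. ((Q - y) $ j)\<^sup>2 + (y $ j)\<^sup>2) {i} = sum (\<lambda>j. ((Q - z) $ j)\<^sup>2 + (z $ j)\<^sup>2) {i}"
        by (rule sum_agree_except) (use y in auto)
      then have "(y $ i - z $ i) * (y $ i + z $ i - Q $ i) = 0"
        by (simp add: power2_eq_square algebra_simps)
      then have "y $ i = z $ i \<or> y $ i = Q $ i - z $ i" by auto
      then have "y = z \<or> y = ?z'" using y by (auto simp: vec_eq_iff)
      then show "y \<in> {z, ?z'}" by blast
    qed
    then have "card {y \<in> {x \<in> sphere_set Q \<tau>. bracket x \<le> A}. \<forall>j\<in>UNIV - {i}. y $ j = z $ j} \<le> card {z, ?z'}"
      by (intro card_mono) auto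
    also have "\<dots> \<le> 2" by (simp add: card_insert_if)
    finally show "card {y \<in> {x \<in> sphere_set Q \<tau>. bracket x \<le> A}. \<forall>j\<in>UNIV - {i}. y $ j = z $ j} \<le> 2" .
  qed
  then show ?thesis by (simp add: card_Diff_singleton)
qed

text \<open>The condition is affine in \<open>x\<close> with normal vector proportional to
  \<open>Q\<close>, so a coordinate in which \<open>Q\<close> does not vanish is determined by the
  others.\<close>

lemma card_plane_crude:
  assumes "A \<ge> 1" "Q \<noteq> 0"
  shows "real (card {x \<in> plane_set (Q :: int ^ 'd) \<tau>. bracket x \<le> A}) \<le> (3 * A) ^ (CARD('d) - 1)"
proof -
  obtain i where i: "Q $ i \<noteq> 0" using assms(2) by (auto simp: vec_eq_iff)
  have "real (card {x \<in> plane_set Q \<tau>. bracket x \<le> A}) \<le> real 1 * (3 * A) ^ card (UNIV - {i})"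
  proof (rule card_coords_le[OF _ assms(1)])
    show "finite {x \<in> plane_set Q \<tau>. bracket x \<le> A}"
      by (rule finite_subset[OF _ finite_bracket_le]) auto
    show "\<bar>real_of_int (y $ j)\<bar> \<le> A" if "y \<in> {x \<in> plane_set Q \<tau>. bracket x \<le> A}" for y j
      using coord_le_bracket[of y j] that by simp
    fix z assume z: "z \<in> {x \<in> plane_set Q \<tau>. bracket x \<le> A}"
    have "{y \<in> {x \<in> plane_set Q \<tau>. bracket x \<le> A}. \<forall>j\<in>UNIV - {i}. y $ j = z $ j} \<subseteq> {z}"
    proof
      fix y assume y: "y \<in> {y \<in> {x \<in> plane_set Q \<tau>. bracket x \<le> A}. \<forall>j\<in>UNIV - {i}. y $ j = z $ j}"
      have "sum (\<lambda>j. ((Q + y) $ j)\<^sup>2 - (y $ j)\<^sup>2) UNIV = sum (\<lambda>j. ((Q + z) $ j)\<^sup>2 - (z $ j)\<^sup>2) UNIV"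
        using y z unfolding plane_set_def sq_def sum_subtractf by simp
      then have "sum (\<lambda>j. ((Q + y) $ j)\<^sup>2 - (y $ j)\<^sup>2) {i} = sum (\<lambda>j. ((Q + z) $ j)\<^sup>2 - (z $ j)\<^sup>2) {i}"
        by (rule sum_agree_except) (use y in auto)
      then have "Q $ i * (y $ i - z $ i) = 0"
        by (simp add: power2_eq_square algebra_simps)
      then have "y = z" using y i by (auto simp: vec_eq_iff)
      then show "y \<in> {z}" by blast
    qed
    then have "card {y \<in> {x \<in> plane_set Q \<tau>. bracket x \<le> A}. \<forall>j\<in>UNIV - {i}. y $ j = z $ j} \<le> card {z}"
      by (intro card_mono) auto
    then show "card {y \<in> {x \<in> plane_set Q \<tau>. bracket x \<le> A}. \<forall>j\<in>UNIV - {i}. y $ j = z $ j} \<le> 1" by simp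
  qed
  then show ?thesis by (simp add: card_Diff_singleton)
qed

text \<open>Meant for Schur's test, where spheres and hyperplanes occur with the same weight. A
  hyperplane can contain about \<open>A ^ (d - 1)\<close> points, so nothing is lost by using the
  crude count for spheres as well.\<close>

lemma sum_wt_quadric:
  assumes "2 * s > real CARD('d) - 1"
  obtains K where "K \<ge> 0"
    "\<And>Q \<tau>. esum (sphere_set (Q :: int ^ 'd) \<tau>) (wt (- 2 * s)) \<le> ennreal K"
    "\<And>Q \<tau>. Q \<noteq> 0 \<Longrightarrow> esum (plane_set (Q :: int ^ 'd) \<tau>) (wt (- 2 * s)) \<le> ennreal K"
proof -
  define n where "n = CARD('d) - 1"
  have n: "real CARD('d) - 1 = real n" by (simp add: n_def)
  define K where "K = (2 * 3 ^ n) * 2 powr real n * 2 powr 0 * (1 / (1 - 2 powr - (2 * s - real n)))\<^sup>2"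
  have main: "esum S (wt (- 2 * s)) \<le> ennreal K"
    if S: "\<And>A. A \<ge> 1 \<Longrightarrow> real (card {x \<in> S. bracket x \<le> A}) \<le> 2 * (3 * A) ^ n" for S :: "(int ^ 'd) set"
  proof -
    have "esum S (\<lambda>x. ennreal (bracket x powr - (2 * s) * 1 powr - (2 * s))) \<le> ennreal K"
      unfolding K_def
    proof (rule dyadic_sum_bound)
      fix A B :: real assume AB: "A \<ge> 1" "B \<ge> 1"
      show "finite {x \<in> S. bracket x \<le> A \<and> 1 \<le> B}"
        by (rule finite_subset[OF _ finite_bracket_le]) auto
      show "real (card {x \<in> S. bracket x \<le> A \<and> 1 \<le> B}) \<le> 2 * 3 ^ n * A powr real n * B powr 0"
        using S[OF AB(1)] AB by (simp add: power_mult_distrib powr_realpow mult.assoc)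
    qed (use assms n in auto)
    then show ?thesis by (simp add: wt_def[abs_def])
  qed
  show ?thesis
  proof (rule that)
    show "K \<ge> 0" by (simp add: K_def)
    show "esum (sphere_set (Q :: int ^ 'd) \<tau>) (wt (- 2 * s)) \<le> ennreal K" for Q \<tau>
      by (rule main) (use card_sphere_crude n_def in auto)
    show "esum (plane_set (Q :: int ^ 'd) \<tau>) (wt (- 2 * s)) \<le> ennreal K" if "Q \<noteq> 0" for Q \<tau>
    proof (rule main)
      fix A :: real assume A: "A \<ge> 1"
      have "(3 * A) ^ n \<ge> 0" using A by simp
      then show "real (card {x \<in> plane_set Q \<tau>. bracket x \<le> A}) \<le> 2 * (3 * A) ^ n"
        using card_plane_crude[OF A that, of \<tau>] unfolding n_def by linarith
    qed
  qed
qed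

lemma ceiling_powr_le:
  fixes A :: real
  assumes "A \<ge> 1" "e \<ge> 0" "real_of_int L \<le> 4 * A" "L \<ge> 0"
  shows "real_of_int L powr e \<le> 4 powr e * A powr e"
  using assms by (subst powr_mult[symmetric]) (auto intro: powr_mono2)

text \<open>Freezing all but two coordinates leaves a circle. It is presented to
  \<open>conic_card_bound\<close> only as a set on which a quadratic polynomial is constant, so
  neither its centre nor its radius has to be controlled.\<close>

lemma card_sphere:
  fixes e :: real
  assumes e: "e > 0" and d: "CARD('d) \<ge> 2"
  obtains C where "C > 0"
    "\<And>Q \<tau> A. A \<ge> 1 \<Longrightarrow> real (card {x \<in> sphere_set (Q :: int ^ 'd) \<tau>. bracket x \<le> A})
       \<le> C * A powr e * A ^ (CARD('d) - 2)"
proof -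
  have b: "(0::int) \<in> {0, 1}" by simp
  obtain C0 where C0: "C0 > 0" and conic: "\<forall>S L \<alpha> \<beta>. L \<ge> 1 \<longrightarrow> (\<forall>x y. (x, y) \<in> S \<longrightarrow> \<bar>x\<bar> \<le> L \<and> \<bar>y\<bar> \<le> L) \<longrightarrow>
       (\<forall>x y x' y'. (x, y) \<in> S \<longrightarrow> (x', y') \<in> S \<longrightarrow>
         x\<^sup>2 + 0 * x * y + y\<^sup>2 + \<alpha> * x + \<beta> * y = x'\<^sup>2 + 0 * x' * y' + y'\<^sup>2 + \<alpha> * x' + \<beta> * y') \<longrightarrow>
       finite S \<and> real (card S) \<le> C0 * real_of_int L powr e"
    using conic_card_bound[OF e b] by blast
  obtain i j :: 'd where ij: "i \<noteq> j"
    using d by (metis One_nat_def card_le_Suc0_iff_eq finite_UNIV not_less_eq_eq numeral_2_eq_2 UNIV_I finite)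
  let ?n = "CARD('d) - 2"
  show ?thesis
  proof (rule that)
    show "C0 * 4 powr e * 3 ^ ?n > 0" using C0 by simp
    fix Q :: "int ^ 'd" and \<tau> :: int and A :: real assume A: "A \<ge> 1"
    define S where "S = {x \<in> sphere_set Q \<tau>. bracket x \<le> A}"
    have coord: "\<bar>real_of_int (y $ j)\<bar> \<le> A" if "y \<in> S" for y j
      using coord_le_bracket[of y j] that by (simp add: S_def)
    have finS: "finite S" unfolding S_def by (rule finite_subset[OF _ finite_bracket_le]) auto
    define L where "L = \<lceil>A\<rceil>"
    have L: "L \<ge> 1" "real_of_int L \<le> 4 * A" using A unfolding L_def by linarith+
    have "real (card S) \<le> real (nat \<lfloor>C0 * real_of_int L powr e\<rfloor>) * (3 * A) ^ card (UNIV - {i, j})"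
    proof (rule card_coords_le[OF finS A coord])
      fix z assume z: "z \<in> S"
      define F where "F = {y \<in> S. \<forall>l\<in>UNIV - {i, j}. y $ l = z $ l}"
      define g where "g = (\<lambda>y :: int ^ 'd. (y $ i, y $ j))"
      have inj: "inj_on g F"
      proof (rule inj_onI)
        fix y y' assume y: "y \<in> F" "y' \<in> F" "g y = g y'"
        have "y $ l = y' $ l" for l
          using y by (cases "l = i \<or> l = j") (auto simp: g_def F_def)
        then show "y = y'" by (simp add: vec_eq_iff)
      qed
      have "finite (g ` F) \<and> real (card (g ` F)) \<le> C0 * real_of_int L powr e"
      proof (rule conic[rule_format, OF L(1), where \<alpha> = "- Q $ i" and \<beta> = "- Q $ j"])
        fix a b assume "(a, b) \<in> g ` F"
        then obtain y where y: "y \<in> S" "a = y $ i" "b = y $ j" by (auto simp: g_def F_def)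
        have "\<bar>y $ l\<bar> \<le> L" for l
        proof -
          have "real_of_int \<bar>y $ l\<bar> \<le> A" using coord[OF y(1), of l] by simp
          then show ?thesis unfolding L_def by linarith
        qed
        then show "\<bar>a\<bar> \<le> L \<and> \<bar>b\<bar> \<le> L" using y by simp
      next
        fix a b a' b' assume "(a, b) \<in> g ` F" "(a', b') \<in> g ` F"
        then obtain y y' where y: "y \<in> F" "a = y $ i" "b = y $ j" and y': "y' \<in> F" "a' = y' $ i" "b' = y' $ j"
          by (auto simp: g_def)
        have "sum (\<lambda>j. ((Q - y) $ j)\<^sup>2 + (y $ j)\<^sup>2) UNIV = sum (\<lambda>j. ((Q - y') $ j)\<^sup>2 + (y' $ j)\<^sup>2) UNIV"
          using y(1) y'(1) unfolding F_def S_def sphere_set_def sq_def sum.distrib by simp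
        then have "sum (\<lambda>j. ((Q - y) $ j)\<^sup>2 + (y $ j)\<^sup>2) {i, j} = sum (\<lambda>j. ((Q - y') $ j)\<^sup>2 + (y' $ j)\<^sup>2) {i, j}"
          by (rule sum_agree_except) (use y(1) y'(1) in \<open>auto simp: F_def\<close>)
        then have "2 * (a\<^sup>2 + b\<^sup>2 - Q $ i * a - Q $ j * b) = 2 * (a'\<^sup>2 + b'\<^sup>2 - Q $ i * a' - Q $ j * b')"
          using ij y y' by (simp add: power2_eq_square algebra_simps)
        then show "a\<^sup>2 + 0 * a * b + b\<^sup>2 + - Q $ i * a + - Q $ j * b = a'\<^sup>2 + 0 * a' * b' + b'\<^sup>2 + - Q $ i * a' + - Q $ j * b'"
          by simp
      qed
      then have "real (card F) \<le> C0 * real_of_int L powr e" using card_image[OF inj] by simp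
      then show "card {y \<in> S. \<forall>l\<in>UNIV - {i, j}. y $ l = z $ l} \<le> nat \<lfloor>C0 * real_of_int L powr e\<rfloor>"
        unfolding F_def[symmetric] by (simp add: le_nat_floor)
    qed
    also have "card (UNIV - {i, j}) = ?n" using ij by (subst card_Diff_subset) auto
    also have "real (nat \<lfloor>C0 * real_of_int L powr e\<rfloor>) * (3 * A) ^ ?n \<le> (C0 * (4 powr e * A powr e)) * (3 * A) ^ ?n"
    proof (intro mult_right_mono)
      have "real (nat \<lfloor>C0 * real_of_int L powr e\<rfloor>) \<le> C0 * real_of_int L powr e"
        using C0 by (intro of_nat_floor) simp
      also have "\<dots> \<le> C0 * (4 powr e * A powr e)"
        using ceiling_powr_le[of A e L] A e L C0 by (intro mult_left_mono) auto
      finally show "real (nat \<lfloor>C0 * real_of_int L powr e\<rfloor>) \<le> C0 * (4 powr e * A powr e)" .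
    qed (use A in auto)
    finally show "real (card {x \<in> sphere_set Q \<tau>. bracket x \<le> A}) \<le> C0 * 4 powr e * 3 ^ ?n * A powr e * A ^ ?n"
      by (simp add: S_def power_mult_distrib mult_ac)
  qed
qed

lemma sum_wt_sphere:
  assumes "2 * s > real CARD('d) - 2" "CARD('d) \<ge> 2"
  obtains K where "K \<ge> 0" "\<And>Q \<tau>. esum (sphere_set (Q :: int ^ 'd) \<tau>) (wt (- 2 * s)) \<le> ennreal K"
proof -
  define n where "n = CARD('d) - 2"
  have n: "real CARD('d) - 2 = real n" using assms(2) by (simp add: n_def)
  define e where "e = (2 * s - real n) / 2"
  have e: "e > 0" using assms n by (simp add: e_def)
  obtain C where C: "C > 0" "\<And>Q \<tau> A. A \<ge> 1 \<Longrightarrow> real (card {x \<in> sphere_set (Q :: int ^ 'd) \<tau>. bracket x \<le> A})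
       \<le> C * A powr e * A ^ (CARD('d) - 2)"
    by (rule card_sphere[OF e assms(2)]) (blast intro: that)
  define K where "K = C * 2 powr (e + real n) * 2 powr 0 * (1 / (1 - 2 powr - e))\<^sup>2"
  show ?thesis
  proof (rule that)
    show "K \<ge> 0" using C by (simp add: K_def)
    fix Q :: "int ^ 'd" and \<tau>
    have "esum (sphere_set Q \<tau>) (\<lambda>x. ennreal (bracket x powr - (2 * s) * 1 powr - (2 * s))) \<le> ennreal K"
      unfolding K_def
    proof (rule dyadic_sum_bound)
      fix A B :: real assume AB: "A \<ge> 1" "B \<ge> 1"
      show "finite {x \<in> sphere_set Q \<tau>. bracket x \<le> A \<and> 1 \<le> B}"
        by (rule finite_subset[OF _ finite_bracket_le]) auto
      show "real (card {x \<in> sphere_set Q \<tau>. bracket x \<le> A \<and> 1 \<le> B}) \<le> C * A powr (e + real n) * B powr 0"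
        using C(2)[OF AB(1), of Q \<tau>] AB by (simp add: powr_add powr_realpow mult.assoc n_def)
    qed (use e n C e_def in \<open>auto simp: field_simps\<close>)
    then show "esum (sphere_set Q \<tau>) (wt (- 2 * s)) \<le> ennreal K" by (simp add: wt_def[abs_def])
  qed
qed

text \<open>Eliminating one of three variables leaves twice the form
  \<open>y^2 + y * y' + y'^2\<close> plus linear terms, hence an ellipse. Its points are so few that
  any positive exponent suffices; this is the gain that replaces spheres in dimension one.\<close>

lemma sum_wt_ellipse:
  assumes "s > 0" and d: "CARD('d) = 1"
  obtains K where "K \<ge> 0"
    "\<And>Q \<tau>. esum {(y, y'). sq ((Q :: int ^ 'd) - y - y') + sq y + sq y' = \<tau>} (\<lambda>(y, y'). wt (- 2 * s) y * wt (- 2 * s) y') \<le> ennreal K"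
proof -
  obtain i :: 'd where i: "UNIV = {i}" using d by (metis card_1_singletonE)
  have sq1: "sq x = (x $ i)\<^sup>2" for x :: "int ^ 'd" by (simp add: sq_def i)
  have eq1: "x = y \<longleftrightarrow> x $ i = y $ i" for x y :: "int ^ 'd"
    using i by (metis UNIV_I singletonD vec_eq_iff)
  have b: "(1::int) \<in> {0, 1}" by simp
  obtain C0 where C0: "C0 > 0" and conic: "\<forall>S L \<alpha> \<beta>. L \<ge> 1 \<longrightarrow> (\<forall>x y. (x, y) \<in> S \<longrightarrow> \<bar>x\<bar> \<le> L \<and> \<bar>y\<bar> \<le> L) \<longrightarrow>
       (\<forall>x y x' y'. (x, y) \<in> S \<longrightarrow> (x', y') \<in> S \<longrightarrow>
         x\<^sup>2 + 1 * x * y + y\<^sup>2 + \<alpha> * x + \<beta> * y = x'\<^sup>2 + 1 * x' * y' + y'\<^sup>2 + \<alpha> * x' + \<beta> * y') \<longrightarrow>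
       finite S \<and> real (card S) \<le> C0 * real_of_int L powr s"
    using conic_card_bound[OF assms(1) b] by blast
  define C where "C = C0 * 4 powr s"
  define K where "K = C * 2 powr s * 2 powr s * (1 / (1 - 2 powr - s))\<^sup>2"
  show ?thesis
  proof (rule that)
    show "K \<ge> 0" using C0 by (simp add: K_def C_def)
    fix Q :: "int ^ 'd" and \<tau>
    let ?S = "{(y, y'). sq (Q - y - y') + sq y + sq y' = \<tau>}"
    have "esum ?S (\<lambda>x. ennreal (bracket (fst x) powr - (2 * s) * bracket (snd x) powr - (2 * s))) \<le> ennreal K"
      unfolding K_def
    proof (rule dyadic_sum_bound)
      fix A B :: real assume AB: "A \<ge> 1" "B \<ge> 1"
      define T where "T = {x \<in> ?S. bracket (fst x) \<le> A \<and> bracket (snd x) \<le> B}"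
      have "T \<subseteq> {y. bracket y \<le> A} \<times> {y. bracket y \<le> B}" by (auto simp: T_def)
      then show "finite {x \<in> ?S. bracket (fst x) \<le> A \<and> bracket (snd x) \<le> B}"
        unfolding T_def[symmetric] by (rule finite_subset) (simp add: finite_bracket_le)
      define L where "L = max \<lceil>A\<rceil> \<lceil>B\<rceil>"
      have L: "L \<ge> 1" "real_of_int L \<le> 4 * (A * B)"
      proof -
        show "L \<ge> 1" using AB unfolding L_def by linarith
        have "A * 1 \<le> A * B" "1 * B \<le> A * B" using AB by (intro mult_mono; simp)+
        then show "real_of_int L \<le> 4 * (A * B)" using AB unfolding L_def by linarith
      qed
      define g where "g = (\<lambda>p :: (int ^ 'd) \<times> (int ^ 'd). (fst p $ i, snd p $ i))"
      have inj: "inj_on g T" by (intro inj_onI) (auto simp: g_def eq1)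
      have "finite (g ` T) \<and> real (card (g ` T)) \<le> C0 * real_of_int L powr s"
      proof (rule conic[rule_format, OF L(1), where \<alpha> = "- Q $ i" and \<beta> = "- Q $ i"])
        fix a b assume "(a, b) \<in> g ` T"
        then obtain y y' where y: "(y, y') \<in> T" "a = y $ i" "b = y' $ i" by (auto simp: g_def)
        have "\<bar>real_of_int a\<bar> \<le> A" "\<bar>real_of_int b\<bar> \<le> B"
          using y coord_le_bracket[of y i] coord_le_bracket[of y' i] by (auto simp: T_def)
        then have "real_of_int \<bar>a\<bar> \<le> A" "real_of_int \<bar>b\<bar> \<le> B" by simp_all
        then show "\<bar>a\<bar> \<le> L \<and> \<bar>b\<bar> \<le> L" unfolding L_def by linarith
      next
        fix a b a' b' assume "(a, b) \<in> g ` T" "(a', b') \<in> g ` T"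
        then have "(Q $ i - a - b)\<^sup>2 + a\<^sup>2 + b\<^sup>2 = \<tau>" "(Q $ i - a' - b')\<^sup>2 + a'\<^sup>2 + b'\<^sup>2 = \<tau>"
          by (auto simp: g_def T_def sq1)
        then have "2 * (a\<^sup>2 + 1 * a * b + b\<^sup>2 + - Q $ i * a + - Q $ i * b) = 2 * (a'\<^sup>2 + 1 * a' * b' + b'\<^sup>2 + - Q $ i * a' + - Q $ i * b')"
          by (simp add: power2_eq_square algebra_simps)
        then show "a\<^sup>2 + 1 * a * b + b\<^sup>2 + - Q $ i * a + - Q $ i * b = a'\<^sup>2 + 1 * a' * b' + b'\<^sup>2 + - Q $ i * a' + - Q $ i * b'"
          by simp
      qed
      then have "real (card T) \<le> C0 * real_of_int L powr s" using card_image[OF inj] by simp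
      also have "\<dots> \<le> C0 * (4 powr s * (A * B) powr s)"
        using ceiling_powr_le[of "A * B" s L] AB L C0 assms(1) mult_mono[of 1 A 1 B] by (intro mult_left_mono) auto
      also have "\<dots> = C * A powr s * B powr s" using AB by (simp add: C_def powr_mult)
      finally show "real (card {x \<in> ?S. bracket (fst x) \<le> A \<and> bracket (snd x) \<le> B}) \<le> C * A powr s * B powr s"
        unfolding T_def .
    qed (use assms C0 in \<open>auto simp: C_def\<close>)
    then show "esum ?S (\<lambda>(y, y'). wt (- 2 * s) y * wt (- 2 * s) y') \<le> ennreal K"
      by (simp add: wt_def case_prod_unfold flip: ennreal_mult)
  qed
qed

section \<open>Two variables completed by \<open>n_q\<close> in dimension two\<close>

text \<open>The variable \<open>u\<close> stands for \<open>n_q\<close>, and the sign of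
  \<open>x\<close> has been normalised to 1. The condition \<open>x \<noteq> u\<close> is what
  non-resonance provides; the ordering of \<open>x\<close> and \<open>y\<close> makes the choice of
  \<open>y\<close> cheap.\<close>

definition pair_set :: "int \<Rightarrow> int \<Rightarrow> int ^ 'd \<Rightarrow> int \<Rightarrow> ((int ^ 'd) \<times> (int ^ 'd)) set" where
  "pair_set c q P \<tau> = {(x, y). bracket y \<le> bracket x \<and>
     (\<exists>u. x + c *s y + q *s u = P \<and> sq x + c * sq y + q * sq u = \<tau> \<and> x \<noteq> u)}"

lemma coord_in_interval:
  assumes "bracket x \<le> A"
  shows "x $ l \<in> {-\<lfloor>A\<rfloor>..\<lfloor>A\<rfloor>}"
proof -
  have "real_of_int (x $ l) \<le> A" "real_of_int (- (x $ l)) \<le> A"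
    using coord_le_bracket[of x l] assms by simp_all
  then have "x $ l \<le> \<lfloor>A\<rfloor>" "- (x $ l) \<le> \<lfloor>A\<rfloor>" by (simp_all only: le_floor_iff)
  then show ?thesis by auto
qed

lemma card_interval_le: "A \<ge> 1 \<Longrightarrow> real (card {-\<lfloor>A\<rfloor>..\<lfloor>A\<rfloor>}) \<le> 3 * (A::real)"
  using of_int_floor_le[of A] by simp linarith

lemma card_prod_interval_le:
  assumes "A \<ge> 1" "B \<ge> 1"
  shows "real (card ({-\<lfloor>A\<rfloor>..\<lfloor>A\<rfloor>} \<times> {-\<lfloor>B\<rfloor>..\<lfloor>B\<rfloor>})) \<le> 9 * A * (B::real)"
proof -
  have "real (card ({-\<lfloor>A\<rfloor>..\<lfloor>A\<rfloor>} \<times> {-\<lfloor>B\<rfloor>..\<lfloor>B\<rfloor>})) = real (card {-\<lfloor>A\<rfloor>..\<lfloor>A\<rfloor>}) * real (card {-\<lfloor>B\<rfloor>..\<lfloor>B\<rfloor>})"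
    by (simp only: card_cartesian_product of_nat_mult)
  also have "\<dots> \<le> (3 * A) * (3 * B)"
    by (rule mult_mono[OF card_interval_le card_interval_le]) (use assms in auto)
  finally show ?thesis by simp
qed

text \<open>For each of the \<open>O(B^2)\<close> values of \<open>y\<close> the point
  \<open>x\<close> lies on a circle; finally \<open>B^2 \<le> A * B\<close>.\<close>

lemma card_pair_set_plus:
  fixes e :: real
  assumes e: "e > 0" and d: "CARD('d) = 2"
  shows "\<exists>C>0. \<forall>c (P :: int ^ 'd) \<tau> A B. A \<ge> 1 \<longrightarrow> B \<ge> 1 \<longrightarrow> B \<le> A \<longrightarrow>
     real (card {p \<in> pair_set c 1 P \<tau>. bracket (fst p) \<le> A \<and> bracket (snd p) \<le> B}) \<le> C * A powr (1 + e) * B"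
proof -
  obtain C where C: "C > 0" "\<And>Q \<tau> A. A \<ge> 1 \<Longrightarrow> real (card {x \<in> sphere_set (Q :: int ^ 'd) \<tau>. bracket x \<le> A})
       \<le> C * A powr e * A ^ (CARD('d) - 2)"
    by (rule card_sphere[OF e, where 'd = 'd]) (use d in \<open>auto intro: that\<close>)
  show ?thesis
  proof (intro exI[of _ "9 * C"] conjI[of "9 * C > 0"] allI impI)
    fix c :: int and P :: "int ^ 'd" and \<tau> :: int and A B :: real
    assume AB: "A \<ge> 1" "B \<ge> 1" "B \<le> A"
    let ?T = "{p \<in> pair_set c 1 P \<tau>. bracket (fst p) \<le> A \<and> bracket (snd p) \<le> B}"
    have "?T \<subseteq> {x. bracket x \<le> A} \<times> {x. bracket x \<le> B}" by auto
    then have fin: "finite ?T" by (rule finite_subset) (simp add: finite_bracket_le)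
    have "card ?T \<le> nat \<lfloor>C * A powr e\<rfloor> * card {y :: int ^ 'd. bracket y \<le> B}"
    proof (rule card_le_fibres[OF fin finite_bracket_le, where f = snd])
      show "snd ` ?T \<subseteq> {y. bracket y \<le> B}" by auto
      fix y :: "int ^ 'd"
      have "inj_on fst {a \<in> ?T. snd a = y}" by (intro inj_onI) auto
      moreover have "fst ` {a \<in> ?T. snd a = y} \<subseteq> {x \<in> sphere_set (P - c *s y) (\<tau> - c * sq y). bracket x \<le> A}"
        by (auto simp: pair_set_def sphere_set_def)
      moreover have "finite {x \<in> sphere_set (P - c *s y) (\<tau> - c * sq y). bracket x \<le> A}"
        by (rule finite_subset[OF _ finite_bracket_le]) auto
      ultimately have "card {a \<in> ?T. snd a = y} \<le> card {x \<in> sphere_set (P - c *s y) (\<tau> - c * sq y). bracket x \<le> A}"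
        by (rule card_inj_on_le)
      then have "real (card {a \<in> ?T. snd a = y}) \<le> C * A powr e"
        using C(2)[OF AB(1), of "P - c *s y" "\<tau> - c * sq y"] d by simp
      then show "card {a \<in> ?T. snd a = y} \<le> nat \<lfloor>C * A powr e\<rfloor>" by (rule le_nat_floor)
    qed
    then have "real (card ?T) \<le> real (nat \<lfloor>C * A powr e\<rfloor>) * real (card {y :: int ^ 'd. bracket y \<le> B})"
      by (simp only: of_nat_le_iff flip: of_nat_mult)
    also have "\<dots> \<le> (C * A powr e) * (3 * B) ^ CARD('d)"
      using C AB by (intro mult_mono card_bracket_le of_nat_floor) auto
    also have "\<dots> = 9 * C * A powr e * B * B" by (simp add: d power2_eq_square)
    also have "\<dots> \<le> 9 * C * A powr e * A * B"
      using C AB by (intro mult_right_mono mult_left_mono) auto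
    also have "\<dots> = 9 * C * A powr (1 + e) * B"
      using AB by (simp add: powr_add mult_ac)
    finally show "real (card ?T) \<le> 9 * C * A powr (1 + e) * B" .
  qed (use C in simp)
qed

text \<open>
  Written in \<open>p = x - u\<close>, the quadratic condition is bilinear; once the first coordinates are fixed it is a
  hyperbola in the second ones.
\<close>

lemma card_pair_set_minus:
  fixes e :: real
  assumes e: "e > 0" and d: "CARD('d) = 2"
  shows "\<exists>C>0. \<forall>c (P :: int ^ 'd) \<tau> A B. c \<in> {1, -1} \<longrightarrow> A \<ge> 1 \<longrightarrow> B \<ge> 1 \<longrightarrow> B \<le> A \<longrightarrow>
     real (card {p \<in> pair_set c (-1) P \<tau>. bracket (fst p) \<le> A \<and> bracket (snd p) \<le> B}) \<le> C * A powr (1 + e) * B"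
proof -
  obtain i j :: 'd where ij: "i \<noteq> j" "UNIV = {i, j}" using d by (metis card_2_iff)
  have vec2: "x = y \<longleftrightarrow> x $ i = y $ i \<and> x $ j = y $ j" for x y :: "int ^ 'd"
  proof
    assume "x $ i = y $ i \<and> x $ j = y $ j"
    then have "x $ l = y $ l" for l using ij(2) by (metis UNIV_I insertE singletonD)
    then show "x = y" by (simp add: vec_eq_iff)
  qed simp
  have sq2: "sq x = (x $ i)\<^sup>2 + (x $ j)\<^sup>2" for x :: "int ^ 'd" unfolding sq_def ij(2) using ij(1) by simp
  obtain C0 where C0: "C0 > 0" and hyp: "\<forall>S L a b c. L \<ge> 1 \<longrightarrow> c \<noteq> 0 \<longrightarrow>
       (\<forall>x y. (x, y) \<in> S \<longrightarrow> \<bar>x - a\<bar> \<le> L \<and> \<bar>y - b\<bar> \<le> L \<and> x * y = c) \<longrightarrow>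
       finite S \<and> real (card S) \<le> C0 * real_of_int L powr e"
    using hyperbola_card_bound[OF e] by blast
  define C where "C = 9 * (C0 * 4 powr e) + 27"
  show ?thesis
  proof (intro exI[of _ C] conjI[of "C > 0"] allI impI)
    show "C > 0" using C0 by (simp add: C_def add_pos_pos)
    fix c :: int and P :: "int ^ 'd" and \<tau> :: int and A B :: real
    assume c: "c \<in> {1, -1}" and AB: "A \<ge> 1" "B \<ge> 1" "B \<le> A"
    define T where "T = {p \<in> pair_set c (-1) P \<tau>. bracket (fst p) \<le> A \<and> bracket (snd p) \<le> B}"
    \<comment> \<open>\<open>p\<close> is \<open>x - u\<close>. The companion factor
      \<open>z\<close> is \<open>x - P\<close> if \<open>c = 1\<close> and \<open>x - y\<close> if
      \<open>c = -1\<close>; in both cases the phase condition says that the inner product of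
      \<open>p\<close> and \<open>z\<close> equals \<open>t\<close>.\<close>
    define p where "p l r = P $ l - c * (snd r $ l)" for l and r :: "(int ^ 'd) \<times> (int ^ 'd)"
    define z where "z l r = fst r $ l - (if c = 1 then P $ l else snd r $ l)" for l and r :: "(int ^ 'd) \<times> (int ^ 'd)"
    define t where "t = (\<tau> - c * sq P) div 2"
    have "T \<subseteq> {x. bracket x \<le> A} \<times> {x. bracket x \<le> B}" by (auto simp: T_def)
    then have fin: "finite T" by (rule finite_subset) (simp add: finite_bracket_le)
    have eq: "p i r * z i r + p j r * z j r = t" and p0: "p i r \<noteq> 0 \<or> p j r \<noteq> 0" if r: "r \<in> T" for r
    proof -
      obtain x y where xy: "r = (x, y)" by (cases r)
      obtain u where u: "x + c *s y + -1 *s u = P" "sq x + c * sq y + -1 * sq u = \<tau>" "x \<noteq> u"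
        using r xy by (auto simp: T_def pair_set_def)
      have ul: "u $ l = x $ l + c * y $ l - P $ l" for l
        unfolding u(1)[symmetric] by simp
      have "2 * (p i r * z i r + p j r * z j r) = \<tau> - c * sq P"
        unfolding u(2)[symmetric] sq2 ul p_def z_def xy fst_conv snd_conv
        using c by (auto simp: power2_eq_square algebra_simps)
      then have "(\<tau> - c * sq P) div 2 = (2 * (p i r * z i r + p j r * z j r)) div 2" by (simp only:)
      then show "p i r * z i r + p j r * z j r = t" unfolding t_def by simp
      show "p i r \<noteq> 0 \<or> p j r \<noteq> 0"
      proof (rule ccontr)
        assume "\<not> (p i r \<noteq> 0 \<or> p j r \<noteq> 0)"
        then have "x = u" unfolding vec2 ul p_def xy by simp
        then show False using u(3) by simp
      qed
    qed
    have pc: "snd r $ l = snd r' $ l" if "p l r = p l r'" for l r r'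
      using that c by (auto simp: p_def)
    have zc: "fst r $ l = fst r' $ l" if "z l r = z l r'" "snd r $ l = snd r' $ l" for l r r'
      using that by (auto simp: z_def split: if_splits)
    have rel: "r = r'" if "fst r $ i = fst r' $ i" "fst r $ j = fst r' $ j" "snd r $ i = snd r' $ i" "snd r $ j = snd r' $ j"
      for r r' :: "(int ^ 'd) \<times> (int ^ 'd)"
      using that by (auto simp: prod_eq_iff vec2)
    have xI: "fst r $ l \<in> {-\<lfloor>A\<rfloor>..\<lfloor>A\<rfloor>}" and yI: "snd r $ l \<in> {-\<lfloor>B\<rfloor>..\<lfloor>B\<rfloor>}"
      if "r \<in> T" for r l
      using that by (auto simp only: T_def mem_Collect_eq intro: coord_in_interval)
    define L where "L = 2 * \<lceil>A\<rceil>"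
    have L1: "L \<ge> 1" and L2: "\<lfloor>A\<rfloor> + \<lfloor>B\<rfloor> \<le> L" and L3: "real_of_int L \<le> 4 * A"
      using AB unfolding L_def by linarith+
    \<comment> \<open>On \<open>T1\<close> the product of the second coordinates is a nonzero number
      fixed by the first coordinates, so they lie on a hyperbola. The other three sets are
      degenerate: there \<open>p j r * z j r = 0\<close>, so \<open>z i r\<close> follows from
      \<open>p i r\<close> whenever \<open>p i r \<noteq> 0\<close>. In each of them two
      coordinates, at least one of them a coordinate of \<open>y\<close>, determine the
      pair.\<close>
    define T1 where "T1 = {r \<in> T. p j r * z j r \<noteq> 0}"
    define T2 where "T2 = {r \<in> T. p j r = 0}"
    define T3 where "T3 = {r \<in> T. z j r = 0 \<and> p i r \<noteq> 0}"
    define T4 where "T4 = {r \<in> T. z j r = 0 \<and> p i r = 0}"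
    have zi: "z i r = z i r'" if "r \<in> T" "r' \<in> T" "p i r = p i r'" "p i r \<noteq> 0" "p j r * z j r = p j r' * z j r'" for r r'
    proof -
      have "p i r * z i r = p i r' * z i r'" using eq[OF that(1)] eq[OF that(2)] that(5) by linarith
      then have "p i r * z i r = p i r * z i r'" by (simp only: that(3))
      then show ?thesis using that(4) by simp
    qed
    have c2: "real (card T2) \<le> 9 * A * B"
    proof -
      have "inj_on (\<lambda>r. (fst r $ j, snd r $ i)) T2"
      proof (rule inj_onI)
        fix r r' assume r: "r \<in> T2" "r' \<in> T2" "(fst r $ j, snd r $ i) = (fst r' $ j, snd r' $ i)"
        have "p j r = 0" "p j r' = 0" using r by (auto simp: T2_def)
        then have yj: "snd r $ j = snd r' $ j" by (intro pc) simp
        have "p i r = p i r'" using r by (simp add: p_def)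
        moreover have "p i r \<noteq> 0" using p0[of r] r by (auto simp: T2_def)
        ultimately have "z i r = z i r'" using r by (intro zi) (auto simp: T2_def)
        then have "fst r $ i = fst r' $ i" using r by (intro zc) auto
        then show "r = r'" using r yj by (intro rel) auto
      qed
      moreover have "(\<lambda>r. (fst r $ j, snd r $ i)) ` T2 \<subseteq> {-\<lfloor>A\<rfloor>..\<lfloor>A\<rfloor>} \<times> {-\<lfloor>B\<rfloor>..\<lfloor>B\<rfloor>}"
        using xI yI by (auto simp: T2_def)
      ultimately have "card T2 \<le> card ({-\<lfloor>A\<rfloor>..\<lfloor>A\<rfloor>} \<times> {-\<lfloor>B\<rfloor>..\<lfloor>B\<rfloor>})"
        by (rule card_inj_on_le) simp
      then show ?thesis using card_prod_interval_le[OF AB(1,2)] by linarith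
    qed
    have c4: "real (card T4) \<le> 9 * A * B"
    proof -
      have "inj_on (\<lambda>r. (fst r $ i, snd r $ j)) T4"
      proof (rule inj_onI)
        fix r r' assume r: "r \<in> T4" "r' \<in> T4" "(fst r $ i, snd r $ j) = (fst r' $ i, snd r' $ j)"
        have "p i r = 0" "p i r' = 0" "z j r = 0" "z j r' = 0" using r by (auto simp: T4_def)
        then have yi: "snd r $ i = snd r' $ i" and "fst r $ j = fst r' $ j"
          using r by (auto intro!: pc zc)
        then show "r = r'" using r by (intro rel) auto
      qed
      moreover have "(\<lambda>r. (fst r $ i, snd r $ j)) ` T4 \<subseteq> {-\<lfloor>A\<rfloor>..\<lfloor>A\<rfloor>} \<times> {-\<lfloor>B\<rfloor>..\<lfloor>B\<rfloor>}"
        using xI yI by (auto simp: T4_def)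
      ultimately have "card T4 \<le> card ({-\<lfloor>A\<rfloor>..\<lfloor>A\<rfloor>} \<times> {-\<lfloor>B\<rfloor>..\<lfloor>B\<rfloor>})"
        by (rule card_inj_on_le) simp
      then show ?thesis using card_prod_interval_le[OF AB(1,2)] by linarith
    qed
    have c3: "real (card T3) \<le> 9 * A * B"
    proof -
      have "inj_on (\<lambda>r. (snd r $ i, snd r $ j)) T3"
      proof (rule inj_onI)
        fix r r' assume r: "r \<in> T3" "r' \<in> T3" "(snd r $ i, snd r $ j) = (snd r' $ i, snd r' $ j)"
        have z: "p i r \<noteq> 0" "z j r = 0" "z j r' = 0" using r by (auto simp: T3_def)
        have "p i r = p i r'" using r by (simp add: p_def)
        then have "z i r = z i r'" using r z by (intro zi) (auto simp: T3_def)
        then have "fst r $ i = fst r' $ i" "fst r $ j = fst r' $ j" using r z by (auto intro!: zc)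
        then show "r = r'" using r by (intro rel) auto
      qed
      moreover have "(\<lambda>r. (snd r $ i, snd r $ j)) ` T3 \<subseteq> {-\<lfloor>B\<rfloor>..\<lfloor>B\<rfloor>} \<times> {-\<lfloor>B\<rfloor>..\<lfloor>B\<rfloor>}"
        using yI by (auto simp: T3_def)
      ultimately have "card T3 \<le> card ({-\<lfloor>B\<rfloor>..\<lfloor>B\<rfloor>} \<times> {-\<lfloor>B\<rfloor>..\<lfloor>B\<rfloor>})"
        by (rule card_inj_on_le) simp
      then have "real (card T3) \<le> 9 * B * B" using card_prod_interval_le[OF AB(2,2)] by linarith
      also have "\<dots> \<le> 9 * A * B" using AB by (intro mult_right_mono) auto
      finally show ?thesis .
    qed
    have c1: "real (card T1) \<le> (C0 * (4 powr e * A powr e)) * (9 * A * B)"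
    proof -
      have "card T1 \<le> nat \<lfloor>C0 * real_of_int L powr e\<rfloor> * card ({-\<lfloor>A\<rfloor>..\<lfloor>A\<rfloor>} \<times> {-\<lfloor>B\<rfloor>..\<lfloor>B\<rfloor>})"
      proof (rule card_le_fibres[where f = "\<lambda>r. (fst r $ i, snd r $ i)"])
        show "finite T1" using fin by (simp add: T1_def)
        show "finite ({-\<lfloor>A\<rfloor>..\<lfloor>A\<rfloor>} \<times> {-\<lfloor>B\<rfloor>..\<lfloor>B\<rfloor>})" by simp
        show "(\<lambda>r. (fst r $ i, snd r $ i)) ` T1 \<subseteq> {-\<lfloor>A\<rfloor>..\<lfloor>A\<rfloor>} \<times> {-\<lfloor>B\<rfloor>..\<lfloor>B\<rfloor>}"
          using xI yI by (auto simp: T1_def)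
        fix b :: "int \<times> int"
        define F where "F = {a \<in> T1. (fst a $ i, snd a $ i) = b}"
        show "card {a \<in> T1. (fst a $ i, snd a $ i) = b} \<le> nat \<lfloor>C0 * real_of_int L powr e\<rfloor>"
        proof (cases "F = {}")
          case False
          then obtain r0 where r0: "r0 \<in> F" by blast
          define g where "g r = (p j r, z j r)" for r
          have pz: "p j r * z j r = p j r0 * z j r0" if "r \<in> F" for r
          proof -
            have f: "fst r $ i = fst r0 $ i" "snd r $ i = snd r0 $ i" using that r0 by (auto simp: F_def)
            then have "p i r = p i r0" "z i r = z i r0" by (simp_all add: p_def z_def)
            then show ?thesis using eq[of r] eq[of r0] that r0 by (auto simp: F_def T1_def)
          qed
          have "inj_on g F"
          proof (rule inj_onI)
            fix r r' assume r: "r \<in> F" "r' \<in> F" "g r = g r'"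
            then have "snd r $ j = snd r' $ j" by (intro pc) (simp add: g_def)
            moreover from this have "fst r $ j = fst r' $ j" using r by (intro zc) (simp_all add: g_def)
            ultimately show "r = r'" using r by (intro rel) (auto simp: F_def)
          qed
          moreover have "finite (g ` F) \<and> real (card (g ` F)) \<le> C0 * real_of_int L powr e"
          proof (rule hyp[rule_format, OF L1])
            show "p j r0 * z j r0 \<noteq> 0" using r0 by (simp add: F_def T1_def)
            fix a b assume "(a, b) \<in> g ` F"
            then obtain r where r: "r \<in> F" "a = p j r" "b = z j r" by (auto simp: g_def)
            have rT: "r \<in> T" using r by (simp add: F_def T1_def)
            have "\<bar>snd r $ j\<bar> \<le> \<lfloor>B\<rfloor>" "\<bar>fst r $ j\<bar> \<le> \<lfloor>A\<rfloor>" using xI[OF rT, of j] yI[OF rT, of j] by (auto simp: abs_le_iff)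
            moreover have "\<lfloor>A\<rfloor> \<ge> 0" "\<lfloor>B\<rfloor> \<ge> 0" using AB by auto
            ultimately have "\<bar>p j r - P $ j\<bar> \<le> L" "\<bar>z j r - (if c = 1 then - P $ j else 0)\<bar> \<le> L"
              using L2 c by (auto simp: p_def z_def)
            then show "\<bar>a - P $ j\<bar> \<le> L \<and> \<bar>b - (if c = 1 then - P $ j else 0)\<bar> \<le> L \<and> a * b = p j r0 * z j r0"
              using r pz by simp
          qed
          ultimately have "real (card F) \<le> C0 * real_of_int L powr e" by (simp add: card_image)
          then show ?thesis unfolding F_def by (rule le_nat_floor)
        next
          case True
          then show ?thesis unfolding F_def[symmetric] by simp
        qed
      qed
      then have "real (card T1) \<le> real (nat \<lfloor>C0 * real_of_int L powr e\<rfloor>) * real (card ({-\<lfloor>A\<rfloor>..\<lfloor>A\<rfloor>} \<times> {-\<lfloor>B\<rfloor>..\<lfloor>B\<rfloor>}))"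
        by (simp only: of_nat_le_iff flip: of_nat_mult)
      also have "\<dots> \<le> (C0 * (4 powr e * A powr e)) * (9 * A * B)"
      proof (rule mult_mono)
        have "real (nat \<lfloor>C0 * real_of_int L powr e\<rfloor>) \<le> C0 * real_of_int L powr e"
          using C0 by (intro of_nat_floor) simp
        also have "\<dots> \<le> C0 * (4 powr e * A powr e)"
          using ceiling_powr_le[of A e L] AB e L1 L3 C0 by (intro mult_left_mono) auto
        finally show "real (nat \<lfloor>C0 * real_of_int L powr e\<rfloor>) \<le> C0 * (4 powr e * A powr e)" .
      qed (use C0 card_prod_interval_le[OF AB(1,2)] in auto)
      finally show ?thesis .
    qed
    have "T \<subseteq> T1 \<union> (T2 \<union> (T3 \<union> T4))" by (auto simp: T1_def T2_def T3_def T4_def)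
    moreover have "finite (T1 \<union> (T2 \<union> (T3 \<union> T4)))" using fin by (simp add: T1_def T2_def T3_def T4_def)
    ultimately have "card T \<le> card (T1 \<union> (T2 \<union> (T3 \<union> T4)))" by (intro card_mono)
    also have "\<dots> \<le> card T1 + (card T2 + (card T3 + card T4))"
      using card_Un_le[of T1 "T2 \<union> (T3 \<union> T4)"] card_Un_le[of T2 "T3 \<union> T4"] card_Un_le[of T3 T4] by linarith
    finally have "real (card T) \<le> (C0 * (4 powr e * A powr e)) * (9 * A * B) + 27 * A * B"
      using c1 c2 c3 c4 by linarith
    also have "27 * A * B \<le> 27 * A * B * A powr e"
      using AB e mult_left_mono[of 1 "A powr e" "27 * A * B"] ge_one_powr_ge_zero[of A e] by simp
    also have "(C0 * (4 powr e * A powr e)) * (9 * A * B) + 27 * A * B * A powr e = C * A powr (1 + e) * B"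
      using AB by (simp add: C_def powr_add algebra_simps)
    finally show "real (card {p \<in> pair_set c (-1) P \<tau>. bracket (fst p) \<le> A \<and> bracket (snd p) \<le> B}) \<le> C * A powr (1 + e) * B"
      unfolding T_def by simp
  qed
qed

text \<open>The order built into \<open>pair_set\<close> lets \<open>B\<close> be replaced by
  \<open>min A B\<close>, so the count for \<open>B \<le> A\<close> covers all blocks. The weights
  beat it because \<open>2 * s = 1 + 2 * e\<close>.\<close>

lemma sum_wt_pair_set:
  assumes "2 * s > 1" and d: "CARD('d) = 2"
  obtains K where "K \<ge> 0"
    "\<And>c q (P :: int ^ 'd) \<tau>. c \<in> {1, -1} \<Longrightarrow> q \<in> {1, -1} \<Longrightarrow>
      esum (pair_set c q P \<tau>) (\<lambda>p. wt (- 2 * s) (fst p) * wt (- 2 * s) (snd p)) \<le> ennreal K"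
proof -
  define e where "e = (2 * s - 1) / 2"
  have e: "e > 0" using assms by (simp add: e_def)
  obtain C1 where C1: "C1 > 0" "\<forall>c (P :: int ^ 'd) \<tau> A B. A \<ge> 1 \<longrightarrow> B \<ge> 1 \<longrightarrow> B \<le> A \<longrightarrow>
     real (card {p \<in> pair_set c 1 P \<tau>. bracket (fst p) \<le> A \<and> bracket (snd p) \<le> B}) \<le> C1 * A powr (1 + e) * B"
    using card_pair_set_plus[OF e d] by blast
  obtain C2 where C2: "C2 > 0" "\<forall>c (P :: int ^ 'd) \<tau> A B. c \<in> {1, -1} \<longrightarrow> A \<ge> 1 \<longrightarrow> B \<ge> 1 \<longrightarrow> B \<le> A \<longrightarrow>
     real (card {p \<in> pair_set c (-1) P \<tau>. bracket (fst p) \<le> A \<and> bracket (snd p) \<le> B}) \<le> C2 * A powr (1 + e) * B"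
    using card_pair_set_minus[OF e d] by blast
  define C where "C = max C1 C2"
  define K where "K = C * 2 powr (1 + e) * 2 powr 1 * (1 / (1 - 2 powr - e))\<^sup>2"
  show ?thesis
  proof (rule that)
    show "K \<ge> 0" using C1 by (simp add: K_def C_def)
    fix c q :: int and P :: "int ^ 'd" and \<tau> :: int
    assume cq: "c \<in> {1, -1}" "q \<in> {1, -1}"
    have bound: "real (card {p \<in> pair_set c q P \<tau>. bracket (fst p) \<le> A \<and> bracket (snd p) \<le> B}) \<le> C * A powr (1 + e) * B"
      if AB: "A \<ge> 1" "B \<ge> 1" "B \<le> A" for A B
    proof -
      have "C1 * A powr (1 + e) * B \<le> C * A powr (1 + e) * B" "C2 * A powr (1 + e) * B \<le> C * A powr (1 + e) * B"
        using AB by (intro mult_right_mono; simp add: C_def)+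
      moreover have "q = 1 \<or> q = -1" using cq by simp
      ultimately show ?thesis
        using C1(2)[rule_format, OF AB, of c P \<tau>] C2(2)[rule_format, OF cq(1) AB, of P \<tau>]
        by (elim disjE) (hypsubst; linarith)+
    qed
    have "esum (pair_set c q P \<tau>) (\<lambda>p. ennreal (bracket (fst p) powr - (2 * s) * bracket (snd p) powr - (2 * s))) \<le> ennreal K"
      unfolding K_def
    proof (rule dyadic_sum_bound)
      fix A B :: real assume AB: "A \<ge> 1" "B \<ge> 1"
      have "{p \<in> pair_set c q P \<tau>. bracket (fst p) \<le> A \<and> bracket (snd p) \<le> B} \<subseteq> {x. bracket x \<le> A} \<times> {x. bracket x \<le> B}"
        by auto
      then show "finite {p \<in> pair_set c q P \<tau>. bracket (fst p) \<le> A \<and> bracket (snd p) \<le> B}"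
        by (rule finite_subset) (simp add: finite_bracket_le)
      have "{p \<in> pair_set c q P \<tau>. bracket (fst p) \<le> A \<and> bracket (snd p) \<le> B}
          = {p \<in> pair_set c q P \<tau>. bracket (fst p) \<le> A \<and> bracket (snd p) \<le> min A B}"
        by (auto simp: pair_set_def)
      then have "real (card {p \<in> pair_set c q P \<tau>. bracket (fst p) \<le> A \<and> bracket (snd p) \<le> B}) \<le> C * A powr (1 + e) * min A B"
        using bound[of A "min A B"] AB by simp
      also have "\<dots> \<le> C * A powr (1 + e) * B" using C1 AB by (intro mult_left_mono) (auto simp: C_def)
      finally show "real (card {p \<in> pair_set c q P \<tau>. bracket (fst p) \<le> A \<and> bracket (snd p) \<le> B}) \<le> C * A powr (1 + e) * B powr 1"
        using AB by simp
    qed (use e C1 in \<open>auto simp: C_def e_def field_simps\<close>)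
    then show "esum (pair_set c q P \<tau>) (\<lambda>p. wt (- 2 * s) (fst p) * wt (- 2 * s) (snd p)) \<le> ennreal K"
      by (simp add: wt_def flip: ennreal_mult)
  qed
qed

section \<open>Multilinear forms\<close>

lemma esum_Sigma: "esum (Sigma A B) f = esum A (\<lambda>x. esum (B x) (\<lambda>y. f (x, y)))"
proof -
  have "esum (Sigma A B) f = (\<integral>\<^sup>+p. f p * indicator (Sigma A B) p \<partial>count_space UNIV)"
    using nn_integral_count_space_indicator[of "Sigma A B" f]
    by (cases "Sigma A B = UNIV") (auto simp: NO_MATCH_def)
  also have "\<dots> = (\<integral>\<^sup>+x. \<integral>\<^sup>+y. f (x, y) * indicator (Sigma A B) (x, y) \<partial>count_space UNIV \<partial>count_space UNIV)"
    by (rule nn_integral_fst_count_space[symmetric])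
  also have "\<dots> = (\<integral>\<^sup>+x. (\<integral>\<^sup>+y. f (x, y) * indicator (B x) y \<partial>count_space UNIV) * indicator A x \<partial>count_space UNIV)"
    by (intro nn_integral_cong) (auto simp: indicator_def)
  also have "\<dots> = (\<integral>\<^sup>+x. esum (B x) (\<lambda>y. f (x, y)) * indicator A x \<partial>count_space UNIV)"
    by (intro nn_integral_cong arg_cong2[of _ _ _ _ "(*)"] refl
        nn_integral_count_space_indicator[symmetric]) (simp add: NO_MATCH_def)
  also have "\<dots> = esum A (\<lambda>x. esum (B x) (\<lambda>y. f (x, y)))"
    by (rule nn_integral_count_space_indicator[symmetric]) (simp add: NO_MATCH_def)
  finally show ?thesis .
qed

lemma esum_bij: "bij_betw g A B \<Longrightarrow> esum B f = esum A (\<lambda>x. f (g x))"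
  by (rule nn_integral_bij_count_space[symmetric])

lemma esum_swap: "esum A (\<lambda>x. esum B (\<lambda>y. f x y)) = esum B (\<lambda>y. esum A (\<lambda>x. f x y))"
proof -
  have "esum A (\<lambda>x. esum B (\<lambda>y. f x y)) = esum (A \<times> B) (\<lambda>p. f (fst p) (snd p))"
    by (simp add: esum_Sigma)
  also have "\<dots> = esum (B \<times> A) (\<lambda>p. f (snd p) (fst p))"
  proof -
    have "bij_betw prod.swap (B \<times> A) (A \<times> B)"
      by (rule bij_betw_byWitness[where f' = prod.swap]) auto
    from esum_bij[OF this, of "\<lambda>p. f (fst p) (snd p)"] show ?thesis by simp
  qed
  also have "\<dots> = esum B (\<lambda>y. esum A (\<lambda>x. f x y))" by (simp add: esum_Sigma)
  finally show ?thesis .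
qed

lemma esum_mono: "(\<And>x. x \<in> A \<Longrightarrow> f x \<le> g x) \<Longrightarrow> esum A f \<le> esum A g"
  by (intro nn_integral_mono) simp

lemma esum_cong: "(\<And>x. x \<in> A \<Longrightarrow> f x = g x) \<Longrightarrow> esum A f = esum A g"
  by (intro nn_integral_cong) simp

lemma esum_cmult: "esum A (\<lambda>x. c * f x) = c * esum A f" for c :: ennreal
  by (rule nn_integral_cmult) simp

lemma esum_multc: "esum A (\<lambda>x. f x * c) = esum A f * c" for c :: ennreal
  by (rule nn_integral_multc) simp

lemma esum_subset: "A \<subseteq> B \<Longrightarrow> esum A f \<le> esum B f"
proof -
  assume "A \<subseteq> B"
  have 1: "esum C f = esum UNIV (\<lambda>x. f x * indicator C x)" for C
    by (cases "C = UNIV") (auto intro!: nn_integral_count_space_indicator simp: NO_MATCH_def)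
  show ?thesis unfolding 1 using \<open>A \<subseteq> B\<close> by (intro esum_mono) (auto simp: indicator_def)
qed

lemma esum_le_inj:
  assumes "inj_on \<pi> X" "\<pi> ` X \<subseteq> Y"
  shows "esum X (\<lambda>m. G (\<pi> m)) \<le> esum Y G"
proof -
  have "esum X (\<lambda>m. G (\<pi> m)) = esum (\<pi> ` X) G"
    by (rule esum_bij[symmetric]) (simp add: assms inj_on_imp_bij_betw)
  also have "\<dots> \<le> esum Y G" using assms(2) by (rule esum_subset)
  finally show ?thesis .
qed

lemma esum_partition: "esum X f = esum UNIV (\<lambda>y. esum {m \<in> X. \<pi> m = y} f)"
proof -
  have b: "bij_betw snd (Sigma UNIV (\<lambda>y. {m \<in> X. \<pi> m = y})) X"
    by (auto simp: bij_betw_def inj_on_def image_def)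
  have "esum X f = esum (Sigma UNIV (\<lambda>y. {m \<in> X. \<pi> m = y})) (\<lambda>p. f (snd p))"
    by (rule esum_bij[OF b])
  then show ?thesis by (simp add: esum_Sigma)
qed

text \<open>One half of Schur's test: the function is constant on the fibre, and the weight is
  summed along it.\<close>

lemma esum_fibre_le:
  assumes "\<And>y. esum {m \<in> X. \<pi> m = y} W \<le> K"
  shows "esum X (\<lambda>m. G (\<pi> m) * W m) \<le> esum UNIV G * K"
proof -
  have "esum X (\<lambda>m. G (\<pi> m) * W m) = esum UNIV (\<lambda>y. esum {m \<in> X. \<pi> m = y} (\<lambda>m. G (\<pi> m) * W m))"
    by (rule esum_partition)
  also have "\<dots> = esum UNIV (\<lambda>y. G y * esum {m \<in> X. \<pi> m = y} W)"
    unfolding esum_cmult[symmetric] by (intro esum_cong) auto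
  also have "\<dots> \<le> esum UNIV (\<lambda>y. G y * K)" by (intro esum_mono mult_left_mono assms) auto
  finally show ?thesis by (simp add: esum_multc)
qed

lemma esum_Cauchy_Schwarz: "(esum X (\<lambda>m. u m * v m))\<^sup>2 \<le> esum X (\<lambda>m. (u m)\<^sup>2) * esum X (\<lambda>m. (v m)\<^sup>2)"
  by (rule Cauchy_Schwarz_nn_integral) auto

text \<open>Bounds are kept as bounds on squares; a root obtained in this way makes it possible to
  add or multiply them unsquared.\<close>

lemma ennreal_ex_sqrt: "\<exists>B :: ennreal. B\<^sup>2 = x"
proof (cases x)
  case (real r)
  then have "(ennreal (sqrt r))\<^sup>2 = x" by (simp add: ennreal_power)
  then show ?thesis ..
next
  case top
  then have "(top::ennreal)\<^sup>2 = x" by (simp add: power2_eq_square ennreal_top_mult)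
  then show ?thesis ..
qed

lemma ennreal_power2_le_imp_le: "x\<^sup>2 \<le> y\<^sup>2 \<Longrightarrow> x \<le> y" for x y :: ennreal
proof (rule ccontr)
  assume a: "x\<^sup>2 \<le> y\<^sup>2" "\<not> x \<le> y"
  then have "y < x" by simp
  then obtain r where r: "y = ennreal r" "r \<ge> 0" by (cases y) (auto simp: top_unique)
  show False
  proof (cases x)
    case (real t)
    then have "r < t" "t \<ge> 0" using \<open>y < x\<close> r by (auto simp: ennreal_less_iff)
    then have "r\<^sup>2 < t\<^sup>2" using r by (intro power_strict_mono) auto
    moreover have "ennreal (t\<^sup>2) \<le> ennreal (r\<^sup>2)"
      using a(1) real r by (simp add: ennreal_power)
    ultimately show False by (simp add: ennreal_le_iff)
  next
    case top
    then show False using a(1) r by (simp add: ennreal_power power2_eq_square[of "top::ennreal"] ennreal_top_mult top_unique)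
  qed
qed

section \<open>Constrained tuples and convolutions\<close>

text \<open>The group of values is left open: it is \<open>int ^ 'd\<close> when only the sum is
  prescribed, and \<open>(int ^ 'd) \<times> int\<close> when the phase is prescribed too. Tuples
  are extensional, so that their equality can be checked on \<open>I\<close>.\<close>

definition XS :: "'i set \<Rightarrow> ('i \<Rightarrow> 'a \<Rightarrow> 'g::ab_group_add) \<Rightarrow> 'g \<Rightarrow> ('i \<Rightarrow> 'a) set" where
  "XS I \<phi> z = {m \<in> PiE I (\<lambda>_. UNIV). (\<Sum>i\<in>I. \<phi> i (m i)) = z}"

definition n2 :: "('a \<Rightarrow> ennreal) \<Rightarrow> ennreal" where
  "n2 f = esum UNIV (\<lambda>x. (f x)\<^sup>2)"

definition n1 :: "('a \<Rightarrow> ennreal) \<Rightarrow> ennreal" where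
  "n1 f = esum UNIV f"

lemma XS_empty: "XS {} \<phi> z = (if z = 0 then {\<lambda>_. undefined} else {})"
  by (auto simp: XS_def)

lemma esum_XS_insert:
  assumes "finite I" "j \<notin> I"
  shows "esum (XS (insert j I) \<phi> z) H = esum UNIV (\<lambda>x. esum (XS I \<phi> (z - \<phi> j x)) (\<lambda>m. H (m(j := x))))"
proof -
  have s: "(\<Sum>i\<in>I. \<phi> i ((m(j := x)) i)) = (\<Sum>i\<in>I. \<phi> i (m i))" for m x
    using assms by (intro sum.cong) auto
  have b: "bij_betw (\<lambda>(x, m). m(j := x)) (Sigma UNIV (\<lambda>x. XS I \<phi> (z - \<phi> j x))) (XS (insert j I) \<phi> z)"
  proof (rule bij_betw_byWitness[where f' = "\<lambda>m. (m j, m(j := undefined))"])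
    show "\<forall>p\<in>Sigma UNIV (\<lambda>x. XS I \<phi> (z - \<phi> j x)). (\<lambda>m. (m j, m(j := undefined))) (case p of (x, m) \<Rightarrow> m(j := x)) = p"
      using assms by (auto simp: XS_def PiE_def extensional_def fun_eq_iff)
    show "\<forall>m\<in>XS (insert j I) \<phi> z. (case (m j, m(j := undefined)) of (x, m) \<Rightarrow> m(j := x)) = m"
      by auto
    show "(\<lambda>(x, m). m(j := x)) ` Sigma UNIV (\<lambda>x. XS I \<phi> (z - \<phi> j x)) \<subseteq> XS (insert j I) \<phi> z"
      using assms s by (auto simp: XS_def PiE_def extensional_def)
    show "(\<lambda>m. (m j, m(j := undefined))) ` XS (insert j I) \<phi> z \<subseteq> Sigma UNIV (\<lambda>x. XS I \<phi> (z - \<phi> j x))"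
      using assms s by (auto simp: XS_def PiE_def extensional_def algebra_simps)
  qed
  show ?thesis unfolding esum_bij[OF b] by (simp add: esum_Sigma)
qed

text \<open>The variables in \<open>J\<close> are summed absolutely one after the other. Fixing one
  of them merely shifts \<open>z\<close>, and the bound for the core is uniform in
  \<open>z\<close>.\<close>

lemma esum_XS_rest_le:
  assumes "finite J" "finite I" "I \<inter> J = {}"
    and B: "\<And>z. esum (XS I \<phi> z) H \<le> B"
    and H: "\<And>m j x. j \<in> J \<Longrightarrow> H (m(j := x)) = H m"
  shows "esum (XS (I \<union> J) \<phi> z) (\<lambda>m. H m * (\<Prod>j\<in>J. g j (m j))) \<le> B * (\<Prod>j\<in>J. n1 (g j))"
  using assms(1,3,5)
proof (induction J arbitrary: z rule: finite_induct)
  case empty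
  then show ?case using B by simp
next
  case (insert j J)
  have fin: "finite (I \<union> J)" and j: "j \<notin> I \<union> J" using insert assms(2) by auto
  have pr: "(\<Prod>l\<in>insert j J. g l ((m(j := x)) l)) = g j x * (\<Prod>l\<in>J. g l (m l))" for m x
  proof -
    have "(\<Prod>l\<in>J. g l ((m(j := x)) l)) = (\<Prod>l\<in>J. g l (m l))"
      using insert.hyps by (intro prod.cong) auto
    then show ?thesis using insert.hyps by simp
  qed
  have IH: "esum (XS (I \<union> J) \<phi> z) (\<lambda>m. H m * (\<Prod>j\<in>J. g j (m j))) \<le> B * (\<Prod>j\<in>J. n1 (g j))" for z
    using insert by auto
  have Hj: "H (m(j := x)) = H m" for m x by (rule insert.prems(2)) simp
  have "esum (XS (I \<union> insert j J) \<phi> z) (\<lambda>m. H m * (\<Prod>j\<in>insert j J. g j (m j)))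
     = esum UNIV (\<lambda>x. esum (XS (I \<union> J) \<phi> (z - \<phi> j x)) (\<lambda>m. g j x * (H m * (\<Prod>l\<in>J. g l (m l)))))"
    unfolding Un_insert_right esum_XS_insert[OF fin j] pr Hj by (simp add: mult_ac)
  also have "\<dots> = esum UNIV (\<lambda>x. g j x * esum (XS (I \<union> J) \<phi> (z - \<phi> j x)) (\<lambda>m. H m * (\<Prod>l\<in>J. g l (m l))))"
    by (simp only: esum_cmult)
  also have "\<dots> \<le> esum UNIV (\<lambda>x. g j x * (B * (\<Prod>j\<in>J. n1 (g j))))"
    by (intro esum_mono mult_left_mono IH) auto
  also have "\<dots> = n1 (g j) * (B * (\<Prod>j\<in>J. n1 (g j)))"
    unfolding n1_def by (rule esum_multc)
  also have "\<dots> = B * (\<Prod>j\<in>insert j J. n1 (g j))"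
    using insert.hyps by (simp add: mult_ac)
  finally show ?case .
qed

lemma esum_shift: "esum UNIV (\<lambda>y. f (y + a)) = esum UNIV f" for a :: "'g::ab_group_add"
  by (rule esum_bij[symmetric], rule bij_betw_byWitness[where f' = "\<lambda>y. y - a"]) auto

lemma esum_reflect: "esum UNIV (\<lambda>y. f (a - y)) = esum UNIV f" for a :: "'g::ab_group_add"
  by (rule esum_bij[symmetric], rule bij_betw_byWitness[where f' = "\<lambda>y. a - y"]) auto

text \<open>The convolution over \<open>I\<close> of the functions \<open>u l\<close>, transported
  along \<open>\<phi> l\<close>.\<close>

definition cf :: "'i set \<Rightarrow> ('i \<Rightarrow> 'a \<Rightarrow> 'g::ab_group_add) \<Rightarrow> ('i \<Rightarrow> 'a \<Rightarrow> ennreal) \<Rightarrow> 'g \<Rightarrow> ennreal" where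
  "cf I \<phi> u z = esum (XS I \<phi> z) (\<lambda>m. \<Prod>l\<in>I. u l (m l))"

lemma cf_insert:
  assumes "finite I" "j \<notin> I"
  shows "cf (insert j I) \<phi> u z = esum UNIV (\<lambda>x. u j x * cf I \<phi> u (z - \<phi> j x))"
proof -
  have "(\<Prod>l\<in>insert j I. u l ((m(j := x)) l)) = u j x * (\<Prod>l\<in>I. u l (m l))" for m x
  proof -
    have "(\<Prod>l\<in>I. u l ((m(j := x)) l)) = (\<Prod>l\<in>I. u l (m l))"
      using assms by (intro prod.cong) auto
    then show ?thesis using assms by simp
  qed
  then show ?thesis unfolding cf_def esum_XS_insert[OF assms] by (simp only: esum_cmult)
qed

lemma cf_empty: "cf {} \<phi> u z = indicator {0} z"
  by (simp add: cf_def XS_empty nn_integral_count_space_finite)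

lemma cf_union:
  assumes "finite I" "finite J" "I \<inter> J = {}"
  shows "cf (I \<union> J) \<phi> u z = esum UNIV (\<lambda>y. cf I \<phi> u y * cf J \<phi> u (z - y))"
  using assms(1,3)
proof (induction I arbitrary: z rule: finite_induct)
  case empty
  have "esum UNIV (\<lambda>y. cf {} \<phi> u y * cf J \<phi> u (z - y)) = (\<Sum>y\<in>{0}. cf {} \<phi> u y * cf J \<phi> u (z - y))"
    by (rule nn_integral_count_space') (auto simp: cf_empty)
  then show ?case by (simp add: cf_empty)
next
  case (insert i I)
  have i: "i \<notin> I \<union> J" "finite (I \<union> J)" using insert assms by auto
  have "cf (insert i I \<union> J) \<phi> u z = esum UNIV (\<lambda>x. u i x * esum UNIV (\<lambda>y. cf I \<phi> u y * cf J \<phi> u (z - \<phi> i x - y)))"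
    using insert unfolding Un_insert_left cf_insert[OF i(2,1)] by simp
  also have "\<dots> = esum UNIV (\<lambda>x. u i x * esum UNIV (\<lambda>y. cf I \<phi> u (y - \<phi> i x) * cf J \<phi> u (z - y)))"
  proof -
    have "esum UNIV (\<lambda>y. cf I \<phi> u y * cf J \<phi> u (z - \<phi> i x - y)) = esum UNIV (\<lambda>y. cf I \<phi> u (y - \<phi> i x) * cf J \<phi> u (z - y))" for x
      using esum_shift[of "\<lambda>y. cf I \<phi> u (y - \<phi> i x) * cf J \<phi> u (z - y)" "\<phi> i x"] by (simp add: algebra_simps)
    then show ?thesis by (simp only:)
  qed
  also have "\<dots> = esum UNIV (\<lambda>y. esum UNIV (\<lambda>x. u i x * cf I \<phi> u (y - \<phi> i x)) * cf J \<phi> u (z - y))"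
    unfolding esum_cmult[symmetric] esum_multc[symmetric] by (subst esum_swap) (simp add: mult.assoc)
  finally show ?case unfolding cf_insert[OF insert.hyps(1,2)] .
qed

text \<open>Cauchy-Schwarz in the share \<open>y\<close> of the constraint that falls to
  \<open>I\<close>. Afterwards the two groups of variables are treated separately, each in
  \<open>\<ell>^2\<close>.\<close>

lemma cf_union_le:
  assumes "finite I" "finite J" "I \<inter> J = {}"
  shows "(cf (I \<union> J) \<phi> u z)\<^sup>2 \<le> n2 (cf I \<phi> u) * n2 (cf J \<phi> u)"
  unfolding cf_union[OF assms] n2_def
  using esum_Cauchy_Schwarz[of UNIV "cf I \<phi> u" "\<lambda>y. cf J \<phi> u (z - y)"]
  by (simp add: esum_reflect[of "\<lambda>y. (cf J \<phi> u y)\<^sup>2"])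

lemma esum_cf: "finite I \<Longrightarrow> esum UNIV (cf I \<phi> u) = (\<Prod>l\<in>I. n1 (u l))"
proof (induction I rule: finite_induct)
  case empty
  have "esum UNIV (cf {} \<phi> u) = (\<Sum>y\<in>{0}. cf {} \<phi> u y)"
    by (rule nn_integral_count_space') (auto simp: cf_empty)
  then show ?case by (simp add: cf_empty)
next
  case (insert j I)
  have "esum UNIV (cf (insert j I) \<phi> u) = esum UNIV (\<lambda>x. esum UNIV (\<lambda>z. u j x * cf I \<phi> u (z - \<phi> j x)))"
    unfolding cf_insert[OF insert.hyps] by (rule esum_swap)
  also have "\<dots> = esum UNIV (\<lambda>x. u j x * esum UNIV (cf I \<phi> u))"
    using esum_shift[of "cf I \<phi> u" "- \<phi> j _"] by (simp add: esum_cmult)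
  finally show ?case using insert by (simp add: esum_multc n1_def)
qed

lemma cf_cong: "(\<And>i. i \<in> I \<Longrightarrow> \<phi> i = \<psi> i) \<Longrightarrow> cf I \<phi> u z = cf I \<psi> u z"
  unfolding cf_def XS_def by (intro arg_cong[where f = "\<lambda>X. esum X _"] Collect_cong conj_cong arg_cong[where f = "\<lambda>t. t = z"] sum.cong) auto

text \<open>
  Up to a translation of the summation variable, the quadruple sum \<open>\<Sum>\<^sub>z (f * g)(z)\<^sup>2\<close> does not change when
  \<open>g\<close> is reflected; this is the counterpart of \<open>\<parallel>F G\<parallel>\<^sub>2 = \<parallel>F G\<^sup>-\<parallel>\<^sub>2\<close> with \<open>G\<^sup>-\<close> the complex conjugate.
\<close>

lemma n2_cf_flip:
  fixes \<phi> :: "'i \<Rightarrow> 'a \<Rightarrow> 'g::ab_group_add"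
  assumes "finite I" "j \<in> I"
  shows "n2 (cf I (\<phi>(j := \<lambda>x. - \<phi> j x)) u) = n2 (cf I \<phi> u)"
proof -
  define I' where "I' = I - {j}"
  have I: "I = insert j I'" "finite I'" "j \<notin> I'" using assms by (auto simp: I'_def)
  have e: "cf I' (\<phi>(j := \<lambda>x. - \<phi> j x)) u z = cf I' \<phi> u z" for z
    using I by (intro cf_cong) auto
  define F where "F = cf I' \<phi> u"
  have sq: "(esum UNIV f)\<^sup>2 = esum UNIV (\<lambda>x. esum UNIV (\<lambda>y. f x * f y))" for f :: "'a \<Rightarrow> ennreal"
    by (simp add: esum_cmult esum_multc power2_eq_square)
  have gen: "n2 (\<lambda>z. esum UNIV (\<lambda>x. u j x * F (z - \<psi> x)))
     = esum UNIV (\<lambda>x. esum UNIV (\<lambda>y. u j x * u j y * esum UNIV (\<lambda>z. F (z - \<psi> x) * F (z - \<psi> y))))" for \<psi> :: "'a \<Rightarrow> 'g"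
  proof -
    have "n2 (\<lambda>z. esum UNIV (\<lambda>x. u j x * F (z - \<psi> x)))
      = esum UNIV (\<lambda>z. esum UNIV (\<lambda>x. esum UNIV (\<lambda>y. u j x * F (z - \<psi> x) * (u j y * F (z - \<psi> y)))))"
      unfolding n2_def sq ..
    also have "\<dots> = esum UNIV (\<lambda>x. esum UNIV (\<lambda>z. esum UNIV (\<lambda>y. u j x * F (z - \<psi> x) * (u j y * F (z - \<psi> y)))))"
      by (rule esum_swap)
    also have "\<dots> = esum UNIV (\<lambda>x. esum UNIV (\<lambda>y. esum UNIV (\<lambda>z. u j x * F (z - \<psi> x) * (u j y * F (z - \<psi> y)))))"
      by (intro esum_cong esum_swap)
    finally show ?thesis unfolding esum_cmult[symmetric] by (simp only: mult_ac)
  qed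
  \<comment> \<open>Translating \<open>z\<close> by \<open>- a - b\<close> exchanges the two
    arguments.\<close>
  have "esum UNIV (\<lambda>z. F (z - - a) * F (z - - b)) = esum UNIV (\<lambda>z. F (z - a) * F (z - b))" for a b
    using esum_shift[of "\<lambda>z. F (z - - a) * F (z - - b)" "- a - b"] by (simp add: mult.commute)
  then have "n2 (\<lambda>z. esum UNIV (\<lambda>x. u j x * F (z - - \<phi> j x))) = n2 (\<lambda>z. esum UNIV (\<lambda>x. u j x * F (z - \<phi> j x)))"
    unfolding gen by simp
  then show ?thesis
    unfolding I(1) cf_insert[OF I(2,3), abs_def] e F_def by simp
qed

lemma n2_cf_signs:
  fixes \<phi> \<psi> :: "'i \<Rightarrow> 'a \<Rightarrow> 'g::ab_group_add"
  assumes "finite I" and s: "\<And>i. i \<in> I \<Longrightarrow> \<phi> i = \<psi> i \<or> \<phi> i = (\<lambda>x. - \<psi> i x)"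
  shows "n2 (cf I \<phi> u) = n2 (cf I \<psi> u)"
proof -
  define T where "T S = (\<lambda>i. if i \<in> S then (\<lambda>x. - \<psi> i x) else \<psi> i)" for S
  have "n2 (cf I (T S) u) = n2 (cf I \<psi> u)" if "S \<subseteq> I" for S
    using finite_subset[OF that assms(1)] that
  proof (induction S rule: finite_induct)
    case empty
    then show ?case by (simp add: T_def)
  next
    case (insert j S)
    have "T (insert j S) = (T S)(j := \<lambda>x. - T S j x)"
      using insert.hyps by (auto simp: T_def fun_eq_iff)
    then have "n2 (cf I (T (insert j S)) u) = n2 (cf I ((T S)(j := \<lambda>x. - T S j x)) u)" by (simp only:)
    also have "\<dots> = n2 (cf I (T S) u)" using insert by (intro n2_cf_flip assms) auto
    finally show ?case using insert by simp
  qed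
  from this[of "{i \<in> I. \<phi> i \<noteq> \<psi> i}"] have "n2 (cf I (T {i \<in> I. \<phi> i \<noteq> \<psi> i}) u) = n2 (cf I \<psi> u)" by auto
  moreover have "cf I (T {i \<in> I. \<phi> i \<noteq> \<psi> i}) u = cf I \<phi> u"
  proof (rule ext, rule cf_cong)
    fix i assume "i \<in> I"
    then show "T {i \<in> I. \<phi> i \<noteq> \<psi> i} i = \<phi> i" using s[of i] by (auto simp: T_def)
  qed
  ultimately show ?thesis by simp
qed

text \<open>Cauchy-Schwarz on each level set separates the weights, which give \<open>K\<close>,
  from the functions. The squared functions are then summed over all level sets, where the
  constraint disappears and the sum factorises.\<close>

lemma n2_cf_le:
  assumes "finite I" "\<And>z. esum (XS I \<phi> z) (\<lambda>m. \<Prod>l\<in>I. (w l (m l))\<^sup>2) \<le> K"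
  shows "n2 (cf I \<phi> (\<lambda>l x. w l x * f l x)) \<le> K * (\<Prod>l\<in>I. n2 (f l))"
proof -
  have "n2 (cf I \<phi> (\<lambda>l x. w l x * f l x)) \<le> esum UNIV (\<lambda>z. K * cf I \<phi> (\<lambda>l x. (f l x)\<^sup>2) z)"
    unfolding n2_def
  proof (intro esum_mono)
    fix z
    have "(cf I \<phi> (\<lambda>l x. w l x * f l x) z)\<^sup>2 = (esum (XS I \<phi> z) (\<lambda>m. (\<Prod>l\<in>I. w l (m l)) * (\<Prod>l\<in>I. f l (m l))))\<^sup>2"
      by (simp add: cf_def prod.distrib)
    also have "\<dots> \<le> esum (XS I \<phi> z) (\<lambda>m. (\<Prod>l\<in>I. w l (m l))\<^sup>2) * esum (XS I \<phi> z) (\<lambda>m. (\<Prod>l\<in>I. f l (m l))\<^sup>2)"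
      by (rule esum_Cauchy_Schwarz)
    also have "\<dots> \<le> K * cf I \<phi> (\<lambda>l x. (f l x)\<^sup>2) z"
      unfolding cf_def using assms(2)[of z] by (simp add: prod_power_distrib mult_right_mono)
    finally show "(cf I \<phi> (\<lambda>l x. w l x * f l x) z)\<^sup>2 \<le> K * cf I \<phi> (\<lambda>l x. (f l x)\<^sup>2) z" .
  qed
  also have "\<dots> = K * (\<Prod>l\<in>I. n1 (\<lambda>x. (f l x)\<^sup>2))"
    by (simp add: esum_cmult esum_cf[OF assms(1)])
  finally show ?thesis by (simp add: n1_def n2_def)
qed

lemma wt_power2: "(wt s x)\<^sup>2 = wt (2 * s) x"
  by (simp add: power2_eq_square wt_mult)

lemma n1_wt_le:
  fixes f :: "int ^ 'd \<Rightarrow> ennreal"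
  assumes "esum (UNIV :: (int ^ 'd) set) (wt (- 2 * \<beta>)) \<le> K"
  shows "(n1 (\<lambda>x. wt (- \<beta>) x * f x))\<^sup>2 \<le> K * n2 f"
proof -
  have "(n1 (\<lambda>x. wt (- \<beta>) x * f x))\<^sup>2 \<le> esum UNIV (\<lambda>x :: int ^ 'd. (wt (- \<beta>) x)\<^sup>2) * n2 f"
    unfolding n1_def n2_def by (rule esum_Cauchy_Schwarz)
  also have "\<dots> \<le> K * n2 f"
    using assms by (intro mult_right_mono) (simp_all add: wt_power2)
  finally show ?thesis .
qed

section \<open>Linear and quadratic constraints, bounded forms\<close>

definition lin :: "('i \<Rightarrow> int) \<Rightarrow> 'i \<Rightarrow> int ^ 'd \<Rightarrow> int ^ 'd" where
  "lin \<epsilon> l x = \<epsilon> l *s x"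

text \<open>The sign multiplies both components, so that reversing it is negation in the group, the
  operation that \<open>n2_cf_flip\<close> allows.\<close>

definition phs :: "('i \<Rightarrow> int) \<Rightarrow> 'i \<Rightarrow> int ^ 'd \<Rightarrow> (int ^ 'd) \<times> int" where
  "phs \<epsilon> l x = (\<epsilon> l *s x, \<epsilon> l * sq x)"

lemma prod_less_top: "(\<And>l. l \<in> J \<Longrightarrow> f l < top) \<Longrightarrow> (\<Prod>l\<in>J. f l) < (top :: ennreal)"
  by (induction J rule: infinite_finite_induct) (auto simp: ennreal_mult_less_top)

lemma prod_mono_ennreal: "(\<And>l. l \<in> J \<Longrightarrow> f l \<le> g l) \<Longrightarrow> (\<Prod>l\<in>J. f l) \<le> (\<Prod>l\<in>J. g l :: ennreal)"
  by (induction J rule: infinite_finite_induct) (auto intro: mult_mono)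

lemma sum_less_top: "(\<And>l. l \<in> J \<Longrightarrow> f l < top) \<Longrightarrow> (\<Sum>l\<in>J. f l) < (top :: ennreal)"
  by (induction J rule: infinite_finite_induct) auto

text \<open>
  The sum over the tuples in \<open>XS I \<phi> z\<close> with weight \<open>W\<close> is bounded by the product of the \<open>\<ell>\<^sup>2\<close> norms of
  the functions with index in \<open>P\<close>, uniformly in \<open>z \<in> Z\<close>. Everything is squared to avoid square roots
  in \<^typ>\<open>ennreal\<close>.
\<close>

definition bounded_form ::
    "'i set \<Rightarrow> 'i set \<Rightarrow> ('i \<Rightarrow> 'a \<Rightarrow> 'g::ab_group_add) \<Rightarrow> 'g set \<Rightarrow> (('i \<Rightarrow> 'a) \<Rightarrow> ennreal) \<Rightarrow> bool" where
  "bounded_form I P \<phi> Z W \<longleftrightarrow> (\<exists>K<top. \<forall>z\<in>Z. \<forall>f.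
     (esum (XS I \<phi> z) (\<lambda>m. W m * (\<Prod>l\<in>P. f l (m l))))\<^sup>2 \<le> K * (\<Prod>l\<in>P. n2 (f l)))"

lemma bounded_formI:
  assumes "K < top" "\<And>z f. z \<in> Z \<Longrightarrow>
     (esum (XS I \<phi> z) (\<lambda>m. W m * (\<Prod>l\<in>P. f l (m l))))\<^sup>2 \<le> K * (\<Prod>l\<in>P. n2 (f l))"
  shows "bounded_form I P \<phi> Z W"
  using assms unfolding bounded_form_def by blast

text \<open>The weights are compared only on the level sets, because the relation between the
  largest variables is valid only there.\<close>

lemma bounded_form_mono:
  assumes W': "bounded_form I P \<phi> Z' W'" and "Z \<subseteq> Z'"
    and le: "\<And>z m. z \<in> Z \<Longrightarrow> m \<in> XS I \<phi> z \<Longrightarrow> W m \<le> ennreal c * W' m"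
  shows "bounded_form I P \<phi> Z W"
proof -
  obtain K where K: "K < top" "\<forall>z\<in>Z'. \<forall>f.
     (esum (XS I \<phi> z) (\<lambda>m. W' m * (\<Prod>l\<in>P. f l (m l))))\<^sup>2 \<le> K * (\<Prod>l\<in>P. n2 (f l))"
    using W' unfolding bounded_form_def by blast
  show ?thesis
  proof (rule bounded_formI)
    show "(ennreal c)\<^sup>2 * K < top" using K(1) by (simp add: ennreal_mult_less_top power_less_top_ennreal)
    fix z f assume z: "z \<in> Z"
    have "esum (XS I \<phi> z) (\<lambda>m. W m * (\<Prod>l\<in>P. f l (m l)))
       \<le> esum (XS I \<phi> z) (\<lambda>m. ennreal c * (W' m * (\<Prod>l\<in>P. f l (m l))))"
      using le[OF z] by (intro esum_mono) (simp add: mult_right_mono mult.assoc[symmetric])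
    then have "(esum (XS I \<phi> z) (\<lambda>m. W m * (\<Prod>l\<in>P. f l (m l))))\<^sup>2
       \<le> (ennreal c * esum (XS I \<phi> z) (\<lambda>m. W' m * (\<Prod>l\<in>P. f l (m l))))\<^sup>2"
      unfolding esum_cmult by (intro power_mono) auto
    also have "\<dots> \<le> (ennreal c)\<^sup>2 * (K * (\<Prod>l\<in>P. n2 (f l)))"
      unfolding power_mult_distrib using K z \<open>Z \<subseteq> Z'\<close> by (intro mult_left_mono) auto
    finally show "(esum (XS I \<phi> z) (\<lambda>m. W m * (\<Prod>l\<in>P. f l (m l))))\<^sup>2 \<le> (ennreal c)\<^sup>2 * K * (\<Prod>l\<in>P. n2 (f l))"
      by (simp add: mult.assoc)
  qed
qed

lemma bounded_form_mono1:
  assumes "bounded_form I P \<phi> Z' W'" "Z \<subseteq> Z'"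
    and "\<And>z m. z \<in> Z \<Longrightarrow> m \<in> XS I \<phi> z \<Longrightarrow> W m \<le> W' m"
  shows "bounded_form I P \<phi> Z W"
  by (rule bounded_form_mono[OF assms(1,2), where c = 1]) (use assms(3) in auto)

lemma bounded_form_sum:
  fixes \<phi> :: "'i \<Rightarrow> 'a \<Rightarrow> 'g::ab_group_add"
  assumes "finite C" "\<And>c. c \<in> C \<Longrightarrow> bounded_form I P \<phi> Z (W c)"
  shows "bounded_form I P \<phi> Z (\<lambda>m. \<Sum>c\<in>C. W c m)"
proof -
  have "\<forall>c\<in>C. \<exists>K<top. \<forall>z\<in>Z. \<forall>f.
     (esum (XS I \<phi> z) (\<lambda>m. W c m * (\<Prod>l\<in>P. f l (m l))))\<^sup>2 \<le> K * (\<Prod>l\<in>P. n2 (f l))"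
    using assms(2) unfolding bounded_form_def by blast
  from bchoice[OF this] obtain K where K: "\<And>c. c \<in> C \<Longrightarrow> K c < top"
    "\<And>c z f. c \<in> C \<Longrightarrow> z \<in> Z \<Longrightarrow>
     (esum (XS I \<phi> z) (\<lambda>m. W c m * (\<Prod>l\<in>P. f l (m l))))\<^sup>2 \<le> K c * (\<Prod>l\<in>P. n2 (f l))" by blast
  define KK where "KK = (\<Sum>c\<in>C. K c)"
  show ?thesis
  proof (rule bounded_formI)
    have "KK < top" unfolding KK_def using K(1) by (rule sum_less_top)
    then show "(of_nat (card C))\<^sup>2 * KK < top"
      by (simp add: ennreal_mult_less_top power_less_top_ennreal of_nat_less_top)
    fix z and f :: "'i \<Rightarrow> 'a \<Rightarrow> ennreal" assume z: "z \<in> Z"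
    obtain B where B: "B\<^sup>2 = KK * (\<Prod>l\<in>P. n2 (f l))" using ennreal_ex_sqrt by blast
    have "esum (XS I \<phi> z) (\<lambda>m. W c m * (\<Prod>l\<in>P. f l (m l))) \<le> B" if c: "c \<in> C" for c
    proof (rule ennreal_power2_le_imp_le)
      have "K c \<le> KK" unfolding KK_def using assms(1) c by (intro member_le_sum) auto
      then show "(esum (XS I \<phi> z) (\<lambda>m. W c m * (\<Prod>l\<in>P. f l (m l))))\<^sup>2 \<le> B\<^sup>2"
        using K(2)[OF c z, of f] unfolding B by (meson mult_right_mono order_trans zero_le)
    qed
    then have "(\<Sum>c\<in>C. esum (XS I \<phi> z) (\<lambda>m. W c m * (\<Prod>l\<in>P. f l (m l)))) \<le> of_nat (card C) * B"
      by (rule sum_bounded_above)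
    moreover have "esum (XS I \<phi> z) (\<lambda>m. (\<Sum>c\<in>C. W c m) * (\<Prod>l\<in>P. f l (m l)))
        = (\<Sum>c\<in>C. esum (XS I \<phi> z) (\<lambda>m. W c m * (\<Prod>l\<in>P. f l (m l))))"
      unfolding sum_distrib_right by (rule nn_integral_sum) simp
    ultimately have "(esum (XS I \<phi> z) (\<lambda>m. (\<Sum>c\<in>C. W c m) * (\<Prod>l\<in>P. f l (m l))))\<^sup>2 \<le> (of_nat (card C) * B)\<^sup>2"
      by (intro power_mono) auto
    then show "(esum (XS I \<phi> z) (\<lambda>m. (\<Sum>c\<in>C. W c m) * (\<Prod>l\<in>P. f l (m l))))\<^sup>2
        \<le> (of_nat (card C))\<^sup>2 * KK * (\<Prod>l\<in>P. n2 (f l))"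
      by (simp add: power_mult_distrib B mult.assoc)
  qed
qed

lemma cf_rest_le:
  assumes "finite I" "finite J" "I \<inter> J = {}" "\<And>z. cf I \<phi> g z \<le> B"
  shows "cf (I \<union> J) \<phi> g z \<le> B * (\<Prod>j\<in>J. n1 (g j))"
proof -
  have "cf (I \<union> J) \<phi> g z = esum (XS (I \<union> J) \<phi> z) (\<lambda>m. (\<Prod>l\<in>I. g l (m l)) * (\<Prod>j\<in>J. g j (m j)))"
    by (simp add: cf_def prod.union_disjoint assms)
  also have "\<dots> \<le> B * (\<Prod>j\<in>J. n1 (g j))"
  proof (rule esum_XS_rest_le[OF assms(2,1,3)])
    show "esum (XS I \<phi> z) (\<lambda>m. \<Prod>l\<in>I. g l (m l)) \<le> B" for z using assms(4) by (simp add: cf_def)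
    show "(\<Prod>l\<in>I. g l ((m(j := x)) l)) = (\<Prod>l\<in>I. g l (m l))" if "j \<in> J" for m j x
      using that assms(3) by (intro prod.cong) auto
  qed
  finally show ?thesis .
qed

text \<open>The groups \<open>A\<close> and \<open>B\<close> are separated by Cauchy-Schwarz, and
  each has its own count. The weights on \<open>J\<close> are square summable, so these variables
  are summed absolutely.\<close>

lemma bounded_form_split:
  fixes \<phi> :: "'i \<Rightarrow> int ^ 'd \<Rightarrow> 'g::ab_group_add"
  assumes fin: "finite A" "finite B" "finite J" "A \<inter> B = {}" "(A \<union> B) \<inter> J = {}"
    and KA: "KA < top" "\<And>f. n2 (cf A \<phi> (\<lambda>l x. wt (- t l) x * f l x)) \<le> KA * (\<Prod>l\<in>A. n2 (f l))"
    and KB: "KB < top" "\<And>f. n2 (cf B \<phi> (\<lambda>l x. wt (- t l) x * f l x)) \<le> KB * (\<Prod>l\<in>B. n2 (f l))"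
    and J: "\<And>l. l \<in> J \<Longrightarrow> 2 * t l > real CARD('d)"
  shows "bounded_form (A \<union> B \<union> J) (A \<union> B \<union> J) \<phi> UNIV (\<lambda>m. \<Prod>l\<in>A \<union> B \<union> J. wt (- t l) (m l))"
proof -
  have "\<forall>l\<in>J. \<exists>K<top. esum (UNIV :: (int ^ 'd) set) (wt (- 2 * t l)) \<le> K"
  proof
    fix l assume "l \<in> J"
    then obtain K where "K \<ge> 0" "esum (UNIV :: (int ^ 'd) set) (wt (- 2 * t l)) \<le> ennreal K"
      using sum_wt_finite[OF J] by blast
    then show "\<exists>K<top. esum (UNIV :: (int ^ 'd) set) (wt (- 2 * t l)) \<le> K"
      by (intro exI[of _ "ennreal K"]) auto
  qed
  from bchoice[OF this] obtain KJ where
    KJ: "\<And>l. l \<in> J \<Longrightarrow> KJ l < top" "\<And>l. l \<in> J \<Longrightarrow> esum (UNIV :: (int ^ 'd) set) (wt (- 2 * t l)) \<le> KJ l"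
    by blast
  let ?I = "A \<union> B \<union> J"
  show ?thesis
  proof (rule bounded_formI)
    show "KA * KB * (\<Prod>l\<in>J. KJ l) < top"
      using KA(1) KB(1) prod_less_top[of J KJ, OF KJ(1)] by (simp add: ennreal_mult_less_top)
    fix z and f :: "'i \<Rightarrow> int ^ 'd \<Rightarrow> ennreal"
    let ?g = "\<lambda>l x. wt (- t l) x * f l x"
    obtain C where C: "C\<^sup>2 = n2 (cf A \<phi> ?g) * n2 (cf B \<phi> ?g)" using ennreal_ex_sqrt by blast
    have le_J: "(\<Prod>j\<in>J. (n1 (?g j))\<^sup>2) \<le> (\<Prod>l\<in>J. KJ l * n2 (f l))"
    proof (rule prod_mono_ennreal)
      show "(n1 (?g l))\<^sup>2 \<le> KJ l * n2 (f l)" if "l \<in> J" for l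
        using KJ(2)[OF that] by (rule n1_wt_le)
    qed
    have "cf (A \<union> B) \<phi> ?g z \<le> C" for z
      by (rule ennreal_power2_le_imp_le) (unfold C, rule cf_union_le[OF fin(1,2,4)])
    then have "cf ?I \<phi> ?g z \<le> C * (\<Prod>j\<in>J. n1 (?g j))"
      using fin by (intro cf_rest_le) auto
    then have "(cf ?I \<phi> ?g z)\<^sup>2 \<le> (C * (\<Prod>j\<in>J. n1 (?g j)))\<^sup>2" by (intro power_mono) auto
    also have "\<dots> = n2 (cf A \<phi> ?g) * n2 (cf B \<phi> ?g) * (\<Prod>j\<in>J. (n1 (?g j))\<^sup>2)"
      by (simp add: power_mult_distrib C prod_power_distrib)
    also have "\<dots>
        \<le> (KA * (\<Prod>l\<in>A. n2 (f l))) * (KB * (\<Prod>l\<in>B. n2 (f l))) * (\<Prod>l\<in>J. KJ l * n2 (f l))"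
      by (intro mult_mono KA KB le_J) auto
    also have "\<dots> = KA * KB * (\<Prod>l\<in>J. KJ l) * (\<Prod>l\<in>?I. n2 (f l))"
      using fin by (simp add: prod.union_disjoint prod.distrib mult_ac)
    finally show "(esum (XS ?I \<phi> z) (\<lambda>m. (\<Prod>l\<in>?I. wt (- t l) (m l)) * (\<Prod>l\<in>?I. f l (m l))))\<^sup>2
        \<le> KA * KB * (\<Prod>l\<in>J. KJ l) * (\<Prod>l\<in>?I. n2 (f l))"
      by (simp add: cf_def prod.distrib)
  qed
qed

lemma esum_singleton_le: "esum X (\<lambda>m. c) \<le> c" if inj: "\<And>m m'. m \<in> X \<Longrightarrow> m' \<in> X \<Longrightarrow> m = m'" for c :: ennreal
proof (cases "X = {}")
  case False
  then obtain m where "m \<in> X" by blast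
  then have "X = {m}" using inj by blast
  then show ?thesis by (simp add: nn_integral_count_space_finite)
qed simp

lemma scale_sign_inj: "\<epsilon> \<in> {1, -1 :: int} \<Longrightarrow> \<epsilon> *s x = \<epsilon> *s y \<longleftrightarrow> x = y"
  by (auto simp: vec_eq_iff)

text \<open>The two variables without weight form one group each. In such a group a level set
  contains at most one point, so the count is 1.\<close>

lemma bounded_form_lin:
  fixes \<epsilon> :: "'i \<Rightarrow> int"
  assumes "finite I" "i \<in> I" "j \<in> I" "i \<noteq> j" "\<And>l. l \<in> I \<Longrightarrow> \<epsilon> l \<in> {1, -1}" "2 * \<beta> > real CARD('d)"
  shows "bounded_form I I (lin \<epsilon> :: 'i \<Rightarrow> int ^ 'd \<Rightarrow> int ^ 'd) UNIV (\<lambda>m. \<Prod>l\<in>I - {i, j}. wt (- \<beta>) (m l))"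
proof -
  define t where "t l = (if l = i \<or> l = j then 0 else \<beta>)" for l
  have one: "n2 (cf {a} (lin \<epsilon>) (\<lambda>l x. wt (- t l) x * f l x)) \<le> 1 * (\<Prod>l\<in>{a}. n2 (f l))"
    if a: "a \<in> I" "t a = 0" for a and f :: "'i \<Rightarrow> int ^ 'd \<Rightarrow> ennreal"
  proof (rule n2_cf_le)
    fix z :: "int ^ 'd"
    have "esum (XS {a} (lin \<epsilon>) z) (\<lambda>m. \<Prod>l\<in>{a}. (wt (- t l) (m l))\<^sup>2) = esum (XS {a} (lin \<epsilon>) z) (\<lambda>m. 1)"
      by (intro esum_cong) (simp add: a)
    also have "\<dots> \<le> 1"
    proof (rule esum_singleton_le)
      fix m m' assume "m \<in> XS {a} (lin \<epsilon>) z" "m' \<in> XS {a} (lin \<epsilon>) z"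
      then have e: "m \<in> extensional {a}" "m' \<in> extensional {a}" "\<epsilon> a *s m a = \<epsilon> a *s m' a"
        by (auto simp: XS_def lin_def PiE_def)
      then have "m a = m' a" using assms(5)[OF a(1)] by (simp add: scale_sign_inj)
      then show "m = m'" using e by (auto intro: extensionalityI)
    qed
    finally show "esum (XS {a} (lin \<epsilon>) z) (\<lambda>m. \<Prod>l\<in>{a}. (wt (- t l) (m l))\<^sup>2) \<le> 1" .
  qed simp
  have "bounded_form ({i} \<union> {j} \<union> (I - {i, j})) ({i} \<union> {j} \<union> (I - {i, j})) (lin \<epsilon> :: 'i \<Rightarrow> int ^ 'd \<Rightarrow> int ^ 'd) UNIV
     (\<lambda>m. \<Prod>l\<in>{i} \<union> {j} \<union> (I - {i, j}). wt (- t l) (m l))"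
  proof (rule bounded_form_split)
    show "n2 (cf {i} (lin \<epsilon>) (\<lambda>l x. wt (- t l) x * f l x)) \<le> 1 * (\<Prod>l\<in>{i}. n2 (f l))"
      for f :: "'i \<Rightarrow> int ^ 'd \<Rightarrow> ennreal" using assms by (intro one) (auto simp: t_def)
    show "n2 (cf {j} (lin \<epsilon>) (\<lambda>l x. wt (- t l) x * f l x)) \<le> 1 * (\<Prod>l\<in>{j}. n2 (f l))"
      for f :: "'i \<Rightarrow> int ^ 'd \<Rightarrow> ennreal" using assms by (intro one) (auto simp: t_def)
  qed (use assms in \<open>auto simp: t_def\<close>)
  moreover have "{i} \<union> {j} \<union> (I - {i, j}) = I" using assms by auto
  moreover have "(\<Prod>l\<in>I. wt (- t l) (m l)) = (\<Prod>l\<in>I - {i, j}. wt (- \<beta>) (m l))" for m :: "'i \<Rightarrow> int ^ 'd"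
  proof -
    have "(\<Prod>l\<in>I. wt (- t l) (m l)) = (\<Prod>l\<in>I - {i, j}. wt (- t l) (m l))"
      using assms(1) by (intro prod.mono_neutral_right) (auto simp: t_def)
    also have "\<dots> = (\<Prod>l\<in>I - {i, j}. wt (- \<beta>) (m l))" by (intro prod.cong) (auto simp: t_def)
    finally show ?thesis .
  qed
  ultimately show ?thesis by simp
qed

text \<open>By invariance under signs the count is required only for the definite form with all
  signs equal to 1.\<close>

lemma n2_cf_phs:
  fixes \<epsilon> :: "'i \<Rightarrow> int" and f :: "'i \<Rightarrow> int ^ 'd \<Rightarrow> ennreal"
  assumes "finite A" "\<And>l. l \<in> A \<Longrightarrow> \<epsilon> l \<in> {1, -1}"
    and K: "\<And>z. esum (XS A (phs (\<lambda>_. 1)) z) (\<lambda>m. \<Prod>l\<in>A. (wt (- t l) (m l :: int ^ 'd))\<^sup>2) \<le> K"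
  shows "n2 (cf A (phs \<epsilon>) (\<lambda>l x. wt (- t l) x * f l x)) \<le> K * (\<Prod>l\<in>A. n2 (f l))"
proof -
  have "n2 (cf A (phs \<epsilon>) (\<lambda>l x. wt (- t l) x * f l x)) = n2 (cf A (phs (\<lambda>_. 1)) (\<lambda>l x. wt (- t l) x * f l x))"
  proof (rule n2_cf_signs[OF assms(1)])
    fix i assume "i \<in> A"
    then show "phs \<epsilon> i = phs (\<lambda>_. 1) i \<or> phs \<epsilon> i = (\<lambda>x :: int ^ 'd. - phs (\<lambda>_. 1) i x)"
      using assms(2)[of i] by (auto simp: phs_def fun_eq_iff vec_eq_iff)
  qed
  also have "\<dots> \<le> K * (\<Prod>l\<in>A. n2 (f l))" by (rule n2_cf_le[OF assms(1) K])
  finally show ?thesis .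
qed

lemma fst_sum_phs: "fst (\<Sum>l\<in>I. phs \<epsilon> l (m l)) = (\<Sum>l\<in>I. \<epsilon> l *s m l)"
  and snd_sum_phs: "snd (\<Sum>l\<in>I. phs \<epsilon> l (m l)) = (\<Sum>l\<in>I. \<epsilon> l * sq (m l))"
  by (simp_all add: fst_sum snd_sum phs_def)

lemma XS_phs_iff:
  "m \<in> XS I (phs \<epsilon>) z \<longleftrightarrow> m \<in> PiE I (\<lambda>_. UNIV) \<and> (\<Sum>l\<in>I. \<epsilon> l *s m l) = fst z \<and> (\<Sum>l\<in>I. \<epsilon> l * sq (m l)) = snd z"
  unfolding XS_def by (auto simp: fst_sum_phs snd_sum_phs prod_eq_iff)

lemma phs_pair_bound:
  assumes "i \<noteq> a" "t i = 0" "\<And>Q \<tau>. esum (sphere_set (Q :: int ^ 'd) \<tau>) (wt (- 2 * t a)) \<le> K"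
  shows "esum (XS {i, a} (phs (\<lambda>_. 1)) z) (\<lambda>m. \<Prod>l\<in>{i, a}. (wt (- t l) (m l :: int ^ 'd))\<^sup>2) \<le> K"
proof -
  let ?X = "XS {i, a} (phs (\<lambda>_. 1)) z :: ('a \<Rightarrow> int ^ 'd) set"
  have m: "m i = fst z - m a" "sq (m i) + sq (m a) = snd z" "m \<in> extensional {i, a}" if "m \<in> ?X" for m
    using that assms(1) unfolding XS_phs_iff by (auto simp: PiE_def algebra_simps)
  have "esum ?X (\<lambda>m. \<Prod>l\<in>{i, a}. (wt (- t l) (m l))\<^sup>2) = esum ?X (\<lambda>m. wt (- 2 * t a) (m a))"
    using assms by (intro esum_cong) (simp add: wt_power2)
  also have "\<dots> \<le> esum (sphere_set (fst z) (snd z)) (wt (- 2 * t a))"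
  proof (rule esum_le_inj)
    show "inj_on (\<lambda>m. m a) ?X"
    proof (rule inj_onI)
      fix m m' assume "m \<in> ?X" "m' \<in> ?X" "m a = m' a"
      then have "m i = m' i" using m(1) by metis
      then show "m = m'" using \<open>m a = m' a\<close> m(3)[OF \<open>m \<in> ?X\<close>] m(3)[OF \<open>m' \<in> ?X\<close>]
        by (auto intro: extensionalityI)
    qed
    show "(\<lambda>m. m a) ` ?X \<subseteq> sphere_set (fst z) (snd z)"
      unfolding sphere_set_def using m(1,2) by (auto simp del: split_paired_All)
  qed
  also have "\<dots> \<le> K" by (rule assms)
  finally show ?thesis .
qed

lemma phs_triple_bound:
  assumes "i \<noteq> a" "i \<noteq> b" "a \<noteq> b" "t i = 0" "t a = s" "t b = s"
    and K: "\<And>Q \<tau>. esum {(y, y'). sq ((Q :: int ^ 'd) - y - y') + sq y + sq y' = \<tau>} (\<lambda>(y, y'). wt (- 2 * s) y * wt (- 2 * s) y') \<le> K"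
  shows "esum (XS {i, a, b} (phs (\<lambda>_. 1)) z) (\<lambda>m. \<Prod>l\<in>{i, a, b}. (wt (- t l) (m l :: int ^ 'd))\<^sup>2) \<le> K"
proof -
  let ?X = "XS {i, a, b} (phs (\<lambda>_. 1)) z :: ('a \<Rightarrow> int ^ 'd) set"
  let ?S = "{(y, y'). sq (fst z - y - y') + sq y + sq y' = snd z}"
  have m: "m i = fst z - m a - m b" "sq (m i) + sq (m a) + sq (m b) = snd z" "m \<in> extensional {i, a, b}" if "m \<in> ?X" for m
    using that assms(1-3) unfolding XS_phs_iff by (auto simp: PiE_def algebra_simps)
  have "esum ?X (\<lambda>m. \<Prod>l\<in>{i, a, b}. (wt (- t l) (m l))\<^sup>2) = esum ?X (\<lambda>m. (\<lambda>(y, y'). wt (- 2 * s) y * wt (- 2 * s) y') (m a, m b))"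
    using assms by (intro esum_cong) (simp add: wt_power2)
  also have "\<dots> \<le> esum ?S (\<lambda>(y, y'). wt (- 2 * s) y * wt (- 2 * s) y')"
  proof (rule esum_le_inj)
    show "inj_on (\<lambda>m. (m a, m b)) ?X"
    proof (rule inj_onI)
      fix m m' assume mm: "m \<in> ?X" "m' \<in> ?X" "(m a, m b) = (m' a, m' b)"
      then have "m i = m' i" using m(1)[OF mm(1)] m(1)[OF mm(2)] by simp
      then show "m = m'" using mm(3) m(3)[OF mm(1)] m(3)[OF mm(2)]
        by (auto intro: extensionalityI)
    qed
    show "(\<lambda>m. (m a, m b)) ` ?X \<subseteq> ?S"
      using m(1,2) by fastforce
  qed
  also have "\<dots> \<le> K" by (rule K)
  finally show ?thesis .
qed

section \<open>Redistribution of exponents\<close>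

lemma obtain_top:
  fixes x :: "'i \<Rightarrow> real"
  assumes "finite L" "p \<le> card L"
  shows "\<exists>T\<subseteq>L. card T = p \<and> (\<forall>a\<in>T. \<forall>l\<in>L - T. x l \<le> x a)"
  using assms(2)
proof (induction p)
  case 0
  then show ?case by (intro exI[of _ "{}"]) auto
next
  case (Suc p)
  then obtain T where T: "T \<subseteq> L" "card T = p" "\<forall>a\<in>T. \<forall>l\<in>L - T. x l \<le> x a" by auto
  have "L - T \<noteq> {}" using Suc.prems T by (metis Diff_eq_empty_iff Suc_n_not_le_n subset_antisym)
  then obtain b where b: "b \<in> L - T" "\<forall>l\<in>L - T. x l \<le> x b"
    using assms(1) Max_in[of "x ` (L - T)"] Max_ge[of "x ` (L - T)"] by (metis (no_types, lifting) finite_Diff finite_imageI imageE image_eqI image_is_empty)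
  have "finite T" using T(1) assms(1) by (rule finite_subset)
  then have "insert b T \<subseteq> L" "card (insert b T) = Suc p" using b T by auto
  moreover have "\<forall>a\<in>insert b T. \<forall>l\<in>L - insert b T. x l \<le> x a" using b T by auto
  ultimately show ?case by blast
qed

text \<open>Exponents may be moved from the variables above the pivot \<open>X\<close> to those below it.\<close>

lemma pivot:
  fixes x s t :: "'i \<Rightarrow> real"
  assumes "finite L" "X \<ge> 1" "K \<ge> 1" "\<And>l. l \<in> L \<Longrightarrow> x l \<ge> 1"
    and c: "\<And>l. l \<in> L \<Longrightarrow> (x l \<ge> X \<and> s l \<ge> t l) \<or> (x l \<le> K * X \<and> s l \<le> t l)"
    and sum: "(\<Sum>l\<in>L. t l) \<le> (\<Sum>l\<in>L. s l)"
  shows "(\<Prod>l\<in>L. x l powr - s l) \<le> K powr (\<Sum>l\<in>L. \<bar>s l - t l\<bar>) * (\<Prod>l\<in>L. x l powr - t l)"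
proof -
  have "(\<Prod>l\<in>L. x l powr - s l) = (\<Prod>l\<in>L. x l powr (t l - s l)) * (\<Prod>l\<in>L. x l powr - t l)"
    unfolding prod.distrib[symmetric] powr_add[symmetric] by simp
  also have "(\<Prod>l\<in>L. x l powr (t l - s l)) \<le> (\<Prod>l\<in>L. K powr \<bar>s l - t l\<bar> * X powr (t l - s l))"
  proof (intro prod_mono conjI)
    fix l assume l: "l \<in> L"
    have K1: "K powr r \<ge> 1" if "r \<ge> 0" for r using assms(3) that by (rule ge_one_powr_ge_zero)
    from c[OF l] show "x l powr (t l - s l) \<le> K powr \<bar>s l - t l\<bar> * X powr (t l - s l)"
    proof
      assume a: "x l \<ge> X \<and> s l \<ge> t l"
      then have "x l powr (t l - s l) \<le> X powr (t l - s l)"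
        using assms(2) by (intro powr_mono2') auto
      also have "\<dots> \<le> K powr \<bar>s l - t l\<bar> * X powr (t l - s l)"
        using K1[of "\<bar>s l - t l\<bar>"] mult_right_mono[of 1 "K powr \<bar>s l - t l\<bar>" "X powr (t l - s l)"] by simp
      finally show ?thesis .
    next
      assume a: "x l \<le> K * X \<and> s l \<le> t l"
      then have "x l powr (t l - s l) \<le> (K * X) powr (t l - s l)"
        using assms(4)[OF l] by (intro powr_mono2) auto
      also have "\<dots> = K powr \<bar>s l - t l\<bar> * X powr (t l - s l)"
        using a assms(2,3) by (simp add: powr_mult)
      finally show ?thesis .
    qed
  qed simp
  also have "(\<Prod>l\<in>L. K powr \<bar>s l - t l\<bar> * X powr (t l - s l)) = K powr (\<Sum>l\<in>L. \<bar>s l - t l\<bar>) * X powr (\<Sum>l\<in>L. t l - s l)"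
    using assms(2,3) by (simp add: prod.distrib powr_sum)
  \<comment> \<open>The net power of \<open>X\<close> is not positive, by
    \<open>sum\<close>.\<close>
  also have "\<dots> \<le> K powr (\<Sum>l\<in>L. \<bar>s l - t l\<bar>) * 1"
  proof (intro mult_left_mono)
    have "X powr (\<Sum>l\<in>L. t l - s l) \<le> X powr 0"
      using assms(2) sum by (intro powr_mono) (auto simp: sum_subtractf)
    then show "X powr (\<Sum>l\<in>L. t l - s l) \<le> 1" using assms(2) by simp
  qed simp
  finally show ?thesis by (simp add: mult_right_mono prod_nonneg)
qed

lemma prod_wt: "(\<Prod>l\<in>L. wt (s l) (m l)) = ennreal (\<Prod>l\<in>L. bracket (m l) powr s l)"
  unfolding wt_def by (rule prod_ennreal) simp

text \<open>The pivot is the smallest size occurring in \<open>T\<close>. Exponents drop to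
  \<open>\<alpha>\<close> on the large variables and rise to \<open>\<beta>\<close> on the small
  ones; the product cannot decrease as long as the total exponent does not grow.\<close>

lemma prod_wt_pivot:
  fixes m :: "'i \<Rightarrow> int ^ 'd"
  assumes "finite L" "T \<subseteq> L" "T \<noteq> {}" "\<And>l. l \<in> L \<Longrightarrow> \<alpha> \<le> t l \<and> t l \<le> \<beta>"
    and top: "\<And>a l. a \<in> T \<Longrightarrow> l \<in> L - T \<Longrightarrow> bracket (m l) \<le> bracket (m a)"
    and sum: "real (card T) * \<alpha> + real (card L - card T) * \<beta> \<le> (\<Sum>l\<in>L. t l)"
  shows "(\<Prod>l\<in>L. wt (- t l) (m l)) \<le> (\<Prod>l\<in>L. wt (- (if l \<in> T then \<alpha> else \<beta>)) (m l))"
proof -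
  have finT: "finite T" using assms(1,2) by (rule rev_finite_subset)
  define X where "X = Min ((\<lambda>a. bracket (m a)) ` T)"
  have X1: "X \<ge> 1" unfolding X_def using finT assms(3) by (subst Min_ge_iff) auto
  have XT: "bracket (m a) \<ge> X" if "a \<in> T" for a unfolding X_def using finT that by auto
  have XL: "bracket (m l) \<le> 1 * X" if "l \<in> L - T" for l
    unfolding X_def mult_1_left using finT assms(3) top that by (subst Min_ge_iff) auto
  have "(\<Prod>l\<in>L. bracket (m l) powr - t l)
      \<le> 1 powr (\<Sum>l\<in>L. \<bar>t l - (if l \<in> T then \<alpha> else \<beta>)\<bar>) * (\<Prod>l\<in>L. bracket (m l) powr - (if l \<in> T then \<alpha> else \<beta>))"
  proof (rule pivot[OF assms(1) X1])
    have "(\<Sum>l\<in>L. if l \<in> T then \<alpha> else \<beta>) = (\<Sum>l\<in>L \<inter> T. \<alpha>) + (\<Sum>l\<in>L - T. \<beta>)"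
      using assms(1) by (simp add: sum.If_cases Diff_eq)
    also have "L \<inter> T = T" using assms(2) by auto
    also have "(\<Sum>l\<in>T. \<alpha>) + (\<Sum>l\<in>L - T. \<beta>) = real (card T) * \<alpha> + real (card L - card T) * \<beta>"
      using assms(2) finT by (simp add: card_Diff_subset)
    finally show "(\<Sum>l\<in>L. if l \<in> T then \<alpha> else \<beta>) \<le> (\<Sum>l\<in>L. t l)" using sum by simp
    show "X \<le> bracket (m l) \<and> (if l \<in> T then \<alpha> else \<beta>) \<le> t l \<or> bracket (m l) \<le> 1 * X \<and> t l \<le> (if l \<in> T then \<alpha> else \<beta>)" if "l \<in> L" for l
      using XT[of l] XL[of l] assms(4) that by auto
  qed auto
  then show ?thesis unfolding prod_wt by (intro ennreal_leI) simp
qed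

text \<open>Which \<open>p\<close> variables are largest depends on the tuple, so the bound is a
  finite sum over all candidates \<open>T\<close>. Each summand is a fixed weight and can be treated
  as a form of its own.\<close>

lemma prod_wt_top:
  fixes m :: "'i \<Rightarrow> int ^ 'd"
  assumes "finite L" "0 < p" "p \<le> card L" "\<And>l. l \<in> L \<Longrightarrow> \<alpha> \<le> t l \<and> t l \<le> \<beta>"
    and sum: "real p * \<alpha> + real (card L - p) * \<beta> \<le> (\<Sum>l\<in>L. t l)"
  shows "(\<Prod>l\<in>L. wt (- t l) (m l)) \<le> (\<Sum>T | T \<subseteq> L \<and> card T = p. \<Prod>l\<in>L. wt (- (if l \<in> T then \<alpha> else \<beta>)) (m l))"
proof -
  obtain T where T: "T \<subseteq> L" "card T = p" "\<forall>a\<in>T. \<forall>l\<in>L - T. bracket (m l) \<le> bracket (m a)"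
    using obtain_top[OF assms(1,3), of "\<lambda>l. bracket (m l)"] by blast
  have "(\<Prod>l\<in>L. wt (- t l) (m l)) \<le> (\<Prod>l\<in>L. wt (- (if l \<in> T then \<alpha> else \<beta>)) (m l))"
    by (rule prod_wt_pivot) (use T assms in auto)
  also have "\<dots> \<le> (\<Sum>T | T \<subseteq> L \<and> card T = p. \<Prod>l\<in>L. wt (- (if l \<in> T then \<alpha> else \<beta>)) (m l))"
    using T assms(1) by (intro member_le_sum[where f = "\<lambda>T. \<Prod>l\<in>L. wt (- (if l \<in> T then \<alpha> else \<beta>)) (m l)"]) auto
  finally show ?thesis .
qed

text \<open>\<open>P\<close> may be smaller than \<open>I\<close>: a variable in
  \<open>I - P\<close> carries no function, like \<open>n_q\<close> in the
  \<open>\<ell>^\<infinity>\<close> estimates.\<close>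

lemma bounded_form_rest:
  fixes \<phi> :: "'i \<Rightarrow> int ^ 'd \<Rightarrow> 'g::ab_group_add"
  assumes fin: "finite I" "finite J" "I \<inter> J = {}" "P \<subseteq> I" and \<beta>: "2 * \<beta> > real CARD('d)"
    and core: "bounded_form I P \<phi> UNIV W"
    and W: "\<And>m j x. j \<in> J \<Longrightarrow> W (m(j := x)) = W m"
  shows "bounded_form (I \<union> J) (P \<union> J) \<phi> UNIV (\<lambda>m. W m * (\<Prod>l\<in>J. wt (- \<beta>) (m l)))"
proof -
  obtain K where K: "K < top" "\<And>z f. (esum (XS I \<phi> z) (\<lambda>m. W m * (\<Prod>l\<in>P. f l (m l))))\<^sup>2 \<le> K * (\<Prod>l\<in>P. n2 (f l))"
    using core unfolding bounded_form_def by blast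
  obtain KJ where KJ: "KJ \<ge> 0" "esum (UNIV :: (int ^ 'd) set) (wt (- 2 * \<beta>)) \<le> ennreal KJ"
    using sum_wt_finite[OF \<beta>] by blast
  have finP: "finite P" using fin(1,4) by (rule rev_finite_subset)
  have PJ: "P \<inter> J = {}" using fin by blast
  show ?thesis
  proof (rule bounded_formI)
    show "K * ennreal KJ ^ card J < top"
      using K(1) by (simp add: ennreal_mult_less_top power_less_top_ennreal)
    fix z and f :: "'i \<Rightarrow> int ^ 'd \<Rightarrow> ennreal"
    obtain B where B: "B\<^sup>2 = K * (\<Prod>l\<in>P. n2 (f l))" using ennreal_ex_sqrt by blast
    let ?H = "\<lambda>m. W m * (\<Prod>l\<in>P. f l (m l))"
    let ?g = "\<lambda>l x. wt (- \<beta>) x * f l x"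
    have "esum (XS (I \<union> J) \<phi> z) (\<lambda>m. ?H m * (\<Prod>j\<in>J. ?g j (m j))) \<le> B * (\<Prod>j\<in>J. n1 (?g j))"
    proof (rule esum_XS_rest_le[OF fin(2,1,3)])
      show "esum (XS I \<phi> z) ?H \<le> B" for z
        by (rule ennreal_power2_le_imp_le) (simp add: B K)
      fix m j x assume j: "j \<in> J"
      have "(\<Prod>l\<in>P. f l ((m(j := x)) l)) = (\<Prod>l\<in>P. f l (m l))"
        using j PJ by (intro prod.cong) auto
      then show "?H (m(j := x)) = ?H m" using W[OF j, of m x] by (simp only:)
    qed
    then have "(esum (XS (I \<union> J) \<phi> z) (\<lambda>m. ?H m * (\<Prod>j\<in>J. ?g j (m j))))\<^sup>2 \<le> (B * (\<Prod>j\<in>J. n1 (?g j)))\<^sup>2"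
      by (intro power_mono) auto
    also have "\<dots> = K * (\<Prod>l\<in>P. n2 (f l)) * (\<Prod>j\<in>J. (n1 (?g j))\<^sup>2)"
      by (simp add: power_mult_distrib B prod_power_distrib)
    also have "\<dots> \<le> K * (\<Prod>l\<in>P. n2 (f l)) * (\<Prod>j\<in>J. ennreal KJ * n2 (f j))"
      by (intro mult_left_mono prod_mono_ennreal n1_wt_le KJ) auto
    also have "\<dots> = K * ennreal KJ ^ card J * (\<Prod>l\<in>P \<union> J. n2 (f l))"
      using fin finP PJ by (simp add: prod.union_disjoint prod.distrib mult_ac)
    finally show "(esum (XS (I \<union> J) \<phi> z) (\<lambda>m. W m * (\<Prod>l\<in>J. wt (- \<beta>) (m l)) * (\<Prod>l\<in>P \<union> J. f l (m l))))\<^sup>2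
        \<le> K * ennreal KJ ^ card J * (\<Prod>l\<in>P \<union> J. n2 (f l))"
      using fin finP PJ by (simp add: prod.union_disjoint prod.distrib mult_ac)
  qed
qed

lemma prod_wt_extend:
  assumes "finite I" "\<And>l. l \<in> I - L \<Longrightarrow> t l = 0" "L \<subseteq> I" "\<And>l. l \<in> L \<Longrightarrow> t l = s l"
  shows "(\<Prod>l\<in>I. wt (- t l) (m l)) = (\<Prod>l\<in>L. wt (- s l) (m l))"
proof -
  have "(\<Prod>l\<in>I. wt (- t l) (m l)) = (\<Prod>l\<in>L. wt (- t l) (m l))"
    using assms by (intro prod.mono_neutral_right) auto
  also have "\<dots> = (\<Prod>l\<in>L. wt (- s l) (m l))" using assms by (intro prod.cong) auto
  finally show ?thesis .
qed

text \<open>This is where \<open>s_crit\<close> comes from. With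
  \<open>\<delta> = t - s_crit d k\<close> the \<open>2 * k\<close> weights have total exponent
  \<open>k * d - 2 + 2 * k * \<delta>\<close>. If \<open>d \<ge> 2\<close>, this is exactly enough
  for \<open>(d - 2) / 2 + \<delta>\<close> on the two largest variables and
  \<open>d / 2 + \<delta>\<close> on the others; \<open>i\<close> and \<open>j\<close> are paired
  with one large variable each, and each pair lies on a sphere. If \<open>d = 1\<close>, it is
  exactly enough for \<open>\<delta>\<close> on the four largest variables and
  \<open>1 / 2 + \<delta>\<close> on the others; \<open>i\<close> and \<open>j\<close> then belong
  to two triples on ellipses, and \<open>k \<ge> 2\<close> guarantees that there are four
  variables.\<close>

lemma bounded_form_phs:
  fixes \<epsilon> :: "'i \<Rightarrow> int"
  assumes I: "finite I" "card I = 2 * k + 2" "i \<in> I" "j \<in> I" "i \<noteq> j" "\<And>l. l \<in> I \<Longrightarrow> \<epsilon> l \<in> {1, -1}"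
    and k: "k \<ge> 1" "(CARD('d), k) \<noteq> (1, 1)" and t: "t > s_crit CARD('d) k"
  shows "bounded_form I I (phs \<epsilon> :: 'i \<Rightarrow> int ^ 'd \<Rightarrow> (int ^ 'd) \<times> int) UNIV (\<lambda>m. \<Prod>l\<in>I - {i, j}. wt (- t) (m l))"
proof -
  define d where "d = CARD('d)"
  have d0: "d \<ge> 1" by (simp add: d_def Suc_leI)
  define L where "L = I - {i, j}"
  have L: "finite L" "card L = 2 * k" using I by (simp_all add: L_def)
  define \<delta> where "\<delta> = t - s_crit d k"
  have \<delta>: "\<delta> > 0" using t by (simp add: \<delta>_def d_def)
  have kt: "real (2 * k) * t = real d * real k - 2 + 2 * real k * \<delta>"
    using k by (simp add: \<delta>_def s_crit_def field_simps)
  have tt: "t = real d / 2 - 1 / real k + \<delta>" by (simp add: \<delta>_def s_crit_def)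
  define W where "W \<alpha> T m = (\<Prod>l\<in>L. wt (- (if l \<in> T then \<alpha> else real d / 2 + \<delta>)) (m l))" for \<alpha> T and m :: "'i \<Rightarrow> int ^ 'd"
  have main: "bounded_form I I (phs \<epsilon> :: 'i \<Rightarrow> int ^ 'd \<Rightarrow> (int ^ 'd) \<times> int) UNIV (\<lambda>m. \<Prod>l\<in>I - {i, j}. wt (- t) (m l))"
    if p: "0 < p" "p \<le> 2 * k" "\<alpha> \<le> t" "real p * \<alpha> + real (2 * k - p) * (real d / 2 + \<delta>) \<le> real (2 * k) * t"
      and b: "\<And>T. T \<subseteq> L \<Longrightarrow> card T = p \<Longrightarrow> bounded_form I I (phs \<epsilon> :: 'i \<Rightarrow> int ^ 'd \<Rightarrow> (int ^ 'd) \<times> int) UNIV (W \<alpha> T)"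
    for p \<alpha>
  proof (rule bounded_form_mono1[where W' = "\<lambda>m. \<Sum>T | T \<subseteq> L \<and> card T = p. W \<alpha> T m"])
    show "bounded_form I I (phs \<epsilon> :: 'i \<Rightarrow> int ^ 'd \<Rightarrow> (int ^ 'd) \<times> int) UNIV (\<lambda>m. \<Sum>T | T \<subseteq> L \<and> card T = p. W \<alpha> T m)"
      using b L by (intro bounded_form_sum) auto
    fix m :: "'i \<Rightarrow> int ^ 'd"
    have "1 / real k > 0" using k by simp
    then have "t \<le> real d / 2 + \<delta>" unfolding tt by linarith
    then show "(\<Prod>l\<in>I - {i, j}. wt (- t) (m l)) \<le> (\<Sum>T | T \<subseteq> L \<and> card T = p. W \<alpha> T m)"
      unfolding W_def L_def[symmetric] using p L by (intro prod_wt_top) auto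
  qed simp
  show ?thesis
  proof (cases "d \<ge> 2")
    case True
    define \<alpha> where "\<alpha> = (real d - 2) / 2 + \<delta>"
    obtain K where K: "K \<ge> 0" "\<And>Q \<tau>. esum (sphere_set (Q :: int ^ 'd) \<tau>) (wt (- 2 * \<alpha>)) \<le> ennreal K"
    proof (rule sum_wt_sphere[of \<alpha>, where 'd = 'd])
      show "2 * \<alpha> > real CARD('d) - 2" using \<delta> by (simp add: \<alpha>_def d_def field_simps)
      show "CARD('d) \<ge> 2" using True by (simp add: d_def)
    qed (blast intro: that)
    show ?thesis
    proof (rule main[of 2 \<alpha>])
      have "1 / real k \<le> 1" using k by simp
      then show "\<alpha> \<le> t" unfolding tt \<alpha>_def by (simp add: field_simps)
      show "real 2 * \<alpha> + real (2 * k - 2) * (real d / 2 + \<delta>) \<le> real (2 * k) * t"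
        unfolding kt \<alpha>_def using k by (simp add: of_nat_diff field_simps)
      fix T assume T: "T \<subseteq> L" "card T = 2"
      obtain a b where ab: "T = {a, b}" "a \<noteq> b" using T(2) by (metis card_2_iff)
      have abI: "a \<in> I" "b \<in> I" "a \<noteq> i" "a \<noteq> j" "b \<noteq> i" "b \<noteq> j" using T(1) ab by (auto simp: L_def)
      define t' where "t' l = (if l = i \<or> l = j then 0 else if l \<in> T then \<alpha> else real d / 2 + \<delta>)" for l
      have "bounded_form ({i, a} \<union> {j, b} \<union> (L - T)) ({i, a} \<union> {j, b} \<union> (L - T)) (phs \<epsilon> :: 'i \<Rightarrow> int ^ 'd \<Rightarrow> (int ^ 'd) \<times> int) UNIV
         (\<lambda>m. \<Prod>l\<in>{i, a} \<union> {j, b} \<union> (L - T). wt (- t' l) (m l))"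
      proof (rule bounded_form_split[where KA = "ennreal K" and KB = "ennreal K"])
        show "n2 (cf {i, a} (phs \<epsilon>) (\<lambda>l x. wt (- t' l) x * f l x)) \<le> ennreal K * (\<Prod>l\<in>{i, a}. n2 (f l))"
          for f :: "'i \<Rightarrow> int ^ 'd \<Rightarrow> ennreal"
          using abI I ab K by (intro n2_cf_phs phs_pair_bound) (auto simp: t'_def)
        show "n2 (cf {j, b} (phs \<epsilon>) (\<lambda>l x. wt (- t' l) x * f l x)) \<le> ennreal K * (\<Prod>l\<in>{j, b}. n2 (f l))"
          for f :: "'i \<Rightarrow> int ^ 'd \<Rightarrow> ennreal"
          using abI I ab K by (intro n2_cf_phs phs_pair_bound) (auto simp: t'_def)
      qed (use abI I ab L \<delta> in \<open>auto simp: t'_def d_def L_def\<close>)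
      moreover have "{i, a} \<union> {j, b} \<union> (L - T) = I" using abI I ab by (auto simp: L_def)
      moreover have "(\<Prod>l\<in>I. wt (- t' l) (m l)) = W \<alpha> T m" for m
        unfolding W_def using I by (intro prod_wt_extend) (auto simp: L_def t'_def)
      ultimately show "bounded_form I I (phs \<epsilon> :: 'i \<Rightarrow> int ^ 'd \<Rightarrow> (int ^ 'd) \<times> int) UNIV (W \<alpha> T)" by simp
    qed (use k in auto)
  next
    case False
    then have d1: "d = 1" using d0 by simp
    then have k2: "k \<ge> 2" using k by (cases "k = 1") (auto simp: d_def)
    obtain K where K: "K \<ge> 0" "\<And>Q \<tau>. esum {(y, y'). sq ((Q :: int ^ 'd) - y - y') + sq y + sq y' = \<tau>} (\<lambda>(y, y'). wt (- 2 * \<delta>) y * wt (- 2 * \<delta>) y') \<le> ennreal K"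
      by (rule sum_wt_ellipse[of \<delta>, where 'd = 'd]) (use \<delta> d1 in \<open>auto simp: d_def intro: that\<close>)
    show ?thesis
    proof (rule main[of 4 \<delta>])
      show "4 \<le> 2 * k" using k2 by simp
      have "1 / real k \<le> 1 / 2" using k2 by (intro divide_left_mono) auto
      then show "\<delta> \<le> t" unfolding tt d1 by simp
      show "real 4 * \<delta> + real (2 * k - 4) * (real d / 2 + \<delta>) \<le> real (2 * k) * t"
        unfolding kt d1 using k2 by (simp add: of_nat_diff field_simps)
      fix T assume T: "T \<subseteq> L" "card T = 4"
      have "\<exists>a b c e. T = {a, b, c, e} \<and> a \<noteq> b \<and> a \<noteq> c \<and> a \<noteq> e \<and> b \<noteq> c \<and> b \<noteq> e \<and> c \<noteq> e"
      proof -
        obtain a S where S: "T = insert a S" "a \<notin> S" "card S = 3"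
          using T(2) card_eq_SucD[of T 3] by auto
        then show ?thesis using card_3_iff[of S] by auto
      qed
      then obtain a b c e where ab: "T = {a, b, c, e}" "a \<noteq> b" "a \<noteq> c" "a \<noteq> e" "b \<noteq> c" "b \<noteq> e" "c \<noteq> e" by blast
      have abI: "a \<in> I" "b \<in> I" "c \<in> I" "e \<in> I" "a \<noteq> i" "a \<noteq> j" "b \<noteq> i" "b \<noteq> j" "c \<noteq> i" "c \<noteq> j" "e \<noteq> i" "e \<noteq> j"
        using T(1) ab by (auto simp: L_def)
      define t' where "t' l = (if l = i \<or> l = j then 0 else if l \<in> T then \<delta> else real d / 2 + \<delta>)" for l
      have "bounded_form ({i, a, b} \<union> {j, c, e} \<union> (L - T)) ({i, a, b} \<union> {j, c, e} \<union> (L - T)) (phs \<epsilon> :: 'i \<Rightarrow> int ^ 'd \<Rightarrow> (int ^ 'd) \<times> int) UNIV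
         (\<lambda>m. \<Prod>l\<in>{i, a, b} \<union> {j, c, e} \<union> (L - T). wt (- t' l) (m l))"
      proof (rule bounded_form_split[where KA = "ennreal K" and KB = "ennreal K"])
        show "n2 (cf {i, a, b} (phs \<epsilon>) (\<lambda>l x. wt (- t' l) x * f l x)) \<le> ennreal K * (\<Prod>l\<in>{i, a, b}. n2 (f l))"
          for f :: "'i \<Rightarrow> int ^ 'd \<Rightarrow> ennreal"
          using abI I ab K by (intro n2_cf_phs phs_triple_bound) (auto simp: t'_def)
        show "n2 (cf {j, c, e} (phs \<epsilon>) (\<lambda>l x. wt (- t' l) x * f l x)) \<le> ennreal K * (\<Prod>l\<in>{j, c, e}. n2 (f l))"
          for f :: "'i \<Rightarrow> int ^ 'd \<Rightarrow> ennreal"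
          using abI I ab K by (intro n2_cf_phs phs_triple_bound) (auto simp: t'_def)
      qed (use abI I ab L \<delta> in \<open>auto simp: t'_def d_def L_def\<close>)
      moreover have "{i, a, b} \<union> {j, c, e} \<union> (L - T) = I" using abI I ab by (auto simp: L_def)
      moreover have "(\<Prod>l\<in>I. wt (- t' l) (m l)) = W \<delta> T m" for m
        unfolding W_def using I by (intro prod_wt_extend) (auto simp: L_def t'_def)
      ultimately show "bounded_form I I (phs \<epsilon> :: 'i \<Rightarrow> int ^ 'd \<Rightarrow> (int ^ 'd) \<times> int) UNIV (W \<delta> T)" by simp
    qed simp
  qed
qed

text \<open>Without the phase two variables may go unweighted. All exponents are pushed off the two
  largest variables onto the others, which reduces the form to
  \<open>bounded_form_lin\<close>.\<close>

lemma bounded_form_lin_weights: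
  fixes \<epsilon> :: "'i \<Rightarrow> int"
  assumes I: "finite I" "card I \<ge> 2" "\<And>l. l \<in> I \<Longrightarrow> \<epsilon> l \<in> {1, -1}"
    and \<beta>: "2 * \<beta> > real CARD('d)" and \<alpha>: "\<And>l. l \<in> I \<Longrightarrow> 0 \<le> \<alpha> l \<and> \<alpha> l \<le> \<beta>"
    and sum: "real (card I - 2) * \<beta> \<le> (\<Sum>l\<in>I. \<alpha> l)"
  shows "bounded_form I I (lin \<epsilon> :: 'i \<Rightarrow> int ^ 'd \<Rightarrow> int ^ 'd) UNIV (\<lambda>m. \<Prod>l\<in>I. wt (- \<alpha> l) (m l))"
proof (rule bounded_form_mono1[where W' = "\<lambda>m. \<Sum>T | T \<subseteq> I \<and> card T = 2. \<Prod>l\<in>I. wt (- (if l \<in> T then 0 else \<beta>)) (m l)"])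
  show "bounded_form I I (lin \<epsilon> :: 'i \<Rightarrow> int ^ 'd \<Rightarrow> int ^ 'd) UNIV
     (\<lambda>m. \<Sum>T | T \<subseteq> I \<and> card T = 2. \<Prod>l\<in>I. wt (- (if l \<in> T then 0 else \<beta>)) (m l))"
  proof (rule bounded_form_sum)
    fix T assume "T \<in> {T. T \<subseteq> I \<and> card T = 2}"
    then obtain i j where T: "T = {i, j}" "i \<noteq> j" "i \<in> I" "j \<in> I" by (auto simp: card_2_iff)
    have "(\<Prod>l\<in>I. wt (- (if l \<in> T then 0 else \<beta>)) (m l)) = (\<Prod>l\<in>I - {i, j}. wt (- \<beta>) (m l))" for m :: "'i \<Rightarrow> int ^ 'd"
      using I T by (intro prod_wt_extend) auto
    then show "bounded_form I I (lin \<epsilon> :: 'i \<Rightarrow> int ^ 'd \<Rightarrow> int ^ 'd) UNIV (\<lambda>m. \<Prod>l\<in>I. wt (- (if l \<in> T then 0 else \<beta>)) (m l))"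
      using bounded_form_lin[OF I(1) T(3,4,2) I(3) \<beta>] by simp
  qed (use I in simp)
  fix m :: "'i \<Rightarrow> int ^ 'd"
  show "(\<Prod>l\<in>I. wt (- \<alpha> l) (m l)) \<le> (\<Sum>T | T \<subseteq> I \<and> card T = 2. \<Prod>l\<in>I. wt (- (if l \<in> T then 0 else \<beta>)) (m l))"
    using I \<alpha> sum by (intro prod_wt_top) auto
qed simp

section \<open>Transfer of a growing weight\<close>

lemma bracket_le_sum:
  fixes m :: "'i \<Rightarrow> int ^ 'd"
  assumes "finite I" "p \<in> I" "\<And>l. l \<in> I \<Longrightarrow> \<epsilon> l \<in> {1, -1 :: int}" "(\<Sum>l\<in>I. \<epsilon> l *s m l) = 0"
    and j: "\<And>l. l \<in> I - {p} \<Longrightarrow> bracket (m l) \<le> B" "B \<ge> 1"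
  shows "bracket (m p) \<le> real (card I) * B"
proof -
  have z: "zabs (\<epsilon> l *s m l) = zabs (m l)" if "l \<in> I" for l
  proof -
    have "\<epsilon> l *s m l = m l \<or> \<epsilon> l *s m l = - m l" using assms(3)[OF that] by (auto simp: vec_eq_iff)
    then show ?thesis by auto
  qed
  have "\<epsilon> p *s m p = - (\<Sum>l\<in>I - {p}. \<epsilon> l *s m l)"
    using assms(4) sum.remove[OF assms(1,2), of "\<lambda>l. \<epsilon> l *s m l"] by (simp add: eq_neg_iff_add_eq_0)
  then have "zabs (m p) = zabs (- (\<Sum>l\<in>I - {p}. \<epsilon> l *s m l))" using z[OF assms(2)] by (simp only:)
  also have "\<dots> \<le> (\<Sum>l\<in>I - {p}. zabs (\<epsilon> l *s m l))" unfolding zabs_uminus by (rule zabs_sum)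
  also have "\<dots> \<le> (\<Sum>l\<in>I - {p}. B)"
  proof (rule sum_mono)
    fix l assume "l \<in> I - {p}"
    then show "zabs (\<epsilon> l *s m l) \<le> B"
      using z[of l] j(1)[of l] zabs_le_bracket[of "m l"] by simp
  qed
  also have "\<dots> = (real (card I) - 1) * B"
    using assms(1,2) card_gt_0_iff[of I] by (auto simp: of_nat_diff Suc_le_eq)
  \<comment> \<open>The summand 1 of the bracket is absorbed by \<open>B \<ge> 1\<close>, which
    turns \<open>card I - 1\<close> into \<open>card I\<close>.\<close>
  finally show ?thesis using bracket_le_1_zabs[of "m p"] j(2) by (simp add: algebra_simps)
qed

text \<open>Let \<open>j\<close> be the largest variable other than \<open>p\<close>. As the signed
  sum vanishes, \<open>j\<close> dominates \<open>p\<close> up to a constant and absorbs the growing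
  weight. The exponent \<open>t - c\<close> left on \<open>j\<close> is then passed on to the
  smaller variable \<open>i\<close>. What remains lacks weights exactly at \<open>p\<close> and
  \<open>j\<close>; since \<open>j\<close> varies with the tuple, all candidates are summed.\<close>

lemma pointwise_transfer:
  fixes m :: "'i \<Rightarrow> int ^ 'd"
  assumes I: "finite I" "p \<in> I" "i \<in> I" "p \<noteq> i" "\<And>l. l \<in> I \<Longrightarrow> \<epsilon> l \<in> {1, -1 :: int}" "(\<Sum>l\<in>I. \<epsilon> l *s m l) = 0"
    and c: "0 \<le> c" "c \<le> t"
  shows "wt c (m p) * wt (- c) (m i) * (\<Prod>l\<in>I - {p, i}. wt (- t) (m l))
    \<le> ennreal (real (card I) powr c) * (\<Sum>j\<in>I - {p}. \<Prod>l\<in>I - {p, j}. wt (- t) (m l))"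
proof -
  have "I - {p} \<noteq> {}" using I by blast
  then have "1 \<le> card (I - {p})" using I(1) by (simp add: Suc_le_eq card_gt_0_iff)
  then obtain T where T: "T \<subseteq> I - {p}" "card T = 1" "\<forall>a\<in>T. \<forall>l\<in>I - {p} - T. bracket (m l) \<le> bracket (m a)"
    using obtain_top[of "I - {p}" 1 "\<lambda>l. bracket (m l)"] I(1) by blast
  obtain j where Tj: "T = {j}" using T(2) by (metis card_1_singletonE)
  have j: "j \<in> I" "j \<noteq> p" using T(1) Tj by auto
  have jmax: "bracket (m l) \<le> bracket (m j)" if "l \<in> I - {p}" for l
    using T(3) Tj that by (cases "l = j") auto
  have "bracket (m p) \<le> real (card I) * bracket (m j)"
    using I jmax by (intro bracket_le_sum[where \<epsilon> = \<epsilon>]) auto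
  then have "bracket (m p) powr c \<le> (real (card I) * bracket (m j)) powr c" using c by (intro powr_mono2) auto
  then have "wt c (m p) \<le> ennreal (real (card I) powr c) * wt c (m j)"
    unfolding wt_def by (simp add: powr_mult ennreal_mult[symmetric] ennreal_leI)
  then have "wt c (m p) * wt (- c) (m i) * (\<Prod>l\<in>I - {p, i}. wt (- t) (m l))
    \<le> ennreal (real (card I) powr c) * wt c (m j) * wt (- c) (m i) * (\<Prod>l\<in>I - {p, i}. wt (- t) (m l))"
    by (intro mult_right_mono) auto
  also have "\<dots> \<le> ennreal (real (card I) powr c) * (\<Prod>l\<in>I - {p, j}. wt (- t) (m l))"
  proof (cases "j = i")
    case True
    have "wt c (m j) * wt (- c) (m i) = 1" by (simp add: True wt_mult)
    then show ?thesis by (simp add: True mult.assoc)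
  next
    case False
    have 1: "(\<Prod>l\<in>I - {p, i}. wt (- t) (m l)) = wt (- t) (m j) * (\<Prod>l\<in>I - {p, i, j}. wt (- t) (m l))"
      using I j False by (subst prod.remove[of _ j]) (auto intro!: arg_cong[where f = "\<lambda>S. _ * prod _ S"])
    have 2: "(\<Prod>l\<in>I - {p, j}. wt (- t) (m l)) = wt (- t) (m i) * (\<Prod>l\<in>I - {p, i, j}. wt (- t) (m l))"
      using I j False by (subst prod.remove[of _ i]) (auto intro!: arg_cong[where f = "\<lambda>S. _ * prod _ S"])
    have "bracket (m j) powr (c - t) \<le> bracket (m i) powr (c - t)"
      using jmax[of i] I c by (intro powr_mono2') auto
    then have "wt (c - t) (m j) \<le> wt (c - t) (m i)" unfolding wt_def by (rule ennreal_leI)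
    then have "wt (c - t) (m j) * wt (- c) (m i) \<le> wt (c - t) (m i) * wt (- c) (m i)" by (intro mult_right_mono) auto
    then have "wt c (m j) * wt (- t) (m j) * wt (- c) (m i) \<le> wt (- t) (m i)" by (simp add: wt_mult)
    then have "ennreal (real (card I) powr c) * (wt c (m j) * wt (- t) (m j) * wt (- c) (m i)) * (\<Prod>l\<in>I - {p, i, j}. wt (- t) (m l))
       \<le> ennreal (real (card I) powr c) * wt (- t) (m i) * (\<Prod>l\<in>I - {p, i, j}. wt (- t) (m l))"
      by (intro mult_right_mono mult_left_mono) auto
    then show ?thesis unfolding 1 2 by (simp add: mult_ac)
  qed
  also have "\<dots> \<le> ennreal (real (card I) powr c) * (\<Sum>j\<in>I - {p}. \<Prod>l\<in>I - {p, j}. wt (- t) (m l))"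
    using I j by (intro mult_left_mono member_le_sum[where f = "\<lambda>j. \<Prod>l\<in>I - {p, j}. wt (- t) (m l)"]) auto
  finally show ?thesis .
qed

lemma bounded_form_transfer:
  fixes \<phi> :: "'i \<Rightarrow> int ^ 'd \<Rightarrow> 'g::ab_group_add"
  assumes I: "finite I" "p \<in> I" "i \<in> I" "p \<noteq> i" "\<And>l. l \<in> I \<Longrightarrow> \<epsilon> l \<in> {1, -1 :: int}"
    and Z: "\<And>z m. z \<in> Z \<Longrightarrow> m \<in> XS I \<phi> z \<Longrightarrow> (\<Sum>l\<in>I. \<epsilon> l *s m l) = 0"
    and c: "0 \<le> c" "c \<le> t"
    and b: "\<And>j. j \<in> I - {p} \<Longrightarrow> bounded_form I I \<phi> UNIV (\<lambda>m. \<Prod>l\<in>I - {p, j}. wt (- t) (m l))"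
  shows "bounded_form I I \<phi> Z (\<lambda>m. wt c (m p) * wt (- c) (m i) * (\<Prod>l\<in>I - {p, i}. wt (- t) (m l)))"
proof (rule bounded_form_mono)
  show "bounded_form I I \<phi> UNIV (\<lambda>m. \<Sum>j\<in>I - {p}. \<Prod>l\<in>I - {p, j}. wt (- t) (m l))"
    using I b by (intro bounded_form_sum) auto
  fix z m assume "z \<in> Z" "m \<in> XS I \<phi> z"
  then show "wt c (m p) * wt (- c) (m i) * (\<Prod>l\<in>I - {p, i}. wt (- t) (m l))
    \<le> ennreal (real (card I) powr c) * (\<Sum>j\<in>I - {p}. \<Prod>l\<in>I - {p, j}. wt (- t) (m l))"
    using Z I c by (intro pointwise_transfer[where \<epsilon> = \<epsilon>]) auto
qed simp

section \<open>Diagonal forms and Schur's test\<close>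

lemma esum_UNIV: "esum A f = esum UNIV (\<lambda>x. f x * indicator A x)"
  by (cases "A = UNIV") (auto intro!: nn_integral_count_space_indicator simp: NO_MATCH_def)

lemma esum_indicator: "esum A (\<lambda>x. f x * indicator B x) = esum (A \<inter> B) f"
  unfolding esum_UNIV[of A] esum_UNIV[of "A \<inter> B"] by (intro esum_cong) (auto simp: indicator_def)

lemma esum_prod_n2: "esum UNIV (\<lambda>(x, y). (f x)\<^sup>2 * (g y)\<^sup>2) = n2 f * n2 g"
proof -
  have "esum UNIV (\<lambda>(x, y). (f x)\<^sup>2 * (g y)\<^sup>2) = esum UNIV (\<lambda>x. esum UNIV (\<lambda>y. (f x)\<^sup>2 * (g y)\<^sup>2))"
    using esum_Sigma[of UNIV "\<lambda>_. UNIV" "\<lambda>(x, y). (f x)\<^sup>2 * (g y)\<^sup>2"] by simp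
  then show ?thesis by (simp only: esum_cmult esum_multc n2_def)
qed

text \<open>On the diagonal a tuple is determined by one of \<open>m p\<close>, \<open>m q\<close>
  together with one of \<open>m i\<close>, \<open>m j\<close>. Cauchy-Schwarz with the groups
  \<open>{p, i}\<close> and \<open>{q, j}\<close> therefore needs no weights at all.\<close>

lemma bounded_form_diagonal:
  fixes \<epsilon> :: "'i \<Rightarrow> int"
  assumes "distinct [p, q, i, j]" "\<And>l. l \<in> {p, q, i, j} \<Longrightarrow> \<epsilon> l \<in> {1, -1}"
  shows "bounded_form {p, q, i, j} {p, q, i, j} (lin \<epsilon> :: 'i \<Rightarrow> int ^ 'd \<Rightarrow> int ^ 'd) UNIV (indicator {m. m p = m q})"
proof (rule bounded_formI[where K = 1])
  fix z and f :: "'i \<Rightarrow> int ^ 'd \<Rightarrow> ennreal"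
  let ?X = "XS {p, q, i, j} (lin \<epsilon>) z :: ('i \<Rightarrow> int ^ 'd) set"
  let ?D = "{m :: 'i \<Rightarrow> int ^ 'd. m p = m q}"
  have ne: "p \<noteq> q" "p \<noteq> i" "p \<noteq> j" "q \<noteq> i" "q \<noteq> j" "i \<noteq> j" using assms(1) by auto
  have X: "m \<in> extensional {p, q, i, j}" "\<epsilon> p *s m p + (\<epsilon> q *s m q + (\<epsilon> i *s m i + \<epsilon> j *s m j)) = z" if "m \<in> ?X" for m
    using that ne by (auto simp: XS_def lin_def PiE_def)
  have key: "esum (?X \<inter> ?D) (\<lambda>m. (f a (m a))\<^sup>2 * (f b (m b))\<^sup>2) \<le> n2 (f a) * n2 (f b)"
    if ab: "a \<in> {p, q}" "b \<in> {i, j}" for a b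
  proof -
    have "esum (?X \<inter> ?D) (\<lambda>m. (f a (m a))\<^sup>2 * (f b (m b))\<^sup>2) = esum (?X \<inter> ?D) (\<lambda>m. (\<lambda>(x, y). (f a x)\<^sup>2 * (f b y)\<^sup>2) (m a, m b))"
      by simp
    also have "\<dots> \<le> esum UNIV (\<lambda>(x, y). (f a x)\<^sup>2 * (f b y)\<^sup>2)"
    proof (rule esum_le_inj)
      show "inj_on (\<lambda>m. (m a, m b)) (?X \<inter> ?D)"
      proof (rule inj_onI)
        fix m m' assume m: "m \<in> ?X \<inter> ?D" "m' \<in> ?X \<inter> ?D" "(m a, m b) = (m' a, m' b)"
        then have pq: "m p = m' p" "m q = m' q" using ab by auto
        have "\<epsilon> p *s m p + (\<epsilon> q *s m q + (\<epsilon> i *s m i + \<epsilon> j *s m j))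
          = \<epsilon> p *s m' p + (\<epsilon> q *s m' q + (\<epsilon> i *s m' i + \<epsilon> j *s m' j))"
          using X(2)[of m] X(2)[of m'] m(1,2) by simp
        then have "\<epsilon> i *s m i + \<epsilon> j *s m j = \<epsilon> i *s m' i + \<epsilon> j *s m' j"
          unfolding pq by simp
        then have ij: "m i = m' i \<and> m j = m' j"
          using ab m(3) assms(2)[of i] assms(2)[of j] by (auto simp: scale_sign_inj)
        show "m = m'"
          by (rule extensionalityI[of _ "{p, q, i, j}"]) (use X(1) m pq ij in auto)
      qed
    qed simp
    finally show ?thesis by (simp only: esum_prod_n2)
  qed
  have pr: "(\<Prod>l\<in>{p, q, i, j}. f l (m l)) = f p (m p) * f i (m i) * (f q (m q) * f j (m j))" for m
    using ne by (simp add: mult_ac)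
  have "(esum ?X (\<lambda>m. indicator ?D m * (\<Prod>l\<in>{p, q, i, j}. f l (m l))))\<^sup>2
     = (esum (?X \<inter> ?D) (\<lambda>m. f p (m p) * f i (m i) * (f q (m q) * f j (m j))))\<^sup>2"
    unfolding pr by (subst esum_indicator[symmetric]) (simp add: mult.commute)
  also have "\<dots> \<le> esum (?X \<inter> ?D) (\<lambda>m. (f p (m p) * f i (m i))\<^sup>2) * esum (?X \<inter> ?D) (\<lambda>m. (f q (m q) * f j (m j))\<^sup>2)"
    by (rule esum_Cauchy_Schwarz)
  also have "\<dots> \<le> (n2 (f p) * n2 (f i)) * (n2 (f q) * n2 (f j))"
    unfolding power_mult_distrib by (intro mult_mono key) auto
  also have "\<dots> = 1 * (\<Prod>l\<in>{p, q, i, j}. n2 (f l))" using ne by (simp add: mult_ac)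
  finally show "(esum ?X (\<lambda>m. indicator ?D m * (\<Prod>l\<in>{p, q, i, j}. f l (m l))))\<^sup>2 \<le> 1 * (\<Prod>l\<in>{p, q, i, j}. n2 (f l))" .
qed simp

lemma sign_scale_cancel: "\<epsilon> \<in> {1, -1 :: int} \<Longrightarrow> \<epsilon> *s (\<epsilon> *s x) = x"
  by (auto simp: vec_eq_iff)

text \<open>Equal signs put \<open>m b\<close> on a sphere. Opposite signs put it on a hyperplane
  with normal vector \<open>m q - m b\<close>, and this is where the two variables must be
  distinct.\<close>

lemma quadric_fibre:
  fixes X :: "('i \<Rightarrow> int ^ 'd) set"
  assumes sg: "\<epsilon> b \<in> {1, -1 :: int}" "\<epsilon> q \<in> {1, -1}"
    and X: "\<And>m. m \<in> X \<Longrightarrow> \<epsilon> b *s m b + \<epsilon> q *s m q = P \<and> \<epsilon> b * sq (m b) + \<epsilon> q * sq (m q) = \<tau>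
      \<and> (\<epsilon> b = \<epsilon> q \<or> m b \<noteq> m q)"
    and inj: "inj_on (\<lambda>m. m b) X"
    and K: "\<And>Q \<tau>. esum (sphere_set (Q :: int ^ 'd) \<tau>) (wt (- 2 * s)) \<le> K"
    "\<And>Q \<tau>. Q \<noteq> 0 \<Longrightarrow> esum (plane_set (Q :: int ^ 'd) \<tau>) (wt (- 2 * s)) \<le> K"
  shows "esum X (\<lambda>m. wt (- 2 * s) (m b)) \<le> K"
proof (cases "X = {}")
  case False
  then obtain m0 where m0: "m0 \<in> X" by blast
  define Q where "Q = \<epsilon> q *s P"
  show ?thesis
  proof (cases "\<epsilon> b = \<epsilon> q")
    case True
    have "(\<lambda>m. m b) ` X \<subseteq> sphere_set Q (\<epsilon> q * \<tau>)"
    proof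
      fix x assume "x \<in> (\<lambda>m. m b) ` X"
      then obtain m where m: "m \<in> X" "x = m b" by blast
      have "\<epsilon> q *s (m b + m q) = P" "\<epsilon> q * (sq (m b) + sq (m q)) = \<tau>"
        using X[OF m(1)] True by (simp_all add: algebra_simps)
      then have "m q = Q - m b" "sq (m b) + sq (m q) = \<epsilon> q * \<tau>"
        using sg(2) unfolding Q_def by (auto simp: sign_scale_cancel)
      then show "x \<in> sphere_set Q (\<epsilon> q * \<tau>)" unfolding sphere_set_def m(2) by (simp add: add.commute)
    qed
    then have "esum X (\<lambda>m. wt (- 2 * s) (m b)) \<le> esum (sphere_set Q (\<epsilon> q * \<tau>)) (wt (- 2 * s))"
      by (rule esum_le_inj[OF inj])
    also have "\<dots> \<le> K" by (rule K)
    finally show ?thesis .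
  next
    case False
    then have eb: "\<epsilon> b = - \<epsilon> q" using sg by auto
    have m: "m q = m b + Q" "sq (m q) - sq (m b) = \<epsilon> q * \<tau>" "m b \<noteq> m q" if "m \<in> X" for m
    proof -
      have 1: "\<epsilon> q *s (m q - m b) = P" "\<epsilon> q * (sq (m q) - sq (m b)) = \<tau>"
        using X[OF that] by (simp_all add: eb algebra_simps vec_eq_iff)
      show "m q = m b + Q" unfolding Q_def 1(1)[symmetric] sign_scale_cancel[OF sg(2)] by simp
      show "sq (m q) - sq (m b) = \<epsilon> q * \<tau>" unfolding 1(2)[symmetric] using sg(2) by auto
      show "m b \<noteq> m q" using X[OF that] False by blast
    qed
    have "(\<lambda>m. m b) ` X \<subseteq> plane_set Q (\<epsilon> q * \<tau>)"
    proof
      fix x assume "x \<in> (\<lambda>m. m b) ` X"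
      then obtain m' where m': "m' \<in> X" "x = m' b" by blast
      show "x \<in> plane_set Q (\<epsilon> q * \<tau>)"
        using m(2)[OF m'(1)] unfolding plane_set_def m'(2) m(1)[OF m'(1)] by (simp add: add.commute)
    qed
    then have "esum X (\<lambda>m. wt (- 2 * s) (m b)) \<le> esum (plane_set Q (\<epsilon> q * \<tau>)) (wt (- 2 * s))"
      by (rule esum_le_inj[OF inj])
    also have "\<dots> \<le> K" by (rule K) (use m(1,3)[OF m0] in auto)
    finally show ?thesis .
  qed
qed (simp add: nn_integral_count_space_finite)

text \<open>Schur's test with \<open>m q\<close> as the dependent variable. Each function is paired
  with the weight of the other variable: once \<open>m a\<close> is fixed, \<open>m b\<close> and
  \<open>m q\<close> have a prescribed signed sum and phase, and likewise with \<open>a\<close> and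
  \<open>b\<close> exchanged.\<close>

lemma bounded_form_schur:
  fixes \<epsilon> :: "'i \<Rightarrow> int"
  assumes "distinct [q, a, b]" and sg: "\<And>l. l \<in> {q, a, b} \<Longrightarrow> \<epsilon> l \<in> {1, -1}" and s: "2 * s > real CARD('d) - 1"
  shows "bounded_form {q, a, b} {a, b} (phs \<epsilon> :: 'i \<Rightarrow> int ^ 'd \<Rightarrow> (int ^ 'd) \<times> int) UNIV
    (\<lambda>m. indicator {m. (\<epsilon> a = \<epsilon> q \<or> m a \<noteq> m q) \<and> (\<epsilon> b = \<epsilon> q \<or> m b \<noteq> m q)} m * (wt (- s) (m a) * wt (- s) (m b)))"
proof -
  obtain K where K: "K \<ge> 0" "\<And>Q \<tau>. esum (sphere_set (Q :: int ^ 'd) \<tau>) (wt (- 2 * s)) \<le> ennreal K"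
    "\<And>Q \<tau>. Q \<noteq> 0 \<Longrightarrow> esum (plane_set (Q :: int ^ 'd) \<tau>) (wt (- 2 * s)) \<le> ennreal K"
    by (rule sum_wt_quadric[OF s]) (blast intro: that)
  have ne: "q \<noteq> a" "q \<noteq> b" "a \<noteq> b" using assms(1) by auto
  show ?thesis
  proof (rule bounded_formI)
    show "ennreal K * ennreal K < top" by (simp add: ennreal_mult_less_top)
    fix z and f :: "'i \<Rightarrow> int ^ 'd \<Rightarrow> ennreal"
    define C where "C = {m :: 'i \<Rightarrow> int ^ 'd. (\<epsilon> a = \<epsilon> q \<or> m a \<noteq> m q) \<and> (\<epsilon> b = \<epsilon> q \<or> m b \<noteq> m q)}"
    let ?X = "XS {q, a, b} (phs \<epsilon>) z \<inter> C"
    have X: "m \<in> extensional {q, a, b}" "\<epsilon> q *s m q + (\<epsilon> a *s m a + \<epsilon> b *s m b) = fst z"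
      "\<epsilon> q * sq (m q) + (\<epsilon> a * sq (m a) + \<epsilon> b * sq (m b)) = snd z" "m \<in> C" if "m \<in> ?X" for m
      using that ne by (auto simp: XS_phs_iff PiE_def)
    have key: "esum ?X (\<lambda>m. (f a' (m a'))\<^sup>2 * wt (- 2 * s) (m b')) \<le> n2 (f a') * ennreal K"
      if ab: "(a' = a \<and> b' = b) \<or> (a' = b \<and> b' = a)" for a' b'
      unfolding n2_def
    proof (rule esum_fibre_le[where G = "\<lambda>x. (f a' x)\<^sup>2" and \<pi> = "\<lambda>m. m a'"])
      fix y
      show "esum {m \<in> ?X. m a' = y} (\<lambda>m. wt (- 2 * s) (m b')) \<le> ennreal K"
      proof (rule quadric_fibre[where \<epsilon> = \<epsilon> and q = q and P = "fst z - \<epsilon> a' *s y" and \<tau> = "snd z - \<epsilon> a' * sq y", OF _ _ _ _ K(2,3)])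
        show "\<epsilon> b' \<in> {1, -1}" "\<epsilon> q \<in> {1, -1}" using sg ab by auto
        show "\<epsilon> b' *s m b' + \<epsilon> q *s m q = fst z - \<epsilon> a' *s y \<and> \<epsilon> b' * sq (m b') + \<epsilon> q * sq (m q) = snd z - \<epsilon> a' * sq y
          \<and> (\<epsilon> b' = \<epsilon> q \<or> m b' \<noteq> m q)" if "m \<in> {m \<in> ?X. m a' = y}" for m
          using X(2-4)[of m] that ab by (auto simp: C_def algebra_simps)
        show "inj_on (\<lambda>m. m b') {m \<in> ?X. m a' = y}"
        proof (rule inj_onI)
          fix m m' assume m: "m \<in> {m \<in> ?X. m a' = y}" "m' \<in> {m \<in> ?X. m a' = y}" "m b' = m' b'"
          then have 1: "m a = m' a" "m b = m' b" using ab by auto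
          then have "\<epsilon> q *s m q = \<epsilon> q *s m' q" using X(2)[of m] X(2)[of m'] m by (metis (no_types, lifting) add_right_cancel mem_Collect_eq)
          then have "m q = m' q" using sg[of q] by (simp add: scale_sign_inj)
          then show "m = m'"
            using 1 X(1)[of m] X(1)[of m'] m by (auto intro!: extensionalityI[of _ "{q, a, b}"])
        qed
      qed
    qed
    have "(esum (XS {q, a, b} (phs \<epsilon>) z) (\<lambda>m. indicator C m * (wt (- s) (m a) * wt (- s) (m b)) * (\<Prod>l\<in>{a, b}. f l (m l))))\<^sup>2
      = (esum ?X (\<lambda>m. (f a (m a) * wt (- s) (m b)) * (f b (m b) * wt (- s) (m a))))\<^sup>2"
      using ne by (subst esum_indicator[symmetric]) (simp add: mult_ac)
    also have "\<dots> \<le> esum ?X (\<lambda>m. (f a (m a) * wt (- s) (m b))\<^sup>2) * esum ?X (\<lambda>m. (f b (m b) * wt (- s) (m a))\<^sup>2)"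
      by (rule esum_Cauchy_Schwarz)
    also have "\<dots> \<le> (n2 (f a) * ennreal K) * (n2 (f b) * ennreal K)"
      using key[of a b] key[of b a] by (intro mult_mono) (simp_all add: power_mult_distrib wt_power2)
    also have "\<dots> = ennreal K * ennreal K * (\<Prod>l\<in>{a, b}. n2 (f l))" using ne by (simp add: mult_ac)
    finally show "(esum (XS {q, a, b} (phs \<epsilon>) z) (\<lambda>m. indicator {m. (\<epsilon> a = \<epsilon> q \<or> m a \<noteq> m q) \<and> (\<epsilon> b = \<epsilon> q \<or> m b \<noteq> m q)} m
        * (wt (- s) (m a) * wt (- s) (m b)) * (\<Prod>l\<in>{a, b}. f l (m l))))\<^sup>2 \<le> ennreal K * ennreal K * (\<Prod>l\<in>{a, b}. n2 (f l))"
      unfolding C_def .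
  qed
qed

text \<open>Four variables rather than two get by with an exponent just above \<open>1 / 2\<close>,
  because two are fixed at a time: \<open>a, e\<close> against the weights of \<open>b, c\<close>,
  and \<open>b, c\<close> against those of \<open>a, e\<close>. In both cases the two weighted
  variables together with \<open>m q\<close> form a \<open>pair_set\<close>, the larger of them
  being different from \<open>m q\<close>.\<close>

lemma bounded_form_schur2:
  fixes \<epsilon> :: "'i \<Rightarrow> int"
  assumes "distinct [q, a, b, c, e]" and sg: "\<And>l. l \<in> {q, a, b, c, e} \<Longrightarrow> \<epsilon> l \<in> {1, -1}"
    and s: "2 * s > 1" and d: "CARD('d) = 2"
  shows "bounded_form {q, a, b, c, e} {a, b, c, e} (phs \<epsilon> :: 'i \<Rightarrow> int ^ 'd \<Rightarrow> (int ^ 'd) \<times> int) UNIV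
    (\<lambda>m. indicator {m. m a \<noteq> m q \<and> m b \<noteq> m q \<and> bracket (m c) \<le> bracket (m b) \<and> bracket (m e) \<le> bracket (m a)} m
       * (\<Prod>l\<in>{a, b, c, e}. wt (- s) (m l)))"
proof -
  obtain K where K: "K \<ge> 0"
    "\<And>c q (P :: int ^ 'd) \<tau>. c \<in> {1, -1} \<Longrightarrow> q \<in> {1, -1} \<Longrightarrow>
      esum (pair_set c q P \<tau>) (\<lambda>p. wt (- 2 * s) (fst p) * wt (- 2 * s) (snd p)) \<le> ennreal K"
    by (rule sum_wt_pair_set[OF s d]) (blast intro: that)
  have ne: "q \<noteq> a" "q \<noteq> b" "q \<noteq> c" "q \<noteq> e" "a \<noteq> b" "a \<noteq> c" "a \<noteq> e" "b \<noteq> c" "b \<noteq> e" "c \<noteq> e" using assms(1) by auto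
  show ?thesis
  proof (rule bounded_formI)
    show "ennreal K * ennreal K < top" by (simp add: ennreal_mult_less_top)
    fix z and f :: "'i \<Rightarrow> int ^ 'd \<Rightarrow> ennreal"
    define C where "C = {m :: 'i \<Rightarrow> int ^ 'd. m a \<noteq> m q \<and> m b \<noteq> m q \<and> bracket (m c) \<le> bracket (m b) \<and> bracket (m e) \<le> bracket (m a)}"
    let ?I = "{q, a, b, c, e}"
    let ?X = "XS ?I (phs \<epsilon>) z \<inter> C"
    have X: "m \<in> extensional ?I" "\<epsilon> q *s m q + (\<epsilon> a *s m a + (\<epsilon> b *s m b + (\<epsilon> c *s m c + \<epsilon> e *s m e))) = fst z"
      "\<epsilon> q * sq (m q) + (\<epsilon> a * sq (m a) + (\<epsilon> b * sq (m b) + (\<epsilon> c * sq (m c) + \<epsilon> e * sq (m e)))) = snd z" "m \<in> C" if "m \<in> ?X" for m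
      using that ne by (auto simp: XS_phs_iff PiE_def)
    have key: "esum ?X (\<lambda>m. ((f a' (m a'))\<^sup>2 * (f e' (m e'))\<^sup>2) * (wt (- 2 * s) (m b') * wt (- 2 * s) (m c'))) \<le> (n2 (f a') * n2 (f e')) * ennreal K"
      if ab: "(a' = a \<and> b' = b \<and> c' = c \<and> e' = e) \<or> (a' = b \<and> b' = a \<and> c' = e \<and> e' = c)" for a' b' c' e'
    proof -
      have "esum ?X (\<lambda>m. (\<lambda>(x, y). (f a' x)\<^sup>2 * (f e' y)\<^sup>2) (m a', m e') * (wt (- 2 * s) (m b') * wt (- 2 * s) (m c')))
        \<le> esum UNIV (\<lambda>(x, y). (f a' x)\<^sup>2 * (f e' y)\<^sup>2) * ennreal K"
      proof (rule esum_fibre_le[where \<pi> = "\<lambda>m. (m a', m e')"])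
        fix y :: "(int ^ 'd) \<times> (int ^ 'd)"
        let ?Y = "{m \<in> ?X. (m a', m e') = y}"
        let ?P = "\<epsilon> b' *s (fst z - \<epsilon> a' *s fst y - \<epsilon> e' *s snd y)"
        let ?t = "\<epsilon> b' * (snd z - \<epsilon> a' * sq (fst y) - \<epsilon> e' * sq (snd y))"
        have sg': "\<epsilon> b' \<in> {1, -1}" "\<epsilon> c' \<in> {1, -1}" "\<epsilon> q \<in> {1, -1}" using sg ab by auto
        have Y: "\<epsilon> b' *s m b' + \<epsilon> c' *s m c' + \<epsilon> q *s m q = fst z - \<epsilon> a' *s fst y - \<epsilon> e' *s snd y"
           "\<epsilon> b' * sq (m b') + \<epsilon> c' * sq (m c') + \<epsilon> q * sq (m q) = snd z - \<epsilon> a' * sq (fst y) - \<epsilon> e' * sq (snd y)"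
           "m b' \<noteq> m q" "bracket (m c') \<le> bracket (m b')" if "m \<in> ?Y" for m
          using X(2-4)[of m] that ab by (auto simp: C_def algebra_simps)
        have "esum ?Y (\<lambda>m. wt (- 2 * s) (m b') * wt (- 2 * s) (m c'))
           = esum ?Y (\<lambda>m. (\<lambda>p. wt (- 2 * s) (fst p) * wt (- 2 * s) (snd p)) (m b', m c'))" by simp
        also have "\<dots> \<le> esum (pair_set (\<epsilon> b' * \<epsilon> c') (\<epsilon> b' * \<epsilon> q) ?P ?t) (\<lambda>p. wt (- 2 * s) (fst p) * wt (- 2 * s) (snd p))"
        proof (rule esum_le_inj)
          show "inj_on (\<lambda>m. (m b', m c')) ?Y"
          proof (rule inj_onI)
            fix m m' assume m: "m \<in> ?Y" "m' \<in> ?Y" "(m b', m c') = (m' b', m' c')"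
            then have "(m a', m e') = (m' a', m' e')" by simp
            with m(3) have 1: "m a = m' a" "m b = m' b" "m c = m' c" "m e = m' e" using ab by auto
            have "\<epsilon> b' *s m b' + \<epsilon> c' *s m c' + \<epsilon> q *s m q = \<epsilon> b' *s m b' + \<epsilon> c' *s m c' + \<epsilon> q *s m' q"
              using Y(1)[OF m(1)] Y(1)[OF m(2)] m(3) by simp
            then have "m q = m' q" using sg'(3) by (simp add: scale_sign_inj)
            then show "m = m'"
              using 1 X(1)[of m] X(1)[of m'] m by (auto intro!: extensionalityI[of _ ?I])
          qed
          show "(\<lambda>m. (m b', m c')) ` ?Y \<subseteq> pair_set (\<epsilon> b' * \<epsilon> c') (\<epsilon> b' * \<epsilon> q) ?P ?t"
          proof
            fix p assume "p \<in> (\<lambda>m. (m b', m c')) ` ?Y"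
            then obtain m where m: "m \<in> ?Y" "p = (m b', m c')" by blast
            have "m b' + (\<epsilon> b' * \<epsilon> c') *s m c' + (\<epsilon> b' * \<epsilon> q) *s m q = ?P"
              unfolding Y(1)[OF m(1), symmetric] using sg'(1) by (auto simp: vec_eq_iff)
            moreover have "sq (m b') + (\<epsilon> b' * \<epsilon> c') * sq (m c') + (\<epsilon> b' * \<epsilon> q) * sq (m q) = ?t"
              unfolding Y(2)[OF m(1), symmetric] using sg'(1) by (auto simp: algebra_simps)
            ultimately show "p \<in> pair_set (\<epsilon> b' * \<epsilon> c') (\<epsilon> b' * \<epsilon> q) ?P ?t"
              unfolding pair_set_def m(2) using Y(3,4)[OF m(1)] by blast
          qed
        qed
        also have "\<dots> \<le> ennreal K" using sg' by (intro K(2)) auto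
        finally show "esum ?Y (\<lambda>m. wt (- 2 * s) (m b') * wt (- 2 * s) (m c')) \<le> ennreal K" .
      qed
      then show ?thesis unfolding esum_prod_n2 by simp
    qed
    have "(esum (XS ?I (phs \<epsilon>) z) (\<lambda>m. indicator C m * (\<Prod>l\<in>{a, b, c, e}. wt (- s) (m l)) * (\<Prod>l\<in>{a, b, c, e}. f l (m l))))\<^sup>2
      = (esum ?X (\<lambda>m. (f a (m a) * f e (m e) * (wt (- s) (m b) * wt (- s) (m c))) * (f b (m b) * f c (m c) * (wt (- s) (m a) * wt (- s) (m e)))))\<^sup>2"
      using ne by (subst esum_indicator[symmetric]) (simp add: mult_ac)
    also have "\<dots> \<le> esum ?X (\<lambda>m. (f a (m a) * f e (m e) * (wt (- s) (m b) * wt (- s) (m c)))\<^sup>2)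
        * esum ?X (\<lambda>m. (f b (m b) * f c (m c) * (wt (- s) (m a) * wt (- s) (m e)))\<^sup>2)"
      by (rule esum_Cauchy_Schwarz)
    also have "\<dots> \<le> ((n2 (f a) * n2 (f e)) * ennreal K) * ((n2 (f b) * n2 (f c)) * ennreal K)"
      using key[of a b c e] key[of b a e c] by (intro mult_mono) (simp_all add: power_mult_distrib wt_power2)
    also have "\<dots> = ennreal K * ennreal K * (\<Prod>l\<in>{a, b, c, e}. n2 (f l))" using ne by (simp add: mult_ac)
    finally show "(esum (XS ?I (phs \<epsilon>) z) (\<lambda>m. indicator {m. m a \<noteq> m q \<and> m b \<noteq> m q \<and> bracket (m c) \<le> bracket (m b) \<and> bracket (m e) \<le> bracket (m a)} m
        * (\<Prod>l\<in>{a, b, c, e}. wt (- s) (m l)) * (\<Prod>l\<in>{a, b, c, e}. f l (m l))))\<^sup>2 \<le> ennreal K * ennreal K * (\<Prod>l\<in>{a, b, c, e}. n2 (f l))"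
      unfolding C_def .
  qed
qed

section \<open>Ordered sums at the endpoint\<close>

lemma bracket_neq_0 [simp]: "bracket x \<noteq> 0"
  using bracket_pos[of x] by linarith

text \<open>Dyadic shells are counted downwards from radius \<open>A\<close>. Below the exponent
  \<open>d / 2\<close> the outermost shell dominates, so the natural power of \<open>A\<close> comes
  out without a logarithm.\<close>

lemma sum_wt_ball:
  assumes s: "s \<ge> 0" "2 * s < real CARD('d)"
  obtains K where "K \<ge> 0"
    "\<And>A. A \<ge> 1 \<Longrightarrow> esum {x :: int ^ 'd. bracket x \<le> A} (wt (- 2 * s)) \<le> ennreal (K * A powr (real CARD('d) - 2 * s))"
proof -
  define d where "d = CARD('d)"
  define \<delta> where "\<delta> = real d - 2 * s"
  have \<delta>: "\<delta> > 0" using s by (simp add: \<delta>_def d_def)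
  define q where "q = (2::real) powr - \<delta>"
  have q: "0 < q" "q < 1" using \<delta> by (simp_all add: q_def powr_less_one)
  define K where "K = 3 ^ d * 2 powr (2 * s) * (1 / (1 - q))"
  show ?thesis
  proof (rule that)
    show "K \<ge> 0" using q by (simp add: K_def)
    fix A :: real assume A: "A \<ge> 1"
    define S where "S = {x :: int ^ 'd. bracket x \<le> A}"
    define n where "n x = nat \<lfloor>log 2 (A / bracket x)\<rfloor>" for x :: "int ^ 'd"
    have n: "2 ^ n x \<le> A / bracket x" "A / bracket x \<le> 2 ^ (n x + 1)" if "x \<in> S" for x
    proof -
      define t where "t = A / bracket x"
      have t1: "t \<ge> 1" using that by (simp add: S_def t_def)
      have l: "log 2 t \<ge> 0" using t1 by simp
      have t: "t = 2 powr (log 2 t)" using t1 by simp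
      have nt: "n x = nat \<lfloor>log 2 t\<rfloor>" by (simp add: n_def t_def)
      have "real (n x) \<le> log 2 t" using l by (simp add: nt)
      then have "2 powr real (n x) \<le> 2 powr (log 2 t)" by (intro powr_mono) auto
      then have "2 ^ n x \<le> t" using t by (simp add: powr_realpow)
      then show "2 ^ n x \<le> A / bracket x" by (simp only: t_def)
      have "log 2 t \<le> real (n x + 1)" using l unfolding nt by linarith
      then have "2 powr (log 2 t) \<le> 2 powr real (n x + 1)" by (intro powr_mono) auto
      then have "t \<le> 2 ^ (n x + 1)" using t by (simp only: powr_realpow)
      then show "A / bracket x \<le> 2 ^ (n x + 1)" by (simp only: t_def)
    qed
    define c where "c = 3 ^ d * 2 powr (2 * s) * A powr \<delta>"
    have c: "c \<ge> 0" by (simp add: c_def)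
    have "esum S (wt (- 2 * s)) = esum UNIV (\<lambda>i. esum {x \<in> S. n x = i} (wt (- 2 * s)))"
      by (rule esum_partition)
    also have "\<dots> \<le> esum UNIV (\<lambda>i. ennreal (c * q ^ i))"
    proof (rule esum_mono)
      fix i
      let ?B = "A / 2 ^ i"
      define T where "T = {x \<in> S. n x = i}"
      show "esum {x \<in> S. n x = i} (wt (- 2 * s)) \<le> ennreal (c * q ^ i)"
      proof (cases "T = {}")
        case True
        then show ?thesis unfolding T_def[symmetric] by (simp add: nn_integral_count_space_finite)
      next
        case False
        have TB: "bracket x \<le> ?B" "A / 2 ^ (i + 1) \<le> bracket x" if "x \<in> T" for x
          using n[of x] that bracket_pos[of x] by (auto simp: T_def field_simps)
        have B1: "?B \<ge> 1"
        proof -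
          obtain x where "x \<in> T" using False by blast
          then show ?thesis using TB(1)[of x] bracket_ge_1[of x] by linarith
        qed
        have finT: "finite T" by (rule finite_subset[OF _ finite_bracket_le[of ?B]]) (use TB in auto)
        have "card T \<le> card {x :: int ^ 'd. bracket x \<le> ?B}"
          by (rule card_mono[OF finite_bracket_le]) (use TB in auto)
        then have cT: "real (card T) \<le> (3 * ?B) ^ d"
          using card_bracket_le[OF B1, where 'd = 'd] unfolding d_def by linarith
        define w where "w = (A / 2 ^ (i + 1)) powr (- 2 * s)"
        have w: "wt (- 2 * s) x \<le> ennreal w" if "x \<in> T" for x
          unfolding wt_def w_def using TB(2)[OF that] A s by (intro ennreal_leI powr_mono2') auto
        have "esum T (wt (- 2 * s)) \<le> esum T (\<lambda>_. ennreal w)" by (rule esum_mono[OF w])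
        also have "\<dots> = ennreal (real (card T) * w)"
          using finT by (simp add: nn_integral_count_space_finite ennreal_mult ennreal_of_nat_eq_real_of_nat w_def mult.commute)
        also have "\<dots> \<le> ennreal ((3 * ?B) ^ d * w)"
          using cT by (intro ennreal_leI mult_right_mono) (auto simp: w_def)
        also have "(3 * ?B) ^ d * w = c * q ^ i"
        proof -
          have p: "A / 2 ^ j = A * 2 powr - real j" for j
            by (simp add: powr_minus powr_realpow divide_inverse)
          have 1: "(3 * ?B) ^ d = 3 ^ d * (A powr real d * 2 powr (- (real i * real d)))"
          proof -
            have "(2 powr - real i) ^ d = 2 powr (- (real i * real d))"
              by (simp add: powr_realpow[symmetric] powr_powr)
            then show ?thesis unfolding p using A by (simp add: power_mult_distrib powr_realpow)
          qed
          have 2: "w = A powr (- 2 * s) * 2 powr (real (i + 1) * (2 * s))"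
            unfolding w_def p using A by (simp only: powr_mult powr_powr powr_ge_zero) (simp add: algebra_simps)
          have 3: "q ^ i = 2 powr (- \<delta> * real i)" unfolding q_def by (simp add: powr_realpow[symmetric] powr_powr)
          have "(3 * ?B) ^ d * w = 3 ^ d * (A powr real d * A powr (- 2 * s)) * (2 powr (- (real i * real d)) * 2 powr (real (i + 1) * (2 * s)))"
            unfolding 1 2 by (simp add: mult_ac)
          also have "\<dots> = 3 ^ d * A powr \<delta> * (2 powr (2 * s) * q ^ i)"
            unfolding 3 powr_add[symmetric] \<delta>_def by (simp add: algebra_simps)
          finally show ?thesis by (simp add: c_def mult_ac)
        qed
        finally show ?thesis unfolding T_def .
      qed
    qed
    also have "\<dots> = ennreal c * esum UNIV (\<lambda>i. ennreal (q ^ i))"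
      using c q by (simp add: ennreal_mult esum_cmult)
    also have "\<dots> = ennreal c * ennreal (1 / (1 - q))"
      using q by (simp add: nn_integral_count_space_nat suminf_ennreal2 summable_geometric suminf_geometric)
    also have "\<dots> = ennreal (K * A powr \<delta>)"
      using c q by (simp add: ennreal_mult[symmetric] K_def c_def mult_ac)
    finally show "esum {x :: int ^ 'd. bracket x \<le> A} (wt (- 2 * s)) \<le> ennreal (K * A powr (real CARD('d) - 2 * s))"
      by (simp add: S_def \<delta>_def d_def)
  qed
qed

text \<open>The zero map into \<open>int\<close> imposes no constraint, so the free product is a
  case of \<open>cf_rest_le\<close> with an empty core.\<close>

lemma esum_PiE_prod: "finite L \<Longrightarrow> esum (PiE L (\<lambda>_. UNIV)) (\<lambda>m. \<Prod>l\<in>L. g l (m l)) \<le> (\<Prod>l\<in>L. n1 (g l))"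
proof -
  assume "finite L"
  have "cf ({} \<union> L) (\<lambda>_ _. 0 :: int) g 0 \<le> 1 * (\<Prod>l\<in>L. n1 (g l))"
    by (rule cf_rest_le) (use \<open>finite L\<close> in \<open>auto simp: cf_empty indicator_def\<close>)
  then show ?thesis by (simp add: cf_def XS_def)
qed

text \<open>
  Given the values of \<open>m i\<close> and of \<open>m l\<close> for \<open>l \<in> L\<close>, the tuple is determined. The exponents are
  chosen such that the powers of \<open>\<langle>m i\<rangle>\<close> which come from the sums over the balls cancel exactly;
  this is what makes the endpoint case work.
\<close>

lemma endpoint_half:
  fixes X :: "('i \<Rightarrow> int ^ 'd) set"
  assumes L: "finite L" and s: "s \<ge> 0" "2 * s < real CARD('d)" and r: "real (card L) * (real CARD('d) / 2 - s) \<le> r"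
    and inj: "\<And>m m'. m \<in> X \<Longrightarrow> m' \<in> X \<Longrightarrow> m i = m' i \<Longrightarrow> (\<And>l. l \<in> L \<Longrightarrow> m l = m' l) \<Longrightarrow> m = m'"
    and X: "\<And>m l. m \<in> X \<Longrightarrow> l \<in> L \<Longrightarrow> bracket (m l) \<le> bracket (m i)"
    and K: "K \<ge> 0" "\<And>A. A \<ge> 1 \<Longrightarrow> esum {x :: int ^ 'd. bracket x \<le> A} (wt (- 2 * s)) \<le> ennreal (K * A powr (real CARD('d) - 2 * s))"
  shows "(esum X (\<lambda>m. F (m i) * wt (- r) (m i) * (\<Prod>l\<in>L. wt (- s) (m l) * f l (m l))))\<^sup>2
    \<le> (esum UNIV F)\<^sup>2 * (ennreal K ^ card L * (\<Prod>l\<in>L. n2 (f l)))"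
proof -
  obtain D where D: "D\<^sup>2 = ennreal K ^ card L * (\<Prod>l\<in>L. n2 (f l))" using ennreal_ex_sqrt by blast
  \<comment> \<open>Cauchy-Schwarz on the ball of radius \<open>bracket y\<close> costs the power
    \<open>d / 2 - s\<close> for each variable in \<open>L\<close>; by \<open>r\<close> the weight
    at \<open>y\<close> pays for all of them.\<close>
  have inner: "wt (- r) y * esum {m \<in> X. m i = y} (\<lambda>m. \<Prod>l\<in>L. wt (- s) (m l) * f l (m l)) \<le> D" for y
  proof -
    define g where "g l x = wt (- s) x * indicator {x. bracket x \<le> bracket y} x * f l x" for l and x :: "int ^ 'd"
    have "esum {m \<in> X. m i = y} (\<lambda>m. \<Prod>l\<in>L. wt (- s) (m l) * f l (m l))
       = esum {m \<in> X. m i = y} (\<lambda>m. (\<lambda>m. \<Prod>l\<in>L. g l (m l)) (restrict m L))"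
      using X by (intro esum_cong prod.cong) (auto simp: g_def)
    also have "\<dots> \<le> esum (PiE L (\<lambda>_. UNIV)) (\<lambda>m. \<Prod>l\<in>L. g l (m l))"
    proof (rule esum_le_inj)
      show "inj_on (\<lambda>m. restrict m L) {m \<in> X. m i = y}"
      proof (rule inj_onI)
        fix m m' assume m: "m \<in> {m \<in> X. m i = y}" "m' \<in> {m \<in> X. m i = y}" "restrict m L = restrict m' L"
        show "m = m'"
        proof (rule inj)
          show "m l = m' l" if "l \<in> L" for l using fun_cong[OF m(3), of l] that by simp
        qed (use m in auto)
      qed
    qed auto
    also have "\<dots> \<le> (\<Prod>l\<in>L. n1 (g l))" by (rule esum_PiE_prod[OF L])
    finally have le: "esum {m \<in> X. m i = y} (\<lambda>m. \<Prod>l\<in>L. wt (- s) (m l) * f l (m l)) \<le> (\<Prod>l\<in>L. n1 (g l))" .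
    have g2: "(n1 (g l))\<^sup>2 \<le> ennreal (K * bracket y powr (real CARD('d) - 2 * s)) * n2 (f l)" for l
    proof -
      have "(n1 (g l))\<^sup>2 \<le> esum UNIV (\<lambda>x :: int ^ 'd. (wt (- s) x * indicator {x. bracket x \<le> bracket y} x)\<^sup>2) * n2 (f l)"
        unfolding n1_def n2_def g_def by (rule esum_Cauchy_Schwarz)
      also have "esum UNIV (\<lambda>x :: int ^ 'd. (wt (- s) x * indicator {x. bracket x \<le> bracket y} x)\<^sup>2) = esum {x :: int ^ 'd. bracket x \<le> bracket y} (wt (- 2 * s))"
        unfolding esum_UNIV[of "{x :: int ^ 'd. bracket x \<le> bracket y}"]
        by (intro esum_cong) (auto simp: power_mult_distrib wt_power2 indicator_def)
      also have "\<dots> * n2 (f l) \<le> ennreal (K * bracket y powr (real CARD('d) - 2 * s)) * n2 (f l)"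
        using K(2)[of "bracket y"] by (intro mult_right_mono) auto
      finally show ?thesis .
    qed
    have "(wt (- r) y * (\<Prod>l\<in>L. n1 (g l)))\<^sup>2 = wt (- 2 * r) y * (\<Prod>l\<in>L. (n1 (g l))\<^sup>2)"
      by (simp add: power_mult_distrib wt_power2 prod_power_distrib)
    also have "\<dots> \<le> wt (- 2 * r) y * (\<Prod>l\<in>L. ennreal (K * bracket y powr (real CARD('d) - 2 * s)) * n2 (f l))"
      by (intro mult_left_mono prod_mono_ennreal g2) auto
    also have "\<dots> = wt (- 2 * r) y * wt (real (card L) * (real CARD('d) - 2 * s)) y * (ennreal K ^ card L * (\<Prod>l\<in>L. n2 (f l)))"
      using K(1) by (simp add: prod.distrib ennreal_mult power_mult_distrib wt_def ennreal_power powr_realpow[symmetric] powr_powr mult_ac)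
    also have "\<dots> \<le> 1 * (ennreal K ^ card L * (\<Prod>l\<in>L. n2 (f l)))"
    proof (rule mult_right_mono)
      have "wt (- 2 * r) y * wt (real (card L) * (real CARD('d) - 2 * s)) y \<le> wt 0 y"
        unfolding wt_mult using r by (intro wt_mono) (simp add: field_simps)
      then show "wt (- 2 * r) y * wt (real (card L) * (real CARD('d) - 2 * s)) y \<le> 1" by simp
    qed simp
    finally have "(wt (- r) y * (\<Prod>l\<in>L. n1 (g l)))\<^sup>2 \<le> D\<^sup>2" by (simp add: D)
    then have "wt (- r) y * (\<Prod>l\<in>L. n1 (g l)) \<le> D" by (rule ennreal_power2_le_imp_le)
    then show ?thesis using mult_left_mono[OF le, of "wt (- r) y"] by (meson order_trans zero_le)
  qed
  have "esum X (\<lambda>m. F (m i) * wt (- r) (m i) * (\<Prod>l\<in>L. wt (- s) (m l) * f l (m l)))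
     = esum UNIV (\<lambda>y. esum {m \<in> X. m i = y} (\<lambda>m. F (m i) * wt (- r) (m i) * (\<Prod>l\<in>L. wt (- s) (m l) * f l (m l))))"
    by (rule esum_partition)
  also have "\<dots> = esum UNIV (\<lambda>y. F y * (wt (- r) y * esum {m \<in> X. m i = y} (\<lambda>m. \<Prod>l\<in>L. wt (- s) (m l) * f l (m l))))"
    unfolding mult.assoc[symmetric] esum_cmult[symmetric] by (intro esum_cong) auto
  also have "\<dots> \<le> esum UNIV (\<lambda>y. F y * D)" by (intro esum_mono mult_left_mono inner) auto
  also have "\<dots> = esum UNIV F * D" by (rule esum_multc)
  finally have "(esum X (\<lambda>m. F (m i) * wt (- r) (m i) * (\<Prod>l\<in>L. wt (- s) (m l) * f l (m l))))\<^sup>2 \<le> (esum UNIV F * D)\<^sup>2"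
    by (intro power_mono) auto
  then show ?thesis by (simp add: power_mult_distrib D)
qed

text \<open>Let \<open>i\<close> be the largest and \<open>j\<close> the second largest variable,
  \<open>n\<close> the number of the others and \<open>D = d / 2\<close>; the hypothesis reads
  \<open>(n + 2) * s = n * D\<close>. Cauchy-Schwarz gives two sums, one with \<open>f i\<close>
  squared and one with \<open>f j\<close> squared. In the first, the weight of \<open>j\<close> is
  spread evenly over the smaller variables while \<open>i\<close> keeps \<open>s\<close>, and
  \<open>n * (D - s') = s\<close>. In the second, the weight of \<open>i\<close> is moved to
  \<open>j\<close>, and \<open>n * (D - s) = 2 * s\<close>. Both are the balance required by
  \<open>endpoint_half\<close>, with equality.\<close>

lemma bounded_form_endpoint:
  fixes \<epsilon> :: "'i \<Rightarrow> int"
  assumes I: "finite I" "card I \<ge> 3" "\<And>l. l \<in> I \<Longrightarrow> \<epsilon> l \<in> {1, -1}"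
    and s: "real (card I) * s = real (card I - 2) * (real CARD('d) / 2)"
  shows "bounded_form I I (lin \<epsilon> :: 'i \<Rightarrow> int ^ 'd \<Rightarrow> int ^ 'd) UNIV (\<lambda>m. \<Prod>l\<in>I. wt (- s) (m l))"
proof -
  define n where "n = card I - 2"
  have n1: "n \<ge> 1" "card I = n + 2" using I by (simp_all add: n_def)
  define D where "D = real CARD('d) / 2"
  have D0: "D > 0" by (simp add: D_def)
  have ns: "(real n + 2) * s = real n * D" using s n1 by (simp add: D_def add.commute)
  have s0: "s > 0" using ns n1 D0 by (metis mult_pos_pos of_nat_0_less_iff add_pos_pos less_le_trans zero_less_mult_pos zero_less_numeral zero_less_one)
  \<comment> \<open>The exponent of a small variable after it has received the share
    \<open>s / n\<close> of the weight of \<open>j\<close>.\<close>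
  define s' where "s' = s * (real n + 1) / real n"
  have ns': "real n * s' = (real n + 1) * s" using n1 by (simp add: s'_def)
  have s'D: "s' < D"
  proof -
    have "real n * s' < real n * D" using ns ns' s0 by (simp add: algebra_simps)
    then show ?thesis using n1 by simp
  qed
  have ss': "s \<le> s'" unfolding s'_def using s0 n1 by (simp add: field_simps)
  have sD: "s < D" using ss' s'D by linarith
  obtain K1 where K1: "K1 \<ge> 0" "\<And>A. A \<ge> 1 \<Longrightarrow> esum {x :: int ^ 'd. bracket x \<le> A} (wt (- 2 * s)) \<le> ennreal (K1 * A powr (real CARD('d) - 2 * s))"
    by (rule sum_wt_ball[of s, where 'd = 'd]) (use s0 sD in \<open>auto simp: D_def intro: that\<close>)
  obtain K2 where K2: "K2 \<ge> 0" "\<And>A. A \<ge> 1 \<Longrightarrow> esum {x :: int ^ 'd. bracket x \<le> A} (wt (- 2 * s')) \<le> ennreal (K2 * A powr (real CARD('d) - 2 * s'))"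
    by (rule sum_wt_ball[of s', where 'd = 'd]) (use s0 ss' s'D in \<open>auto simp: D_def intro: that\<close>)
  define R where "R i j = {m :: 'i \<Rightarrow> int ^ 'd. bracket (m j) \<le> bracket (m i) \<and> (\<forall>l\<in>I - {i, j}. bracket (m l) \<le> bracket (m j))}" for i j
  show ?thesis
  proof (rule bounded_form_mono1[where W' = "\<lambda>m. \<Sum>p\<in>{p \<in> I \<times> I. fst p \<noteq> snd p}. indicator (R (fst p) (snd p)) m * (\<Prod>l\<in>I. wt (- s) (m l))"])
    fix m :: "'i \<Rightarrow> int ^ 'd"
    obtain T where T: "T \<subseteq> I" "card T = 1" "\<forall>a\<in>T. \<forall>l\<in>I - T. bracket (m l) \<le> bracket (m a)"
      using obtain_top[of I 1 "\<lambda>l. bracket (m l)"] I by auto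
    obtain i where i: "T = {i}" using T(2) by (metis card_1_singletonE)
    have cI: "1 \<le> card (I - {i})" using I T i by simp
    obtain U where U: "U \<subseteq> I - {i}" "card U = 1" "\<forall>a\<in>U. \<forall>l\<in>I - {i} - U. bracket (m l) \<le> bracket (m a)"
      using obtain_top[OF _ cI, of "\<lambda>l. bracket (m l)"] I(1) by auto
    obtain j where j: "U = {j}" using U(2) by (metis card_1_singletonE)
    have "(i, j) \<in> {p \<in> I \<times> I. fst p \<noteq> snd p}" "m \<in> R i j" using T U i j by (auto simp: R_def)
    then have "(\<Prod>l\<in>I. wt (- s) (m l)) = indicator (R (fst (i, j)) (snd (i, j))) m * (\<Prod>l\<in>I. wt (- s) (m l))" by simp
    also have "\<dots> \<le> (\<Sum>p\<in>{p \<in> I \<times> I. fst p \<noteq> snd p}. indicator (R (fst p) (snd p)) m * (\<Prod>l\<in>I. wt (- s) (m l)))"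
      using \<open>(i, j) \<in> _\<close> I(1) by (intro member_le_sum[where f = "\<lambda>p. indicator (R (fst p) (snd p)) m * (\<Prod>l\<in>I. wt (- s) (m l))"]) auto
    finally show "(\<Prod>l\<in>I. wt (- s) (m l)) \<le> (\<Sum>p\<in>{p \<in> I \<times> I. fst p \<noteq> snd p}. indicator (R (fst p) (snd p)) m * (\<Prod>l\<in>I. wt (- s) (m l)))" .
  next
    show "bounded_form I I (lin \<epsilon> :: 'i \<Rightarrow> int ^ 'd \<Rightarrow> int ^ 'd) UNIV
       (\<lambda>m. \<Sum>p\<in>{p \<in> I \<times> I. fst p \<noteq> snd p}. indicator (R (fst p) (snd p)) m * (\<Prod>l\<in>I. wt (- s) (m l)))"
    proof (rule bounded_form_sum)
      show "finite {p \<in> I \<times> I. fst p \<noteq> snd p}" using I(1) by simp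
      fix p assume p: "p \<in> {p \<in> I \<times> I. fst p \<noteq> snd p}"
      define i where "i = fst p"
      define j where "j = snd p"
      have ij: "i \<in> I" "j \<in> I" "i \<noteq> j" using p by (auto simp: i_def j_def)
      define L where "L = I - {i, j}"
      have L: "finite L" "card L = n" "i \<notin> L" "j \<notin> L" "I = insert i (insert j L)"
        using I(1) ij n1 by (auto simp: L_def)
      show "bounded_form I I (lin \<epsilon> :: 'i \<Rightarrow> int ^ 'd \<Rightarrow> int ^ 'd) UNIV (\<lambda>m. indicator (R (fst p) (snd p)) m * (\<Prod>l\<in>I. wt (- s) (m l)))"
      proof (rule bounded_formI)
        define KK where "KK = ennreal (max K1 K2) ^ n"
        show "KK < top" by (simp add: KK_def power_less_top_ennreal)
        fix z and f :: "'i \<Rightarrow> int ^ 'd \<Rightarrow> ennreal"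
        define X where "X = XS I (lin \<epsilon>) z \<inter> R i j"
        have Xd: "m \<in> extensional I" "\<epsilon> i *s m i + (\<epsilon> j *s m j + (\<Sum>l\<in>L. \<epsilon> l *s m l)) = z" "m \<in> R i j" if "m \<in> X" for m
          using that L ij by (auto simp: X_def XS_def lin_def PiE_def)
        have det: "m = m'" if m: "m \<in> X" "m' \<in> X" "\<And>l. l \<in> L \<Longrightarrow> m l = m' l" "m i = m' i \<or> m j = m' j" for m m'
        proof -
          have "(\<Sum>l\<in>L. \<epsilon> l *s m l) = (\<Sum>l\<in>L. \<epsilon> l *s m' l)" using m(3) by (intro sum.cong) auto
          then have "\<epsilon> i *s m i + \<epsilon> j *s m j = \<epsilon> i *s m' i + \<epsilon> j *s m' j"
            using Xd(2)[OF m(1)] Xd(2)[OF m(2)] unfolding add.assoc[symmetric] by (metis add_right_cancel)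
          then have "m i = m' i \<and> m j = m' j"
            using m(4) I(3)[OF ij(1)] I(3)[OF ij(2)] by (auto simp: scale_sign_inj)
          then show ?thesis
            using m(3) Xd(1)[OF m(1)] Xd(1)[OF m(2)] L(5) by (intro extensionalityI[of m I]) auto
        qed
        \<comment> \<open>The functions of the small variables are split into square roots, so that
          both sums produced by Cauchy-Schwarz contain these functions to the first power.\<close>
        have "\<forall>l x. \<exists>y. y\<^sup>2 = f l x" using ennreal_ex_sqrt by blast
        then obtain h where h: "\<And>l x. (h l x)\<^sup>2 = f l x" by metis
        define V where "V m = wt (- s / 2) (m i) * wt (- s / 2) (m j) * (\<Prod>l\<in>L. wt (- s / 2) (m l) * h l (m l))" for m :: "'i \<Rightarrow> int ^ 'd"
        have V2: "(V m)\<^sup>2 = wt (- s) (m i) * wt (- s) (m j) * (\<Prod>l\<in>L. wt (- s) (m l) * f l (m l))" for m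
          by (simp add: V_def power_mult_distrib wt_power2 prod_power_distrib h)
        have half: "ennreal K ^ n * (\<Prod>l\<in>L. n2 (f l)) \<le> KK * (\<Prod>l\<in>L. n2 (f l))" if "K \<le> max K1 K2" for K
          unfolding KK_def using that by (intro mult_right_mono power_mono ennreal_leI) auto
        obtain E where E: "E\<^sup>2 = KK * (\<Prod>l\<in>L. n2 (f l))" using ennreal_ex_sqrt by blast
        have A1: "esum X (\<lambda>m. (f i (m i) * V m)\<^sup>2) \<le> n2 (f i) * E"
        proof (rule ennreal_power2_le_imp_le)
          have "esum X (\<lambda>m. (f i (m i) * V m)\<^sup>2) \<le> esum X (\<lambda>m. (f i (m i))\<^sup>2 * wt (- s) (m i) * (\<Prod>l\<in>L. wt (- s') (m l) * f l (m l)))"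
          proof (rule esum_mono)
            fix m assume m: "m \<in> X"
            have "bracket (m j) powr (- s) = (\<Prod>l\<in>L. bracket (m j) powr (- s / real n))"
              using n1 L by (simp add: powr_realpow[symmetric] powr_powr)
            also have "\<dots> \<le> (\<Prod>l\<in>L. bracket (m l) powr (- s / real n))"
              using Xd(3)[OF m] s0 by (intro prod_mono conjI powr_mono2') (auto simp: R_def L_def)
            finally have "wt (- s) (m j) \<le> (\<Prod>l\<in>L. wt (- s / real n) (m l))"
              unfolding prod_wt by (simp add: wt_def ennreal_leI)
            then have "wt (- s) (m j) * (\<Prod>l\<in>L. wt (- s) (m l) * f l (m l)) \<le> (\<Prod>l\<in>L. wt (- s / real n) (m l)) * (\<Prod>l\<in>L. wt (- s) (m l) * f l (m l))"
              by (rule mult_right_mono) simp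
            also have "\<dots> = (\<Prod>l\<in>L. wt (- s') (m l) * f l (m l))"
            proof -
              have "- s / real n + - s = - s'" using n1 by (simp add: s'_def field_simps)
              then show ?thesis by (simp add: prod.distrib[symmetric] mult.assoc[symmetric] wt_mult)
            qed
            finally have le: "wt (- s) (m j) * (\<Prod>l\<in>L. wt (- s) (m l) * f l (m l)) \<le> (\<Prod>l\<in>L. wt (- s') (m l) * f l (m l))" .
            have "(f i (m i) * V m)\<^sup>2 = (f i (m i))\<^sup>2 * wt (- s) (m i) * (wt (- s) (m j) * (\<Prod>l\<in>L. wt (- s) (m l) * f l (m l)))"
              by (simp only: power_mult_distrib V2 mult_ac)
            also have "\<dots> \<le> (f i (m i))\<^sup>2 * wt (- s) (m i) * (\<Prod>l\<in>L. wt (- s') (m l) * f l (m l))"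
              by (rule mult_left_mono[OF le]) simp
            finally show "(f i (m i) * V m)\<^sup>2 \<le> (f i (m i))\<^sup>2 * wt (- s) (m i) * (\<Prod>l\<in>L. wt (- s') (m l) * f l (m l))" .
          qed
          then have "(esum X (\<lambda>m. (f i (m i) * V m)\<^sup>2))\<^sup>2 \<le> (esum X (\<lambda>m. (f i (m i))\<^sup>2 * wt (- s) (m i) * (\<Prod>l\<in>L. wt (- s') (m l) * f l (m l))))\<^sup>2"
            by (intro power_mono) auto
          also have "\<dots> \<le> (n2 (f i))\<^sup>2 * (ennreal K2 ^ card L * (\<Prod>l\<in>L. n2 (f l)))"
          proof (rule endpoint_half[where F = "\<lambda>x. (f i x)\<^sup>2", OF L(1) _ _ _ _ _ K2, folded n2_def])
            show "s' \<ge> 0" "2 * s' < real CARD('d)" using s0 ss' s'D by (auto simp: D_def)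
            show "real (card L) * (real CARD('d) / 2 - s') \<le> s"
              unfolding L(2) D_def[symmetric] right_diff_distrib ns' ns[symmetric] by (simp add: algebra_simps)
            show "bracket (m l) \<le> bracket (m i)" if "m \<in> X" "l \<in> L" for m l
              using Xd(3)[OF that(1)] that(2) by (auto simp: R_def L_def intro: order_trans)
          qed (use det in blast)
          also have "\<dots> \<le> (n2 (f i) * E)\<^sup>2"
            unfolding power_mult_distrib E L(2) by (intro mult_left_mono half) auto
          finally show "(esum X (\<lambda>m. (f i (m i) * V m)\<^sup>2))\<^sup>2 \<le> (n2 (f i) * E)\<^sup>2" .
        qed
        have A2: "esum X (\<lambda>m. (f j (m j) * V m)\<^sup>2) \<le> n2 (f j) * E"
        proof (rule ennreal_power2_le_imp_le)
          have "esum X (\<lambda>m. (f j (m j) * V m)\<^sup>2) \<le> esum X (\<lambda>m. (f j (m j))\<^sup>2 * wt (- (2 * s)) (m j) * (\<Prod>l\<in>L. wt (- s) (m l) * f l (m l)))"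
          proof (rule esum_mono)
            fix m assume m: "m \<in> X"
            have "wt (- s) (m i) \<le> wt (- s) (m j)"
              unfolding wt_def using Xd(3)[OF m] s0 by (intro ennreal_leI powr_mono2') (auto simp: R_def)
            then have "wt (- s) (m i) * wt (- s) (m j) \<le> wt (- s) (m j) * wt (- s) (m j)" by (rule mult_right_mono) simp
            then have le: "wt (- s) (m i) * wt (- s) (m j) \<le> wt (- (2 * s)) (m j)" by (simp add: wt_mult)
            have "(f j (m j) * V m)\<^sup>2 = (f j (m j))\<^sup>2 * (wt (- s) (m i) * wt (- s) (m j)) * (\<Prod>l\<in>L. wt (- s) (m l) * f l (m l))"
              by (simp only: power_mult_distrib V2 mult_ac)
            also have "\<dots> \<le> (f j (m j))\<^sup>2 * wt (- (2 * s)) (m j) * (\<Prod>l\<in>L. wt (- s) (m l) * f l (m l))"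
              by (intro mult_right_mono mult_left_mono le) auto
            finally show "(f j (m j) * V m)\<^sup>2 \<le> (f j (m j))\<^sup>2 * wt (- (2 * s)) (m j) * (\<Prod>l\<in>L. wt (- s) (m l) * f l (m l))" .
          qed
          then have "(esum X (\<lambda>m. (f j (m j) * V m)\<^sup>2))\<^sup>2 \<le> (esum X (\<lambda>m. (f j (m j))\<^sup>2 * wt (- (2 * s)) (m j) * (\<Prod>l\<in>L. wt (- s) (m l) * f l (m l))))\<^sup>2"
            by (intro power_mono) auto
          also have "\<dots> \<le> (n2 (f j))\<^sup>2 * (ennreal K1 ^ card L * (\<Prod>l\<in>L. n2 (f l)))"
          proof (rule endpoint_half[where F = "\<lambda>x. (f j x)\<^sup>2", OF L(1) _ _ _ _ _ K1, folded n2_def])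
            show "s \<ge> 0" "2 * s < real CARD('d)" using s0 sD by (auto simp: D_def)
            show "real (card L) * (real CARD('d) / 2 - s) \<le> 2 * s"
              unfolding L(2) D_def[symmetric] right_diff_distrib ns[symmetric] by (simp add: algebra_simps)
            show "bracket (m l) \<le> bracket (m j)" if "m \<in> X" "l \<in> L" for m l
              using Xd(3)[OF that(1)] that(2) by (auto simp: R_def L_def)
          qed (use det in blast)
          also have "\<dots> \<le> (n2 (f j) * E)\<^sup>2"
            unfolding power_mult_distrib E L(2) by (intro mult_left_mono half) auto
          finally show "(esum X (\<lambda>m. (f j (m j) * V m)\<^sup>2))\<^sup>2 \<le> (n2 (f j) * E)\<^sup>2" .
        qed
        have "(\<Prod>l\<in>I. wt (- s) (m l)) * (\<Prod>l\<in>I. f l (m l)) = (f i (m i) * V m) * (f j (m j) * V m)" for m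
        proof -
          have "(f i (m i) * V m) * (f j (m j) * V m) = f i (m i) * f j (m j) * (V m)\<^sup>2"
            by (simp add: power2_eq_square mult_ac)
          then show ?thesis unfolding V2 L(5) using L(1,3,4) ij(3) by (simp add: prod.distrib mult_ac)
        qed
        then have "indicator (R (fst p) (snd p)) m * (\<Prod>l\<in>I. wt (- s) (m l)) * (\<Prod>l\<in>I. f l (m l))
            = (f i (m i) * V m) * (f j (m j) * V m) * indicator (R i j) m" for m
          unfolding mult.assoc[of "indicator _ _"] i_def[symmetric] j_def[symmetric] by (simp only: mult.commute)
        then have "(esum (XS I (lin \<epsilon>) z) (\<lambda>m. indicator (R (fst p) (snd p)) m * (\<Prod>l\<in>I. wt (- s) (m l)) * (\<Prod>l\<in>I. f l (m l))))\<^sup>2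
           = (esum X (\<lambda>m. (f i (m i) * V m) * (f j (m j) * V m)))\<^sup>2"
          unfolding X_def esum_indicator[symmetric] by (simp only:)
        also have "\<dots> \<le> esum X (\<lambda>m. (f i (m i) * V m)\<^sup>2) * esum X (\<lambda>m. (f j (m j) * V m)\<^sup>2)"
          by (rule esum_Cauchy_Schwarz)
        also have "\<dots> \<le> (n2 (f i) * E) * (n2 (f j) * E)" by (intro mult_mono A1 A2) auto
        also have "\<dots> = n2 (f i) * n2 (f j) * E\<^sup>2" by (simp add: power2_eq_square mult_ac)
        also have "\<dots> = KK * (\<Prod>l\<in>I. n2 (f l))"
          unfolding E L(5) using L(1,3,4) ij(3) by (simp add: mult_ac)
        finally show "(esum (XS I (lin \<epsilon>) z) (\<lambda>m. indicator (R (fst p) (snd p)) m * (\<Prod>l\<in>I. wt (- s) (m l)) * (\<Prod>l\<in>I. f l (m l))))\<^sup>2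
          \<le> KK * (\<Prod>l\<in>I. n2 (f l))" .
      qed
    qed
  qed simp
qed

section \<open>From multilinear forms to norm estimates\<close>

text \<open>The signs of \<open>altsum\<close>, extended to index 0. There the value is -1, so that
  the output becomes one more variable and the constraint a vanishing signed sum.\<close>

definition sg :: "nat \<Rightarrow> int" where
  "sg l = (-1) ^ (l + 1)"

lemma sg_cases: "sg l \<in> {1, -1}"
  unfolding sg_def by (cases "even l") auto

lemma sg_0 [simp]: "sg 0 = -1"
  by (simp add: sg_def)

lemma altsum_XS: "{m \<in> tuples k. altsum k m = n} = XS {1..2*k+1} (lin sg) n"
  by (simp add: XS_def tuples_def altsum_def lin_def sg_def)

lemma phase_iff: "phase k n m = of_int \<mu> \<longleftrightarrow> (\<Sum>l=1..2*k+1. sg l * sq (m l)) = sq n - \<mu>"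
proof -
  have "phase k n m = of_int (sq n - (\<Sum>l=1..2*k+1. sg l * sq (m l)))"
    unfolding phase_def zabs_sq by (simp add: sg_def sum_negf)
  then have "phase k n m = of_int \<mu> \<longleftrightarrow> sq n - (\<Sum>l=1..2*k+1. sg l * sq (m l)) = \<mu>"
    by (simp only: of_int_eq_iff)
  then show ?thesis by auto
qed

lemma phase_set_XS:
  fixes n :: "int ^ 'd"
  shows "XS {1..2*k+1} (lin sg) n \<inter> phase_set k \<mu> = XS {1..2*k+1} (phs sg) (n, sq n - \<mu>)"
proof -
  have "m \<in> XS {1..2*k+1} (lin sg) n \<inter> phase_set k \<mu> \<longleftrightarrow> m \<in> XS {1..2*k+1} (phs sg) (n, sq n - \<mu>)" for m :: "nat \<Rightarrow> int ^ 'd"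
  proof -
    have a: "m \<in> XS {1..2*k+1} (lin sg) n \<longleftrightarrow> m \<in> tuples k \<and> altsum k m = n"
      unfolding altsum_XS[symmetric] by simp
    have b: "m \<in> XS {1..2*k+1} (phs sg) (n, sq n - \<mu>) \<longleftrightarrow>
        m \<in> tuples k \<and> altsum k m = n \<and> (\<Sum>l=1..2*k+1. sg l * sq (m l)) = sq n - \<mu>"
      unfolding XS_phs_iff tuples_def altsum_def sg_def by simp
    show ?thesis unfolding a b Int_iff phase_set_def mem_Collect_eq phase_iff by auto
  qed
  then show ?thesis by blast
qed

text \<open>The multilinear sum with all moduli taken, hence always defined; its finiteness supplies
  the absolute convergence that \<open>converges\<close> demands.\<close>

definition habs :: "nat \<Rightarrow> (nat \<Rightarrow> int ^ 'd) set \<Rightarrow> (nat \<Rightarrow> int ^ 'd \<Rightarrow> ennreal) \<Rightarrow> int ^ 'd \<Rightarrow> ennreal" where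
  "habs k E f n = esum (XS {1..2*k+1} (lin sg) n) (\<lambda>m. indicator E m * (\<Prod>l=1..2*k+1. f l (m l)))"

abbreviation eabs :: "('a \<Rightarrow> complex) \<Rightarrow> 'a \<Rightarrow> ennreal" where
  "eabs \<omega> \<equiv> (\<lambda>x. ennreal (cmod (\<omega> x)))"

lemma norm_summand: "ennreal (norm (summand k E \<omega> m)) = indicator E m * (\<Prod>l=1..2*k+1. eabs (\<omega> l) (m l))"
proof -
  have "ennreal (norm (summand k E \<omega> m)) = ennreal (indicator E m) * ennreal (\<Prod>l=1..2*k+1. cmod (\<omega> l (m l)))"
    by (simp add: summand_def norm_mult prod_norm indicator_def)
  also have "ennreal (\<Prod>l=1..2*k+1. cmod (\<omega> l (m l))) = (\<Prod>l=1..2*k+1. eabs (\<omega> l) (m l))"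
    by (rule prod_ennreal[symmetric]) simp
  finally show ?thesis by (simp add: ennreal_indicator)
qed

lemma multisum_le_habs:
  assumes "habs k E (\<lambda>l. eabs (\<omega> l)) n < top"
  shows "(\<lambda>m. norm (summand k E \<omega> m)) summable_on {m \<in> tuples k. altsum k m = n}"
    and "ennreal (cmod (multisum k E \<omega> n)) \<le> habs k E (\<lambda>l. eabs (\<omega> l)) n"
proof -
  let ?X = "{m \<in> tuples k. altsum k m = n}"
  have h: "habs k E (\<lambda>l. eabs (\<omega> l)) n = esum ?X (\<lambda>m. ennreal (norm (summand k E \<omega> m)))"
    unfolding habs_def altsum_XS by (simp only: norm_summand)
  then have int: "integrable (count_space ?X) (summand k E \<omega>)"
    using assms by (intro integrableI_bounded) auto
  then have abs: "Infinite_Set_Sum.abs_summable_on (summand k E \<omega>) ?X"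
    unfolding Infinite_Set_Sum.abs_summable_on_def .
  then show s: "(\<lambda>m. norm (summand k E \<omega> m)) summable_on ?X"
    by (simp add: abs_summable_equivalent)
  have nabs: "Infinite_Set_Sum.abs_summable_on (\<lambda>m. norm (summand k E \<omega> m)) ?X"
    using abs by (rule abs_summable_on_norm_iff[THEN iffD2])
  have "multisum k E \<omega> n = infsetsum (summand k E \<omega>) ?X"
    unfolding multisum_def by (rule infsetsum_infsum[OF abs, symmetric])
  then have "cmod (multisum k E \<omega> n) \<le> infsetsum (\<lambda>m. norm (summand k E \<omega> m)) ?X"
    by (simp add: norm_infsetsum_bound)
  then have "ennreal (cmod (multisum k E \<omega> n)) \<le> ennreal (infsetsum (\<lambda>m. norm (summand k E \<omega> m)) ?X)"
    by (rule ennreal_leI)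
  also have "\<dots> = habs k E (\<lambda>l. eabs (\<omega> l)) n"
    unfolding h by (rule nn_integral_conv_infsetsum[OF nabs, symmetric]) simp
  finally show "ennreal (cmod (multisum k E \<omega> n)) \<le> habs k E (\<lambda>l. eabs (\<omega> l)) n" .
qed

section \<open>Duality and norms\<close>

lemma n2_mono: "(\<And>x. f x \<le> g x) \<Longrightarrow> n2 f \<le> n2 g"
  unfolding n2_def by (intro esum_mono power_mono) auto

lemma n2_point_le: "(f x)\<^sup>2 \<le> n2 f"
  unfolding n2_def using nn_integral_ge_point[of x UNIV "\<lambda>x. (f x)\<^sup>2"] by simp

lemma min_power2_ennreal: "(min x y)\<^sup>2 = min (x\<^sup>2) ((y::ennreal)\<^sup>2)"
proof (cases "x \<le> y")
  case True
  then have "x\<^sup>2 \<le> y\<^sup>2" by (intro power_mono) auto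
  then show ?thesis using True by (simp add: min_def)
next
  case False
  then have "y \<le> x" by simp
  then have "y\<^sup>2 \<le> x\<^sup>2" by (intro power_mono) auto
  then show ?thesis using \<open>y \<le> x\<close> by (simp add: min_absorb2)
qed

lemma ennreal_power2_le_mult: "S\<^sup>2 \<le> K * S \<Longrightarrow> S < top \<Longrightarrow> S \<le> (K::ennreal)"
proof (cases "S = 0")
  case False
  assume a: "S\<^sup>2 \<le> K * S" "S < top"
  obtain s where s: "S = ennreal s" "s > 0" using a(2) False by (cases S) auto
  show ?thesis
  proof (cases K)
    case (real k)
    then have "s * s \<le> k * s" using a(1) s by (simp add: power2_eq_square ennreal_mult[symmetric])
    then show ?thesis using s real by simp
  qed simp
qed simp

text \<open>Testing with \<open>H\<close> itself gives \<open>(n2 H)^2 \<le> K * n2 H\<close>, but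
  dividing requires \<open>n2 H\<close> to be finite. Therefore \<open>H\<close> is cut off in size
  and in support; the cut-off functions increase to \<open>H\<close>, and monotone convergence
  concludes.\<close>

lemma n2_le_dual:
  fixes H :: "int ^ 'd \<Rightarrow> ennreal"
  assumes K: "\<And>a. (esum UNIV (\<lambda>n. a n * H n))\<^sup>2 \<le> K * n2 a"
  shows "n2 H \<le> K"
proof -
  define b where "b N x = ennreal (sqrt (real N)) * indicator {x. bracket x \<le> real N} x" for N :: nat and x :: "int ^ 'd"
  define a where "a N x = min (H x) (b N x)" for N x
  have b2: "(b N x)\<^sup>2 = of_nat N * indicator {x. bracket x \<le> real N} x" for N x
    by (simp add: b_def power_mult_distrib ennreal_power indicator_def ennreal_of_nat_eq_real_of_nat)
  have a2: "(a N x)\<^sup>2 = min ((H x)\<^sup>2) ((b N x)\<^sup>2)" for N x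
    by (simp add: a_def min_power2_ennreal)
  have SUPb: "(SUP N. (b N x)\<^sup>2) = top" for x
  proof (rule ennreal_SUP_eq_top)
    fix n :: nat
    define N where "N = max n (nat \<lceil>bracket x\<rceil>)"
    have "bracket x \<le> real N" unfolding N_def by linarith
    then have "of_nat n \<le> (b N x)\<^sup>2" by (simp add: b2 N_def)
    then show "\<exists>i\<in>UNIV. of_nat n \<le> (b i x)\<^sup>2" by blast
  qed
  have "(SUP N. (a N x)\<^sup>2) = (H x)\<^sup>2" for x
  proof -
    have "(SUP N. (a N x)\<^sup>2) = inf ((H x)\<^sup>2) (SUP N. (b N x)\<^sup>2)"
      unfolding a2 inf_SUP by (simp add: inf_min)
    then show ?thesis by (simp add: SUPb)
  qed
  then have "n2 H = esum UNIV (\<lambda>x. SUP N. (a N x)\<^sup>2)" by (simp add: n2_def)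
  also have "\<dots> = (SUP N. n2 (a N))"
    unfolding n2_def
  proof (rule nn_integral_monotone_convergence_SUP)
    show "incseq (\<lambda>N x. (a N x)\<^sup>2)"
    proof (intro incseq_SucI le_funI)
      fix N x
      have "(b N x)\<^sup>2 \<le> (b (Suc N) x)\<^sup>2" unfolding b2 by (intro mult_mono) (auto simp: indicator_def)
      then show "(a N x)\<^sup>2 \<le> (a (Suc N) x)\<^sup>2" unfolding a2 by (intro min.mono) auto
    qed
  qed simp
  also have "\<dots> \<le> K"
  proof (rule SUP_least)
    fix N
    have "n2 (a N) \<le> esum UNIV (\<lambda>x :: int ^ 'd. of_nat N * indicator {x. bracket x \<le> real N} x)"
      unfolding n2_def a2 b2[symmetric] by (intro esum_mono) simp
    also have "\<dots> = esum {x :: int ^ 'd. bracket x \<le> real N} (\<lambda>_. of_nat N)"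
      by (simp only: esum_UNIV[of "{x :: int ^ 'd. bracket x \<le> real N}"])
    also have "\<dots> < top"
      by (simp add: nn_integral_count_space_finite finite_bracket_le ennreal_mult_less_top of_nat_less_top)
    finally have fin: "n2 (a N) < top" .
    have "n2 (a N) \<le> esum UNIV (\<lambda>n. a N n * H n)"
      unfolding n2_def power2_eq_square by (intro esum_mono mult_left_mono) (auto simp: a_def)
    then have "(n2 (a N))\<^sup>2 \<le> (esum UNIV (\<lambda>n. a N n * H n))\<^sup>2" by (intro power_mono) auto
    also have "\<dots> \<le> K * n2 (a N)" by (rule K)
    finally show "n2 (a N) \<le> K" using fin by (rule ennreal_power2_le_mult)
  qed
  finally show ?thesis .
qed

lemma bounded_form_dual:
  fixes \<phi> :: "nat \<Rightarrow> int ^ 'd \<Rightarrow> 'g::ab_group_add"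
  assumes "bounded_form {0..2*k+1} {0..2*k+1} \<phi> Z W"
  shows "\<exists>K<top. \<forall>z\<in>Z. \<forall>f. n2 (\<lambda>n. esum (XS {1..2*k+1} \<phi> (z - \<phi> 0 n)) (\<lambda>m. W (m(0 := n)) * (\<Prod>l=1..2*k+1. f l (m l))))
     \<le> K * (\<Prod>l=1..2*k+1. n2 (f l))"
proof -
  have I: "{0..2*k+1} = insert 0 {1..2*k+1}" by auto
  obtain K where K: "K < top" "\<And>z f. z \<in> Z \<Longrightarrow>
     (esum (XS {0..2*k+1} \<phi> z) (\<lambda>m. W m * (\<Prod>l\<in>{0..2*k+1}. f l (m l))))\<^sup>2 \<le> K * (\<Prod>l\<in>{0..2*k+1}. n2 (f l))"
    using assms unfolding bounded_form_def by blast
  show ?thesis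
  proof (intro exI[of _ K] conjI ballI allI)
    show "K < top" by (rule K)
    fix z and f :: "nat \<Rightarrow> int ^ 'd \<Rightarrow> ennreal" assume z: "z \<in> Z"
    show "n2 (\<lambda>n. esum (XS {1..2*k+1} \<phi> (z - \<phi> 0 n)) (\<lambda>m. W (m(0 := n)) * (\<Prod>l=1..2*k+1. f l (m l)))) \<le> K * (\<Prod>l=1..2*k+1. n2 (f l))"
    proof (rule n2_le_dual)
      fix a :: "int ^ 'd \<Rightarrow> ennreal"
      define g where "g = f(0 := a)"
      have gp: "(\<Prod>l=1..2*k+1. g l (m l)) = (\<Prod>l=1..2*k+1. f l (m l))" for m
        by (intro prod.cong) (auto simp: g_def)
      have gm: "(\<Prod>l=1..2*k+1. g l ((m(0 := x)) l)) = (\<Prod>l=1..2*k+1. f l (m l))" for m x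
        by (intro prod.cong) (auto simp: g_def)
      have gn: "(\<Prod>l=1..2*k+1. n2 (g l)) = (\<Prod>l=1..2*k+1. n2 (f l))"
        by (intro prod.cong) (auto simp: g_def)
      have "esum (XS {0..2*k+1} \<phi> z) (\<lambda>m. W m * (\<Prod>l\<in>{0..2*k+1}. g l (m l)))
        = esum UNIV (\<lambda>n. esum (XS {1..2*k+1} \<phi> (z - \<phi> 0 n)) (\<lambda>m. a n * (W (m(0 := n)) * (\<Prod>l=1..2*k+1. f l (m l)))))"
      proof -
        have fin: "finite {1..2*k+1}" "0 \<notin> {1..2*k+1}" by simp_all
        have "W (m(0 := n)) * (\<Prod>l\<in>insert 0 {1..2*k+1}. g l ((m(0 := n)) l))
            = a n * (W (m(0 := n)) * (\<Prod>l=1..2*k+1. f l (m l)))" for m n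
          unfolding prod.insert[OF fin] gm by (simp only: g_def fun_upd_same mult_ac)
        then show ?thesis unfolding I esum_XS_insert[OF fin] by (simp only:)
      qed
      also have "\<dots> = esum UNIV (\<lambda>n. a n * esum (XS {1..2*k+1} \<phi> (z - \<phi> 0 n)) (\<lambda>m. W (m(0 := n)) * (\<Prod>l=1..2*k+1. f l (m l))))"
        by (simp only: esum_cmult)
      finally have "(esum UNIV (\<lambda>n. a n * esum (XS {1..2*k+1} \<phi> (z - \<phi> 0 n)) (\<lambda>m. W (m(0 := n)) * (\<Prod>l=1..2*k+1. f l (m l)))))\<^sup>2
         \<le> K * (\<Prod>l\<in>{0..2*k+1}. n2 (g l))"
        using K(2)[OF z, of g] by (simp only:)
      also have "(\<Prod>l\<in>{0..2*k+1}. n2 (g l)) = (\<Prod>l=1..2*k+1. n2 (f l)) * n2 a"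
        unfolding I using gn by (simp add: g_def mult.commute)
      finally show "(esum UNIV (\<lambda>n. a n * esum (XS {1..2*k+1} \<phi> (z - \<phi> 0 n)) (\<lambda>m. W (m(0 := n)) * (\<Prod>l=1..2*k+1. f l (m l)))))\<^sup>2
         \<le> K * (\<Prod>l=1..2*k+1. n2 (f l)) * n2 a" by (simp only: mult.assoc)
    qed
  qed
qed

lemma lnorm_2: "(lnorm 2 s \<omega>)\<^sup>2 = n2 (\<lambda>x. wt s x * eabs \<omega> x)"
proof -
  have two: "enn2real 2 = 2" by simp
  define I where "I = (\<integral>\<^sup>+ n. ennreal ((bracket n powr s * cmod (\<omega> n)) powr 2) \<partial>count_space UNIV)"
  have I: "I = n2 (\<lambda>x. wt s x * eabs \<omega> x)"
    unfolding I_def n2_def by (intro esum_cong) (simp add: wt_def ennreal_mult[symmetric] ennreal_power)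
  have l: "lnorm 2 s \<omega> = (if I = top then top else ennreal (enn2real I powr (1/2)))"
    unfolding lnorm_def two Let_def I_def by simp
  show ?thesis
  proof (cases "I = top")
    case True
    then show ?thesis using I l by (simp add: power2_eq_square ennreal_top_mult)
  next
    case False
    then have "(lnorm 2 s \<omega>)\<^sup>2 = ennreal (enn2real I)"
      unfolding l by (simp add: ennreal_power powr_half_sqrt)
    also have "\<dots> = I" using False by (simp add: less_top)
    finally show ?thesis using I by simp
  qed
qed

lemma lnorm_inf: "lnorm top b \<omega> = (SUP n. wt b n * eabs \<omega> n)"
proof -
  have "ennreal (bracket n powr b * cmod (\<omega> n)) = wt b n * eabs \<omega> n" for n
    unfolding wt_def by (rule ennreal_mult) auto
  then show ?thesis unfolding lnorm_def by simp
qed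

lemma ennreal_ex_const:
  assumes "K < (top :: ennreal)"
  shows "\<exists>C>0. K \<le> (ennreal C)\<^sup>2"
proof -
  obtain r where r: "K = ennreal r" "r \<ge> 0" using assms by (cases K) auto
  have "r \<le> (sqrt r + 1)\<^sup>2" using r by (simp add: power2_eq_square algebra_simps)
  then have "K \<le> (ennreal (sqrt r + 1))\<^sup>2" using r by (simp add: ennreal_power del: ennreal_plus)
  moreover have "sqrt r + 1 > 0" using r by (simp add: add_nonneg_pos)
  ultimately show ?thesis by blast
qed

lemma lnorm_2_multisum:
  assumes b: "n2 (\<lambda>n. wt \<sigma> n * habs k E (\<lambda>l. eabs (\<omega> l)) n) \<le> R\<^sup>2" and R: "R < top"
  shows "converges k E \<omega>" "lnorm 2 \<sigma> (multisum k E \<omega>) \<le> R"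
proof -
  have fin: "habs k E (\<lambda>l. eabs (\<omega> l)) n < top" for n
  proof -
    have "(wt \<sigma> n * habs k E (\<lambda>l. eabs (\<omega> l)) n)\<^sup>2 \<le> R\<^sup>2"
      using n2_point_le[of "\<lambda>n. wt \<sigma> n * habs k E (\<lambda>l. eabs (\<omega> l)) n" n] b by (rule order_trans)
    then have "wt \<sigma> n * habs k E (\<lambda>l. eabs (\<omega> l)) n < top"
      using R by (meson ennreal_power2_le_imp_le le_less_trans)
    then show ?thesis by (auto simp: ennreal_mult_less_top)
  qed
  show "converges k E \<omega>" unfolding converges_def using multisum_le_habs(1)[OF fin] by blast
  have "(lnorm 2 \<sigma> (multisum k E \<omega>))\<^sup>2 \<le> R\<^sup>2"
    unfolding lnorm_2 by (rule order_trans[OF n2_mono b]) (intro mult_left_mono multisum_le_habs(2) fin, simp)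
  then show "lnorm 2 \<sigma> (multisum k E \<omega>) \<le> R" by (rule ennreal_power2_le_imp_le)
qed

lemma lnorm_inf_multisum:
  assumes b: "\<And>n. (wt b n * habs k E (\<lambda>l. eabs (\<omega> l)) n)\<^sup>2 \<le> R\<^sup>2" and R: "R < top"
  shows "converges k E \<omega>" "lnorm top b (multisum k E \<omega>) \<le> R"
proof -
  have le: "wt b n * habs k E (\<lambda>l. eabs (\<omega> l)) n \<le> R" for n using assms(1) by (rule ennreal_power2_le_imp_le)
  have fin: "habs k E (\<lambda>l. eabs (\<omega> l)) n < top" for n
  proof -
    have "wt b n * habs k E (\<lambda>l. eabs (\<omega> l)) n < top" using le R by (rule le_less_trans)
    then show ?thesis by (auto simp: ennreal_mult_less_top)
  qed
  show "converges k E \<omega>" unfolding converges_def using multisum_le_habs(1)[OF fin] by blast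
  show "lnorm top b (multisum k E \<omega>) \<le> R"
    unfolding lnorm_inf
  proof (rule SUP_least)
    fix n
    have "wt b n * eabs (multisum k E \<omega>) n \<le> wt b n * habs k E (\<lambda>l. eabs (\<omega> l)) n"
      by (intro mult_left_mono multisum_le_habs(2) fin) simp
    then show "wt b n * eabs (multisum k E \<omega>) n \<le> R" using le[of n] by (rule order_trans)
  qed
qed

section \<open>Estimates uniform over families of sets of tuples\<close>

text \<open>One constant serves all sets in \<open>\<E>\<close>; the families that occur run over
  \<mu> and over the admissible orders.\<close>

definition estimate :: "nat \<Rightarrow> (nat \<Rightarrow> int ^ 'd) set set \<Rightarrow> ((int ^ 'd \<Rightarrow> complex) \<Rightarrow> ennreal) \<Rightarrow>
    ((nat \<Rightarrow> int ^ 'd \<Rightarrow> complex) \<Rightarrow> ennreal) \<Rightarrow> bool" where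
  "estimate k \<E> N A \<longleftrightarrow> (\<exists>C>0. \<forall>E\<in>\<E>. \<forall>\<omega>. A \<omega> < top \<longrightarrow>
     converges k E \<omega> \<and> N (multisum k E \<omega>) \<le> ennreal C * A \<omega>)"

lemma estimateI:
  assumes "K < top"
    and "\<And>E \<omega> C. E \<in> \<E> \<Longrightarrow> C > 0 \<Longrightarrow> K \<le> (ennreal C)\<^sup>2 \<Longrightarrow> A \<omega> < top \<Longrightarrow>
      converges k E \<omega> \<and> N (multisum k E \<omega>) \<le> ennreal C * A \<omega>"
  shows "estimate k \<E> N A"
proof -
  obtain C where "C > 0" "K \<le> (ennreal C)\<^sup>2" using ennreal_ex_const[OF assms(1)] by blast
  then show ?thesis unfolding estimate_def using assms(2) by blast
qed

lemma estimate_mono: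
  assumes "estimate k \<E> N A" "\<E>' \<subseteq> \<E>" and le: "\<And>\<omega>. A \<omega> \<le> A' \<omega>"
  shows "estimate k \<E>' N A'"
proof -
  obtain C where C: "C > 0" "\<forall>E\<in>\<E>. \<forall>\<omega>. A \<omega> < top \<longrightarrow>
     converges k E \<omega> \<and> N (multisum k E \<omega>) \<le> ennreal C * A \<omega>"
    using assms(1) unfolding estimate_def by blast
  have "converges k E \<omega> \<and> N (multisum k E \<omega>) \<le> ennreal C * A' \<omega>" if "E \<in> \<E>'" "A' \<omega> < top" for E \<omega>
  proof -
    have "A \<omega> < top" using le[of \<omega>] that(2) by (rule le_less_trans)
    then have "converges k E \<omega>" "N (multisum k E \<omega>) \<le> ennreal C * A \<omega>" using C that assms(2) by blast+
    moreover have "ennreal C * A \<omega> \<le> ennreal C * A' \<omega>" by (rule mult_left_mono[OF le]) simp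
    ultimately show ?thesis by (meson order_trans)
  qed
  then show ?thesis unfolding estimate_def using C(1) by blast
qed

text \<open>The minimising index depends on \<open>\<omega>\<close>, so the constants of all indices
  are added.\<close>

lemma estimate_Min:
  assumes "finite Q" "Q \<noteq> {}" "\<And>q. q \<in> Q \<Longrightarrow> estimate k \<E> N (A q)"
  shows "estimate k \<E> N (\<lambda>\<omega>. MIN q\<in>Q. A q \<omega>)"
proof -
  have "\<forall>q\<in>Q. \<exists>C>0. \<forall>E\<in>\<E>. \<forall>\<omega>. A q \<omega> < top \<longrightarrow>
     converges k E \<omega> \<and> N (multisum k E \<omega>) \<le> ennreal C * A q \<omega>"
    using assms(3) unfolding estimate_def by blast
  from bchoice[OF this] obtain C where C: "\<And>q. q \<in> Q \<Longrightarrow> C q > 0"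
    "\<And>q E \<omega>. q \<in> Q \<Longrightarrow> E \<in> \<E> \<Longrightarrow> A q \<omega> < top \<Longrightarrow>
       converges k E \<omega> \<and> N (multisum k E \<omega>) \<le> ennreal (C q) * A q \<omega>" by blast
  define D where "D = sum C Q"
  have CD: "C q \<le> D" if "q \<in> Q" for q
    unfolding D_def using assms(1) that C(1) by (intro member_le_sum) (auto intro: less_imp_le)
  have D: "D > 0" unfolding D_def using assms(1,2) C(1) by (intro sum_pos) auto
  have "converges k E \<omega> \<and> N (multisum k E \<omega>) \<le> ennreal D * (MIN q\<in>Q. A q \<omega>)"
    if E: "E \<in> \<E>" and fin: "(MIN q\<in>Q. A q \<omega>) < top" for E \<omega>
  proof -
    have "(MIN q\<in>Q. A q \<omega>) \<in> (\<lambda>q. A q \<omega>) ` Q" using assms(1,2) by (intro Min_in) auto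
    then obtain q where q: "q \<in> Q" "(MIN q\<in>Q. A q \<omega>) = A q \<omega>" by blast
    have "converges k E \<omega>" "N (multisum k E \<omega>) \<le> ennreal (C q) * A q \<omega>"
      using C(2)[OF q(1) E] fin q(2) by auto
    moreover have "ennreal (C q) * A q \<omega> \<le> ennreal D * A q \<omega>"
      using CD[OF q(1)] by (intro mult_right_mono ennreal_leI) auto
    ultimately show ?thesis unfolding q(2) by (meson order_trans)
  qed
  then show ?thesis unfolding estimate_def using D by blast
qed

lemma prod_wt_cancel: "(\<Prod>l\<in>L. wt (- s l) (m l)) * (\<Prod>l\<in>L. wt (s l) (m l)) = 1"
  by (simp add: prod.distrib[symmetric] wt_mult)

text \<open>
  Here index \<open>0\<close> carries the output variable, so that the tuples in \<open>\<E>\<close> become tuples with index set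
  \<open>{0..2 * k + 1}\<close> and alternating sum zero.
\<close>

lemma estimate_l2:
  fixes \<phi> :: "nat \<Rightarrow> int ^ 'd \<Rightarrow> 'g::ab_group_add"
  assumes bf: "bounded_form {0..2*k+1} {0..2*k+1} \<phi> Z W"
    and \<E>: "\<And>E. E \<in> \<E> \<Longrightarrow> \<exists>z\<in>Z. \<forall>n m. m \<in> XS {1..2*k+1} (lin sg) n \<longrightarrow> m \<in> E \<longrightarrow>
       m \<in> XS {1..2*k+1} \<phi> (z - \<phi> 0 n) \<and> wt \<sigma> n \<le> W (m(0 := n)) * (\<Prod>l=1..2*k+1. wt (s l) (m l))"
  shows "estimate k \<E> (lnorm 2 \<sigma>) (\<lambda>\<omega>. \<Prod>l=1..2*k+1. lnorm 2 (s l) (\<omega> l))"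
proof -
  obtain K where K: "K < top" "\<And>z f. z \<in> Z \<Longrightarrow>
     n2 (\<lambda>n. esum (XS {1..2*k+1} \<phi> (z - \<phi> 0 n)) (\<lambda>m. W (m(0 := n)) * (\<Prod>l=1..2*k+1. f l (m l))))
     \<le> K * (\<Prod>l=1..2*k+1. n2 (f l))"
    using bounded_form_dual[OF bf] by blast
  show ?thesis
  proof (rule estimateI[OF K(1)])
    fix E :: "(nat \<Rightarrow> int ^ 'd) set" and \<omega> :: "nat \<Rightarrow> int ^ 'd \<Rightarrow> complex" and C :: real
    assume E: "E \<in> \<E>" and C: "C > 0" "K \<le> (ennreal C)\<^sup>2" and fin: "(\<Prod>l=1..2*k+1. lnorm 2 (s l) (\<omega> l)) < top"
    obtain z where z: "z \<in> Z" "\<And>n m. m \<in> XS {1..2*k+1} (lin sg) n \<Longrightarrow> m \<in> E \<Longrightarrow>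
       m \<in> XS {1..2*k+1} \<phi> (z - \<phi> 0 n) \<and> wt \<sigma> n \<le> W (m(0 := n)) * (\<Prod>l=1..2*k+1. wt (s l) (m l))"
      using \<E>[OF E] by blast
    define f where "f l x = wt (s l) x * eabs (\<omega> l) x" for l x
    define R where "R = ennreal C * (\<Prod>l=1..2*k+1. lnorm 2 (s l) (\<omega> l))"
    have "n2 (\<lambda>n. wt \<sigma> n * habs k E (\<lambda>l. eabs (\<omega> l)) n)
      \<le> n2 (\<lambda>n. esum (XS {1..2*k+1} \<phi> (z - \<phi> 0 n)) (\<lambda>m. W (m(0 := n)) * (\<Prod>l=1..2*k+1. f l (m l))))"
    proof (rule n2_mono)
      fix n
      let ?X = "XS {1..2*k+1} (lin sg) n :: (nat \<Rightarrow> int ^ 'd) set"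
      have "wt \<sigma> n * habs k E (\<lambda>l. eabs (\<omega> l)) n = esum ?X (\<lambda>m. (wt \<sigma> n * (\<Prod>l=1..2*k+1. eabs (\<omega> l) (m l))) * indicator E m)"
        unfolding habs_def esum_cmult[symmetric] by (simp only: mult_ac)
      also have "\<dots> = esum (?X \<inter> E) (\<lambda>m. wt \<sigma> n * (\<Prod>l=1..2*k+1. eabs (\<omega> l) (m l)))"
        by (rule esum_indicator)
      also have "\<dots> \<le> esum (?X \<inter> E) (\<lambda>m. W (m(0 := n)) * (\<Prod>l=1..2*k+1. f l (m l)))"
      proof (rule esum_mono)
        fix m assume "m \<in> ?X \<inter> E"
        then have "wt \<sigma> n * (\<Prod>l=1..2*k+1. eabs (\<omega> l) (m l))
           \<le> (W (m(0 := n)) * (\<Prod>l=1..2*k+1. wt (s l) (m l))) * (\<Prod>l=1..2*k+1. eabs (\<omega> l) (m l))"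
          using z(2) by (intro mult_right_mono) auto
        then show "wt \<sigma> n * (\<Prod>l=1..2*k+1. eabs (\<omega> l) (m l)) \<le> W (m(0 := n)) * (\<Prod>l=1..2*k+1. f l (m l))"
          unfolding f_def prod.distrib by (simp only: mult.assoc)
      qed
      also have "\<dots> \<le> esum (XS {1..2*k+1} \<phi> (z - \<phi> 0 n)) (\<lambda>m. W (m(0 := n)) * (\<Prod>l=1..2*k+1. f l (m l)))"
        using z(2) by (intro esum_subset) blast
      finally show "wt \<sigma> n * habs k E (\<lambda>l. eabs (\<omega> l)) n
        \<le> esum (XS {1..2*k+1} \<phi> (z - \<phi> 0 n)) (\<lambda>m. W (m(0 := n)) * (\<Prod>l=1..2*k+1. f l (m l)))" .
    qed
    also have "\<dots> \<le> K * (\<Prod>l=1..2*k+1. n2 (f l))" by (rule K(2)[OF z(1)])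
    also have "\<dots> \<le> (ennreal C)\<^sup>2 * (\<Prod>l=1..2*k+1. n2 (f l))" by (rule mult_right_mono[OF C(2)]) simp
    also have "\<dots> = R\<^sup>2"
      unfolding R_def power_mult_distrib prod_power_distrib lnorm_2 f_def ..
    finally have b: "n2 (\<lambda>n. wt \<sigma> n * habs k E (\<lambda>l. eabs (\<omega> l)) n) \<le> R\<^sup>2" .
    have "R < top" unfolding R_def using fin by (simp add: ennreal_mult_less_top)
    from lnorm_2_multisum[OF b this] show "converges k E \<omega> \<and> lnorm 2 \<sigma> (multisum k E \<omega>) \<le> ennreal C * (\<Prod>l=1..2*k+1. lnorm 2 (s l) (\<omega> l))"
      by (simp add: R_def)
  qed
qed

text \<open>The functions in \<open>P\<close> are measured in \<open>\<ell>^2\<close> through the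
  form, all others by their suprema \<open>B l\<close>. The output \<open>n\<close> is fixed, so the
  constraint value \<open>z\<close> may depend on it.\<close>

lemma habs_form_le:
  fixes \<phi> :: "nat \<Rightarrow> int ^ 'd \<Rightarrow> 'g::ab_group_add"
  assumes K: "\<And>z f. (esum (XS {1..2*k+1} \<phi> z) (\<lambda>m. W m * (\<Prod>l\<in>P. f l (m l))))\<^sup>2 \<le> K * (\<Prod>l\<in>P. n2 (f l))"
    and P: "P \<subseteq> {1..2*k+1}"
    and E: "\<And>m. m \<in> XS {1..2*k+1} (lin sg) n \<Longrightarrow> m \<in> E \<Longrightarrow>
       m \<in> XS {1..2*k+1} \<phi> z \<and> c \<le> W m * (\<Prod>l\<in>P. wt (s l) (m l))"
    and B: "\<And>l x. l \<in> {1..2*k+1} - P \<Longrightarrow> f l x \<le> B l"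
  shows "(c * habs k E f n)\<^sup>2 \<le> K * ((\<Prod>l\<in>{1..2*k+1} - P. (B l)\<^sup>2) * (\<Prod>l\<in>P. n2 (\<lambda>x. wt (s l) x * f l x)))"
proof -
  let ?X = "XS {1..2*k+1} (lin sg) n :: (nat \<Rightarrow> int ^ 'd) set"
  define g where "g l x = wt (s l) x * f l x" for l x
  define BB where "BB = (\<Prod>l\<in>{1..2*k+1} - P. B l)"
  have "c * habs k E f n = esum ?X (\<lambda>m. (c * (\<Prod>l=1..2*k+1. f l (m l))) * indicator E m)"
    unfolding habs_def esum_cmult[symmetric] by (simp only: mult_ac)
  also have "\<dots> = esum (?X \<inter> E) (\<lambda>m. c * (\<Prod>l=1..2*k+1. f l (m l)))"
    by (rule esum_indicator)
  also have "\<dots> \<le> esum (?X \<inter> E) (\<lambda>m. BB * (W m * (\<Prod>l\<in>P. g l (m l))))"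
  proof (rule esum_mono)
    fix m assume m: "m \<in> ?X \<inter> E"
    have "(\<Prod>l=1..2*k+1. f l (m l)) = (\<Prod>l\<in>{1..2*k+1} - P. f l (m l)) * (\<Prod>l\<in>P. f l (m l))"
      by (rule prod.subset_diff[OF P]) simp
    also have "\<dots> \<le> BB * (\<Prod>l\<in>P. f l (m l))"
      unfolding BB_def by (intro mult_right_mono prod_mono_ennreal B) auto
    finally have "c * (\<Prod>l=1..2*k+1. f l (m l)) \<le> (W m * (\<Prod>l\<in>P. wt (s l) (m l))) * (BB * (\<Prod>l\<in>P. f l (m l)))"
      using E m by (intro mult_mono) auto
    also have "\<dots> = BB * (W m * (\<Prod>l\<in>P. g l (m l)))"
      unfolding g_def prod.distrib by (simp only: mult_ac)
    finally show "c * (\<Prod>l=1..2*k+1. f l (m l)) \<le> BB * (W m * (\<Prod>l\<in>P. g l (m l)))" .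
  qed
  also have "\<dots> \<le> esum (XS {1..2*k+1} \<phi> z) (\<lambda>m. BB * (W m * (\<Prod>l\<in>P. g l (m l))))"
    using E by (intro esum_subset) blast
  also have "\<dots> = BB * esum (XS {1..2*k+1} \<phi> z) (\<lambda>m. W m * (\<Prod>l\<in>P. g l (m l)))" by (rule esum_cmult)
  finally have "(c * habs k E f n)\<^sup>2 \<le> (BB * esum (XS {1..2*k+1} \<phi> z) (\<lambda>m. W m * (\<Prod>l\<in>P. g l (m l))))\<^sup>2"
    by (intro power_mono) auto
  also have "\<dots> \<le> BB\<^sup>2 * (K * (\<Prod>l\<in>P. n2 (g l)))"
    unfolding power_mult_distrib by (intro mult_left_mono K) auto
  also have "\<dots> = K * ((\<Prod>l\<in>{1..2*k+1} - P. (B l)\<^sup>2) * (\<Prod>l\<in>P. n2 (g l)))"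
    unfolding BB_def prod_power_distrib by (simp only: mult_ac)
  finally show ?thesis unfolding g_def .
qed

lemma estimate_inf:
  fixes \<phi> :: "nat \<Rightarrow> int ^ 'd \<Rightarrow> 'g::ab_group_add"
  assumes bf: "bounded_form {1..2*k+1} ({1..2*k+1} - {q}) \<phi> UNIV W" and q: "q \<in> {1..2*k+1}"
    and \<E>: "\<And>E n. E \<in> \<E> \<Longrightarrow> \<exists>z. \<forall>m. m \<in> XS {1..2*k+1} (lin sg) n \<longrightarrow> m \<in> E \<longrightarrow>
       m \<in> XS {1..2*k+1} \<phi> z \<and> 1 \<le> W m * (\<Prod>l\<in>{1..2*k+1} - {q}. wt (s l) (m l))"
  shows "estimate k \<E> (lnorm top 0) (\<lambda>\<omega>. lnorm top 0 (\<omega> q) * (\<Prod>l\<in>{1..2*k+1} - {q}. lnorm 2 (s l) (\<omega> l)))"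
proof -
  let ?P = "{1..2*k+1} - {q}"
  obtain K where K: "K < top" "\<And>z f. (esum (XS {1..2*k+1} \<phi> z) (\<lambda>m. W m * (\<Prod>l\<in>?P. f l (m l))))\<^sup>2 \<le> K * (\<Prod>l\<in>?P. n2 (f l))"
    using bf unfolding bounded_form_def by blast
  show ?thesis
  proof (rule estimateI[OF K(1)])
    fix E :: "(nat \<Rightarrow> int ^ 'd) set" and \<omega> :: "nat \<Rightarrow> int ^ 'd \<Rightarrow> complex" and C :: real
    assume E: "E \<in> \<E>" and C: "C > 0" "K \<le> (ennreal C)\<^sup>2"
      and fin: "lnorm top 0 (\<omega> q) * (\<Prod>l\<in>?P. lnorm 2 (s l) (\<omega> l)) < top"
    define R where "R = ennreal C * (lnorm top 0 (\<omega> q) * (\<Prod>l\<in>?P. lnorm 2 (s l) (\<omega> l)))"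
    have Pq: "{1..2*k+1} - ?P = {q}" using q by auto
    have b: "(wt 0 n * habs k E (\<lambda>l. eabs (\<omega> l)) n)\<^sup>2 \<le> R\<^sup>2" for n
    proof -
      obtain z where z: "\<And>m. m \<in> XS {1..2*k+1} (lin sg) n \<Longrightarrow> m \<in> E \<Longrightarrow>
         m \<in> XS {1..2*k+1} \<phi> z \<and> 1 \<le> W m * (\<Prod>l\<in>?P. wt (s l) (m l))"
        using \<E>[OF E, of n] by blast
      have bnd: "eabs (\<omega> l) x \<le> lnorm top 0 (\<omega> l)" for l x
        unfolding lnorm_inf using SUP_upper[of x UNIV "\<lambda>n. wt 0 n * eabs (\<omega> l) n"] by simp
      have "(1 * habs k E (\<lambda>l. eabs (\<omega> l)) n)\<^sup>2
        \<le> K * ((\<Prod>l\<in>{1..2*k+1} - ?P. (lnorm top 0 (\<omega> l))\<^sup>2) * (\<Prod>l\<in>?P. n2 (\<lambda>x. wt (s l) x * eabs (\<omega> l) x)))"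
        by (rule habs_form_le[OF K(2) _ z bnd]) auto
      also have "\<dots> \<le> (ennreal C)\<^sup>2 * ((\<Prod>l\<in>{1..2*k+1} - ?P. (lnorm top 0 (\<omega> l))\<^sup>2) * (\<Prod>l\<in>?P. n2 (\<lambda>x. wt (s l) x * eabs (\<omega> l) x)))"
        by (rule mult_right_mono[OF C(2)]) simp
      also have "\<dots> = R\<^sup>2"
        unfolding R_def power_mult_distrib prod_power_distrib lnorm_2 Pq by simp
      finally show ?thesis by simp
    qed
    have "R < top" unfolding R_def using fin by (simp add: ennreal_mult_less_top)
    from lnorm_inf_multisum[OF b this]
    show "converges k E \<omega> \<and> lnorm top 0 (multisum k E \<omega>) \<le> ennreal C * (lnorm top 0 (\<omega> q) * (\<Prod>l\<in>?P. lnorm 2 (s l) (\<omega> l)))"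
      by (simp add: R_def)
  qed
qed

lemma estimate_inf_all:
  fixes \<phi> :: "nat \<Rightarrow> int ^ 'd \<Rightarrow> 'g::ab_group_add"
  assumes bf: "bounded_form {1..2*k+1} {1..2*k+1} \<phi> UNIV W"
    and \<E>: "\<And>E n. E \<in> \<E> \<Longrightarrow> \<exists>z. \<forall>m. m \<in> XS {1..2*k+1} (lin sg) n \<longrightarrow> m \<in> E \<longrightarrow>
       m \<in> XS {1..2*k+1} \<phi> z \<and> wt b n \<le> W m * (\<Prod>l\<in>{1..2*k+1}. wt (s l) (m l))"
  shows "estimate k \<E> (lnorm top b) (\<lambda>\<omega>. \<Prod>l=1..2*k+1. lnorm 2 (s l) (\<omega> l))"
proof -
  let ?P = "{1..2*k+1}"
  obtain K where K: "K < top" "\<And>z f. (esum (XS {1..2*k+1} \<phi> z) (\<lambda>m. W m * (\<Prod>l\<in>?P. f l (m l))))\<^sup>2 \<le> K * (\<Prod>l\<in>?P. n2 (f l))"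
    using bf unfolding bounded_form_def by blast
  show ?thesis
  proof (rule estimateI[OF K(1)])
    fix E :: "(nat \<Rightarrow> int ^ 'd) set" and \<omega> :: "nat \<Rightarrow> int ^ 'd \<Rightarrow> complex" and C :: real
    assume E: "E \<in> \<E>" and C: "C > 0" "K \<le> (ennreal C)\<^sup>2"
      and fin: "(\<Prod>l\<in>?P. lnorm 2 (s l) (\<omega> l)) < top"
    define R where "R = ennreal C * (\<Prod>l\<in>?P. lnorm 2 (s l) (\<omega> l))"
    have bb: "(wt b n * habs k E (\<lambda>l. eabs (\<omega> l)) n)\<^sup>2 \<le> R\<^sup>2" for n
    proof -
      obtain z where z: "\<And>m. m \<in> XS {1..2*k+1} (lin sg) n \<Longrightarrow> m \<in> E \<Longrightarrow>
         m \<in> XS {1..2*k+1} \<phi> z \<and> wt b n \<le> W m * (\<Prod>l\<in>?P. wt (s l) (m l))"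
        using \<E>[OF E, of n] by blast
      have "(wt b n * habs k E (\<lambda>l. eabs (\<omega> l)) n)\<^sup>2
        \<le> K * ((\<Prod>l\<in>?P - ?P. (0 :: ennreal)\<^sup>2) * (\<Prod>l\<in>?P. n2 (\<lambda>x. wt (s l) x * eabs (\<omega> l) x)))"
        by (rule habs_form_le[OF K(2) _ z]) auto
      also have "\<dots> \<le> (ennreal C)\<^sup>2 * ((\<Prod>l\<in>?P - ?P. (0 :: ennreal)\<^sup>2) * (\<Prod>l\<in>?P. n2 (\<lambda>x. wt (s l) x * eabs (\<omega> l) x)))"
        by (rule mult_right_mono[OF C(2)]) simp
      also have "\<dots> = R\<^sup>2"
        unfolding R_def power_mult_distrib prod_power_distrib lnorm_2 by simp
      finally show ?thesis .
    qed
    have "R < top" unfolding R_def using fin by (simp add: ennreal_mult_less_top)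
    from lnorm_inf_multisum[OF bb this]
    show "converges k E \<omega> \<and> lnorm top b (multisum k E \<omega>) \<le> ennreal C * (\<Prod>l\<in>?P. lnorm 2 (s l) (\<omega> l))"
      by (simp add: R_def)
  qed
qed

lemma lnorm_2_mono: "s \<le> t \<Longrightarrow> lnorm 2 s \<omega> \<le> lnorm 2 t \<omega>"
  by (rule ennreal_power2_le_imp_le) (auto simp: lnorm_2 intro!: n2_mono mult_right_mono wt_mono)

lemma lin_XS_0:
  assumes "m \<in> XS {1..2*k+1} (lin sg) n"
  shows "(\<Sum>l\<in>{0..2*k+1}. sg l *s (m(0 := n)) l) = (0 :: int ^ 'd)"
proof -
  have I: "{0..2*k+1} = insert 0 {1..2*k+1}" by auto
  have "(\<Sum>l\<in>{1..2*k+1}. sg l *s (m(0 := n)) l) = (\<Sum>l\<in>{1..2*k+1}. sg l *s m l)"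
    by (intro sum.cong) auto
  also have "\<dots> = n" using assms by (simp add: XS_def lin_def)
  finally have 1: "(\<Sum>l\<in>{1..2*k+1}. sg l *s (m(0 := n)) l) = n" .
  have "(\<Sum>l\<in>{0..2*k+1}. sg l *s (m(0 := n)) l) = sg 0 *s (m(0 := n)) 0 + (\<Sum>l\<in>{1..2*k+1}. sg l *s (m(0 := n)) l)"
    unfolding I by (rule sum.insert) auto
  also have "\<dots> = - n + n" unfolding 1 by (simp add: vec_eq_iff)
  finally show ?thesis by simp
qed

lemma transfer_weight:
  fixes m :: "nat \<Rightarrow> int ^ 'd"
  assumes q: "q \<in> {1..2*k+1}" and s: "s q = - c" "\<And>l. l \<in> {1..2*k+1} - {q} \<Longrightarrow> s l = t"
  shows "wt (- c) n \<le> wt c ((m(0 := n)) q) * wt (- c) ((m(0 := n)) 0) * (\<Prod>l\<in>{0..2*k+1} - {q, 0}. wt (- t) ((m(0 := n)) l))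
     * (\<Prod>l=1..2*k+1. wt (s l) (m l))"
proof -
  have I: "{0..2*k+1} - {q, 0} = {1..2*k+1} - {q}" by auto
  have 1: "(\<Prod>l\<in>{1..2*k+1} - {q}. wt (- t) ((m(0 := n)) l)) = (\<Prod>l\<in>{1..2*k+1} - {q}. wt (- t) (m l))"
    by (intro prod.cong) auto
  have "(\<Prod>l=1..2*k+1. wt (s l) (m l)) = wt (s q) (m q) * (\<Prod>l\<in>{1..2*k+1} - {q}. wt (s l) (m l))"
    using q by (intro prod.remove) auto
  also have "(\<Prod>l\<in>{1..2*k+1} - {q}. wt (s l) (m l)) = (\<Prod>l\<in>{1..2*k+1} - {q}. wt t (m l))"
    using s(2) by (intro prod.cong) auto
  finally have 2: "(\<Prod>l=1..2*k+1. wt (s l) (m l)) = wt (- c) (m q) * (\<Prod>l\<in>{1..2*k+1} - {q}. wt t (m l))" by (simp only: s(1))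
  have "wt c (m q) * wt (- c) n * (\<Prod>l\<in>{1..2*k+1} - {q}. wt (- t) (m l)) * (wt (- c) (m q) * (\<Prod>l\<in>{1..2*k+1} - {q}. wt t (m l)))
     = (wt c (m q) * wt (- c) (m q)) * wt (- c) n * ((\<Prod>l\<in>{1..2*k+1} - {q}. wt (- t) (m l)) * (\<Prod>l\<in>{1..2*k+1} - {q}. wt t (m l)))"
    by (simp only: mult_ac)
  also have "\<dots> = wt (- c) n" unfolding prod_wt_cancel wt_mult by simp
  finally have 3: "wt c (m q) * wt (- c) n * (\<Prod>l\<in>{1..2*k+1} - {q}. wt (- t) (m l)) * (wt (- c) (m q) * (\<Prod>l\<in>{1..2*k+1} - {q}. wt t (m l))) = wt (- c) n" .
  have "q \<noteq> 0" using q by auto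
  then show ?thesis unfolding I 1 2 by (simp only: fun_upd_other fun_upd_same 3 not_False_eq_True)
qed

text \<open>The parameter \<open>p\<close> is the index whose norm has the exponent \<open>- c\<close>; \<open>p = 0\<close> is the output.\<close>

lemma estimate_transfer:
  fixes \<phi> :: "nat \<Rightarrow> int ^ 'd \<Rightarrow> 'g::ab_group_add"
  assumes q: "q \<in> {1..2*k+1}" and c: "0 \<le> c" "c \<le> t"
    and Z: "\<And>z m. z \<in> Z \<Longrightarrow> m \<in> XS {0..2*k+1} \<phi> z \<Longrightarrow> (\<Sum>l\<in>{0..2*k+1}. sg l *s m l) = 0"
    and b: "\<And>i j. i \<in> {0..2*k+1} \<Longrightarrow> j \<in> {0..2*k+1} \<Longrightarrow> i \<noteq> j \<Longrightarrow>
      bounded_form {0..2*k+1} {0..2*k+1} \<phi> UNIV (\<lambda>m. \<Prod>l\<in>{0..2*k+1} - {i, j}. wt (- t) (m l))"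
    and \<E>: "\<And>E. E \<in> \<E> \<Longrightarrow> \<exists>z\<in>Z. \<forall>n m. m \<in> XS {1..2*k+1} (lin sg) n \<longrightarrow> m \<in> E \<longrightarrow> m \<in> XS {1..2*k+1} \<phi> (z - \<phi> 0 n)"
  shows "estimate k \<E> (lnorm 2 (- c)) (\<lambda>\<omega>. lnorm 2 (- c) (\<omega> q) * (\<Prod>l\<in>{1..2*k+1} - {q}. lnorm 2 t (\<omega> l)))"
    and "estimate k \<E> (lnorm 2 t) (\<lambda>\<omega>. \<Prod>l=1..2*k+1. lnorm 2 t (\<omega> l))"
proof -
  define s where "s l = (if l = q then - c else t)" for l
  have tr: "bounded_form {0..2*k+1} {0..2*k+1} \<phi> Z (\<lambda>m. wt c' (m p) * wt (- c') (m i) * (\<Prod>l\<in>{0..2*k+1} - {p, i}. wt (- t) (m l)))"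
    if "p \<in> {0..2*k+1}" "i \<in> {0..2*k+1}" "p \<noteq> i" "0 \<le> c'" "c' \<le> t" for p i c'
    by (rule bounded_form_transfer[where \<epsilon> = sg]) (use that sg_cases Z b in auto)
  \<comment> \<open>Measuring \<open>\<omega> q\<close> with the exponent \<open>- c\<close> leaves
    a growing weight at \<open>q\<close>; the output norm contributes the decaying weight at index
    0.\<close>
  have "estimate k \<E> (lnorm 2 (- c)) (\<lambda>\<omega>. \<Prod>l=1..2*k+1. lnorm 2 (s l) (\<omega> l))"
  proof (rule estimate_l2[OF tr[of q 0 c]])
    fix E assume E: "E \<in> \<E>"
    have "wt (- c) n \<le> wt c ((m(0 := n)) q) * wt (- c) ((m(0 := n)) 0) * (\<Prod>l\<in>{0..2*k+1} - {q, 0}. wt (- t) ((m(0 := n)) l))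
         * (\<Prod>l=1..2*k+1. wt (s l) (m l))" for n and m :: "nat \<Rightarrow> int ^ 'd"
      by (rule transfer_weight[OF q]) (simp_all add: s_def)
    then show "\<exists>z\<in>Z. \<forall>n m. m \<in> XS {1..2*k+1} (lin sg) n \<longrightarrow> m \<in> E \<longrightarrow> m \<in> XS {1..2*k+1} \<phi> (z - \<phi> 0 n) \<and>
       wt (- c) n \<le> wt c ((m(0 := n)) q) * wt (- c) ((m(0 := n)) 0) * (\<Prod>l\<in>{0..2*k+1} - {q, 0}. wt (- t) ((m(0 := n)) l))
         * (\<Prod>l=1..2*k+1. wt (s l) (m l))"
      using \<E>[OF E] by blast
  qed (use q c in auto)
  moreover have "(\<Prod>l=1..2*k+1. lnorm 2 (s l) (\<omega> l)) = lnorm 2 (- c) (\<omega> q) * (\<Prod>l\<in>{1..2*k+1} - {q}. lnorm 2 t (\<omega> l))"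
    for \<omega> :: "nat \<Rightarrow> int ^ 'd \<Rightarrow> complex"
  proof -
    have "(\<Prod>l=1..2*k+1. lnorm 2 (s l) (\<omega> l)) = lnorm 2 (s q) (\<omega> q) * (\<Prod>l\<in>{1..2*k+1} - {q}. lnorm 2 (s l) (\<omega> l))"
      using q by (intro prod.remove) auto
    also have "(\<Prod>l\<in>{1..2*k+1} - {q}. lnorm 2 (s l) (\<omega> l)) = (\<Prod>l\<in>{1..2*k+1} - {q}. lnorm 2 t (\<omega> l))"
      by (intro prod.cong) (auto simp: s_def)
    finally show ?thesis by (simp add: s_def)
  qed
  ultimately show "estimate k \<E> (lnorm 2 (- c)) (\<lambda>\<omega>. lnorm 2 (- c) (\<omega> q) * (\<Prod>l\<in>{1..2*k+1} - {q}. lnorm 2 t (\<omega> l)))"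
    by simp
  \<comment> \<open>Here the output carries the growing weight, so the transfer starts from index 0
    with the full exponent \<open>t\<close>, and any input can play the part of
    \<open>i\<close>.\<close>
  show "estimate k \<E> (lnorm 2 t) (\<lambda>\<omega>. \<Prod>l=1..2*k+1. lnorm 2 t (\<omega> l))"
  proof (rule estimate_l2[OF tr[of 0 q t]])
    fix E assume E: "E \<in> \<E>"
    have w: "wt t n \<le> wt t ((m(0 := n)) 0) * wt (- t) ((m(0 := n)) q) * (\<Prod>l\<in>{0..2*k+1} - {0, q}. wt (- t) ((m(0 := n)) l))
         * (\<Prod>l=1..2*k+1. wt t (m l))" for n and m :: "nat \<Rightarrow> int ^ 'd"
    proof -
      have I: "{0..2*k+1} - {0, q} = {1..2*k+1} - {q}" by auto
      have "wt (- t) ((m(0 := n)) q) * (\<Prod>l\<in>{1..2*k+1} - {q}. wt (- t) ((m(0 := n)) l)) = (\<Prod>l\<in>{1..2*k+1}. wt (- t) ((m(0 := n)) l))"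
        using q by (intro prod.remove[symmetric]) auto
      also have "\<dots> = (\<Prod>l\<in>{1..2*k+1}. wt (- t) (m l))" by (intro prod.cong) auto
      finally have "wt t ((m(0 := n)) 0) * wt (- t) ((m(0 := n)) q) * (\<Prod>l\<in>{0..2*k+1} - {0, q}. wt (- t) ((m(0 := n)) l))
         * (\<Prod>l=1..2*k+1. wt t (m l)) = wt t n * ((\<Prod>l=1..2*k+1. wt (- t) (m l)) * (\<Prod>l=1..2*k+1. wt t (m l)))"
        unfolding I by (simp only: fun_upd_same mult.assoc)
      then show ?thesis unfolding prod_wt_cancel by simp
    qed
    show "\<exists>z\<in>Z. \<forall>n m. m \<in> XS {1..2*k+1} (lin sg) n \<longrightarrow> m \<in> E \<longrightarrow> m \<in> XS {1..2*k+1} \<phi> (z - \<phi> 0 n) \<and>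
       wt t n \<le> wt t ((m(0 := n)) 0) * wt (- t) ((m(0 := n)) q) * (\<Prod>l\<in>{0..2*k+1} - {0, q}. wt (- t) ((m(0 := n)) l))
         * (\<Prod>l=1..2*k+1. wt t (m l))"
      using \<E>[OF E] w by blast
  qed (use q c in auto)
qed

lemma estimate_transfer_phs:
  assumes q: "q \<in> {1..2*k+1}" and c: "0 \<le> c" "c \<le> t" and k: "k \<ge> 1" "(CARD('d), k) \<noteq> (1, 1)" and t: "t > s_crit CARD('d) k"
    and \<E>: "\<And>E :: (nat \<Rightarrow> int ^ 'd) set. E \<in> \<E> \<Longrightarrow> \<exists>\<mu>. E \<subseteq> phase_set k \<mu>"
  shows "estimate k \<E> (lnorm 2 (- c)) (\<lambda>\<omega>. lnorm 2 (- c) (\<omega> q) * (\<Prod>l\<in>{1..2*k+1} - {q}. lnorm 2 t (\<omega> l)))"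
    and "estimate k \<E> (lnorm 2 t) (\<lambda>\<omega>. \<Prod>l=1..2*k+1. lnorm 2 t (\<omega> l))"
proof -
  have Z: "(\<Sum>l\<in>{0..2*k+1}. sg l *s m l) = 0" if "z \<in> {0} \<times> UNIV" "m \<in> XS {0..2*k+1} (phs sg) z" for z and m :: "nat \<Rightarrow> int ^ 'd"
    using that unfolding XS_phs_iff by auto
  have b: "bounded_form {0..2*k+1} {0..2*k+1} (phs sg :: nat \<Rightarrow> int ^ 'd \<Rightarrow> _) UNIV (\<lambda>m. \<Prod>l\<in>{0..2*k+1} - {i, j}. wt (- t) (m l))"
    if "i \<in> {0..2*k+1}" "j \<in> {0..2*k+1}" "i \<noteq> j" for i j
    by (rule bounded_form_phs[where k = k]) (use that k t sg_cases in auto)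
  have E: "\<exists>z\<in>{0} \<times> UNIV. \<forall>n m. m \<in> XS {1..2*k+1} (lin sg) n \<longrightarrow> m \<in> E \<longrightarrow> m \<in> XS {1..2*k+1} (phs sg) (z - phs sg 0 n)"
    if EE: "E \<in> \<E>" for E
  proof -
    obtain \<mu> where \<mu>: "E \<subseteq> phase_set k \<mu>" using \<E>[OF EE] by blast
    \<comment> \<open>With the output as variable 0 of sign -1 the phase is minus the signed sum of
      squares, hence \<open>- \<mu>\<close>.\<close>
    have "(0, - \<mu>) - phs sg 0 n = (n, sq n - \<mu>)" for n :: "int ^ 'd"
      by (simp add: phs_def vec_eq_iff)
    then have "\<forall>n m. m \<in> XS {1..2*k+1} (lin sg) n \<longrightarrow> m \<in> E \<longrightarrow> m \<in> XS {1..2*k+1} (phs sg) ((0, - \<mu>) - phs sg 0 n)"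
      using \<mu> by (auto simp only: phase_set_XS[symmetric])
    then show ?thesis by (intro bexI[of _ "(0, - \<mu>)"]) auto
  qed
  show "estimate k \<E> (lnorm 2 (- c)) (\<lambda>\<omega>. lnorm 2 (- c) (\<omega> q) * (\<Prod>l\<in>{1..2*k+1} - {q}. lnorm 2 t (\<omega> l)))"
    by (rule estimate_transfer(1)[OF q c Z b E])
  show "estimate k \<E> (lnorm 2 t) (\<lambda>\<omega>. \<Prod>l=1..2*k+1. lnorm 2 t (\<omega> l))"
    by (rule estimate_transfer(2)[OF q c Z b E])
qed

section \<open>Estimates without restriction on the phase\<close>

lemma lin_0_minus: "0 - lin sg 0 n = (n :: int ^ 'd)"
  by (simp add: lin_def vec_eq_iff)

lemma estimate_transfer_lin:
  assumes q: "q \<in> {1..2*k+1}" and c: "0 \<le> c" "c \<le> t" and t: "2 * t > real CARD('d)"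
  shows "estimate k (UNIV :: (nat \<Rightarrow> int ^ 'd) set set) (lnorm 2 (- c)) (\<lambda>\<omega>. lnorm 2 (- c) (\<omega> q) * (\<Prod>l\<in>{1..2*k+1} - {q}. lnorm 2 t (\<omega> l)))"
    and "estimate k (UNIV :: (nat \<Rightarrow> int ^ 'd) set set) (lnorm 2 t) (\<lambda>\<omega>. \<Prod>l=1..2*k+1. lnorm 2 t (\<omega> l))"
proof -
  have Z: "(\<Sum>l\<in>{0..2*k+1}. sg l *s m l) = 0" if "z \<in> {0}" "m \<in> XS {0..2*k+1} (lin sg) z" for z and m :: "nat \<Rightarrow> int ^ 'd"
    using that by (simp add: XS_def lin_def)
  have b: "bounded_form {0..2*k+1} {0..2*k+1} (lin sg :: nat \<Rightarrow> int ^ 'd \<Rightarrow> _) UNIV (\<lambda>m. \<Prod>l\<in>{0..2*k+1} - {i, j}. wt (- t) (m l))"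
    if "i \<in> {0..2*k+1}" "j \<in> {0..2*k+1}" "i \<noteq> j" for i j
    by (rule bounded_form_lin) (use that t sg_cases in auto)
  have E: "\<exists>z\<in>{0}. \<forall>n m. m \<in> XS {1..2*k+1} (lin sg) n \<longrightarrow> m \<in> E \<longrightarrow> m \<in> XS {1..2*k+1} (lin sg) (z - lin sg 0 n)"
    for E :: "(nat \<Rightarrow> int ^ 'd) set" unfolding bex_simps lin_0_minus by (simp add: lin_0_minus)
  show "estimate k (UNIV :: (nat \<Rightarrow> int ^ 'd) set set) (lnorm 2 (- c)) (\<lambda>\<omega>. lnorm 2 (- c) (\<omega> q) * (\<Prod>l\<in>{1..2*k+1} - {q}. lnorm 2 t (\<omega> l)))"
    by (rule estimate_transfer(1)[OF q c Z b E])
  show "estimate k (UNIV :: (nat \<Rightarrow> int ^ 'd) set set) (lnorm 2 t) (\<lambda>\<omega>. \<Prod>l=1..2*k+1. lnorm 2 t (\<omega> l))"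
    by (rule estimate_transfer(2)[OF q c Z b E])
qed

lemma wt_ge_1: "0 \<le> s \<Longrightarrow> 1 \<le> wt s x"
  using wt_mono[of 0 s x] by simp

lemma estimate_empty:
  "estimate k {{}} (lnorm 2 \<sigma>) (\<lambda>\<omega>. \<Prod>l=1..2*k+1. lnorm 2 (s l) (\<omega> l :: int ^ 'd \<Rightarrow> complex))"
proof (rule estimate_l2[where \<phi> = "lin sg" and Z = "{0}" and W = "\<lambda>_. 0"])
  show "bounded_form {0..2*k+1} {0..2*k+1} (lin sg :: nat \<Rightarrow> int ^ 'd \<Rightarrow> int ^ 'd) {0} (\<lambda>_. 0)"
    by (rule bounded_formI[where K = 0]) auto
qed auto

text \<open>The balance for \<open>2 * k + 2\<close> variables: all but two need the exponent
  \<open>\<beta>\<close>, the output offers \<open>a\<close> and each input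
  \<open>s\<close>.\<close>

lemma estimate_lin_weights:
  fixes a s \<beta> :: real
  assumes "2 * \<beta> > real CARD('d)" "0 \<le> a" "a \<le> \<beta>" "0 \<le> s" "s \<le> \<beta>" "real (2 * k) * \<beta> \<le> a + real (2 * k + 1) * s"
  shows "estimate k (UNIV :: (nat \<Rightarrow> int ^ 'd) set set) (lnorm 2 (- a)) (\<lambda>\<omega>. \<Prod>l=1..2*k+1. lnorm 2 s (\<omega> l))"
proof (rule estimate_l2)
  define \<alpha> where "\<alpha> l = (if l = (0::nat) then a else s)" for l
  have I: "{0..2*k+1} = insert 0 {1..2*k+1}" by auto
  show "bounded_form {0..2*k+1} {0..2*k+1} (lin sg :: nat \<Rightarrow> int ^ 'd \<Rightarrow> int ^ 'd) UNIV (\<lambda>m. \<Prod>l\<in>{0..2*k+1}. wt (- \<alpha> l) (m l))"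
  proof (rule bounded_form_lin_weights[OF _ _ _ assms(1)])
    have "(\<Sum>l\<in>{1..2*k+1}. \<alpha> l) = (\<Sum>l\<in>{1..2*k+1}. s)" by (intro sum.cong) (auto simp: \<alpha>_def)
    then have "(\<Sum>l\<in>{0..2*k+1}. \<alpha> l) = a + real (2 * k + 1) * s" unfolding I by (simp add: \<alpha>_def)
    then show "real (card {0..2*k+1} - 2) * \<beta> \<le> (\<Sum>l\<in>{0..2*k+1}. \<alpha> l)" using assms(6) by simp
  qed (use assms sg_cases in \<open>auto simp: \<alpha>_def\<close>)
  fix E :: "(nat \<Rightarrow> int ^ 'd) set"
  have w: "wt (- a) n \<le> (\<Prod>l\<in>{0..2*k+1}. wt (- \<alpha> l) ((m(0 := n)) l)) * (\<Prod>l=1..2*k+1. wt s (m l))" for n and m :: "nat \<Rightarrow> int ^ 'd"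
  proof -
    have "(\<Prod>l\<in>{1..2*k+1}. wt (- \<alpha> l) ((m(0 := n)) l)) = (\<Prod>l\<in>{1..2*k+1}. wt (- s) (m l))"
      by (intro prod.cong) (auto simp: \<alpha>_def)
    moreover have "(\<Prod>l\<in>insert 0 {1..2*k+1}. wt (- \<alpha> l) ((m(0 := n)) l)) = wt (- \<alpha> 0) n * (\<Prod>l\<in>{1..2*k+1}. wt (- \<alpha> l) ((m(0 := n)) l))"
      by (subst prod.insert) auto
    ultimately have "(\<Prod>l\<in>{0..2*k+1}. wt (- \<alpha> l) ((m(0 := n)) l)) * (\<Prod>l=1..2*k+1. wt s (m l))
       = wt (- \<alpha> 0) n * ((\<Prod>l\<in>{1..2*k+1}. wt (- s) (m l)) * (\<Prod>l\<in>{1..2*k+1}. wt s (m l)))"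
      unfolding I by (simp only: mult.assoc)
    then show ?thesis unfolding prod_wt_cancel by (simp add: \<alpha>_def)
  qed
  show "\<exists>z\<in>UNIV. \<forall>n m. m \<in> XS {1..2*k+1} (lin sg) n \<longrightarrow> m \<in> E \<longrightarrow> m \<in> XS {1..2*k+1} (lin sg) (z - lin sg 0 n) \<and>
     wt (- a) n \<le> (\<Prod>l\<in>{0..2*k+1}. wt (- \<alpha> l) ((m(0 := n)) l)) * (\<Prod>l=1..2*k+1. wt s (m l))"
    by (rule bexI[of _ 0]) (use w in \<open>simp_all only: lin_0_minus, simp_all\<close>)
qed

text \<open>The origin of \<open>s_e\<close>: the identity
  \<open>(2 * k + 1) * s_e = (2 * k - 1) * d / 2\<close> is the balance of
  \<open>bounded_form_endpoint\<close> for the \<open>2 * k + 1\<close> inputs.\<close>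

lemma estimate_endpoint:
  assumes "k \<ge> 1" "s_e CARD('d) k \<le> s"
  shows "estimate k (UNIV :: (nat \<Rightarrow> int ^ 'd) set set) (lnorm top 0) (\<lambda>\<omega>. \<Prod>l=1..2*k+1. lnorm 2 s (\<omega> l))"
proof (rule estimate_mono)
  let ?s = "s_e CARD('d) k"
  show "estimate k (UNIV :: (nat \<Rightarrow> int ^ 'd) set set) (lnorm top 0) (\<lambda>\<omega>. \<Prod>l=1..2*k+1. lnorm 2 ?s (\<omega> l))"
  proof (rule estimate_inf_all)
    show "bounded_form {1..2*k+1} {1..2*k+1} (lin sg :: nat \<Rightarrow> int ^ 'd \<Rightarrow> int ^ 'd) UNIV (\<lambda>m. \<Prod>l\<in>{1..2*k+1}. wt (- ?s) (m l))"
    proof (rule bounded_form_endpoint)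
      show "real (card {1..2*k+1}) * ?s = real (card {1..2*k+1} - 2) * (real CARD('d) / 2)"
        using assms(1) by (simp add: s_e_def of_nat_diff field_simps)
    qed (use assms sg_cases in auto)
    show "\<exists>z. \<forall>m. m \<in> XS {1..2*k+1} (lin sg) n \<longrightarrow> m \<in> E \<longrightarrow> m \<in> XS {1..2*k+1} (lin sg) z \<and>
       wt 0 n \<le> (\<Prod>l\<in>{1..2*k+1}. wt (- ?s) (m l)) * (\<Prod>l\<in>{1..2*k+1}. wt ?s (m l))" for E :: "(nat \<Rightarrow> int ^ 'd) set" and n
      unfolding prod_wt_cancel by auto
  qed
  show "(\<Prod>l=1..2*k+1. lnorm 2 ?s (\<omega> l)) \<le> (\<Prod>l=1..2*k+1. lnorm 2 s (\<omega> l))" for \<omega> :: "nat \<Rightarrow> int ^ 'd \<Rightarrow> complex"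
    by (intro prod_mono_ennreal lnorm_2_mono assms)
qed simp

text \<open>Once the other variables are fixed, the linear constraint determines \<open>m q\<close>.
  The core form consists of this variable alone, without a function.\<close>

lemma estimate_inf_trivial:
  assumes "2 * t > real CARD('d)" and q: "q \<in> {1..2*k+1}"
  shows "estimate k (UNIV :: (nat \<Rightarrow> int ^ 'd) set set) (lnorm top 0)
    (\<lambda>\<omega>. lnorm top 0 (\<omega> q) * (\<Prod>l\<in>{1..2*k+1} - {q}. lnorm 2 t (\<omega> l)))"
proof (rule estimate_inf[OF _ q])
  let ?J = "{1..2*k+1} - {q}"
  have core: "bounded_form {q} {} (lin sg :: nat \<Rightarrow> int ^ 'd \<Rightarrow> int ^ 'd) UNIV (\<lambda>_. 1)"
  proof (rule bounded_formI[where K = 1])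
    fix z and f :: "nat \<Rightarrow> int ^ 'd \<Rightarrow> ennreal"
    have "esum (XS {q} (lin sg) z :: (nat \<Rightarrow> int ^ 'd) set) (\<lambda>m. 1) \<le> 1"
    proof (rule esum_singleton_le)
      fix m m' :: "nat \<Rightarrow> int ^ 'd" assume "m \<in> XS {q} (lin sg) z" "m' \<in> XS {q} (lin sg) z"
      then have e: "m \<in> extensional {q}" "m' \<in> extensional {q}" "sg q *s m q = sg q *s m' q"
        by (auto simp: XS_def lin_def PiE_def)
      then have "m q = m' q" using scale_sign_inj[OF sg_cases] by blast
      then show "m = m'" using e by (auto intro: extensionalityI)
    qed
    then have "(esum (XS {q} (lin sg) z :: (nat \<Rightarrow> int ^ 'd) set) (\<lambda>m. 1))\<^sup>2 \<le> 1\<^sup>2" by (intro power_mono) auto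
    then show "(esum (XS {q} (lin sg) z) (\<lambda>m. 1 * (\<Prod>l\<in>{}. f l (m l))))\<^sup>2 \<le> 1 * (\<Prod>l\<in>{}. n2 (f l))" by simp
  qed simp
  have "bounded_form ({q} \<union> ?J) ({} \<union> ?J) (lin sg :: nat \<Rightarrow> int ^ 'd \<Rightarrow> int ^ 'd) UNIV (\<lambda>m. 1 * (\<Prod>l\<in>?J. wt (- t) (m l)))"
    by (rule bounded_form_rest[OF _ _ _ _ assms(1) core]) auto
  moreover have "{q} \<union> ?J = {1..2*k+1}" using q by auto
  ultimately show "bounded_form {1..2*k+1} ?J (lin sg :: nat \<Rightarrow> int ^ 'd \<Rightarrow> int ^ 'd) UNIV (\<lambda>m. 1 * (\<Prod>l\<in>?J. wt (- t) (m l)))"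
    by (simp only: Un_empty_left)
  show "\<exists>z. \<forall>m. m \<in> XS {1..2*k+1} (lin sg) n \<longrightarrow> m \<in> E \<longrightarrow> m \<in> XS {1..2*k+1} (lin sg) z \<and>
       1 \<le> 1 * (\<Prod>l\<in>?J. wt (- t) (m l)) * (\<Prod>l\<in>?J. wt t (m l))" for E :: "(nat \<Rightarrow> int ^ 'd) set" and n
    unfolding mult_1_left prod_wt_cancel by auto
qed

text \<open>If \<open>m 2\<close> cancels against \<open>m 1\<close> or \<open>m 3\<close>, the
  output equals the remaining variable and inherits its weight; the other two weights are at least
  1.\<close>

lemma estimate_diagonal_cubic:
  assumes s: "s \<ge> 0"
  shows "estimate 1 {{m \<in> tuples 1. m 2 = m 1 \<or> m 2 = m 3}} (lnorm 2 s) (\<lambda>\<omega>. \<Prod>l=1..2*1+1. lnorm 2 s (\<omega> l :: int ^ 'd \<Rightarrow> complex))"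
proof (rule estimate_l2[where Z = UNIV])
  let ?W = "\<lambda>m :: nat \<Rightarrow> int ^ 'd. \<Sum>c\<in>{True, False}. (if c then indicator {m. m 1 = m 2} m else indicator {m. m 2 = m 3} m) :: ennreal"
  have b1: "bounded_form {1, 2, 0, 3} {1, 2, 0, 3} (lin sg :: nat \<Rightarrow> int ^ 'd \<Rightarrow> int ^ 'd) UNIV (indicator {m. m 1 = m 2})"
    by (rule bounded_form_diagonal) (use sg_cases in auto)
  have b2: "bounded_form {2, 3, 0, 1} {2, 3, 0, 1} (lin sg :: nat \<Rightarrow> int ^ 'd \<Rightarrow> int ^ 'd) UNIV (indicator {m. m 2 = m 3})"
    by (rule bounded_form_diagonal) (use sg_cases in auto)
  have I: "{0..2*1+1} = {1, 2, 0, 3 :: nat}" "{0..2*1+1} = {2, 3, 0, 1 :: nat}" by auto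
  show "bounded_form {0..2*1+1} {0..2*1+1} (lin sg :: nat \<Rightarrow> int ^ 'd \<Rightarrow> int ^ 'd) UNIV ?W"
  proof (rule bounded_form_sum)
    fix c assume "c \<in> {True, False}"
    show "bounded_form {0..2*1+1} {0..2*1+1} (lin sg :: nat \<Rightarrow> int ^ 'd \<Rightarrow> int ^ 'd) UNIV
       (\<lambda>m. if c then indicator {m. m 1 = m 2} m else indicator {m. m 2 = m 3} m)"
      using b1 b2 unfolding I(1)[symmetric] I(2)[symmetric] by (cases c) auto
  qed simp
  fix E :: "(nat \<Rightarrow> int ^ 'd) set" assume E: "E \<in> {{m \<in> tuples 1. m 2 = m 1 \<or> m 2 = m 3}}"
  have w: "wt s n \<le> ?W (m(0 := n)) * (\<Prod>l=1..2*1+1. wt s (m l))" if m: "m \<in> XS {1..2*1+1} (lin sg) n" "m \<in> E" for n and m :: "nat \<Rightarrow> int ^ 'd"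
  proof -
    have I1: "{1..2*1+1} = {1, 2, 3 :: nat}" by auto
    have "m 1 - m 2 + m 3 = n" using m(1) unfolding I1 XS_def by (simp add: lin_def sg_def vec_eq_iff algebra_simps)
    then have n: "n = m 3 \<and> m 1 = m 2 \<or> n = m 1 \<and> m 2 = m 3" using m(2) E by auto
    then have W1: "1 \<le> ?W (m(0 := n))" by (auto simp: indicator_def)
    have 1: "1 \<le> wt s (m l)" for l by (rule wt_ge_1[OF s])
    have "wt s n \<le> wt s (m 1) * (wt s (m 2) * wt s (m 3))"
    proof -
      have "1 * wt s (m 3) \<le> wt s (m 2) * wt s (m 3)" "wt s (m 1) * 1 \<le> wt s (m 1) * (wt s (m 2) * wt s (m 3))"
        using mult_mono[OF 1[of 2] 1[of 3]] by (intro mult_right_mono mult_left_mono 1; simp)+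
      moreover have "1 * (wt s (m 2) * wt s (m 3)) \<le> wt s (m 1) * (wt s (m 2) * wt s (m 3))"
        by (intro mult_right_mono 1) simp
      ultimately show ?thesis using n by (auto intro: order_trans)
    qed
    also have "\<dots> = 1 * (\<Prod>l=1..2*1+1. wt s (m l))" unfolding I1 by simp
    also have "\<dots> \<le> ?W (m(0 := n)) * (\<Prod>l=1..2*1+1. wt s (m l))" by (rule mult_right_mono[OF W1]) simp
    finally show ?thesis .
  qed
  show "\<exists>z\<in>UNIV. \<forall>n m. m \<in> XS {1..2*1+1} (lin sg) n \<longrightarrow> m \<in> E \<longrightarrow> m \<in> XS {1..2*1+1} (lin sg) (z - lin sg 0 n) \<and>
     wt s n \<le> ?W (m(0 := n)) * (\<Prod>l=1..2*1+1. wt s (m l))"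
    by (rule bexI[of _ 0]) (use w in \<open>simp_all only: lin_0_minus, simp_all\<close>)
qed

section \<open>The decreasing rearrangement as a permutation of the indices\<close>

lemma nth_largest_permutation:
  fixes m :: "nat \<Rightarrow> int ^ 'd"
  assumes R: "size_order R"
  shows "\<exists>\<pi>. bij_betw \<pi> {..<2*k+1} {1..2*k+1} \<and> (\<forall>i<2*k+1. nth_largest R k (i + 1) m = m (\<pi> i)) \<and>
    (\<forall>i j. i < j \<longrightarrow> j < 2*k+1 \<longrightarrow> (m (\<pi> i), m (\<pi> j)) \<in> R)"
proof -
  let ?xs = "decreasing_list R k m"
  have "linear_order R" using R by (simp add: size_order_def)
  from theI'[OF decreasing_list_ex1[OF this, of "image_mset m (mset_set {1..2*k+1})"]]
  have xs: "mset ?xs = image_mset m (mset_set {1..2*k+1})" "sorted_wrt (\<lambda>a b. (a, b) \<in> R) ?xs"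
    unfolding decreasing_list_def by auto
  define ys where "ys = map m [1..<2*k+2]"
  have "mset ys = image_mset m (mset_set {1..<2*k+2})" by (simp only: ys_def mset_map mset_upt)
  also have "{1..<2*k+2} = {1..2*k+1}" by auto
  finally have "mset ?xs = mset ys" using xs(1) by simp
  then obtain p where p: "p permutes {..<length ys}" "permute_list p ys = ?xs"
    by (rule mset_eq_permutation)
  have len: "length ys = 2*k+1" by (simp add: ys_def)
  have len': "length ?xs = 2*k+1" using p(2) len by (metis length_permute_list)
  define \<pi> where "\<pi> i = p i + 1" for i
  have nth: "?xs ! i = m (\<pi> i)" if "i < 2*k+1" for i
  proof -
    have "p i < 2*k+1" using permutes_in_image[OF p(1), of i] that len by auto
    then show ?thesis using permute_list_nth[OF p(1), of i] that len unfolding p(2) by (simp add: ys_def \<pi>_def del: upt_Suc)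
  qed
  have "bij_betw p {..<2*k+1} {..<2*k+1}" using p(1) len by (simp add: permutes_imp_bij)
  moreover have "bij_betw (\<lambda>i. i + 1) {..<2*k+1} {1..2*k+1}"
    by (rule bij_betw_byWitness[where f' = "\<lambda>i. i - 1"]) auto
  ultimately have "bij_betw ((\<lambda>i. i + 1) \<circ> p) {..<2*k+1} {1..2*k+1}" by (rule bij_betw_trans)
  then have "bij_betw \<pi> {..<2*k+1} {1..2*k+1}" by (simp add: \<pi>_def[abs_def] comp_def)
  moreover have "\<forall>i<2*k+1. nth_largest R k (i + 1) m = m (\<pi> i)" by (simp add: nth_largest_def nth)
  moreover have "\<forall>i j. i < j \<longrightarrow> j < 2*k+1 \<longrightarrow> (m (\<pi> i), m (\<pi> j)) \<in> R"
    using xs(2) nth len' unfolding sorted_wrt_iff_nth_less by (metis order.strict_trans)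
  ultimately show ?thesis by blast
qed

text \<open>For the last property: an entry that reappears later in a decreasing list equals
  everything in between, by antisymmetry.\<close>

lemma nth_largest_permutation':
  fixes m :: "nat \<Rightarrow> int ^ 'd"
  assumes R: "size_order R"
  obtains \<pi> where "inj_on \<pi> {..<2*k+1}" "\<pi> ` {..<2*k+1} = {1..2*k+1}" "\<And>i. i < 2*k+1 \<Longrightarrow> nth_largest R k (i + 1) m = m (\<pi> i)"
    "\<And>i j. i \<le> j \<Longrightarrow> j < 2*k+1 \<Longrightarrow> bracket (m (\<pi> j)) \<le> bracket (m (\<pi> i))"
    "\<And>i j j'. i < j \<Longrightarrow> j \<le> j' \<Longrightarrow> j' < 2*k+1 \<Longrightarrow> m (\<pi> i) \<noteq> m (\<pi> j) \<Longrightarrow> m (\<pi> i) \<noteq> m (\<pi> j')"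
proof -
  obtain \<pi> where \<pi>: "bij_betw \<pi> {..<2*k+1} {1..2*k+1}" "\<forall>i<2*k+1. nth_largest R k (i + 1) m = m (\<pi> i)"
    "\<And>i j. i < j \<Longrightarrow> j < 2*k+1 \<Longrightarrow> (m (\<pi> i), m (\<pi> j)) \<in> R"
    using nth_largest_permutation[OF R, of k m] by blast
  have anti: "a = b" if "(a, b) \<in> R" "(b, a) \<in> R" for a b
    using R that unfolding size_order_def linear_order_on_def partial_order_on_def antisym_def by blast
  show ?thesis
  proof (rule that)
    show "inj_on \<pi> {..<2*k+1}" "\<pi> ` {..<2*k+1} = {1..2*k+1}" using \<pi>(1) by (auto simp: bij_betw_def)
    show "nth_largest R k (i + 1) m = m (\<pi> i)" if "i < 2*k+1" for i using \<pi>(2) that by blast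
    show "bracket (m (\<pi> j)) \<le> bracket (m (\<pi> i))" if "i \<le> j" "j < 2*k+1" for i j
    proof (cases "i = j")
      case False
      then have "(m (\<pi> i), m (\<pi> j)) \<in> R" using that by (intro \<pi>(3)) auto
      then show ?thesis using R unfolding size_order_def bracket_le_iff by blast
    qed simp
    show "m (\<pi> i) \<noteq> m (\<pi> j')" if "i < j" "j \<le> j'" "j' < 2*k+1" "m (\<pi> i) \<noteq> m (\<pi> j)" for i j j'
    proof
      assume eq: "m (\<pi> i) = m (\<pi> j')"
      then have "j < j'" using that by (cases "j = j'") auto
      then have "(m (\<pi> j), m (\<pi> i)) \<in> R" using \<pi>(3)[of j j'] that eq by simp
      moreover have "(m (\<pi> i), m (\<pi> j)) \<in> R" using \<pi>(3)[of i j] that by simp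
      ultimately show False using anti that(4) by blast
    qed
  qed
qed

section \<open>Resonant part\<close>

text \<open>The diagonal form takes care of \<open>p\<close>, \<open>q\<close>, \<open>r\<close> and
  the output without weights, and every other variable is summed with exponent
  \<open>\<beta>\<close>. As each input brings the exponent \<open>s\<close>, what is left over is
  \<open>2 * s\<close> at \<open>p\<close>, because \<open>m p = m q\<close>, then \<open>s\<close>
  at \<open>r\<close> and \<open>s - \<beta>\<close> elsewhere. The hypothesis on \<open>M\<close>
  says that this covers the weight of the output.\<close>

lemma estimate_resonant:
  fixes \<E> :: "(nat \<Rightarrow> int ^ 'd) set set"
  assumes s: "s \<ge> 0" and \<beta>: "2 * \<beta> > real CARD('d)"
    and \<E>: "\<And>E m. E \<in> \<E> \<Longrightarrow> m \<in> E \<Longrightarrow> \<exists>p q r M. {p, q, r} \<subseteq> {1..2*k+1} \<and> distinct [p, q, r] \<and> m p = m q \<and>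
      (\<forall>l\<in>{1..2*k+1}. bracket (m l) \<le> M) \<and>
      M powr s \<le> bracket (m p) powr (2 * s) * bracket (m r) powr s * (\<Prod>l\<in>{1..2*k+1} - {p, q, r}. bracket (m l) powr (s - \<beta>))"
  shows "estimate k \<E> (lnorm 2 s) (\<lambda>\<omega>. \<Prod>l=1..2*k+1. lnorm 2 s (\<omega> l))"
proof (rule estimate_l2[where Z = UNIV])
  let ?I = "{1..2*k+1}"
  define S where "S = {(p, q, r). {p, q, r} \<subseteq> ?I \<and> distinct [p, q, r]}"
  define V :: "nat \<times> nat \<times> nat \<Rightarrow> (nat \<Rightarrow> int ^ 'd) \<Rightarrow> ennreal"
    where "V = (\<lambda>(p, q, r) m. indicator {m. m p = m q} m * (\<Prod>l\<in>?I - {p, q, r}. wt (- \<beta>) (m l)))"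
  define c where "c = real (2 * k + 2) powr s"
  have finS: "finite S"
    by (rule finite_subset[of _ "?I \<times> ?I \<times> ?I"]) (auto simp: S_def)
  have b: "bounded_form {0..2*k+1} {0..2*k+1} (lin sg :: nat \<Rightarrow> int ^ 'd \<Rightarrow> int ^ 'd) UNIV (V S')" if S': "S' \<in> S" for S'
  proof -
    obtain p q r where pqr: "S' = (p, q, r)" by (cases S')
    have d: "p \<in> ?I" "q \<in> ?I" "r \<in> ?I" "p \<noteq> q" "p \<noteq> r" "q \<noteq> r" using S' by (auto simp: S_def pqr)
    have "bounded_form {p, q, 0, r} {p, q, 0, r} (lin sg :: nat \<Rightarrow> int ^ 'd \<Rightarrow> int ^ 'd) UNIV (indicator {m. m p = m q})"
      by (rule bounded_form_diagonal) (use d sg_cases in auto)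
    then have "bounded_form ({p, q, 0, r} \<union> (?I - {p, q, r})) ({p, q, 0, r} \<union> (?I - {p, q, r})) (lin sg :: nat \<Rightarrow> int ^ 'd \<Rightarrow> int ^ 'd) UNIV
       (\<lambda>m. indicator {m. m p = m q} m * (\<Prod>l\<in>?I - {p, q, r}. wt (- \<beta>) (m l)))"
      by (rule bounded_form_rest[rotated 5]) (use \<beta> in \<open>auto simp: indicator_def\<close>)
    moreover have "{p, q, 0, r} \<union> (?I - {p, q, r}) = {0..2*k+1}" using d by auto
    ultimately show ?thesis by (simp only: V_def pqr prod.case)
  qed
  show "bounded_form {0..2*k+1} {0..2*k+1} (lin sg :: nat \<Rightarrow> int ^ 'd \<Rightarrow> int ^ 'd) UNIV (\<lambda>m. ennreal c * (\<Sum>S'\<in>S. V S' m))"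
    by (rule bounded_form_mono[OF bounded_form_sum[OF finS b]]) auto
  fix E assume E: "E \<in> \<E>"
  have w: "wt s n \<le> ennreal c * (\<Sum>S'\<in>S. V S' (m(0 := n))) * (\<Prod>l=1..2*k+1. wt s (m l))"
    if m: "m \<in> XS {1..2*k+1} (lin sg) n" "m \<in> E" for n and m :: "nat \<Rightarrow> int ^ 'd"
  proof -
    obtain p q r M where d: "p \<in> ?I" "q \<in> ?I" "r \<in> ?I" "p \<noteq> q" "p \<noteq> r" "q \<noteq> r" and eq: "m p = m q"
      and M: "\<And>l. l \<in> ?I \<Longrightarrow> bracket (m l) \<le> M"
        "M powr s \<le> bracket (m p) powr (2 * s) * bracket (m r) powr s * (\<Prod>l\<in>?I - {p, q, r}. bracket (m l) powr (s - \<beta>))"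
    proof -
      obtain p q r M where H: "{p, q, r} \<subseteq> ?I \<and> distinct [p, q, r] \<and> m p = m q \<and> (\<forall>l\<in>?I. bracket (m l) \<le> M) \<and>
        M powr s \<le> bracket (m p) powr (2 * s) * bracket (m r) powr s * (\<Prod>l\<in>?I - {p, q, r}. bracket (m l) powr (s - \<beta>))"
        using \<E>[OF E m(2)] by blast
      then have "p \<noteq> q" "p \<noteq> r" "q \<noteq> r" by auto
      then show thesis using H by (intro that[of p q r M]; blast)
    qed
    have M1: "M \<ge> 1" using M(1)[OF d(1)] bracket_ge_1[of "m p"] by linarith
    have "bracket ((m(0 := n)) 0) \<le> real (card {0..2*k+1}) * M"
      by (rule bracket_le_sum[OF _ _ _ lin_XS_0[OF m(1)]]) (use M M1 sg_cases in auto)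
    then have "bracket n powr s \<le> (real (2 * k + 2) * M) powr s" using s by (intro powr_mono2) auto
    also have "\<dots> = c * M powr s" unfolding c_def by (rule powr_mult)
    finally have n: "wt s n \<le> ennreal c * ennreal (M powr s)"
      unfolding wt_def by (subst ennreal_mult[symmetric]) (auto simp: c_def intro: ennreal_leI)
    have I: "?I = insert p (insert q (insert r (?I - {p, q, r})))" using d by auto
    have "ennreal (M powr s) \<le> ennreal (bracket (m p) powr (2 * s) * bracket (m r) powr s * (\<Prod>l\<in>?I - {p, q, r}. bracket (m l) powr (s - \<beta>)))"
      by (rule ennreal_leI[OF M(2)])
    also have "\<dots> = wt (s + s) (m p) * wt s (m r) * (\<Prod>l\<in>?I - {p, q, r}. wt (- \<beta> + s) (m l))"
      unfolding prod_wt unfolding wt_def by (simp add: ennreal_mult[symmetric] prod_nonneg)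
    also have "\<dots> = wt s (m p) * wt s (m q) * wt s (m r) * ((\<Prod>l\<in>?I - {p, q, r}. wt (- \<beta>) (m l)) * (\<Prod>l\<in>?I - {p, q, r}. wt s (m l)))"
      unfolding wt_mult[symmetric] prod.distrib by (simp add: eq mult_ac)
    also have "\<dots> = (\<Prod>l\<in>?I - {p, q, r}. wt (- \<beta>) (m l)) * (\<Prod>l\<in>insert p (insert q (insert r (?I - {p, q, r}))). wt s (m l))"
      using d by (simp add: mult_ac)
    also have "\<dots> = (\<Prod>l\<in>?I - {p, q, r}. wt (- \<beta>) (m l)) * (\<Prod>l\<in>?I. wt s (m l))"
      unfolding I[symmetric] by (rule refl)
    also have "(\<Prod>l\<in>?I - {p, q, r}. wt (- \<beta>) (m l)) = (\<Prod>l\<in>?I - {p, q, r}. wt (- \<beta>) ((m(0 := n)) l))"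
      by (intro prod.cong) auto
    also have "\<dots> = V (p, q, r) (m(0 := n))"
    proof -
      have "m(0 := n) \<in> {m. m p = m q}" using d eq by auto
      then show ?thesis unfolding V_def prod.case by simp
    qed
    also have "V (p, q, r) (m(0 := n)) * (\<Prod>l\<in>?I. wt s (m l)) \<le> (\<Sum>S'\<in>S. V S' (m(0 := n))) * (\<Prod>l\<in>?I. wt s (m l))"
      by (intro mult_right_mono member_le_sum) (use d finS in \<open>auto simp: S_def\<close>)
    finally have "ennreal c * ennreal (M powr s) \<le> ennreal c * ((\<Sum>S'\<in>S. V S' (m(0 := n))) * (\<Prod>l\<in>?I. wt s (m l)))"
      by (intro mult_left_mono) auto
    with n show ?thesis unfolding mult.assoc by (rule order_trans)
  qed
  show "\<exists>z\<in>UNIV. \<forall>n m. m \<in> XS {1..2*k+1} (lin sg) n \<longrightarrow> m \<in> E \<longrightarrow> m \<in> XS {1..2*k+1} (lin sg) (z - lin sg 0 n) \<and>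
     wt s n \<le> ennreal c * (\<Sum>S'\<in>S. V S' (m(0 := n))) * (\<Prod>l=1..2*k+1. wt s (m l))"
    by (rule bexI[of _ 0]) (use w in \<open>simp_all only: lin_0_minus, simp_all\<close>)
qed

text \<open>Let \<open>X\<close> be the smaller of the sizes at \<open>p\<close> and
  \<open>r\<close>. The \<open>2 * (k - 1)\<close> remaining variables are at most \<open>X\<close>,
  so they lose at most \<open>X powr (2 * s)\<close>, because
  \<open>(k - 1) * \<beta> \<le> k * s\<close>. The weights at \<open>p\<close> and \<open>r\<close>
  exceed the left-hand side by this same factor.\<close>

lemma resonant_product:
  fixes m :: "nat \<Rightarrow> int ^ 'd" and s \<beta> :: real
  assumes k: "k \<ge> 2" and s: "0 \<le> s" "s \<le> \<beta>" "real (k - 1) * \<beta> \<le> real k * s"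
    and pqr: "{p, q, r} \<subseteq> {1..2*k+1}" "distinct [p, q, r]"
    and le: "\<And>l. l \<in> {1..2*k+1} - {p, q, r} \<Longrightarrow> bracket (m l) \<le> bracket (m p) \<and> bracket (m l) \<le> bracket (m r)"
  shows "max (bracket (m p)) (bracket (m r)) powr s
    \<le> bracket (m p) powr (2 * s) * bracket (m r) powr s * (\<Prod>l\<in>{1..2*k+1} - {p, q, r}. bracket (m l) powr (s - \<beta>))"
proof -
  define X where "X = min (bracket (m p)) (bracket (m r))"
  let ?J = "{1..2*k+1} - {p, q, r}"
  have X: "X \<ge> 1" by (simp add: X_def)
  have "card ?J = 2 * (k - 1)" using pqr by (subst card_Diff_subset) auto
  moreover have "X powr (- 2 * s) \<le> X powr (real (2 * (k - 1)) * (s - \<beta>))"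
  proof (rule powr_mono[OF _ X])
    have "real (2 * (k - 1)) * (s - \<beta>) = 2 * ((real k - 1) * s - real (k - 1) * \<beta>)" using k by (simp add: of_nat_diff algebra_simps)
    then show "- 2 * s \<le> real (2 * (k - 1)) * (s - \<beta>)" using s(3) by (simp add: algebra_simps)
  qed
  moreover have "X powr (real (2 * (k - 1)) * (s - \<beta>)) = (X powr (s - \<beta>)) ^ (2 * (k - 1))"
    using X by (subst powr_realpow[symmetric]) (simp_all only: powr_powr mult.commute, simp)
  ultimately have "X powr (- 2 * s) \<le> (\<Prod>l\<in>?J. X powr (s - \<beta>))" by (simp only: prod_constant)
  also have "\<dots> \<le> (\<Prod>l\<in>?J. bracket (m l) powr (s - \<beta>))"
  proof (rule prod_mono)
    fix l assume "l \<in> ?J"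
    then have "bracket (m l) \<le> X" using le[of l] by (simp add: X_def)
    then show "0 \<le> X powr (s - \<beta>) \<and> X powr (s - \<beta>) \<le> bracket (m l) powr (s - \<beta>)"
      using s(2) X by (auto intro: powr_mono2')
  qed
  finally have 1: "X powr (- 2 * s) \<le> (\<Prod>l\<in>?J. bracket (m l) powr (s - \<beta>))" .
  have "max (bracket (m p)) (bracket (m r)) powr s * X powr (2 * s) \<le> bracket (m p) powr (2 * s) * bracket (m r) powr s"
  proof (cases "bracket (m p) \<le> bracket (m r)")
    case False
    then have "bracket (m r) powr s \<le> bracket (m p) powr s" using s(1) by (intro powr_mono2) auto
    then have "bracket (m p) powr s * (bracket (m r) powr s * bracket (m r) powr s)
      \<le> bracket (m p) powr s * (bracket (m p) powr s * bracket (m r) powr s)"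
      by (intro mult_left_mono mult_right_mono) auto
    moreover have "a powr (2 * s) = a powr s * a powr s" for a :: real by (simp add: powr_add[symmetric])
    ultimately show ?thesis using False by (simp add: X_def max_def min_def)
  qed (simp add: X_def max_def min_def)
  then have "max (bracket (m p)) (bracket (m r)) powr s * X powr (2 * s) * X powr (- 2 * s)
    \<le> bracket (m p) powr (2 * s) * bracket (m r) powr s * (\<Prod>l\<in>?J. bracket (m l) powr (s - \<beta>))"
    by (rule mult_mono[OF _ 1]) auto
  moreover have "X powr (2 * s) * X powr (- 2 * s) = 1" using X by (simp add: powr_add[symmetric])
  ultimately show ?thesis by (simp add: mult.assoc)
qed

lemma estimate_resonances:
  fixes s \<beta> :: real
  assumes k: "k \<ge> 2" and s: "0 \<le> s" "s \<le> \<beta>" "real (k - 1) * \<beta> \<le> real k * s" and \<beta>: "2 * \<beta> > real CARD('d)"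
  shows "estimate k {res1 R k \<union> res2 R k | R :: (int ^ 'd) rel. size_order R} (lnorm 2 s) (\<lambda>\<omega>. \<Prod>l=1..2*k+1. lnorm 2 s (\<omega> l))"
    and "k = 2 \<Longrightarrow> \<beta> \<le> 9 * s / 5 \<Longrightarrow>
      estimate k {res1 R k \<union> res2 R k \<union> res3 R k | R :: (int ^ 'd) rel. size_order R} (lnorm 2 s) (\<lambda>\<omega>. \<Prod>l=1..2*k+1. lnorm 2 s (\<omega> l))"
proof -
  let ?I = "{1..2*k+1}"
  let ?G = "\<lambda>m :: nat \<Rightarrow> int ^ 'd. \<exists>p q r M. {p, q, r} \<subseteq> ?I \<and> distinct [p, q, r] \<and> m p = m q \<and>
      (\<forall>l\<in>?I. bracket (m l) \<le> M) \<and>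
      M powr s \<le> bracket (m p) powr (2 * s) * bracket (m r) powr s * (\<Prod>l\<in>?I - {p, q, r}. bracket (m l) powr (s - \<beta>))"
  have 12: "?G m" if R: "size_order R" and m: "m \<in> res1 R k \<union> res2 R k" for R :: "(int ^ 'd) rel" and m
  proof -
    obtain \<pi> where \<pi>: "inj_on \<pi> {..<2*k+1}" "\<pi> ` {..<2*k+1} = ?I" "\<And>i. i < 2*k+1 \<Longrightarrow> nth_largest R k (i + 1) m = m (\<pi> i)"
      "\<And>i j. i \<le> j \<Longrightarrow> j < 2*k+1 \<Longrightarrow> bracket (m (\<pi> j)) \<le> bracket (m (\<pi> i))"
      by (rule nth_largest_permutation'[OF R, of k m]) (blast intro: that)
    have in_I: "\<pi> i \<in> ?I" if "i < 2*k+1" for i using \<pi>(2) that by blast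
    have neq: "\<pi> i \<noteq> \<pi> j" if "i < 2*k+1" "j < 2*k+1" "i \<noteq> j" for i j using inj_onD[OF \<pi>(1)] that by blast
    \<comment> \<open>Positions are counted from 0. In \<open>res1\<close> the equal pair occupies
      positions 0 and 1 and \<open>r\<close> is third; in \<open>res2\<close> the pair occupies
      positions 1 and 2 and \<open>r\<close> is the largest.\<close>
    have key: "?G m" if S: "(i0, i1, i2) \<in> {(0, 1, 2 :: nat), (1, 2, 0)}" and eq: "m (\<pi> i0) = m (\<pi> i1)" for i0 i1 i2
    proof -
      have lt: "i0 < 2*k+1" "i1 < 2*k+1" "i2 < 2*k+1" using S k by auto
      have pqr: "{\<pi> i0, \<pi> i1, \<pi> i2} \<subseteq> ?I" "distinct [\<pi> i0, \<pi> i1, \<pi> i2]" using in_I neq lt S by auto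
      have le: "bracket (m l) \<le> bracket (m (\<pi> i0)) \<and> bracket (m l) \<le> bracket (m (\<pi> i2))" if l: "l \<in> ?I - {\<pi> i0, \<pi> i1, \<pi> i2}" for l
      proof -
        obtain j where j: "j < 2*k+1" "l = \<pi> j" using l \<pi>(2) by blast
        then have "j \<noteq> i0" "j \<noteq> i1" "j \<noteq> i2" using l by auto
        then have "i0 \<le> j" "i2 \<le> j" using S by auto
        then show ?thesis using \<pi>(4) j by blast
      qed
      have "\<forall>l\<in>?I. bracket (m l) \<le> max (bracket (m (\<pi> i0))) (bracket (m (\<pi> i2)))"
      proof
        fix l assume "l \<in> ?I"
        then consider "l = \<pi> i0" | "l = \<pi> i1" | "l = \<pi> i2" | "l \<in> ?I - {\<pi> i0, \<pi> i1, \<pi> i2}" by blast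
        then show "bracket (m l) \<le> max (bracket (m (\<pi> i0))) (bracket (m (\<pi> i2)))" using le eq by cases (auto simp: max_def)
      qed
      then show ?thesis using resonant_product[OF k s pqr le] pqr eq by blast
    qed
    have "nth_largest R k 1 m = m (\<pi> 0)" "nth_largest R k 2 m = m (\<pi> 1)" "nth_largest R k 3 m = m (\<pi> 2)"
      using \<pi>(3)[of 0] \<pi>(3)[of 1] \<pi>(3)[of 2] k by (simp_all add: numeral_eq_Suc)
    then consider "m (\<pi> 0) = m (\<pi> 1)" | "m (\<pi> 1) = m (\<pi> 2)" using m by (auto simp: res1_def res2_def)
    then show ?thesis
    proof cases
      case 1 show ?thesis by (rule key[of 0 1 2]) (use 1 in auto)
    next
      case 2 show ?thesis by (rule key[of 1 2 0]) (use 2 in auto)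
    qed
  qed
  show "estimate k {res1 R k \<union> res2 R k | R :: (int ^ 'd) rel. size_order R} (lnorm 2 s) (\<lambda>\<omega>. \<Prod>l=1..2*k+1. lnorm 2 s (\<omega> l))"
    by (rule estimate_resonant[OF s(1) \<beta>]) (use 12 in blast)
  assume k2: "k = 2" and \<beta>9: "\<beta> \<le> 9 * s / 5"
  \<comment> \<open>Now the equal pair is third and fourth, and \<open>r\<close> is the largest. Of
    the two remaining variables the second largest may exceed the third, but only up to the power
    \<open>3 / 2\<close>. The loss is therefore at most the power
    \<open>(3 / 2 + 1) * (\<beta> - s)\<close> of the third, and it stays within
    \<open>2 * s\<close> precisely if \<open>\<beta> \<le> 9 * s / 5\<close>.\<close>
  have 3: "?G m" if R: "size_order R" and m: "m \<in> res3 R k" for R :: "(int ^ 'd) rel" and m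
  proof -
    obtain \<pi> where \<pi>: "inj_on \<pi> {..<2*k+1}" "\<pi> ` {..<2*k+1} = ?I" "\<And>i. i < 2*k+1 \<Longrightarrow> nth_largest R k (i + 1) m = m (\<pi> i)"
      "\<And>i j. i \<le> j \<Longrightarrow> j < 2*k+1 \<Longrightarrow> bracket (m (\<pi> j)) \<le> bracket (m (\<pi> i))"
      by (rule nth_largest_permutation'[OF R, of k m]) (blast intro: that)
    have in_I: "\<pi> i \<in> ?I" if "i < 2*k+1" for i using \<pi>(2) that by blast
    have neq: "\<pi> i \<noteq> \<pi> j" if "i < 2*k+1" "j < 2*k+1" "i \<noteq> j" for i j using inj_onD[OF \<pi>(1)] that by blast
    have "nth_largest R k 2 m = m (\<pi> 1)" "nth_largest R k 3 m = m (\<pi> 2)" "nth_largest R k 4 m = m (\<pi> 3)"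
      using \<pi>(3)[of 1] \<pi>(3)[of 2] \<pi>(3)[of 3] k by (simp_all add: numeral_eq_Suc)
    then have eq: "m (\<pi> 2) = m (\<pi> 3)" and le: "bracket (m (\<pi> 1)) \<le> bracket (m (\<pi> 2)) powr (3/2)"
      using m by (auto simp: res3_def)
    define x where "x = bracket (m (\<pi> 2))"
    have x: "x \<ge> 1" by (simp add: x_def)
    have five: "{..<2*k+1} = {0, 1, 2, 3, 4}" using k2 by auto
    have J: "?I - {\<pi> 2, \<pi> 3, \<pi> 0} = {\<pi> 1, \<pi> 4}"
      unfolding \<pi>(2)[symmetric] five using neq[of 1 2] neq[of 1 3] neq[of 1 0] neq[of 4 2] neq[of 4 3] neq[of 4 0] k2 by auto
    have "(\<Prod>l\<in>?I - {\<pi> 2, \<pi> 3, \<pi> 0}. bracket (m l) powr (s - \<beta>)) = bracket (m (\<pi> 1)) powr (s - \<beta>) * bracket (m (\<pi> 4)) powr (s - \<beta>)"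
      unfolding J using neq[of 1 4] k2 by simp
    also have "\<dots> \<ge> (x powr (3/2)) powr (s - \<beta>) * x powr (s - \<beta>)"
      using le s(2) \<pi>(4)[of 2 4] k2 by (intro mult_mono powr_mono2') (auto simp: x_def)
    also have "(x powr (3/2)) powr (s - \<beta>) * x powr (s - \<beta>) = x powr (5 / 2 * (s - \<beta>))"
    proof -
      have "3 / 2 * (s - \<beta>) + (s - \<beta>) = 5 / 2 * (s - \<beta>)" by (simp add: field_simps)
      then show ?thesis by (simp only: powr_powr powr_add[symmetric])
    qed
    also have "x powr (5 / 2 * (s - \<beta>)) \<ge> x powr (- 2 * s)" using \<beta>9 by (intro powr_mono x) simp
    finally have "x powr (2 * s) * x powr (- 2 * s) \<le> x powr (2 * s) * (\<Prod>l\<in>?I - {\<pi> 2, \<pi> 3, \<pi> 0}. bracket (m l) powr (s - \<beta>))"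
      by (intro mult_left_mono) auto
    then have "1 \<le> x powr (2 * s) * (\<Prod>l\<in>?I - {\<pi> 2, \<pi> 3, \<pi> 0}. bracket (m l) powr (s - \<beta>))"
      using x by (simp add: powr_add[symmetric])
    then have "bracket (m (\<pi> 0)) powr s * 1 \<le> bracket (m (\<pi> 0)) powr s * (x powr (2 * s) * (\<Prod>l\<in>?I - {\<pi> 2, \<pi> 3, \<pi> 0}. bracket (m l) powr (s - \<beta>)))"
      by (intro mult_left_mono) auto
    then have "bracket (m (\<pi> 0)) powr s \<le> bracket (m (\<pi> 2)) powr (2 * s) * bracket (m (\<pi> 0)) powr s * (\<Prod>l\<in>?I - {\<pi> 2, \<pi> 3, \<pi> 0}. bracket (m l) powr (s - \<beta>))"
      by (simp only: x_def mult_ac mult_1)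
    moreover have "\<forall>l\<in>?I. bracket (m l) \<le> bracket (m (\<pi> 0))"
      unfolding \<pi>(2)[symmetric] using \<pi>(4) by blast
    moreover have "{\<pi> 2, \<pi> 3, \<pi> 0} \<subseteq> ?I" using in_I k2 by auto
    moreover have "distinct [\<pi> 2, \<pi> 3, \<pi> 0]" using neq k2 by simp
    ultimately show ?thesis using eq by blast
  qed
  show "estimate k {res1 R k \<union> res2 R k \<union> res3 R k | R :: (int ^ 'd) rel. size_order R} (lnorm 2 s) (\<lambda>\<omega>. \<Prod>l=1..2*k+1. lnorm 2 s (\<omega> l))"
    by (rule estimate_resonant[OF s(1) \<beta>]) (use 12 3 in blast)
qed

section \<open>Nonresonant part\<close>

lemma prod_wt_split:
  assumes "finite L" "T \<subseteq> L"
  shows "(\<Prod>l\<in>L. wt (- (if l \<in> T then \<alpha> else \<beta>)) (m l)) = (\<Prod>l\<in>T. wt (- \<alpha>) (m l)) * (\<Prod>l\<in>L - T. wt (- \<beta>) (m l))"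
proof -
  have "(\<Prod>l\<in>L. wt (- (if l \<in> T then \<alpha> else \<beta>)) (m l))
    = (\<Prod>l\<in>L - T. wt (- (if l \<in> T then \<alpha> else \<beta>)) (m l)) * (\<Prod>l\<in>T. wt (- (if l \<in> T then \<alpha> else \<beta>)) (m l))"
    by (rule prod.subset_diff[OF assms(2,1)])
  also have "(\<Prod>l\<in>L - T. wt (- (if l \<in> T then \<alpha> else \<beta>)) (m l)) = (\<Prod>l\<in>L - T. wt (- \<beta>) (m l))"
    by (intro prod.cong) auto
  also have "(\<Prod>l\<in>T. wt (- (if l \<in> T then \<alpha> else \<beta>)) (m l)) = (\<Prod>l\<in>T. wt (- \<alpha>) (m l))"
    by (intro prod.cong) auto
  finally show ?thesis by (simp only: mult.commute)
qed

text \<open>The frame for all non-resonant cases. A configuration \<open>c\<close> selects the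
  largest variables \<open>T c\<close> other than \<open>n_q\<close> and a non-degeneracy condition
  \<open>D c\<close>. On \<open>insert q (T c)\<close> a Schur-type form with exponent
  \<open>\<alpha>\<close> is given, the rest is summed absolutely with exponent
  \<open>\<beta>\<close>, and \<open>sum\<close> is the budget for this redistribution.\<close>

lemma estimate_schur_sum:
  fixes \<E> :: "(nat \<Rightarrow> int ^ 'd) set set" and V :: "'c \<Rightarrow> (nat \<Rightarrow> int ^ 'd) \<Rightarrow> ennreal" and T :: "'c \<Rightarrow> nat set"
  assumes q: "q \<in> {1..2*k+1}" and \<beta>: "2 * \<beta> > real CARD('d)" and t: "\<alpha> \<le> t" "t \<le> \<beta>"
    and C: "finite C" "\<And>c. c \<in> C \<Longrightarrow> T c \<subseteq> {1..2*k+1} - {q}" "\<And>c. c \<in> C \<Longrightarrow> T c \<noteq> {}"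
    and sum: "\<And>c. c \<in> C \<Longrightarrow> real (card (T c)) * \<alpha> + real (2 * k - card (T c)) * \<beta> \<le> real (2 * k) * t"
    and b: "\<And>c. c \<in> C \<Longrightarrow> bounded_form (insert q (T c)) (T c) (phs sg :: nat \<Rightarrow> int ^ 'd \<Rightarrow> (int ^ 'd) \<times> int) UNIV
       (\<lambda>m. indicator (D c) m * (\<Prod>l\<in>T c. wt (- \<alpha>) (m l)))"
    and D: "\<And>c m j x. c \<in> C \<Longrightarrow> j \<notin> insert q (T c) \<Longrightarrow> m(j := x) \<in> D c \<longleftrightarrow> m \<in> D c"
    and \<E>: "\<And>E. E \<in> \<E> \<Longrightarrow> \<exists>\<mu>. E \<subseteq> phase_set k \<mu>"
    and top: "\<And>E m n. E \<in> \<E> \<Longrightarrow> m \<in> E \<Longrightarrow> m \<in> XS {1..2*k+1} (lin sg) n \<Longrightarrow> \<exists>c\<in>C. m \<in> D c \<and>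
       (\<forall>a\<in>T c. \<forall>l\<in>{1..2*k+1} - {q} - T c. bracket (m l) \<le> bracket (m a))"
  shows "estimate k \<E> (lnorm top 0) (\<lambda>\<omega>. lnorm top 0 (\<omega> q) * (\<Prod>l\<in>{1..2*k+1} - {q}. lnorm 2 t (\<omega> l)))"
proof (rule estimate_inf[OF _ q])
  let ?L = "{1..2*k+1} - {q}"
  define V where "V c m = indicator (D c) m * (\<Prod>l\<in>T c. wt (- \<alpha>) (m l)) * (\<Prod>l\<in>?L - T c. wt (- \<beta>) (m l))" for c and m :: "nat \<Rightarrow> int ^ 'd"
  show "bounded_form {1..2*k+1} ?L (phs sg :: nat \<Rightarrow> int ^ 'd \<Rightarrow> (int ^ 'd) \<times> int) UNIV (\<lambda>m. \<Sum>c\<in>C. V c m)"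
  proof (rule bounded_form_sum[OF C(1)])
    fix c assume c: "c \<in> C"
    have "bounded_form (insert q (T c) \<union> (?L - T c)) (T c \<union> (?L - T c)) (phs sg :: nat \<Rightarrow> int ^ 'd \<Rightarrow> (int ^ 'd) \<times> int) UNIV (V c)"
      unfolding V_def[abs_def]
    proof (rule bounded_form_rest[OF _ _ _ _ \<beta> b[OF c]])
      show "finite (insert q (T c))" using C(2)[OF c] by (auto intro: finite_subset)
      fix m :: "nat \<Rightarrow> int ^ 'd" and j x assume j: "j \<in> ?L - T c"
      have "(\<Prod>l\<in>T c. wt (- \<alpha>) ((m(j := x)) l)) = (\<Prod>l\<in>T c. wt (- \<alpha>) (m l))" using j by (intro prod.cong) auto
      moreover have "m(j := x) \<in> D c \<longleftrightarrow> m \<in> D c" using j by (intro D c) auto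
      ultimately show "indicator (D c) (m(j := x)) * (\<Prod>l\<in>T c. wt (- \<alpha>) ((m(j := x)) l)) = indicator (D c) m * (\<Prod>l\<in>T c. wt (- \<alpha>) (m l))"
        by (simp add: indicator_def)
    qed auto
    moreover have "insert q (T c) \<union> (?L - T c) = {1..2*k+1}" "T c \<union> (?L - T c) = ?L" using C(2)[OF c] q by auto
    ultimately show "bounded_form {1..2*k+1} ?L (phs sg :: nat \<Rightarrow> int ^ 'd \<Rightarrow> (int ^ 'd) \<times> int) UNIV (V c)" by simp
  qed
  fix E n assume E: "E \<in> \<E>"
  obtain \<mu> where \<mu>: "E \<subseteq> phase_set k \<mu>" using \<E>[OF E] by blast
  have w: "1 \<le> (\<Sum>c\<in>C. V c m) * (\<Prod>l\<in>?L. wt t (m l))" if m: "m \<in> E" "m \<in> XS {1..2*k+1} (lin sg) n" for m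
  proof -
    obtain c where c: "c \<in> C" "m \<in> D c" and tp: "\<And>a l. a \<in> T c \<Longrightarrow> l \<in> ?L - T c \<Longrightarrow> bracket (m l) \<le> bracket (m a)"
      using top[OF E m] by blast
    have "card ?L = 2 * k" using q by simp
    then have "(\<Prod>l\<in>?L. wt (- t) (m l)) \<le> (\<Prod>l\<in>?L. wt (- (if l \<in> T c then \<alpha> else \<beta>)) (m l))"
      by (intro prod_wt_pivot) (use t C(2,3)[OF c(1)] tp sum[OF c(1)] in auto)
    also have "\<dots> = V c m" using c C(2)[OF c(1)] by (subst prod_wt_split) (auto simp: V_def)
    also have "V c m \<le> (\<Sum>c\<in>C. V c m)" using c(1) C(1) by (intro member_le_sum) auto
    finally have "(\<Prod>l\<in>?L. wt (- t) (m l)) * (\<Prod>l\<in>?L. wt t (m l)) \<le> (\<Sum>c\<in>C. V c m) * (\<Prod>l\<in>?L. wt t (m l))"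
      by (rule mult_right_mono) simp
    then show ?thesis unfolding prod_wt_cancel .
  qed
  show "\<exists>z. \<forall>m. m \<in> XS {1..2*k+1} (lin sg) n \<longrightarrow> m \<in> E \<longrightarrow>
       m \<in> XS {1..2*k+1} (phs sg) z \<and> 1 \<le> (\<Sum>c\<in>C. V c m) * (\<Prod>l\<in>?L. wt t (m l))"
    using w \<mu> by (intro exI[of _ "(n, sq n - \<mu>)"]) (auto simp only: phase_set_XS[symmetric])
qed

text \<open>Outside \<open>res1\<close> and \<open>res2\<close> the first two entries in decreasing
  order differ from every other entry. If \<open>n_q\<close> is among these two, it differs from all
  the rest; otherwise the two entries themselves are the largest after \<open>n_q\<close> is
  removed. So in every case the two largest of the other variables differ from
  \<open>n_q\<close>.\<close>

lemma res_complement_top: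
  fixes m :: "nat \<Rightarrow> int ^ 'd"
  assumes R: "size_order R" and m: "m \<notin> res1 R k \<union> res2 R k" "m \<in> tuples k" and k: "k \<ge> 2" and q: "q \<in> {1..2*k+1}"
  obtains a b c e where "distinct [q, a, b, c, e]" "{a, b, c, e} \<subseteq> {1..2*k+1} - {q}" "m a \<noteq> m q" "m b \<noteq> m q"
    "bracket (m b) \<le> bracket (m a)" "bracket (m c) \<le> bracket (m b)" "bracket (m e) \<le> bracket (m c)"
    "\<And>l. l \<in> {1..2*k+1} - {q, a, b, c, e} \<Longrightarrow> bracket (m l) \<le> bracket (m e)"
proof -
  obtain \<pi> where \<pi>: "inj_on \<pi> {..<2*k+1}" "\<pi> ` {..<2*k+1} = {1..2*k+1}" "\<And>i. i < 2*k+1 \<Longrightarrow> nth_largest R k (i + 1) m = m (\<pi> i)"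
    "\<And>i j. i \<le> j \<Longrightarrow> j < 2*k+1 \<Longrightarrow> bracket (m (\<pi> j)) \<le> bracket (m (\<pi> i))"
    "\<And>i j j'. i < j \<Longrightarrow> j \<le> j' \<Longrightarrow> j' < 2*k+1 \<Longrightarrow> m (\<pi> i) \<noteq> m (\<pi> j) \<Longrightarrow> m (\<pi> i) \<noteq> m (\<pi> j')"
    by (rule nth_largest_permutation'[OF R, of k m]) (blast intro: that)
  have "nth_largest R k 1 m = m (\<pi> 0)" "nth_largest R k 2 m = m (\<pi> 1)" "nth_largest R k 3 m = m (\<pi> 2)"
    using \<pi>(3)[of 0] \<pi>(3)[of 1] \<pi>(3)[of 2] k by (simp_all add: numeral_eq_Suc)
  then have "m (\<pi> 0) \<noteq> m (\<pi> 1)" "m (\<pi> 1) \<noteq> m (\<pi> 2)" using m by (auto simp: res1_def res2_def)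
  then have n0: "m (\<pi> 0) \<noteq> m (\<pi> j)" if "j \<ge> 1" "j < 2*k+1" for j using \<pi>(5)[of 0 1 j] that by simp
  have n1: "m (\<pi> 1) \<noteq> m (\<pi> j)" if "j \<ge> 2" "j < 2*k+1" for j using \<pi>(5)[of 1 2 j] that \<open>m (\<pi> 1) \<noteq> m (\<pi> 2)\<close> by simp
  have neq: "\<pi> i \<noteq> \<pi> j" if "i < 2*k+1" "j < 2*k+1" "i \<noteq> j" for i j using inj_onD[OF \<pi>(1)] that by blast
  obtain i where i: "i < 2*k+1" "q = \<pi> i" using q \<pi>(2) by blast
  \<comment> \<open>Enumerates the positions while skipping the position \<open>i\<close> of
    \<open>q\<close>.\<close>
  define \<rho> where "\<rho> j = (if j < i then j else j + 1)" for j
  have \<rho>: "\<rho> j < 2*k+1" "\<rho> j \<noteq> i" if "j < 4" for j using that k i by (auto simp: \<rho>_def)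
  have \<rho>m: "\<rho> j < \<rho> j'" if "j < j'" for j j' using that by (auto simp: \<rho>_def)
  have \<rho>n: "\<pi> (\<rho> j) \<noteq> \<pi> (\<rho> j')" if "j < j'" "j' < 4" for j j' using \<rho>m[OF that(1)] \<rho>(1)[of j] \<rho>(1)[of j'] that by (intro neq) auto
  have \<rho>q: "\<pi> (\<rho> j) \<noteq> q" if "j < 4" for j unfolding i(2) using \<rho>[OF that] i(1) by (intro neq) auto
  show ?thesis
  proof (rule that[of "\<pi> (\<rho> 0)" "\<pi> (\<rho> 1)" "\<pi> (\<rho> 2)" "\<pi> (\<rho> 3)"])
    show "distinct [q, \<pi> (\<rho> 0), \<pi> (\<rho> 1), \<pi> (\<rho> 2), \<pi> (\<rho> 3)]"
      using \<rho>q[of 0] \<rho>q[of 1] \<rho>q[of 2] \<rho>q[of 3] \<rho>n[of 0 1] \<rho>n[of 0 2] \<rho>n[of 0 3] \<rho>n[of 1 2] \<rho>n[of 1 3] \<rho>n[of 2 3] by simp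
    have "\<pi> (\<rho> j) \<in> {1..2*k+1} - {q}" if "j < 4" for j using \<pi>(2) \<rho>[OF that] \<rho>q[OF that] by blast
    then show "{\<pi> (\<rho> 0), \<pi> (\<rho> 1), \<pi> (\<rho> 2), \<pi> (\<rho> 3)} \<subseteq> {1..2*k+1} - {q}" by simp
    show "m (\<pi> (\<rho> 0)) \<noteq> m q"
      using n0[of i] n0[of 1] k i by (cases "i = 0") (auto simp: \<rho>_def)
    show "m (\<pi> (\<rho> 1)) \<noteq> m q"
    proof -
      consider "i = 0" | "i = 1" | "i \<ge> 2" by linarith
      then show ?thesis using n0[of 2] n1[of 2] n1[of i] k i by cases (auto simp: \<rho>_def numeral_2_eq_2)
    qed
    show "bracket (m (\<pi> (\<rho> 1))) \<le> bracket (m (\<pi> (\<rho> 0)))" "bracket (m (\<pi> (\<rho> 2))) \<le> bracket (m (\<pi> (\<rho> 1)))"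
      "bracket (m (\<pi> (\<rho> 3))) \<le> bracket (m (\<pi> (\<rho> 2)))"
      by (rule \<pi>(4); use \<rho>m \<rho>(1) in \<open>simp add: less_imp_le\<close>)+
    fix l assume l: "l \<in> {1..2*k+1} - {q, \<pi> (\<rho> 0), \<pi> (\<rho> 1), \<pi> (\<rho> 2), \<pi> (\<rho> 3)}"
    obtain j where j: "j < 2*k+1" "l = \<pi> j" using l \<pi>(2) by blast
    have "j \<noteq> i" "j \<noteq> \<rho> 0" "j \<noteq> \<rho> 1" "j \<noteq> \<rho> 2" "j \<noteq> \<rho> 3" using l j i by auto
    then have "\<rho> 3 \<le> j" by (auto simp: \<rho>_def split: if_splits)
    then show "bracket (m l) \<le> bracket (m (\<pi> (\<rho> 3)))" using \<pi>(4) j by blast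
  qed
qed

text \<open>For \<open>d = 1\<close> the quadrics have boundedly many points, so any positive
  exponent \<open>\<eta>\<close> is enough on the two largest variables. The budget says that
  \<open>t\<close> lies at least \<open>\<eta>\<close> above
  \<open>1 / 2 - 1 / (2 * k)\<close>.\<close>

lemma estimate_nonresonant_1:
  fixes t \<eta> :: real
  assumes k: "k \<ge> 2" and q: "q \<in> {1..2*k+1}" and d: "CARD('d) = 1" and \<eta>: "\<eta> > 0" "\<eta> \<le> t" "t \<le> 1 / 2 + \<eta>"
    "2 * \<eta> + real (2 * k - 2) * (1 / 2 + \<eta>) \<le> real (2 * k) * t"
    and \<E>: "\<And>E. E \<in> \<E> \<Longrightarrow> \<exists>R \<mu>. size_order R \<and> E \<subseteq> phase_set k \<mu> - (res1 R k \<union> res2 R k)"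
  shows "estimate k \<E> (lnorm top 0) (\<lambda>\<omega>. lnorm top 0 (\<omega> q) * (\<Prod>l\<in>{1..2*k+1} - {q}. lnorm 2 t (\<omega> l :: int ^ 'd \<Rightarrow> complex)))"
proof -
  let ?I = "{1..2*k+1}"
  define C where "C = {(a, b). {a, b} \<subseteq> ?I - {q} \<and> distinct [q, a, b]}"
  define T where "T = (\<lambda>(a, b). {a, b :: nat})"
  define D where "D = (\<lambda>(a, b). {m :: nat \<Rightarrow> int ^ 'd. (sg a = sg q \<or> m a \<noteq> m q) \<and> (sg b = sg q \<or> m b \<noteq> m q)})"
  show ?thesis
  proof (rule estimate_schur_sum[where \<alpha> = \<eta> and \<beta> = "1 / 2 + \<eta>" and C = C and T = T and D = D])
    show "finite C" by (rule finite_subset[of _ "?I \<times> ?I"]) (auto simp: C_def)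
    show "bounded_form (insert q (T c)) (T c) (phs sg :: nat \<Rightarrow> int ^ 'd \<Rightarrow> (int ^ 'd) \<times> int) UNIV
       (\<lambda>m. indicator (D c) m * (\<Prod>l\<in>T c. wt (- \<eta>) (m l)))" if c: "c \<in> C" for c
    proof -
      obtain a b where ab: "c = (a, b)" by (cases c)
      have dist: "distinct [q, a, b]" using c by (auto simp: C_def ab)
      have "(\<lambda>m. indicator (D c) m * (\<Prod>l\<in>T c. wt (- \<eta>) (m l :: int ^ 'd))) =
        (\<lambda>m. indicator {m. (sg a = sg q \<or> m a \<noteq> m q) \<and> (sg b = sg q \<or> m b \<noteq> m q)} m * (wt (- \<eta>) (m a) * wt (- \<eta>) (m b)))"
        using dist by (simp add: D_def T_def ab)
      moreover have "bounded_form {q, a, b} {a, b} (phs sg :: nat \<Rightarrow> int ^ 'd \<Rightarrow> (int ^ 'd) \<times> int) UNIV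
        (\<lambda>m. indicator {m. (sg a = sg q \<or> m a \<noteq> m q) \<and> (sg b = sg q \<or> m b \<noteq> m q)} m * (wt (- \<eta>) (m a) * wt (- \<eta>) (m b)))"
        by (rule bounded_form_schur[OF dist sg_cases]) (use \<eta> d in auto)
      ultimately show ?thesis by (simp add: T_def ab)
    qed
    show "\<exists>c\<in>C. m \<in> D c \<and> (\<forall>a\<in>T c. \<forall>l\<in>?I - {q} - T c. bracket (m l) \<le> bracket (m a))"
      if E: "E \<in> \<E>" "m \<in> E" "m \<in> XS ?I (lin sg) n" for E n and m :: "nat \<Rightarrow> int ^ 'd"
    proof -
      obtain R where R: "size_order R" "m \<notin> res1 R k \<union> res2 R k" using \<E>[OF E(1)] E(2) by blast
      have "m \<in> tuples k" using E(3) altsum_XS[of k n] by blast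
      from res_complement_top[OF R this k q] obtain a b c e where abc: "distinct [q, a, b, c, e]" "{a, b, c, e} \<subseteq> ?I - {q}" "m a \<noteq> m q" "m b \<noteq> m q"
        "bracket (m b) \<le> bracket (m a)" "bracket (m c) \<le> bracket (m b)" "bracket (m e) \<le> bracket (m c)"
        "\<And>l. l \<in> ?I - {q, a, b, c, e} \<Longrightarrow> bracket (m l) \<le> bracket (m e)" by (metis (no_types, lifting))
      have "bracket (m l) \<le> bracket (m b)" if "l \<in> ?I - {q} - {a, b}" for l
        using abc(5-7) abc(8)[of l] that by (cases "l = c \<or> l = e") auto
      then have "\<forall>a'\<in>{a, b}. \<forall>l\<in>?I - {q} - {a, b}. bracket (m l) \<le> bracket (m a')" using abc(5) by force
      then show ?thesis using abc(1-4) by (intro bexI[of _ "(a, b)"]) (auto simp: T_def D_def C_def)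
    qed
    show "\<exists>\<mu>. E \<subseteq> phase_set k \<mu>" if "E \<in> \<E>" for E using \<E>[OF that] by blast
    fix c assume c: "c \<in> C"
    then have "card (T c) = 2" by (auto simp: T_def C_def)
    then show "real (card (T c)) * \<eta> + real (2 * k - card (T c)) * (1 / 2 + \<eta>) \<le> real (2 * k) * t" using \<eta>(4) by simp
    show "m(j := x) \<in> D c \<longleftrightarrow> m \<in> D c" if "j \<notin> insert q (T c)" for m j x
      using that by (cases c) (simp add: T_def D_def)
  qed (use q \<eta> d in \<open>auto simp: C_def T_def\<close>)
qed

text \<open>Four large variables with exponent \<open>1 / 2 + \<eta>\<close> and the rest with
  \<open>1 + \<eta>\<close>: the budget says that \<open>t\<close> lies at least
  \<open>\<eta>\<close> above \<open>1 - 1 / k\<close>, which is \<open>s_crit\<close> for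
  \<open>d = 2\<close>.\<close>

lemma estimate_nonresonant_2:
  fixes t \<eta> :: real
  assumes k: "k \<ge> 2" and q: "q \<in> {1..2*k+1}" and d: "CARD('d) = 2" and \<eta>: "\<eta> > 0" "1 / 2 + \<eta> \<le> t" "t \<le> 1 + \<eta>"
    "4 * (1 / 2 + \<eta>) + real (2 * k - 4) * (1 + \<eta>) \<le> real (2 * k) * t"
    and \<E>: "\<And>E. E \<in> \<E> \<Longrightarrow> \<exists>R \<mu>. size_order R \<and> E \<subseteq> phase_set k \<mu> - (res1 R k \<union> res2 R k)"
  shows "estimate k \<E> (lnorm top 0) (\<lambda>\<omega>. lnorm top 0 (\<omega> q) * (\<Prod>l\<in>{1..2*k+1} - {q}. lnorm 2 t (\<omega> l :: int ^ 'd \<Rightarrow> complex)))"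
proof -
  let ?I = "{1..2*k+1}"
  define C where "C = {(a, b, c, e). {a, b, c, e} \<subseteq> ?I - {q} \<and> distinct [q, a, b, c, e]}"
  define T where "T = (\<lambda>(a, b, c, e). {a, b, c, e :: nat})"
  define D where "D = (\<lambda>(a, b, c, e). {m :: nat \<Rightarrow> int ^ 'd. m a \<noteq> m q \<and> m b \<noteq> m q \<and> bracket (m c) \<le> bracket (m b) \<and> bracket (m e) \<le> bracket (m a)})"
  show ?thesis
  proof (rule estimate_schur_sum[where \<alpha> = "1 / 2 + \<eta>" and \<beta> = "1 + \<eta>" and C = C and T = T and D = D])
    show "finite C" by (rule finite_subset[of _ "?I \<times> ?I \<times> ?I \<times> ?I"]) (auto simp: C_def)
    show "bounded_form (insert q (T c)) (T c) (phs sg :: nat \<Rightarrow> int ^ 'd \<Rightarrow> (int ^ 'd) \<times> int) UNIV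
       (\<lambda>m. indicator (D c) m * (\<Prod>l\<in>T c. wt (- (1 / 2 + \<eta>)) (m l)))" if c: "c \<in> C" for c
    proof -
      obtain a b c' e where ab: "c = (a, b, c', e)" by (cases c)
      have dist: "distinct [q, a, b, c', e]" using c by (auto simp: C_def ab)
      show ?thesis unfolding ab T_def D_def prod.case
        by (rule bounded_form_schur2[OF dist sg_cases]) (use \<eta> d in auto)
    qed
    show "\<exists>c\<in>C. m \<in> D c \<and> (\<forall>a\<in>T c. \<forall>l\<in>?I - {q} - T c. bracket (m l) \<le> bracket (m a))"
      if E: "E \<in> \<E>" "m \<in> E" "m \<in> XS ?I (lin sg) n" for E n and m :: "nat \<Rightarrow> int ^ 'd"
    proof -
      obtain R where R: "size_order R" "m \<notin> res1 R k \<union> res2 R k" using \<E>[OF E(1)] E(2) by blast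
      have "m \<in> tuples k" using E(3) altsum_XS[of k n] by blast
      from res_complement_top[OF R this k q] obtain a b c e where abc: "distinct [q, a, b, c, e]" "{a, b, c, e} \<subseteq> ?I - {q}" "m a \<noteq> m q" "m b \<noteq> m q"
        "bracket (m b) \<le> bracket (m a)" "bracket (m c) \<le> bracket (m b)" "bracket (m e) \<le> bracket (m c)"
        "\<And>l. l \<in> ?I - {q, a, b, c, e} \<Longrightarrow> bracket (m l) \<le> bracket (m e)" by (metis (no_types, lifting))
      have "bracket (m l) \<le> bracket (m a')" if "l \<in> ?I - {q} - {a, b, c, e}" "a' \<in> {a, b, c, e}" for l a'
        using abc(5-7) abc(8)[of l] that by auto
      then show ?thesis using abc(1-7) by (intro bexI[of _ "(a, b, c, e)"]) (auto simp: T_def D_def C_def)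
    qed
    show "\<exists>\<mu>. E \<subseteq> phase_set k \<mu>" if "E \<in> \<E>" for E using \<E>[OF that] by blast
    fix c assume c: "c \<in> C"
    then have "card (T c) = 4" by (auto simp: T_def C_def)
    then show "real (card (T c)) * (1 / 2 + \<eta>) + real (2 * k - card (T c)) * (1 + \<eta>) \<le> real (2 * k) * t" using \<eta>(4) by simp
    show "m(j := x) \<in> D c \<longleftrightarrow> m \<in> D c" if "j \<notin> insert q (T c)" for m j x
      using that by (cases c) (simp add: T_def D_def)
  qed (use q \<eta> d in \<open>auto simp: C_def T_def\<close>)
qed

text \<open>The indices 1 and 3 have the same sign, so a degenerate hyperplane can arise only from
  \<open>m 2 = m 1\<close> or \<open>m 2 = m 3\<close>, and these are excluded. The condition on
  \<open>t\<close> is the one of \<open>sum_wt_quadric\<close>.\<close>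

lemma estimate_nonresonant_cubic:
  fixes t :: real
  assumes q: "q \<in> {1..3}" and t: "2 * t > real CARD('d) - 1"
    and \<E>: "\<And>E. E \<in> \<E> \<Longrightarrow> \<exists>\<mu>. E \<subseteq> phase_set 1 \<mu> - {m \<in> tuples 1. m 2 = m 1 \<or> m 2 = m 3}"
  shows "estimate 1 \<E> (lnorm top 0) (\<lambda>\<omega>. lnorm top 0 (\<omega> q) * (\<Prod>l\<in>{1..2*1+1} - {q}. lnorm 2 t (\<omega> l :: int ^ 'd \<Rightarrow> complex)))"
proof -
  obtain a b where ab: "distinct [q, a, b]" "{1..2*1+1} = {q, a, b}"
  proof -
    have I: "{1..2*1+1} = {1, 2, 3 :: nat}" by auto
    consider "q = 1" | "q = 2" | "q = 3" using q by fastforce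
    then show thesis by cases (rule that[of 2 3] that[of 1 3] that[of 1 2]; auto)+
  qed
  let ?D = "{m :: nat \<Rightarrow> int ^ 'd. (sg a = sg q \<or> m a \<noteq> m q) \<and> (sg b = sg q \<or> m b \<noteq> m q)}"
  have L: "{1..2*1+1} - {q} = {a, b}" using ab by auto
  show ?thesis
  \<comment> \<open>No variable lies outside \<open>{a, b}\<close>, so any
    \<open>\<beta> \<ge> t\<close> above \<open>d / 2\<close> will do.\<close>
  proof (rule estimate_schur_sum[where \<alpha> = t and \<beta> = "max t (real CARD('d))" and C = "{()}" and T = "\<lambda>_. {a, b}" and D = "\<lambda>_. ?D"])
    have "bounded_form {q, a, b} {a, b} (phs sg :: nat \<Rightarrow> int ^ 'd \<Rightarrow> (int ^ 'd) \<times> int) UNIV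
        (\<lambda>m. indicator ?D m * (wt (- t) (m a) * wt (- t) (m b)))"
      by (rule bounded_form_schur[OF ab(1) sg_cases t])
    then show "bounded_form (insert q {a, b}) {a, b} (phs sg :: nat \<Rightarrow> int ^ 'd \<Rightarrow> (int ^ 'd) \<times> int) UNIV
        (\<lambda>m. indicator ?D m * (\<Prod>l\<in>{a, b}. wt (- t) (m l)))" using ab(1) by simp
    show "\<exists>c\<in>{()}. m \<in> ?D \<and> (\<forall>a'\<in>{a, b}. \<forall>l\<in>{1..2*1+1} - {q} - {a, b}. bracket (m l) \<le> bracket (m a'))"
      if E: "E \<in> \<E>" "m \<in> E" "m \<in> XS {1..2*1+1} (lin sg) n" for E n and m :: "nat \<Rightarrow> int ^ 'd"
    proof -
      have "m \<in> tuples 1" using E(3) altsum_XS[of 1 n] by blast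
      then have neq: "m 2 \<noteq> m 1" "m 2 \<noteq> m 3" using \<E>[OF E(1)] E(2) by blast+
      have odd: "sg l = sg l'" if "l \<in> {1, 3}" "l' \<in> {1, 3}" for l l' using that by (auto simp: sg_def)
      have I: "{1..2*1+1} = {1, 2, 3 :: nat}" by auto
      have "sg x = sg q \<or> m x \<noteq> m q" if "x \<in> {1, 2, 3}" for x
      proof (cases "x \<in> {1, 3} \<and> q \<in> {1, 3} \<or> x = q")
        case True then show ?thesis using odd by auto
      next
        case False
        then have "(x = 2 \<and> q \<in> {1, 3}) \<or> (q = 2 \<and> x \<in> {1, 3})" using that ab(2) unfolding I by blast
        then show ?thesis using neq by auto
      qed
      then have "m \<in> ?D" using ab(2) unfolding I by blast
      then show ?thesis unfolding L by simp
    qed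
    show "2 * max t (real CARD('d)) > real CARD('d)" using zero_less_card_finite[where 'a = 'd] by (simp add: max_def)
    show "q \<in> {1..2*1+1}" using q by simp
    have "card {a, b} = 2" using ab(1) by simp
    then show "real (card {a, b}) * t + real (2 * 1 - card {a, b}) * max t (real CARD('d)) \<le> real (2 * 1) * t" by simp
    show "\<exists>\<mu>. E \<subseteq> phase_set 1 \<mu>" if "E \<in> \<E>" for E using \<E>[OF that] by blast
  qed (use L in auto)
qed

section \<open>Interpolation\<close>

lemma lnorm_cong:
  assumes "\<And>x. bracket x powr s * cmod (f x) = bracket x powr s' * cmod (g x)"
  shows "lnorm p s f = lnorm p s' g"
  using assms unfolding lnorm_def by simp

lemma lnorm_ennreal:
  assumes "\<rho> > 0" "I = esum UNIV (\<lambda>n. ennreal ((bracket n powr s * cmod (\<omega> n)) powr \<rho>))"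
  shows "lnorm (ennreal \<rho>) s \<omega> = (if I = top then top else ennreal (enn2real I powr (1 / \<rho>)))"
  using assms by (simp add: lnorm_def Let_def)

lemma lnorm_ennreal_le:
  assumes \<rho>: "\<rho> > 0" and B: "B \<ge> 0"
    and le: "esum UNIV (\<lambda>n. ennreal ((bracket n powr s * cmod (\<omega> n)) powr \<rho>)) \<le> ennreal (B powr \<rho>)"
  shows "lnorm (ennreal \<rho>) s \<omega> \<le> ennreal B"
proof -
  define I where "I = esum UNIV (\<lambda>n. ennreal ((bracket n powr s * cmod (\<omega> n)) powr \<rho>))"
  have "I \<noteq> top" using le unfolding I_def[symmetric] by (auto simp: top_unique)
  moreover have "enn2real I \<le> B powr \<rho>" using le unfolding I_def[symmetric] by (intro enn2real_leI) auto
  then have "enn2real I powr (1 / \<rho>) \<le> (B powr \<rho>) powr (1 / \<rho>)" using \<rho> by (intro powr_mono2) auto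
  then have "enn2real I powr (1 / \<rho>) \<le> B" using \<rho> B by (simp add: powr_powr)
  ultimately show ?thesis using lnorm_ennreal[OF \<rho> I_def] by (simp add: ennreal_leI)
qed

lemma esum_lnorm_ennreal:
  assumes \<rho>: "\<rho> > 0" and u: "lnorm (ennreal \<rho>) s \<omega> = ennreal u" "u \<ge> 0"
  shows "esum UNIV (\<lambda>n. ennreal ((bracket n powr s * cmod (\<omega> n)) powr \<rho>)) = ennreal (u powr \<rho>)"
proof -
  define I where "I = esum UNIV (\<lambda>n. ennreal ((bracket n powr s * cmod (\<omega> n)) powr \<rho>))"
  have I: "I \<noteq> top" using lnorm_ennreal[OF \<rho> I_def] u by (auto split: if_splits)
  then have "ennreal (enn2real I powr (1 / \<rho>)) = ennreal u" using lnorm_ennreal[OF \<rho> I_def] u by simp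
  then have "enn2real I powr (1 / \<rho>) = u" using u(2) by simp
  then have "u powr \<rho> = enn2real I" using \<rho> by (auto simp: powr_powr)
  then show ?thesis using I unfolding I_def[symmetric] by (simp add: less_top)
qed

lemma lnorm_eq_0D:
  assumes \<rho>: "\<rho> > 0" and u: "lnorm (ennreal \<rho>) s \<omega> = 0"
  shows "\<omega> x = 0"
proof -
  have "ennreal ((bracket x powr s * cmod (\<omega> x)) powr \<rho>) \<le> 0"
    using nn_integral_ge_point[of x UNIV "\<lambda>n. ennreal ((bracket n powr s * cmod (\<omega> n)) powr \<rho>)"]
      esum_lnorm_ennreal[OF \<rho>, of s \<omega> 0] u \<rho> by simp
  then show ?thesis by (simp add: ennreal_eq_0_iff)
qed

lemma lnorm_zero: "\<rho> > 0 \<Longrightarrow> lnorm (ennreal \<rho>) s (\<lambda>_. 0) = 0"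
  using lnorm_ennreal_le[of \<rho> 0 s "\<lambda>_. 0"] by simp

lemma multisum_zero:
  assumes "l \<in> {1..2*k+1}" "\<And>x. \<omega> l x = 0"
  shows "converges k E \<omega>" "multisum k E \<omega> = (\<lambda>_. 0)"
proof -
  have "(\<Prod>l=1..2*k+1. \<omega> l (m l)) = 0" for m by (intro prod_zero bexI[of _ l]) (use assms in simp_all)
  then have "summand k E \<omega> m = 0" for m by (simp only: summand_def mult_zero_right)
  then show "converges k E \<omega>" "multisum k E \<omega> = (\<lambda>_. 0)" by (simp_all add: converges_def multisum_def fun_eq_iff)
qed

lemma habs_eq_esum:
  "habs k E (\<lambda>l. eabs (\<omega> l)) n = esum {m \<in> tuples k. altsum k m = n} (\<lambda>m. ennreal (norm (summand k E \<omega> m)))"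
  unfolding habs_def altsum_XS by (simp only: norm_summand)

text \<open>For nonnegative functions nothing cancels. An estimate, which only speaks about
  \<open>multisum\<close>, thus controls the sum of the moduli.\<close>

lemma eabs_multisum_nonneg:
  assumes f: "\<And>l x. f l x \<ge> 0" and c: "converges k E (\<lambda>l x. complex_of_real (f l x))"
  shows "esum {m \<in> tuples k. altsum k m = n} (\<lambda>m. ennreal (norm (summand k E (\<lambda>l x. complex_of_real (f l x)) m)))
    = eabs (multisum k E (\<lambda>l x. complex_of_real (f l x))) n"
proof -
  let ?X = "{m \<in> tuples k. altsum k m = n}"
  define g where "g m = norm (summand k E (\<lambda>l x. complex_of_real (f l x)) m)" for m
  have sg: "summand k E (\<lambda>l x. complex_of_real (f l x)) m = of_real (g m)" for m
  proof -
    have "summand k E (\<lambda>l x. complex_of_real (f l x)) m = of_real (indicator E m * (\<Prod>l=1..2*k+1. f l (m l)))"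
      unfolding summand_def by (simp only: of_real_mult of_real_prod indicator_def of_bool_def) simp
    moreover have "indicator E m * (\<Prod>l=1..2*k+1. f l (m l)) \<ge> 0"
      by (intro mult_nonneg_nonneg prod_nonneg f) simp
    ultimately show ?thesis unfolding g_def by (simp only: norm_of_real abs_of_nonneg)
  qed
  have s: "g summable_on ?X" using c unfolding converges_def g_def by blast
  then have "((\<lambda>m. complex_of_real (g m)) has_sum of_real (infsum g ?X)) ?X"
    by (intro has_sum_of_real has_sum_infsum)
  then have m: "multisum k E (\<lambda>l x. complex_of_real (f l x)) n = of_real (infsum g ?X)"
    unfolding multisum_def sg by (rule infsumI)
  have abs: "Infinite_Set_Sum.abs_summable_on g ?X"
  proof -
    have "norm (g m) = g m" for m by (simp add: g_def)
    then have "(\<lambda>m. norm (g m)) summable_on ?X" using s by presburger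
    then show ?thesis unfolding abs_summable_equivalent .
  qed
  have "esum ?X (\<lambda>m. ennreal (g m)) = ennreal (infsetsum g ?X)"
    by (rule nn_integral_conv_infsetsum[OF abs]) (simp add: g_def)
  also have "infsetsum g ?X = infsum g ?X" by (rule infsetsum_infsum[OF abs])
  finally show ?thesis unfolding m g_def[symmetric] by (simp add: infsum_nonneg g_def)
qed

text \<open>Hoelder's inequality, obtained termwise from Young's inequality after normalising by
  \<open>B0\<close> and \<open>B1\<close>; the case of a vanishing bound is separate because of the
  division.\<close>

lemma esum_Holder_le:
  fixes p0 p1 :: "'a \<Rightarrow> real"
  assumes \<theta>: "0 < \<theta>" "\<theta> < 1" and p: "\<And>m. p0 m \<ge> 0" "\<And>m. p1 m \<ge> 0" and B: "B0 \<ge> 0" "B1 \<ge> 0"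
    and le: "esum X (\<lambda>m. ennreal (p0 m)) \<le> ennreal B0" "esum X (\<lambda>m. ennreal (p1 m)) \<le> ennreal B1"
  shows "esum X (\<lambda>m. ennreal (p0 m powr (1 - \<theta>) * p1 m powr \<theta>)) \<le> ennreal (B0 powr (1 - \<theta>) * B1 powr \<theta>)"
proof (cases "B0 = 0 \<or> B1 = 0")
  case True
  have "p0 m powr (1 - \<theta>) * p1 m powr \<theta> = 0" if m: "m \<in> X" for m
  proof -
    have "ennreal (p0 m) \<le> ennreal B0" "ennreal (p1 m) \<le> ennreal B1"
      using nn_integral_ge_point[OF m, of "\<lambda>m. ennreal (p0 m)"] nn_integral_ge_point[OF m, of "\<lambda>m. ennreal (p1 m)"] le by (auto intro: order_trans)
    then have "p0 m = 0 \<or> p1 m = 0" using True B p[of m] by (auto simp: ennreal_le_iff)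
    then show ?thesis by auto
  qed
  then have "esum X (\<lambda>m. ennreal (p0 m powr (1 - \<theta>) * p1 m powr \<theta>)) = esum X (\<lambda>m. 0)"
    by (intro esum_cong) simp
  then show ?thesis by simp
next
  case False
  then have B: "B0 > 0" "B1 > 0" using B by auto
  define D where "D = B0 powr (1 - \<theta>) * B1 powr \<theta>"
  have D: "D > 0" using B by (simp add: D_def)
  have "p0 m powr (1 - \<theta>) * p1 m powr \<theta> \<le> D * ((1 - \<theta>) / B0) * p0 m + D * (\<theta> / B1) * p1 m" for m
  proof (cases "p0 m = 0 \<or> p1 m = 0")
    case True
    then have "p0 m powr (1 - \<theta>) * p1 m powr \<theta> = 0" by auto
    also have "\<dots> \<le> D * ((1 - \<theta>) / B0) * p0 m + D * (\<theta> / B1) * p1 m"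
      using p[of m] D B \<theta> by (intro add_nonneg_nonneg mult_nonneg_nonneg divide_nonneg_nonneg) auto
    finally show ?thesis .
  next
    case False
    then have pp: "p0 m / B0 > 0" "p1 m / B1 > 0" using p[of m] B by (auto simp: less_le)
    have "(p0 m / B0) powr (1 - \<theta>) * (p1 m / B1) powr \<theta> \<le> (1 - \<theta>) * (p0 m / B0) + \<theta> * (p1 m / B1)"
      by (rule Youngs_inequality_0[OF _ _ _ pp]) (use \<theta> in auto)
    moreover have "(p0 m / B0) powr (1 - \<theta>) * (p1 m / B1) powr \<theta> = (p0 m powr (1 - \<theta>) * p1 m powr \<theta>) / D"
      using p[of m] B by (simp add: powr_divide D_def)
    ultimately have "p0 m powr (1 - \<theta>) * p1 m powr \<theta> \<le> D * ((1 - \<theta>) * (p0 m / B0) + \<theta> * (p1 m / B1))"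
      using D by (simp add: divide_le_eq mult.commute)
    then show ?thesis by (simp add: algebra_simps)
  qed
  then have "esum X (\<lambda>m. ennreal (p0 m powr (1 - \<theta>) * p1 m powr \<theta>))
    \<le> esum X (\<lambda>m. ennreal (D * ((1 - \<theta>) / B0)) * ennreal (p0 m) + ennreal (D * (\<theta> / B1)) * ennreal (p1 m))"
    using p D B \<theta> by (intro esum_mono) (simp add: ennreal_mult[symmetric] ennreal_plus[symmetric] del: ennreal_plus)
  also have "\<dots> = ennreal (D * ((1 - \<theta>) / B0)) * esum X (\<lambda>m. ennreal (p0 m)) + ennreal (D * (\<theta> / B1)) * esum X (\<lambda>m. ennreal (p1 m))"
    by (subst nn_integral_add) (simp_all add: esum_cmult)
  also have "\<dots> \<le> ennreal (D * ((1 - \<theta>) / B0)) * ennreal B0 + ennreal (D * (\<theta> / B1)) * ennreal B1"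
    by (intro add_mono mult_left_mono le) auto
  also have "\<dots> = ennreal (D * ((1 - \<theta>) / B0) * B0 + D * (\<theta> / B1) * B1)"
    using D B \<theta> by (simp add: ennreal_mult[symmetric] ennreal_plus[symmetric] del: ennreal_plus)
  also have "D * ((1 - \<theta>) / B0) * B0 + D * (\<theta> / B1) * B1 = D" using B by (simp add: field_simps)
  finally show ?thesis unfolding D_def .
qed

lemma eabs_le_lnorm_inf: "wt b n * eabs \<omega> n \<le> lnorm top b \<omega>"
  unfolding lnorm_inf by (rule SUP_upper) simp

lemma powr_minus_2: "x \<ge> 0 \<Longrightarrow> \<rho> \<noteq> 0 \<Longrightarrow> x powr (\<rho> - 2) * x\<^sup>2 = x powr \<rho>" for x :: real
proof (cases "x = 0")
  case False
  assume "x \<ge> 0"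
  then have "x powr (\<rho> - 2) * x\<^sup>2 = x powr (\<rho> - 2) * x powr 2" by simp
  also have "\<dots> = x powr \<rho>" by (simp only: powr_add[symmetric]) simp
  finally show ?thesis .
qed simp

text \<open>Of the power \<open>\<rho>\<close> of the modulus, \<open>\<rho> - 2\<close> is bounded
  by the weighted supremum and the remaining square is summed; the condition on
  \<open>\<sigma>\<close> matches the weights.\<close>

lemma estimate_l2_inf:
  assumes e: "estimate k \<E> (lnorm 2 (- a)) A" "estimate k \<E> (lnorm top b) A"
    and \<rho>: "\<rho> > 2" "\<sigma> * \<rho> = - 2 * a + (\<rho> - 2) * b"
  shows "estimate k \<E> (lnorm (ennreal \<rho>) \<sigma>) A"
proof -
  obtain C0 where C0: "C0 > 0" "\<And>E \<omega>. E \<in> \<E> \<Longrightarrow> A \<omega> < top \<Longrightarrow> converges k E \<omega> \<and> lnorm 2 (- a) (multisum k E \<omega>) \<le> ennreal C0 * A \<omega>"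
    using e(1) unfolding estimate_def by blast
  obtain C1 where C1: "C1 > 0" "\<And>E \<omega>. E \<in> \<E> \<Longrightarrow> A \<omega> < top \<Longrightarrow> converges k E \<omega> \<and> lnorm top b (multisum k E \<omega>) \<le> ennreal C1 * A \<omega>"
    using e(2) unfolding estimate_def by blast
  define C where "C = max C0 C1"
  have C: "C > 0" "C0 \<le> C" "C1 \<le> C" using C0(1) by (auto simp: C_def)
  have "converges k E \<omega> \<and> lnorm (ennreal \<rho>) \<sigma> (multisum k E \<omega>) \<le> ennreal C * A \<omega>" if E: "E \<in> \<E>" "A \<omega> < top" for E \<omega>
  proof -
    obtain B where B: "A \<omega> = ennreal B" "B \<ge> 0" using E(2) by (cases "A \<omega>") auto
    let ?F = "multisum k E \<omega>"
    have le: "ennreal C0 * A \<omega> \<le> ennreal (C * B)" "ennreal C1 * A \<omega> \<le> ennreal (C * B)"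
      using C(1) B C(2,3) by (simp_all add: ennreal_mult mult_right_mono ennreal_leI)
    have "lnorm 2 (- a) ?F \<le> ennreal (C * B)" using C0(2)[OF E] le(1) by (blast intro: order_trans)
    then have "n2 (\<lambda>x. wt (- a) x * eabs ?F x) \<le> (ennreal (C * B))\<^sup>2" unfolding lnorm_2[symmetric] by (rule power_mono) simp
    then have 0: "esum UNIV (\<lambda>x. (wt (- a) x * eabs ?F x)\<^sup>2) \<le> ennreal ((C * B)\<^sup>2)" using C B by (simp add: n2_def ennreal_power)
    have "lnorm top b ?F \<le> ennreal (C * B)" using C1(2)[OF E] le(2) by (blast intro: order_trans)
    then have "wt b n * eabs ?F n \<le> ennreal (C * B)" for n using eabs_le_lnorm_inf order_trans by blast
    then have 1: "bracket n powr b * cmod (?F n) \<le> C * B" for n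
      using C B by (simp add: wt_def ennreal_mult[symmetric] ennreal_le_iff)
    have pt: "ennreal ((bracket n powr \<sigma> * cmod (?F n)) powr \<rho>) \<le> ennreal ((C * B) powr (\<rho> - 2)) * (wt (- a) n * eabs ?F n)\<^sup>2" for n
    proof -
      have "(bracket n powr \<sigma> * cmod (?F n)) powr \<rho> = bracket n powr (\<sigma> * \<rho>) * (cmod (?F n) powr (\<rho> - 2) * (cmod (?F n))\<^sup>2)"
        using \<rho>(1) by (simp add: powr_minus_2 powr_mult powr_powr)
      also have "bracket n powr (\<sigma> * \<rho>) = (bracket n powr (- a))\<^sup>2 * (bracket n powr b) powr (\<rho> - 2)"
        unfolding \<rho>(2) by (simp add: powr_add powr_powr power2_eq_square mult.commute powr_add[symmetric])
      also have "(bracket n powr (- a))\<^sup>2 * (bracket n powr b) powr (\<rho> - 2) * (cmod (?F n) powr (\<rho> - 2) * (cmod (?F n))\<^sup>2)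
        = (bracket n powr b * cmod (?F n)) powr (\<rho> - 2) * (bracket n powr (- a) * cmod (?F n))\<^sup>2"
        by (simp add: powr_mult power_mult_distrib mult_ac)
      also have "\<dots> \<le> (C * B) powr (\<rho> - 2) * (bracket n powr (- a) * cmod (?F n))\<^sup>2"
        using \<rho>(1) 1 by (intro mult_right_mono powr_mono2) auto
      finally show ?thesis by (simp add: wt_def ennreal_mult[symmetric] ennreal_power ennreal_leI)
    qed
    have "esum UNIV (\<lambda>n. ennreal ((bracket n powr \<sigma> * cmod (?F n)) powr \<rho>)) \<le> ennreal ((C * B) powr (\<rho> - 2)) * esum UNIV (\<lambda>x. (wt (- a) x * eabs ?F x)\<^sup>2)"
      unfolding esum_cmult[symmetric] by (rule esum_mono[OF pt])
    also have "\<dots> \<le> ennreal ((C * B) powr (\<rho> - 2)) * ennreal ((C * B)\<^sup>2)" by (rule mult_left_mono[OF 0]) simp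
    also have "\<dots> = ennreal ((C * B) powr \<rho>)"
      using \<rho>(1) C B by (subst ennreal_mult[symmetric]) (simp_all add: powr_minus_2)
    finally have "lnorm (ennreal \<rho>) \<sigma> ?F \<le> ennreal (C * B)" using \<rho> C B by (intro lnorm_ennreal_le) auto
    then show ?thesis using C0(2)[OF E] B C by (simp add: ennreal_mult)
  qed
  then show ?thesis unfolding estimate_def using C(1) by blast
qed

text \<open>The kernel is an indicator, so complex interpolation can be avoided. For given
  \<open>\<omega>\<close> each modulus is factorised as
  \<open>h0 powr (1 - \<theta>) * h1 powr \<theta>\<close>; Hoelder's inequality for fixed
  \<open>n\<close> bounds the sum by the two endpoint sums, of which the first is square summable
  and the second bounded in \<open>n\<close>.\<close>

lemma estimate_interpolate:
  fixes c t0 t1 \<theta> :: real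
  assumes q: "q \<in> {1..2*k+1}" and \<theta>: "0 < \<theta>" "\<theta> < 1"
    and e0: "estimate k \<E> (lnorm 2 (- c)) (\<lambda>\<omega>. lnorm 2 (- c) (\<omega> q) * (\<Prod>l\<in>{1..2*k+1} - {q}. lnorm 2 t0 (\<omega> l :: int ^ 'd \<Rightarrow> complex)))"
    and e1: "estimate k \<E> (lnorm top 0) (\<lambda>\<omega>. lnorm top 0 (\<omega> q) * (\<Prod>l\<in>{1..2*k+1} - {q}. lnorm 2 t1 (\<omega> l)))"
    and \<rho>: "(1 - \<theta>) * \<rho> = 2" and \<sigma>: "\<sigma> = - (1 - \<theta>) * c" and t: "t = (1 - \<theta>) * t0 + \<theta> * t1"
  shows "estimate k \<E> (lnorm (ennreal \<rho>) \<sigma>) (\<lambda>\<omega>. lnorm (ennreal \<rho>) \<sigma> (\<omega> q) * (\<Prod>l\<in>{1..2*k+1} - {q}. lnorm 2 t (\<omega> l)))"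
proof -
  let ?L = "{1..2*k+1} - {q}"
  obtain C0 where C0: "C0 > 0" "\<And>E \<omega>. E \<in> \<E> \<Longrightarrow> lnorm 2 (- c) (\<omega> q) * (\<Prod>l\<in>?L. lnorm 2 t0 (\<omega> l)) < top \<Longrightarrow>
      converges k E \<omega> \<and> lnorm 2 (- c) (multisum k E \<omega>) \<le> ennreal C0 * (lnorm 2 (- c) (\<omega> q) * (\<Prod>l\<in>?L. lnorm 2 t0 (\<omega> l)))"
    using e0 unfolding estimate_def by blast
  obtain C1 where C1: "C1 > 0" "\<And>E \<omega>. E \<in> \<E> \<Longrightarrow> lnorm top 0 (\<omega> q) * (\<Prod>l\<in>?L. lnorm 2 t1 (\<omega> l)) < top \<Longrightarrow>
      converges k E \<omega> \<and> lnorm top 0 (multisum k E \<omega>) \<le> ennreal C1 * (lnorm top 0 (\<omega> q) * (\<Prod>l\<in>?L. lnorm 2 t1 (\<omega> l)))"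
    using e1 unfolding estimate_def by blast
  have \<rho>0: "\<rho> > 0" using \<rho> \<theta> by (metis diff_gt_0_iff_gt zero_less_mult_pos zero_less_numeral)
  define C where "C = C0 powr (1 - \<theta>) * C1 powr \<theta>"
  have C: "C > 0" using C0 C1 by (simp add: C_def)
  have "converges k E \<omega> \<and> lnorm (ennreal \<rho>) \<sigma> (multisum k E \<omega>) \<le> ennreal C * (lnorm (ennreal \<rho>) \<sigma> (\<omega> q) * (\<Prod>l\<in>?L. lnorm 2 t (\<omega> l)))"
    if E: "E \<in> \<E>" and fin: "lnorm (ennreal \<rho>) \<sigma> (\<omega> q) * (\<Prod>l\<in>?L. lnorm 2 t (\<omega> l)) < top" for E \<omega>
  \<comment> \<open>If one factor vanishes, the others may be infinite although the product is
    finite. But then some \<open>\<omega> l\<close> is identically zero.\<close>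
  proof (cases "lnorm (ennreal \<rho>) \<sigma> (\<omega> q) = 0 \<or> (\<Prod>l\<in>?L. lnorm 2 t (\<omega> l)) = 0")
    case True
    have "\<exists>l\<in>{1..2*k+1}. \<forall>x. \<omega> l x = 0"
    proof (cases "lnorm (ennreal \<rho>) \<sigma> (\<omega> q) = 0")
      case True then show ?thesis using q lnorm_eq_0D[OF \<rho>0] by blast
    next
      case False
      then have "(\<Prod>l\<in>?L. lnorm 2 t (\<omega> l)) = 0" using True by blast
      then have "\<exists>l\<in>?L. lnorm 2 t (\<omega> l) = 0" unfolding ennreal_prod_eq_0 by blast
      then obtain l where l: "l \<in> ?L" "lnorm 2 t (\<omega> l) = 0" by blast
      then have "lnorm (ennreal 2) t (\<omega> l) = 0" by simp
      then show ?thesis using l lnorm_eq_0D[of 2] by (metis DiffD1 zero_less_numeral)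
    qed
    then show ?thesis using multisum_zero[of _ k \<omega> E] lnorm_zero[OF \<rho>0] by (metis zero_le)
  next
    case False
    obtain u where u: "lnorm (ennreal \<rho>) \<sigma> (\<omega> q) = ennreal u" "u > 0"
      using False fin by (cases "lnorm (ennreal \<rho>) \<sigma> (\<omega> q)") (auto simp: ennreal_mult_less_top)
    define Q where "Q = (\<Prod>l\<in>?L. lnorm 2 t (\<omega> l))"
    obtain P where "Q = ennreal P" "P > 0"
      using False fin unfolding Q_def[symmetric] by (cases Q) (auto simp: ennreal_mult_less_top)
    then have P: "(\<Prod>l\<in>?L. lnorm 2 t (\<omega> l)) = ennreal P" "P > 0" by (simp_all only: Q_def)
    define v where "v x = bracket x powr \<sigma> * cmod (\<omega> q x)" for x
    \<comment> \<open>For \<open>l \<noteq> q\<close> only weights are moved, so that both endpoint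
      norms equal \<open>lnorm 2 t (\<omega> l)\<close>. At \<open>q\<close> the whole function goes
      into \<open>h0\<close>: the power \<open>\<rho> / 2\<close> turns the
      \<open>\<ell>^\<rho>\<close> norm into an \<open>\<ell>^2\<close> norm, and \<open>h1\<close>
      is 1.\<close>
    define h0 where "h0 l x = (if l = q then v x powr (\<rho> / 2) * bracket x powr c else bracket x powr (t - t0) * cmod (\<omega> l x))" for l x
    define h1 where "h1 l x = (if l = q then 1 else bracket x powr (t - t1) * cmod (\<omega> l x))" for l x
    have h: "h0 l x \<ge> 0" "h1 l x \<ge> 0" for l x by (auto simp: h0_def h1_def v_def)
    let ?h0 = "\<lambda>l x. complex_of_real (h0 l x)" and ?h1 = "\<lambda>l x. complex_of_real (h1 l x)"
    have pw: "bracket x powr a * (bracket x powr (b - a) * y) = bracket x powr b * y" for a b y and x :: "int ^ 'd"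
      by (simp add: powr_diff)
    have ch: "cmod (complex_of_real (h0 l x)) = h0 l x" "cmod (complex_of_real (h1 l x)) = h1 l x" for l x
      using h[of l x] by (simp_all only: norm_of_real abs_of_nonneg)
    have "lnorm 2 t0 (?h0 l) = lnorm 2 t (\<omega> l)" "lnorm 2 t1 (?h1 l) = lnorm 2 t (\<omega> l)" if "l \<in> ?L" for l
      by (rule lnorm_cong, unfold ch, use that in \<open>simp add: h0_def h1_def pw\<close>)+
    then have "(\<Prod>l\<in>?L. lnorm 2 t0 (?h0 l)) = ennreal P" "(\<Prod>l\<in>?L. lnorm 2 t1 (?h1 l)) = ennreal P"
      unfolding P(1)[symmetric] by (auto intro: prod.cong)
    moreover have "lnorm top 0 (?h1 q) = 1" by (simp add: lnorm_inf h1_def)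
    moreover have "lnorm 2 (- c) (?h0 q) = ennreal (u powr (\<rho> / 2))"
    proof -
      have "(wt (- c) x * eabs (?h0 q) x)\<^sup>2 = ennreal (v x powr \<rho>)" for x
      proof -
        have "bracket x powr (- c) * h0 q x = v x powr (\<rho> / 2)" by (simp add: h0_def powr_minus)
        then have "(bracket x powr (- c) * h0 q x)\<^sup>2 = v x powr \<rho>"
          by (simp add: power2_eq_square powr_add[symmetric])
        then show ?thesis using h[of q x] by (simp add: wt_def ennreal_mult[symmetric] ennreal_power)
      qed
      then have "(lnorm 2 (- c) (?h0 q))\<^sup>2 = ennreal (u powr \<rho>)"
        unfolding lnorm_2 n2_def using esum_lnorm_ennreal[OF \<rho>0 u(1)] u(2) by (simp add: v_def)
      also have "u powr \<rho> = (u powr (\<rho> / 2))\<^sup>2" by (simp add: power2_eq_square powr_add[symmetric])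
      also have "ennreal ((u powr (\<rho> / 2))\<^sup>2) = (ennreal (u powr (\<rho> / 2)))\<^sup>2" by (simp add: ennreal_power)
      finally have "(lnorm 2 (- c) (?h0 q))\<^sup>2 = (ennreal (u powr (\<rho> / 2)))\<^sup>2" .
      from this[THEN eq_refl] this[symmetric, THEN eq_refl] show ?thesis
        by (intro antisym) (erule ennreal_power2_le_imp_le)+
    qed
    ultimately have c0: "converges k E ?h0" "lnorm 2 (- c) (multisum k E ?h0) \<le> ennreal (C0 * (u powr (\<rho> / 2) * P))"
      and c1: "converges k E ?h1" "lnorm top 0 (multisum k E ?h1) \<le> ennreal (C1 * P)"
      using C0(2)[OF E, of ?h0] C1(2)[OF E, of ?h1] C0(1) C1(1) P(2) u(2) by (auto simp: ennreal_mult[symmetric])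
    define b0 where "b0 n = cmod (multisum k E ?h0 n)" for n
    have habs: "habs k E (\<lambda>l. eabs (\<omega> l)) n \<le> ennreal (b0 n powr (1 - \<theta>) * (C1 * P) powr \<theta>)" for n
    proof -
      have "norm (summand k E \<omega> m) = norm (summand k E ?h0 m) powr (1 - \<theta>) * norm (summand k E ?h1 m) powr \<theta>" for m
      proof -
        have "cmod (\<omega> l x) = h0 l x powr (1 - \<theta>) * h1 l x powr \<theta>" for l x
        proof (cases "l = q")
          case True
          have "v x powr (\<rho> / 2 * (1 - \<theta>)) = v x" using \<rho> by (simp add: mult.commute v_def)
          then have "h0 l x powr (1 - \<theta>) = v x * bracket x powr (c * (1 - \<theta>))"
            using True by (simp add: h0_def powr_mult powr_powr)
          also have "\<dots> = cmod (\<omega> q x) * (bracket x powr \<sigma> * bracket x powr (c * (1 - \<theta>)))" by (simp add: v_def)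
          also have "\<dots> = cmod (\<omega> q x)" unfolding powr_add[symmetric] \<sigma> by (simp add: algebra_simps)
          finally show ?thesis using True by (simp add: h1_def)
        next
          case False
          then have "h0 l x powr (1 - \<theta>) * h1 l x powr \<theta> = bracket x powr ((t - t0) * (1 - \<theta>) + (t - t1) * \<theta>) * (cmod (\<omega> l x) powr (1 - \<theta>) * cmod (\<omega> l x) powr \<theta>)"
            by (simp add: h0_def h1_def powr_mult powr_powr powr_add mult_ac)
          also have "(t - t0) * (1 - \<theta>) + (t - t1) * \<theta> = 0" unfolding t by (simp add: algebra_simps)
          also have "cmod (\<omega> l x) powr (1 - \<theta>) * cmod (\<omega> l x) powr \<theta> = cmod (\<omega> l x)" by (simp add: powr_add[symmetric])
          finally show ?thesis by simp
        qed
        then have "(\<Prod>l=1..2*k+1. cmod (\<omega> l (m l))) = (\<Prod>l=1..2*k+1. h0 l (m l)) powr (1 - \<theta>) * (\<Prod>l=1..2*k+1. h1 l (m l)) powr \<theta>"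
          using h by (simp only: prod_powr_distrib prod.distrib)
        moreover have "norm (summand k E f m) = indicator E m * (\<Prod>l=1..2*k+1. cmod (f l (m l)))" for f
          by (simp add: summand_def norm_mult prod_norm indicator_def)
        ultimately show ?thesis using h \<theta> by (cases "m \<in> E") simp_all
      qed
      then have "habs k E (\<lambda>l. eabs (\<omega> l)) n = esum {m \<in> tuples k. altsum k m = n}
          (\<lambda>m. ennreal (norm (summand k E ?h0 m) powr (1 - \<theta>) * norm (summand k E ?h1 m) powr \<theta>))"
        unfolding habs_eq_esum by simp
      also have "\<dots> \<le> ennreal (b0 n powr (1 - \<theta>) * (C1 * P) powr \<theta>)"
      proof (rule esum_Holder_le[OF \<theta>])
        show "esum {m \<in> tuples k. altsum k m = n} (\<lambda>m. ennreal (norm (summand k E ?h0 m))) \<le> ennreal (b0 n)"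
          unfolding eabs_multisum_nonneg[OF h(1) c0(1)] by (simp add: b0_def)
        show "esum {m \<in> tuples k. altsum k m = n} (\<lambda>m. ennreal (norm (summand k E ?h1 m))) \<le> ennreal (C1 * P)"
          unfolding eabs_multisum_nonneg[OF h(2) c1(1)] using eabs_le_lnorm_inf[of 0 n "multisum k E ?h1"] c1(2) by simp
      qed (use C1 P in \<open>auto simp: b0_def\<close>)
      finally show ?thesis .
    qed
    then have hfin: "habs k E (\<lambda>l. eabs (\<omega> l)) n < top" for n by (rule le_less_trans) simp
    have conv: "converges k E \<omega>" unfolding converges_def using multisum_le_habs(1)[OF hfin] by blast
    let ?F = "multisum k E \<omega>"
    have F: "cmod (?F n) \<le> b0 n powr (1 - \<theta>) * (C1 * P) powr \<theta>" for n
      using order_trans[OF multisum_le_habs(2)[OF hfin] habs, of n] by (simp add: ennreal_le_iff)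
    have pt: "ennreal ((bracket n powr \<sigma> * cmod (?F n)) powr \<rho>) \<le> ennreal ((C1 * P) powr (\<theta> * \<rho>)) * (wt (- c) n * eabs (multisum k E ?h0) n)\<^sup>2" for n
    proof -
      have "(bracket n powr \<sigma> * cmod (?F n)) powr \<rho> \<le> (bracket n powr \<sigma> * (b0 n powr (1 - \<theta>) * (C1 * P) powr \<theta>)) powr \<rho>"
        using \<rho>0 F by (intro powr_mono2 mult_left_mono) auto
      also have "\<dots> = bracket n powr (\<sigma> * \<rho>) * (b0 n powr ((1 - \<theta>) * \<rho>) * (C1 * P) powr (\<theta> * \<rho>))"
        by (simp add: powr_mult powr_powr)
      also have "\<sigma> * \<rho> = - (((1 - \<theta>) * \<rho>) * c)" unfolding \<sigma> by (simp add: algebra_simps)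
      also have "\<dots> = - c + - c" unfolding \<rho> by simp
      also have "b0 n powr ((1 - \<theta>) * \<rho>) = (b0 n)\<^sup>2" unfolding \<rho> by (simp add: b0_def)
      also have "bracket n powr (- c + - c) * ((b0 n)\<^sup>2 * (C1 * P) powr (\<theta> * \<rho>)) = (C1 * P) powr (\<theta> * \<rho>) * (bracket n powr (- c) * b0 n)\<^sup>2"
        unfolding powr_add by (simp add: power2_eq_square mult_ac)
      finally show ?thesis by (simp add: wt_def b0_def ennreal_mult[symmetric] ennreal_power ennreal_leI)
    qed
    have "esum UNIV (\<lambda>n. ennreal ((bracket n powr \<sigma> * cmod (?F n)) powr \<rho>)) \<le> ennreal ((C1 * P) powr (\<theta> * \<rho>)) * (lnorm 2 (- c) (multisum k E ?h0))\<^sup>2"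
      unfolding lnorm_2 n2_def esum_cmult[symmetric] by (rule esum_mono[OF pt])
    also have "\<dots> \<le> ennreal ((C1 * P) powr (\<theta> * \<rho>)) * (ennreal (C0 * (u powr (\<rho> / 2) * P)))\<^sup>2"
      by (intro mult_left_mono power_mono c0) auto
    also have "\<dots> = ennreal ((C1 * P) powr (\<theta> * \<rho>) * (C0 * (u powr (\<rho> / 2) * P))\<^sup>2)"
      using C0 P by (simp add: ennreal_power ennreal_mult[symmetric])
    also have "(C1 * P) powr (\<theta> * \<rho>) * (C0 * (u powr (\<rho> / 2) * P))\<^sup>2 = (C * (u * P)) powr \<rho>"
    proof -
      have "x\<^sup>2 = x powr ((1 - \<theta>) * \<rho>)" if "x > 0" for x :: real unfolding \<rho> using that by simp
      moreover have "(u powr (\<rho> / 2))\<^sup>2 = u powr \<rho>" by (simp add: power2_eq_square powr_add[symmetric])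
      moreover have "P powr (\<theta> * \<rho>) * P powr ((1 - \<theta>) * \<rho>) = P powr \<rho>" by (simp add: powr_add[symmetric] algebra_simps)
      ultimately show ?thesis using C0(1) P(2)
        by (simp add: C_def powr_mult powr_powr power_mult_distrib mult_ac)
    qed
    finally have "lnorm (ennreal \<rho>) \<sigma> ?F \<le> ennreal (C * (u * P))" using \<rho>0 C u P by (intro lnorm_ennreal_le) auto
    then show ?thesis using conv C u P by (simp add: ennreal_mult)
  qed
  then show ?thesis unfolding estimate_def using C by blast
qed

section \<open>The three ranges of dimension and degree\<close>

text \<open>The output is dominated by the largest input \<open>p\<close>. It takes over the weight
  \<open>b\<close>, which lowers its exponent from \<open>s\<close> to \<open>s - b\<close>, and
  \<open>bounded_form_lin_weights\<close> is applied to the \<open>2 * k + 1\<close> inputs.\<close>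

lemma estimate_inf_weighted:
  fixes b s \<beta> :: real
  assumes "k \<ge> 1" "2 * \<beta> > real CARD('d)" "0 \<le> b" "b \<le> s" "s \<le> \<beta>" "real (2 * k - 1) * \<beta> \<le> real (2 * k + 1) * s - b"
  shows "estimate k (UNIV :: (nat \<Rightarrow> int ^ 'd) set set) (lnorm top b) (\<lambda>\<omega>. \<Prod>l=1..2*k+1. lnorm 2 s (\<omega> l))"
proof (rule estimate_inf_all)
  let ?I = "{1..2*k+1}"
  define \<alpha> where "\<alpha> p l = s - (if l = p then b else 0)" for p l :: nat
  define V :: "nat \<Rightarrow> (nat \<Rightarrow> int ^ 'd) \<Rightarrow> ennreal" where "V p m = (\<Prod>l\<in>?I. wt (- \<alpha> p l) (m l))" for p m
  define c where "c = real (2 * k + 2) powr b"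
  have bf: "bounded_form ?I ?I (lin sg :: nat \<Rightarrow> int ^ 'd \<Rightarrow> int ^ 'd) UNIV (V p)" if p: "p \<in> ?I" for p
    unfolding V_def[abs_def]
  proof (rule bounded_form_lin_weights[OF _ _ _ assms(2)])
    have "(\<Sum>l\<in>?I. \<alpha> p l) = real (2 * k + 1) * s - (\<Sum>l\<in>?I. if l = p then b else 0)"
      unfolding \<alpha>_def sum_subtractf by simp
    also have "(\<Sum>l\<in>?I. if l = p then b else 0) = b" using p by (subst sum.delta) auto
    finally show "real (card ?I - 2) * \<beta> \<le> (\<Sum>l\<in>?I. \<alpha> p l)" using assms(6) by simp
  qed (use assms sg_cases in \<open>auto simp: \<alpha>_def\<close>)
  have "bounded_form ?I ?I (lin sg :: nat \<Rightarrow> int ^ 'd \<Rightarrow> int ^ 'd) UNIV (\<lambda>m. \<Sum>p\<in>?I. V p m)"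
    by (rule bounded_form_sum[OF _ bf]) simp
  then show "bounded_form ?I ?I (lin sg :: nat \<Rightarrow> int ^ 'd \<Rightarrow> int ^ 'd) UNIV (\<lambda>m. ennreal c * (\<Sum>p\<in>?I. V p m))"
    by (rule bounded_form_mono) (rule subset_refl order_refl)+
  fix E n
  have "wt b n \<le> ennreal c * (\<Sum>p\<in>?I. V p m) * (\<Prod>l\<in>?I. wt s (m l))" if m: "m \<in> XS ?I (lin sg) n" for m
  proof -
    have "Max ((\<lambda>l. bracket (m l)) ` ?I) \<in> (\<lambda>l. bracket (m l)) ` ?I" by (rule Max_in) auto
    then obtain p where p: "p \<in> ?I" "Max ((\<lambda>l. bracket (m l)) ` ?I) = bracket (m p)" by blast
    then have "\<And>l. l \<in> ?I \<Longrightarrow> bracket (m l) \<le> bracket (m p)" by (metis Max_ge finite_atLeastAtMost finite_imageI imageI)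
    then have "bracket ((m(0 := n)) 0) \<le> real (card {0..2*k+1}) * bracket (m p)"
      by (intro bracket_le_sum[OF _ _ _ lin_XS_0[OF m]]) (use sg_cases in auto)
    then have "bracket n powr b \<le> (real (2 * k + 2) * bracket (m p)) powr b" using assms(3) by (intro powr_mono2) auto
    also have "\<dots> = c * bracket (m p) powr b" unfolding c_def by (rule powr_mult)
    finally have "wt b n \<le> ennreal c * wt b (m p)"
      unfolding wt_def by (subst ennreal_mult[symmetric]) (auto simp: c_def intro: ennreal_leI)
    also have "wt b (m p) = V p m * (\<Prod>l\<in>?I. wt s (m l))"
    proof -
      have "V p m * (\<Prod>l\<in>?I. wt s (m l)) = (\<Prod>l\<in>?I. wt (if l = p then b else 0) (m l))"
        unfolding V_def prod.distrib[symmetric] wt_mult \<alpha>_def by (simp only: minus_diff_eq diff_add_cancel)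
      also have "\<dots> = (\<Prod>l\<in>?I. if l = p then wt b (m p) else 1)" by (intro prod.cong) auto
      also have "\<dots> = wt b (m p)" using p(1) by (subst prod.delta) auto
      finally show ?thesis by simp
    qed
    also have "V p m * (\<Prod>l\<in>?I. wt s (m l)) \<le> (\<Sum>p\<in>?I. V p m) * (\<Prod>l\<in>?I. wt s (m l))"
      using p(1) by (intro mult_right_mono member_le_sum) auto
    finally show ?thesis by (simp only: mult.assoc mult_left_mono zero_le)
  qed
  then show "\<exists>z. \<forall>m. m \<in> XS ?I (lin sg) n \<longrightarrow> m \<in> E \<longrightarrow> m \<in> XS ?I (lin sg) z \<and>
    wt b n \<le> ennreal c * (\<Sum>p\<in>?I. V p m) * (\<Prod>l\<in>?I. wt s (m l))" by blast
qed

lemma estimate_family: "estimate k \<E> N A \<Longrightarrow> \<E>' \<subseteq> \<E> \<Longrightarrow> estimate k \<E>' N A"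
  by (rule estimate_mono) auto

lemma combine_estimates:
  fixes N1 N2 N3 N4 :: "(int ^ 'd \<Rightarrow> complex) \<Rightarrow> ennreal"
  assumes 1: "estimate k {res_set R k |R :: (int ^ 'd) rel. size_order R} N1 A1"
    and 2: "estimate k {- res_set R k \<inter> phase_set k \<mu> |(R :: (int ^ 'd) rel) \<mu>. size_order R} N2 A2"
    and 3: "estimate k {- res_set R k |R :: (int ^ 'd) rel. size_order R} N3 A3"
    and 4: "estimate k {- res_set R k |R :: (int ^ 'd) rel. size_order R} N4 A4"
  shows "\<exists>C>0. \<forall>(R :: (int ^ 'd) rel) \<omega>. size_order R \<longrightarrow>
    (A1 \<omega> < \<infinity> \<longrightarrow> converges k (res_set R k) \<omega> \<and> N1 (multisum k (res_set R k) \<omega>) \<le> ennreal C * A1 \<omega>) \<and>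
    (A2 \<omega> < \<infinity> \<longrightarrow> (\<forall>\<mu>. converges k (- res_set R k \<inter> phase_set k \<mu>) \<omega>) \<and>
       (SUP \<mu>. N2 (multisum k (- res_set R k \<inter> phase_set k \<mu>) \<omega>)) \<le> ennreal C * A2 \<omega>) \<and>
    (A3 \<omega> < \<infinity> \<longrightarrow> converges k (- res_set R k) \<omega> \<and> N3 (multisum k (- res_set R k) \<omega>) \<le> ennreal C * A3 \<omega>) \<and>
    (A4 \<omega> < \<infinity> \<longrightarrow> converges k (- res_set R k) \<omega> \<and> N4 (multisum k (- res_set R k) \<omega>) \<le> ennreal C * A4 \<omega>)"
proof -
  have ex: "\<exists>C>0. \<forall>C'\<ge>C. \<forall>E\<in>\<E>. \<forall>\<omega>. A \<omega> < \<infinity> \<longrightarrow> converges k E \<omega> \<and> N (multisum k E \<omega>) \<le> ennreal C' * A \<omega>"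
    if "estimate k \<E> N A" for \<E> :: "(nat \<Rightarrow> int ^ 'd) set set" and N A
  proof -
    obtain C where C: "C > 0" "\<forall>E\<in>\<E>. \<forall>\<omega>. A \<omega> < top \<longrightarrow> converges k E \<omega> \<and> N (multisum k E \<omega>) \<le> ennreal C * A \<omega>"
      using \<open>estimate k \<E> N A\<close> unfolding estimate_def by (elim exE conjE)
    have "N (multisum k E \<omega>) \<le> ennreal C' * A \<omega>" if "E \<in> \<E>" "A \<omega> < top" "C' \<ge> C" for E \<omega> C'
      using C(2)[rule_format, OF that(1,2)] mult_right_mono[OF ennreal_leI[OF that(3)], of "A \<omega>"] by (auto intro: order_trans)
    then show ?thesis using C by (intro exI[of _ C]) (simp add: infinity_ennreal_def)
  qed
  obtain C1 where C1: "C1 > 0" "\<And>C (R :: (int ^ 'd) rel) \<omega>. C \<ge> C1 \<Longrightarrow> size_order R \<Longrightarrow> A1 \<omega> < \<infinity> \<Longrightarrow>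
      converges k (res_set R k) \<omega> \<and> N1 (multisum k (res_set R k) \<omega>) \<le> ennreal C * A1 \<omega>"
    using ex[OF 1] by blast
  obtain C2 where "C2 > 0" and C2': "\<forall>C\<ge>C2. \<forall>E\<in>{- res_set R k \<inter> phase_set k \<mu> |(R :: (int ^ 'd) rel) \<mu>. size_order R}. \<forall>\<omega>.
      A2 \<omega> < \<infinity> \<longrightarrow> converges k E \<omega> \<and> N2 (multisum k E \<omega>) \<le> ennreal C * A2 \<omega>"
    using ex[OF 2] by (elim exE conjE)
  then have C2: "C2 > 0" "\<And>C (R :: (int ^ 'd) rel) \<mu> \<omega>. C \<ge> C2 \<Longrightarrow> size_order R \<Longrightarrow> A2 \<omega> < \<infinity> \<Longrightarrow>
      converges k (- res_set R k \<inter> phase_set k \<mu>) \<omega> \<and> N2 (multisum k (- res_set R k \<inter> phase_set k \<mu>) \<omega>) \<le> ennreal C * A2 \<omega>"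
    by auto
  obtain C3 where C3: "C3 > 0" "\<And>C (R :: (int ^ 'd) rel) \<omega>. C \<ge> C3 \<Longrightarrow> size_order R \<Longrightarrow> A3 \<omega> < \<infinity> \<Longrightarrow>
      converges k (- res_set R k) \<omega> \<and> N3 (multisum k (- res_set R k) \<omega>) \<le> ennreal C * A3 \<omega>"
    using ex[OF 3] by blast
  obtain C4 where C4: "C4 > 0" "\<And>C (R :: (int ^ 'd) rel) \<omega>. C \<ge> C4 \<Longrightarrow> size_order R \<Longrightarrow> A4 \<omega> < \<infinity> \<Longrightarrow>
      converges k (- res_set R k) \<omega> \<and> N4 (multisum k (- res_set R k) \<omega>) \<le> ennreal C * A4 \<omega>"
    using ex[OF 4] by blast
  define C where "C = C1 + C2 + C3 + C4"
  have C: "C > 0" "C \<ge> C1" "C \<ge> C2" "C \<ge> C3" "C \<ge> C4" using C1(1) C2(1) C3(1) C4(1) by (auto simp: C_def)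
  show ?thesis
    using C(1) C1(2)[OF C(2)] C2(2)[OF C(3)] C3(2)[OF C(4)] C4(2)[OF C(5)]
    by (intro exI[of _ C] conjI allI impI SUP_least) blast+
qed

lemma estimate_Min_norms:
  assumes "\<And>q. q \<in> {1..2*k+1} \<Longrightarrow> estimate k \<E> (lnorm r \<sigma>) (\<lambda>\<omega>. lnorm r \<sigma> (\<omega> q) * (\<Prod>l\<in>{1..2*k+1} - {q}. lnorm 2 t (\<omega> l :: int ^ 'd \<Rightarrow> complex)))"
  shows "estimate k \<E> (lnorm r \<sigma>) (\<lambda>\<omega>. MIN q\<in>{1..2*k+1}. lnorm r \<sigma> (\<omega> q) * (\<Prod>l\<in>{1..2*k+1} - {q}. lnorm 2 t (\<omega> l)))"
  by (rule estimate_Min) (use assms in auto)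

text \<open>The last two estimates are claimed for every set of tuples, of which the complement of
  \<A> is an instance. The minimum over \<open>q\<close> is dissolved into separate
  estimates.\<close>

definition multilinear_estimates :: "'d::finite itself \<Rightarrow> nat \<Rightarrow> real \<Rightarrow> real \<Rightarrow> real \<Rightarrow> ennreal \<Rightarrow> real \<Rightarrow> bool" where
  "multilinear_estimates (T :: 'd itself) k s s1 s2 r \<sigma> \<longleftrightarrow>
    estimate k {res_set R k |R :: (int ^ 'd) rel. size_order R} (lnorm 2 s) (\<lambda>\<omega>. \<Prod>l=1..2*k+1. lnorm 2 s (\<omega> l)) \<and>
    (\<forall>q\<in>{1..2*k+1}. estimate k {- res_set R k \<inter> phase_set k \<mu> |(R :: (int ^ 'd) rel) \<mu>. size_order R} (lnorm r \<sigma>)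
      (\<lambda>\<omega>. lnorm r \<sigma> (\<omega> q) * (\<Prod>l\<in>{1..2*k+1} - {q}. lnorm 2 s1 (\<omega> l)))) \<and>
    (\<forall>q\<in>{1..2*k+1}. estimate k (UNIV :: (nat \<Rightarrow> int ^ 'd) set set) (lnorm r \<sigma>)
      (\<lambda>\<omega>. lnorm r \<sigma> (\<omega> q) * (\<Prod>l\<in>{1..2*k+1} - {q}. lnorm 2 s2 (\<omega> l)))) \<and>
    estimate k (UNIV :: (nat \<Rightarrow> int ^ 'd) set set) (lnorm r \<sigma>) (\<lambda>\<omega>. \<Prod>l=1..2*k+1. lnorm 2 s (\<omega> l))"

lemma estimates_large_dimension:
  assumes k: "k \<ge> 1" and d: "real CARD('d) \<ge> 2 + 2 / real k" and s: "s_crit CARD('d) k < s"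
    and s1: "s_crit CARD('d) k < s1" and s2: "real CARD('d) / 2 < s2"
  shows "multilinear_estimates TYPE('d::finite) k s s1 s2 2 (- s_crit CARD('d) k)"
proof -
  let ?c = "s_crit CARD('d) k"
  have A: "res_set R k = {}" for R :: "(int ^ 'd) rel" using d by (simp add: res_set_def)
  have c: "?c \<ge> 0" using d k by (simp add: s_crit_def field_simps)
  have "1 / real k \<ge> 0" by simp
  then have c2: "?c \<le> s2" using s2 unfolding s_crit_def by linarith
  have dk: "(CARD('d), k) \<noteq> (1, 1)" using d by auto
  show ?thesis unfolding multilinear_estimates_def
  proof (intro conjI ballI)
    show "estimate k {res_set R k |R :: (int ^ 'd) rel. size_order R} (lnorm 2 s) (\<lambda>\<omega>. \<Prod>l=1..2*k+1. lnorm 2 s (\<omega> l))"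
      by (rule estimate_family[OF estimate_empty]) (auto simp: A)
    fix q assume q: "q \<in> {1..2*k+1}"
    show "estimate k {- res_set R k \<inter> phase_set k \<mu> |(R :: (int ^ 'd) rel) \<mu>. size_order R} (lnorm 2 (- ?c))
      (\<lambda>\<omega>. lnorm 2 (- ?c) (\<omega> q) * (\<Prod>l\<in>{1..2*k+1} - {q}. lnorm 2 s1 (\<omega> l)))"
      by (rule estimate_transfer_phs(1)[OF q c _ k dk s1]) (use s1 in auto)
    show "estimate k (UNIV :: (nat \<Rightarrow> int ^ 'd) set set) (lnorm 2 (- ?c))
      (\<lambda>\<omega>. lnorm 2 (- ?c) (\<omega> q) * (\<Prod>l\<in>{1..2*k+1} - {q}. lnorm 2 s2 (\<omega> l)))"
      by (rule estimate_transfer_lin(1)[OF q c c2]) (use s2 in simp)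
  next
    \<comment> \<open>Chosen to satisfy the balance of \<open>estimate_lin_weights\<close> with
      equality. That \<open>\<beta>\<close> exceeds \<open>d / 2\<close> follows from
      \<open>k * d \<le> (2 * k + 2) * s_crit d k\<close>, which is equivalent to
      \<open>d \<ge> 2 + 2 / k\<close>.\<close>
    define \<beta> where "\<beta> = (?c + real (2 * k + 1) * s) / real (2 * k)"
    have k\<beta>: "real (2 * k) * \<beta> = ?c + real (2 * k + 1) * s" using k by (simp add: \<beta>_def)
    have kc: "real k * ?c = real k * real CARD('d) / 2 - 1" using k by (simp add: s_crit_def field_simps)
    have "real k * real CARD('d) \<le> real (2 * k + 2) * ?c"
    proof -
      have "real (2 * k + 2) * ?c = 2 * (real k * ?c) + 2 * ?c" by (simp add: algebra_simps)
      also have "\<dots> = real k * real CARD('d) - 2 + (real CARD('d) - 2 / real k)" unfolding kc by (simp add: s_crit_def)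
      finally show ?thesis using d by linarith
    qed
    also have "\<dots> < real (2 * k) * \<beta>" unfolding k\<beta> using s mult_strict_left_mono[OF s, of "real (2 * k + 1)"] by (simp add: algebra_simps)
    finally have "real k * real CARD('d) < real k * (2 * \<beta>)" by simp
    then have 1: "2 * \<beta> > real CARD('d)" using k by simp
    have "real (2 * k) * ?c \<le> real (2 * k) * \<beta>" unfolding k\<beta> using s mult_left_mono[OF less_imp_le[OF s], of "real (2 * k)"] by (simp add: algebra_simps) (use c in linarith)
    then have 2: "?c \<le> \<beta>" using k by simp
    have "real (2 * k) * s \<le> real (2 * k) * \<beta>" unfolding k\<beta> using s c by (simp add: algebra_simps)
    then have 3: "s \<le> \<beta>" using k by simp
    show "estimate k (UNIV :: (nat \<Rightarrow> int ^ 'd) set set) (lnorm 2 (- ?c)) (\<lambda>\<omega>. \<Prod>l=1..2*k+1. lnorm 2 s (\<omega> l))"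
      by (rule estimate_lin_weights[OF 1 c 2 _ 3]) (use k\<beta> s c in auto)
  qed
qed

lemma eps_pos: "k \<ge> 1 \<Longrightarrow> eps k > 0" and eps_le: "eps k \<le> 1 / (2 * (real k * (2 * real k + 1)))"
proof -
  let ?S = "{1 / (real k * (2 * real k + 1)), 3/5 - 9/16, (2 * real k + 3) / (4 * real k * (2 * real k + 1)), 3/10 - 1/6}"
  show "eps k > 0" if "k \<ge> 1" using that by (simp add: eps_def zero_less_mult_iff add_pos_nonneg)
  have "Min ?S \<le> 1 / (real k * (2 * real k + 1))" by (rule Min_le) auto
  then have "eps k \<le> 1/2 * (1 / (real k * (2 * real k + 1)))" unfolding eps_def by (rule mult_left_mono) simp
  then show "eps k \<le> 1 / (2 * (real k * (2 * real k + 1)))" by simp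
qed

lemma estimates_small_dimension:
  assumes k: "k \<ge> 2" and d: "CARD('d) \<in> {1, 2}" and s: "s_e CARD('d) k \<le> s"
    and s1: "s_crit CARD('d) k < s1" "s_e CARD('d) k - eps k / 2 \<le> s1" and s2: "real CARD('d) / 2 < s2"
  shows "multilinear_estimates TYPE('d::finite) k s s1 s2 top 0"
proof -
  define x where "x = real k"
  have x: "x \<ge> 2" using k by (simp add: x_def)
  have d2: "real CARD('d) \<le> 2" "real CARD('d) > 0" using d by auto
  have "2 / real k > 0" using k by simp
  then have big: "\<not> real CARD('d) \<ge> 2 + 2 / real k" using d2(1) by linarith
  have A: "res_set R k = (if k \<ge> 3 \<or> CARD('d) = 1 then res1 R k \<union> res2 R k else res1 R k \<union> res2 R k \<union> res3 R k)" for R :: "(int ^ 'd) rel"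
    using big k d unfolding res_set_def Let_def by simp
  have sub: "res1 R k \<union> res2 R k \<subseteq> res_set R k" for R :: "(int ^ 'd) rel" unfolding A by auto
  have s0: "s \<ge> 0"
  proof -
    have "s_e CARD('d) k \<ge> 0" using k by (auto simp: s_e_def)
    then show ?thesis using s by simp
  qed
  show ?thesis unfolding multilinear_estimates_def
  proof (intro conjI ballI)
    show "estimate k {res_set R k |R :: (int ^ 'd) rel. size_order R} (lnorm 2 s) (\<lambda>\<omega>. \<Prod>l=1..2*k+1. lnorm 2 s (\<omega> l))"
    proof (cases "k \<ge> 3 \<or> CARD('d) = 1")
      case True
      have e: "{res_set R k |R :: (int ^ 'd) rel. size_order R} = {res1 R k \<union> res2 R k |R :: (int ^ 'd) rel. size_order R}"
        using True unfolding A by simp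
      \<comment> \<open>The largest value that \<open>resonant_product\<close> admits. That it
        exceeds \<open>d / 2\<close> for \<open>s \<ge> s_e\<close> comes down to
        \<open>k * (2 * k - 1) > (2 * k + 1) * (k - 1)\<close>.\<close>
      define \<beta> where "\<beta> = x * s / (x - 1)"
      have k\<beta>: "(x - 1) * \<beta> = x * s" using x by (simp add: \<beta>_def)
      have "(x - 1) * s \<le> (x - 1) * \<beta>" unfolding k\<beta> using s0 by (simp add: algebra_simps)
      then have 1: "s \<le> \<beta>" using x by simp
      have 2: "real (k - 1) * \<beta> \<le> real k * s" using k\<beta> k by (simp add: x_def of_nat_diff)
      have "real CARD('d) * (2 * x - 1) \<le> 2 * (2 * x + 1) * s"
        using s x unfolding s_e_def x_def[symmetric] by (simp add: divide_le_eq mult.commute)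
      then have "x * (real CARD('d) * (2 * x - 1)) \<le> x * (2 * (2 * x + 1) * s)" using x by (intro mult_left_mono) auto
      also have "\<dots> = (2 * x + 1) * 2 * (x * s)" by (simp only: mult_ac)
      also have "\<dots> = (2 * x + 1) * (x - 1) * (2 * \<beta>)" unfolding k\<beta>[symmetric] by (simp only: mult_ac)
      finally have "x * (real CARD('d) * (2 * x - 1)) \<le> (2 * x + 1) * (x - 1) * (2 * \<beta>)" .
      moreover have "(2 * x + 1) * (x - 1) * real CARD('d) < x * (real CARD('d) * (2 * x - 1))" using d2 by (simp add: algebra_simps)
      ultimately have "(2 * x + 1) * (x - 1) * real CARD('d) < (2 * x + 1) * (x - 1) * (2 * \<beta>)" by linarith
      then have 3: "2 * \<beta> > real CARD('d)" using x by (subst (asm) mult_less_cancel_left_pos) auto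
      show ?thesis unfolding e by (rule estimate_resonances(1)[OF k s0 1 2 3])
    next
      case False
      then have k2: "k = 2" and dd: "CARD('d) = 2" using k d by auto
      have e: "{res_set R k |R :: (int ^ 'd) rel. size_order R} = {res1 R k \<union> res2 R k \<union> res3 R k |R :: (int ^ 'd) rel. size_order R}"
        using False unfolding A by simp
      \<comment> \<open>This makes \<open>9 * s / 5\<close> at least \<open>27 / 25\<close>, hence
        greater than \<open>d / 2 = 1\<close>.\<close>
      have "s \<ge> 3 / 5" using s by (simp add: s_e_def k2 dd)
      then show ?thesis unfolding e
        by (intro estimate_resonances(2)[where \<beta> = "9 * s / 5"]) (use k2 dd in auto)
    qed
    fix q assume q: "q \<in> {1..2*k+1}"
    have E: "\<exists>R \<mu>. size_order R \<and> E \<subseteq> phase_set k \<mu> - (res1 R k \<union> res2 R k)"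
      if "E \<in> {- res_set R k \<inter> phase_set k \<mu> |(R :: (int ^ 'd) rel) \<mu>. size_order R}" for E
      using that sub by blast
    show "estimate k {- res_set R k \<inter> phase_set k \<mu> |(R :: (int ^ 'd) rel) \<mu>. size_order R} (lnorm top 0)
      (\<lambda>\<omega>. lnorm top 0 (\<omega> q) * (\<Prod>l\<in>{1..2*k+1} - {q}. lnorm 2 s1 (\<omega> l)))"
    proof (cases "CARD('d) = 1")
      case True
      \<comment> \<open>In dimension one Schur's test requires more than
        \<open>1 / 2 - 1 / (2 * k)\<close>, which lies above \<open>s_crit\<close>. The number
        \<open>s_e\<close> exceeds this threshold by \<open>1 / (2 * k * (2 * k + 1))\<close>, and
        \<open>eps k / 2\<close> is smaller than this gap; this is the purpose of the second entry
        in the maximum that defines \<open>s1\<close>.\<close>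
      define \<eta> where "\<eta> = s1 - (1 / 2 - 1 / (2 * x))"
      have "eps k / 2 < 1 / (2 * (x * (2 * x + 1)))"
        using eps_le[of k] eps_pos[of k] k unfolding x_def[symmetric] by linarith
      moreover have "s_e CARD('d) k - (1 / 2 - 1 / (2 * x)) = 1 / (2 * (x * (2 * x + 1)))"
      proof -
        have "x \<noteq> 0" "2 * x + 1 \<noteq> 0" using x by auto
        then have "(2 * x - 1) / (2 * (2 * x + 1)) - (1 / 2 - 1 / (2 * x)) = 1 / (2 * (x * (2 * x + 1)))"
          by (simp add: divide_simps) (simp add: algebra_simps)
        then show ?thesis using True by (simp add: s_e_def x_def)
      qed
      ultimately have \<eta>: "\<eta> > 0" using s1(2) unfolding \<eta>_def by linarith
      have le: "\<eta> \<le> s1" "s1 \<le> 1 / 2 + \<eta>" using x by (simp_all add: \<eta>_def field_simps)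
      have "2 * \<eta> + real (2 * k - 2) * (1 / 2 + \<eta>) = 2 * (x * \<eta>) + x - 1"
        using k by (simp add: x_def of_nat_diff algebra_simps)
      also have "x * \<eta> = x * s1 - x / 2 + 1 / 2" using x by (simp add: \<eta>_def field_simps)
      finally have "2 * \<eta> + real (2 * k - 2) * (1 / 2 + \<eta>) \<le> real (2 * k) * s1" by (simp add: x_def)
      then show ?thesis by (intro estimate_nonresonant_1[OF k q True \<eta> le]) (use E in auto)
    next
      case False
      then have dd: "CARD('d) = 2" using d by auto
      \<comment> \<open>In dimension two the threshold \<open>1 - 1 / k\<close> is
        \<open>s_crit\<close> itself.\<close>
      define \<eta> where "\<eta> = s1 - (1 - 1 / x)"
      have \<eta>: "\<eta> > 0" using s1(1) by (simp add: \<eta>_def s_crit_def dd x_def)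
      have le: "1 / 2 + \<eta> \<le> s1" "s1 \<le> 1 + \<eta>" using x by (simp_all add: \<eta>_def field_simps)
      have "4 * (1 / 2 + \<eta>) + real (2 * k - 4) * (1 + \<eta>) = 2 * (x * \<eta>) + 2 * x - 2"
        using k by (simp add: x_def of_nat_diff algebra_simps)
      also have "x * \<eta> = x * s1 - x + 1" using x by (simp add: \<eta>_def field_simps)
      finally have "4 * (1 / 2 + \<eta>) + real (2 * k - 4) * (1 + \<eta>) \<le> real (2 * k) * s1" by (simp add: x_def)
      then show ?thesis by (intro estimate_nonresonant_2[OF k q dd \<eta> le]) (use E in auto)
    qed
    show "estimate k (UNIV :: (nat \<Rightarrow> int ^ 'd) set set) (lnorm top 0)
      (\<lambda>\<omega>. lnorm top 0 (\<omega> q) * (\<Prod>l\<in>{1..2*k+1} - {q}. lnorm 2 s2 (\<omega> l)))"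
      by (rule estimate_inf_trivial[OF _ q]) (use s2 in simp)
  next
    show "estimate k (UNIV :: (nat \<Rightarrow> int ^ 'd) set set) (lnorm top 0) (\<lambda>\<omega>. \<Prod>l=1..2*k+1. lnorm 2 s (\<omega> l))"
      by (rule estimate_endpoint) (use k s in auto)
  qed
qed

text \<open>The exponents come from interpolating with \<open>1 - \<theta> = (2 * d - 3) / 5\<close>
  between \<open>\<ell>^2\<close> with weight exponent \<open>- s_crit\<close>, where the inputs
  need more than \<open>d / 2 - 1\<close>, and \<open>\<ell>^\<infinity>\<close>, where they need
  more than \<open>(d - 1) / 2\<close>. This gives \<open>\<rho> = 2 / (1 - \<theta>)\<close>,
  \<open>\<sigma> = - (1 - \<theta>) * (d / 2 - 1)\<close> and the threshold
  \<open>d / 2 - 1 + \<theta> / 2 = (3 * d - 2) / 10\<close>.\<close>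

lemma estimates_cubic:
  fixes s s1 s2 s0 :: real
  defines "s0 \<equiv> (3 * real CARD('d) - 2) / 10"
  assumes d: "CARD('d) \<in> {2, 3}" and s: "s0 < s" "s0 < s1" and s2: "real CARD('d) / 2 < s2"
  shows "multilinear_estimates TYPE('d::finite) 1 s s1 s2 (ennreal (10 / (2 * real CARD('d) - 3)))
    (- ((2 * real CARD('d) - 3) * (real CARD('d) - 2) / 10))"
proof -
  define D where "D = real CARD('d)"
  have D: "D = 2 \<or> D = 3" using d by (auto simp: D_def)
  have A: "res_set R 1 = {m \<in> tuples 1. m 2 = m 1 \<or> m 2 = m 3}" for R :: "(int ^ 'd) rel"
    using d unfolding res_set_def Let_def by auto
  define \<rho> \<sigma> \<theta> c where "\<rho> = 10 / (2 * D - 3)" and "\<sigma> = - ((2 * D - 3) * (D - 2) / 10)" and "\<theta> = (8 - 2 * D) / 5" and "c = D / 2 - 1"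
  have s0: "s0 = (3 * D - 2) / 10" unfolding s0_def D_def by (rule refl)
  have \<theta>: "0 < \<theta>" "\<theta> < 1" and \<rho>: "(1 - \<theta>) * \<rho> = 2" and \<sigma>: "\<sigma> = - (1 - \<theta>) * c" and c: "c \<ge> 0" and \<rho>2: "\<rho> > 2"
    using D by (auto simp: \<theta>_def \<rho>_def \<sigma>_def c_def)
  have crit: "s_crit CARD('d) 1 = c" by (simp add: s_crit_def c_def D_def)
  let ?\<E> = "{- res_set R 1 \<inter> phase_set 1 \<mu> |(R :: (int ^ 'd) rel) \<mu>. size_order R}"
  show ?thesis unfolding D_def[symmetric] \<rho>_def[symmetric] \<sigma>_def[symmetric] multilinear_estimates_def
  proof (intro conjI ballI)
    have "s \<ge> 0" using s s0 D by auto
    from estimate_diagonal_cubic[OF this]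
    show "estimate 1 {res_set R 1 |R :: (int ^ 'd) rel. size_order R} (lnorm 2 s) (\<lambda>\<omega>. \<Prod>l=1..2*1+1. lnorm 2 s (\<omega> l))"
      by (rule estimate_family) (auto simp only: A)
    fix q :: nat assume q: "q \<in> {1..2*1+1}"
    define \<delta> where "\<delta> = s1 - s0"
    have \<delta>: "\<delta> > 0" using s by (simp add: \<delta>_def)
    have dk: "(CARD('d), 1) \<noteq> (1, 1 :: nat)" using d by auto
    show "estimate 1 ?\<E> (lnorm (ennreal \<rho>) \<sigma>) (\<lambda>\<omega>. lnorm (ennreal \<rho>) \<sigma> (\<omega> q) * (\<Prod>l\<in>{1..2*1+1} - {q}. lnorm 2 s1 (\<omega> l)))"
    proof (rule estimate_interpolate[OF q \<theta> _ _ \<rho> \<sigma>])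
      show "estimate 1 ?\<E> (lnorm 2 (- c)) (\<lambda>\<omega>. lnorm 2 (- c) (\<omega> q) * (\<Prod>l\<in>{1..2*1+1} - {q}. lnorm 2 (c + \<delta>) (\<omega> l)))"
        by (rule estimate_transfer_phs(1)[OF q c _ _ dk]) (use \<delta> crit in auto)
      show "estimate 1 ?\<E> (lnorm top 0) (\<lambda>\<omega>. lnorm top 0 (\<omega> q) * (\<Prod>l\<in>{1..2*1+1} - {q}. lnorm 2 ((D - 1) / 2 + \<delta>) (\<omega> l)))"
      proof (rule estimate_nonresonant_cubic)
        show "2 * ((D - 1) / 2 + \<delta>) > real CARD('d) - 1" using \<delta> unfolding D_def[symmetric] by (simp add: field_simps)
      qed (use q A in auto)
      show "s1 = (1 - \<theta>) * (c + \<delta>) + \<theta> * ((D - 1) / 2 + \<delta>)"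
        using D by (auto simp: \<theta>_def c_def \<delta>_def s0 field_simps)
    qed
    show "estimate 1 (UNIV :: (nat \<Rightarrow> int ^ 'd) set set) (lnorm (ennreal \<rho>) \<sigma>)
      (\<lambda>\<omega>. lnorm (ennreal \<rho>) \<sigma> (\<omega> q) * (\<Prod>l\<in>{1..2*1+1} - {q}. lnorm 2 s2 (\<omega> l)))"
    proof (rule estimate_interpolate[OF q \<theta> _ _ \<rho> \<sigma>])
      show "estimate 1 (UNIV :: (nat \<Rightarrow> int ^ 'd) set set) (lnorm 2 (- c)) (\<lambda>\<omega>. lnorm 2 (- c) (\<omega> q) * (\<Prod>l\<in>{1..2*1+1} - {q}. lnorm 2 s2 (\<omega> l)))"
        by (rule estimate_transfer_lin(1)[OF q c]) (use s2 in \<open>auto simp: c_def D_def\<close>)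
      show "estimate 1 (UNIV :: (nat \<Rightarrow> int ^ 'd) set set) (lnorm top 0) (\<lambda>\<omega>. lnorm top 0 (\<omega> q) * (\<Prod>l\<in>{1..2*1+1} - {q}. lnorm 2 s2 (\<omega> l)))"
        by (rule estimate_inf_trivial[OF _ q]) (use s2 in simp)
      show "s2 = (1 - \<theta>) * s2 + \<theta> * s2" by (simp add: algebra_simps)
    qed
  next
    \<comment> \<open>For (B3) the endpoints are chosen such that both have the threshold
      \<open>s0\<close>: the balances \<open>a + 3 * s0 = D\<close> and
      \<open>3 * s0 - b = D / 2\<close> determine \<open>a\<close> and \<open>b\<close>. The values
      of \<open>\<beta>\<close> below satisfy the respective balance with equality and exceed
      \<open>D / 2\<close> because \<open>s > s0\<close>.\<close>
    define a b where "a = D - 3 * s0" and "b = 3 * s0 - D / 2"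
    show "estimate 1 (UNIV :: (nat \<Rightarrow> int ^ 'd) set set) (lnorm (ennreal \<rho>) \<sigma>) (\<lambda>\<omega>. \<Prod>l=1..2*1+1. lnorm 2 s (\<omega> l))"
    proof (rule estimate_l2_inf[OF _ _ \<rho>2])
      show "estimate 1 (UNIV :: (nat \<Rightarrow> int ^ 'd) set set) (lnorm 2 (- a)) (\<lambda>\<omega>. \<Prod>l=1..2*1+1. lnorm 2 s (\<omega> l))"
        by (rule estimate_lin_weights[where \<beta> = "(a + 3 * s) / 2"]) (use s D in \<open>auto simp: a_def s0 D_def[symmetric]\<close>)
      show "estimate 1 (UNIV :: (nat \<Rightarrow> int ^ 'd) set set) (lnorm top b) (\<lambda>\<omega>. \<Prod>l=1..2*1+1. lnorm 2 s (\<omega> l))"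
        by (rule estimate_inf_weighted[where \<beta> = "3 * s - b"]) (use s D in \<open>auto simp: b_def s0 D_def[symmetric]\<close>)
      show "\<sigma> * \<rho> = - 2 * a + (\<rho> - 2) * b"
        using D by (auto simp: \<sigma>_def \<rho>_def a_def b_def s0)
    qed
  qed
qed

lemma multilinear_estimatesD:
  assumes "multilinear_estimates TYPE('d::finite) k s s1 s2 r \<sigma>"
  shows "\<exists>C>0. \<forall>(R :: (int ^ 'd) rel) (\<omega> :: nat \<Rightarrow> int ^ 'd \<Rightarrow> complex). size_order R \<longrightarrow>
      ((\<Prod>l=1..2*k+1. lnorm 2 s (\<omega> l)) < \<infinity> \<longrightarrow>
         converges k (res_set R k) \<omega> \<and>
         lnorm 2 s (multisum k (res_set R k) \<omega>) \<le> ennreal C * (\<Prod>l=1..2*k+1. lnorm 2 s (\<omega> l))) \<and>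
      ((MIN q\<in>{1..2*k+1}. lnorm r \<sigma> (\<omega> q) * (\<Prod>l\<in>{1..2*k+1}-{q}. lnorm 2 s1 (\<omega> l))) < \<infinity> \<longrightarrow>
         (\<forall>\<mu>. converges k (- res_set R k \<inter> phase_set k \<mu>) \<omega>) \<and>
         (SUP \<mu>. lnorm r \<sigma> (multisum k (- res_set R k \<inter> phase_set k \<mu>) \<omega>))
           \<le> ennreal C * (MIN q\<in>{1..2*k+1}. lnorm r \<sigma> (\<omega> q) * (\<Prod>l\<in>{1..2*k+1}-{q}. lnorm 2 s1 (\<omega> l)))) \<and>
      ((MIN q\<in>{1..2*k+1}. lnorm r \<sigma> (\<omega> q) * (\<Prod>l\<in>{1..2*k+1}-{q}. lnorm 2 s2 (\<omega> l))) < \<infinity> \<longrightarrow>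
         converges k (- res_set R k) \<omega> \<and>
         lnorm r \<sigma> (multisum k (- res_set R k) \<omega>)
           \<le> ennreal C * (MIN q\<in>{1..2*k+1}. lnorm r \<sigma> (\<omega> q) * (\<Prod>l\<in>{1..2*k+1}-{q}. lnorm 2 s2 (\<omega> l)))) \<and>
      ((\<Prod>l=1..2*k+1. lnorm 2 s (\<omega> l)) < \<infinity> \<longrightarrow>
         converges k (- res_set R k) \<omega> \<and>
         lnorm r \<sigma> (multisum k (- res_set R k) \<omega>) \<le> ennreal C * (\<Prod>l=1..2*k+1. lnorm 2 s (\<omega> l)))"
proof -
  note e = assms[unfolded multilinear_estimates_def]
  show ?thesis
    by (rule combine_estimates[OF e[THEN conjunct1] estimate_Min_norms estimate_Min_norms
        estimate_family[OF e[THEN conjunct2, THEN conjunct2, THEN conjunct2] subset_UNIV]])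
      (use e estimate_family[OF _ subset_UNIV] in blast)+
qed

lemma exponents_estimates:
  assumes k: "k \<ge> 1" and dk: "(CARD('d::finite), k) \<noteq> (1, 1)" and s: "s > s_crit CARD('d) k"
    and s3: "k = 1 \<Longrightarrow> CARD('d) \<in> {2, 3} \<Longrightarrow> s > (3 * real CARD('d) - 2) / 10"
    and se: "k \<ge> 2 \<or> CARD('d) \<ge> 4 \<Longrightarrow> s \<ge> s_e CARD('d) k"
  obtains s1 r \<sigma> where "exponents CARD('d) k s = (s1, r, \<sigma>)" "s_crit CARD('d) k < s1" "s1 < s" "2 \<le> r" "- s \<le> \<sigma>" "\<sigma> \<le> 0"
    "multilinear_estimates TYPE('d) k s s1 (max (real CARD('d) / 2) s + 1) r \<sigma>"
proof -
  have pos: "CARD('d) \<ge> 1" using zero_less_card_finite[where 'a = 'd] by linarith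
  \<comment> \<open>The ranges are exhaustive: for \<open>k = 1\<close> the case
    \<open>d = 1\<close> is excluded and every \<open>d \<ge> 4\<close> belongs to the first range,
    and for \<open>k \<ge> 2\<close> every \<open>d \<ge> 3\<close> does.\<close>
  consider "real CARD('d) \<ge> 2 + 2 / real k" | "CARD('d) \<in> {1, 2}" "k \<ge> 2" | "CARD('d) \<in> {2, 3}" "k = 1"
  proof (cases "k = 1")
    case True
    then have "CARD('d) \<noteq> 1" using dk by simp
    then have "CARD('d) \<ge> 2" using pos by linarith
    then have "CARD('d) = 2 \<or> CARD('d) = 3 \<or> CARD('d) \<ge> 4" by linarith
    then show thesis using that(1,3) True by auto
  next
    case False
    then have k2: "k \<ge> 2" using k by simp
    show thesis
    proof (cases "CARD('d) \<le> 2")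
      case True
      then have "CARD('d) = 1 \<or> CARD('d) = 2" using pos by linarith
      then show thesis using that(2) k2 by blast
    next
      case False
      then have "real CARD('d) \<ge> 3" by simp
      moreover have "2 / real k \<le> 1" using k2 by simp
      ultimately show thesis using that(1) by linarith
    qed
  qed
  then show thesis
  proof cases
    case 1
    have "s_crit CARD('d) k \<ge> 0" using 1 k by (simp add: s_crit_def field_simps)
    then show thesis
      by (intro that[of "(s + s_crit CARD('d) k) / 2" 2 "- s_crit CARD('d) k"] estimates_large_dimension)
        (use 1 k s in \<open>auto simp: exponents_def\<close>)
  next
    case 2
    let ?s1 = "max ((s + s_crit CARD('d) k) / 2) (s_e CARD('d) k - 1 / 2 * eps k)"
    have "2 / real k > 0" using 2 by simp
    moreover have "real CARD('d) \<le> 2" using 2 by auto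
    ultimately have "\<not> real CARD('d) \<ge> 2 + 2 / real k" by linarith
    then have e: "exponents CARD('d) k s = (?s1, \<infinity>, 0)" using 2 by (simp add: exponents_def)
    have s0: "s \<ge> 0"
    proof -
      have "s_e CARD('d) k \<ge> 0" using 2 by (auto simp: s_e_def)
      then show ?thesis using se 2 by simp
    qed
    have "?s1 < s" using s se 2 eps_pos[OF k] by auto
    moreover have "s_crit CARD('d) k < ?s1" using s by (simp add: less_max_iff_disj)
    moreover have "multilinear_estimates TYPE('d) k s ?s1 (max (real CARD('d) / 2) s + 1) \<infinity> 0"
      unfolding infinity_ennreal_def
      by (rule estimates_small_dimension) (use 2 se s in \<open>auto simp: less_max_iff_disj\<close>)
    ultimately show thesis using that[OF e] s0 by simp
  next
    case 3
    define D where "D = real CARD('d)"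
    have D: "D = 2 \<or> D = 3" using 3 by (auto simp: D_def)
    let ?s1 = "1 / 2 * (s + (3 * D - 2) / 10)"
    have e: "exponents CARD('d) k s = (?s1, ennreal (10 / (2 * D - 3)), - ((2 * D - 3) * (D - 2) / 10))"
      using 3 unfolding exponents_def D_def by auto
    have s': "(3 * D - 2) / 10 < s" using s3 3 by (simp add: D_def)
    have "1 / 2 * (s + y) < s \<and> y < 1 / 2 * (s + y)" if "y < s" for y using that by simp
    from this[OF s'] have s1: "?s1 < s" and s1': "(3 * D - 2) / 10 < ?s1" by blast+
    \<comment> \<open>Equivalent to \<open>d < 4\<close>.\<close>
    have "s_crit CARD('d) k < (3 * D - 2) / 10" using D 3 by (auto simp: s_crit_def D_def[symmetric])
    then have "s_crit CARD('d) k < ?s1" using s1' by (rule less_trans)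
    moreover have "2 \<le> ennreal (10 / (2 * D - 3))" using D by (auto simp: ennreal_le_iff2 numeral_le_ennreal_iff)
    moreover have "- s \<le> - ((2 * D - 3) * (D - 2) / 10)" "- ((2 * D - 3) * (D - 2) / 10) \<le> 0" using D s' by auto
    moreover have "multilinear_estimates TYPE('d) k s ?s1 (max (real CARD('d) / 2) s + 1) (ennreal (10 / (2 * D - 3))) (- ((2 * D - 3) * (D - 2) / 10))"
      unfolding 3(2) D_def
      by (rule estimates_cubic) (use 3 s' s1' D_def in auto)
    ultimately show thesis using s1 by (intro that[OF e])
  qed
qed

theorem proposition1p5:
  fixes d k :: nat
  assumes d: "d = CARD('d::finite)"
    and k: "k \<ge> 1"
    and dk: "(d, k) \<noteq> (1, 1)"
  shows
    "s_crit d k \<ge> 0 \<and>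
     \<comment> \<open>(i), (B1)\<close>
     (\<forall>s1 > s_crit d k. \<exists>C > 0. \<forall>\<omega> :: nat \<Rightarrow> int ^ 'd \<Rightarrow> complex.
        (\<Prod>l=1..2*k+1. lnorm 2 s1 (\<omega> l)) < \<infinity> \<longrightarrow>
          (\<forall>\<mu>. converges k (phase_set k \<mu>) \<omega>) \<and>
          (SUP \<mu>. lnorm 2 s1 (multisum k (phase_set k \<mu>) \<omega>))
            \<le> ennreal C * (\<Prod>l=1..2*k+1. lnorm 2 s1 (\<omega> l))) \<and>
     \<comment> \<open>(i), (B1)'\<close>
     (\<forall>s2 > real d / 2. \<exists>C > 0. \<forall>\<omega> :: nat \<Rightarrow> int ^ 'd \<Rightarrow> complex.
        (\<Prod>l=1..2*k+1. lnorm 2 s2 (\<omega> l)) < \<infinity> \<longrightarrow>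
          converges k UNIV \<omega> \<and>
          lnorm 2 s2 (multisum k UNIV \<omega>)
            \<le> ennreal C * (\<Prod>l=1..2*k+1. lnorm 2 s2 (\<omega> l))) \<and>
     \<comment> \<open>(ii)\<close>
     (\<forall>s > s_crit d k.
        (k = 1 \<and> d \<in> {2, 3} \<longrightarrow> s > (3 * real d - 2) / 10) \<and>
        (k \<ge> 2 \<or> d \<ge> 4 \<longrightarrow> s \<ge> s_e d k) \<longrightarrow>
        (let s2 = max (real d / 2) s + 1; (s1, r, \<sigma>) = exponents d k s in
           s_crit d k < s1 \<and> s1 < s \<and> 2 \<le> r \<and> - s \<le> \<sigma> \<and> \<sigma> \<le> 0 \<and>
           (\<exists>C > 0. \<forall>(R :: (int ^ 'd) rel) (\<omega> :: nat \<Rightarrow> int ^ 'd \<Rightarrow> complex). size_order R \<longrightarrow>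
              \<comment> \<open>(R)\<close>
              ((\<Prod>l=1..2*k+1. lnorm 2 s (\<omega> l)) < \<infinity> \<longrightarrow>
                 converges k (res_set R k) \<omega> \<and>
                 lnorm 2 s (multisum k (res_set R k) \<omega>)
                   \<le> ennreal C * (\<Prod>l=1..2*k+1. lnorm 2 s (\<omega> l))) \<and>
              \<comment> \<open>(B2)\<close>
              ((MIN q\<in>{1..2*k+1}. lnorm r \<sigma> (\<omega> q) * (\<Prod>l\<in>{1..2*k+1}-{q}. lnorm 2 s1 (\<omega> l))) < \<infinity> \<longrightarrow>
                 (\<forall>\<mu>. converges k (- res_set R k \<inter> phase_set k \<mu>) \<omega>) \<and>
                 (SUP \<mu>. lnorm r \<sigma> (multisum k (- res_set R k \<inter> phase_set k \<mu>) \<omega>))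
                   \<le> ennreal C * (MIN q\<in>{1..2*k+1}.
                       lnorm r \<sigma> (\<omega> q) * (\<Prod>l\<in>{1..2*k+1}-{q}. lnorm 2 s1 (\<omega> l)))) \<and>
              \<comment> \<open>(B2)'\<close>
              ((MIN q\<in>{1..2*k+1}. lnorm r \<sigma> (\<omega> q) * (\<Prod>l\<in>{1..2*k+1}-{q}. lnorm 2 s2 (\<omega> l))) < \<infinity> \<longrightarrow>
                 converges k (- res_set R k) \<omega> \<and>
                 lnorm r \<sigma> (multisum k (- res_set R k) \<omega>)
                   \<le> ennreal C * (MIN q\<in>{1..2*k+1}.
                       lnorm r \<sigma> (\<omega> q) * (\<Prod>l\<in>{1..2*k+1}-{q}. lnorm 2 s2 (\<omega> l)))) \<and>
              \<comment> \<open>(B3)\<close>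
              ((\<Prod>l=1..2*k+1. lnorm 2 s (\<omega> l)) < \<infinity> \<longrightarrow>
                 converges k (- res_set R k) \<omega> \<and>
                 lnorm r \<sigma> (multisum k (- res_set R k) \<omega>)
                   \<le> ennreal C * (\<Prod>l=1..2*k+1. lnorm 2 s (\<omega> l))))))"
proof -
  have dk': "(CARD('d), k) \<noteq> (1, 1)" using dk d by simp
  have crit: "s_crit d k \<ge> 0"
  proof (cases "k = 1")
    case True
    then have "d \<noteq> 1" using dk by simp
    moreover have "d > 0" unfolding d by (rule zero_less_card_finite)
    ultimately have "d \<ge> 2" by linarith
    then show ?thesis using True by (simp add: s_crit_def)
  next
    case False
    then have "1 / real k \<le> 1 / 2" using k by (simp add: field_simps)
    moreover have "real d \<ge> 1" using d zero_less_card_finite[where 'a = 'd] by simp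
    ultimately show ?thesis unfolding s_crit_def by linarith
  qed
  have B1: "\<exists>C > 0. \<forall>\<omega> :: nat \<Rightarrow> int ^ 'd \<Rightarrow> complex.
        (\<Prod>l=1..2*k+1. lnorm 2 s1 (\<omega> l)) < \<infinity> \<longrightarrow>
          (\<forall>\<mu>. converges k (phase_set k \<mu>) \<omega>) \<and>
          (SUP \<mu>. lnorm 2 s1 (multisum k (phase_set k \<mu>) \<omega>))
            \<le> ennreal C * (\<Prod>l=1..2*k+1. lnorm 2 s1 (\<omega> l))" if s1: "s1 > s_crit d k" for s1
  proof -
    have "estimate k (range (phase_set k) :: (nat \<Rightarrow> int ^ 'd) set set) (lnorm 2 s1) (\<lambda>\<omega>. \<Prod>l=1..2*k+1. lnorm 2 s1 (\<omega> l))"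
      by (rule estimate_transfer_phs(2)[of 1 k 0]) (use s1 crit k dk' d in auto)
    then obtain C where C: "C > 0" "\<forall>E\<in>range (phase_set k). \<forall>\<omega> :: nat \<Rightarrow> int ^ 'd \<Rightarrow> complex.
        (\<Prod>l=1..2*k+1. lnorm 2 s1 (\<omega> l)) < top \<longrightarrow>
        converges k E \<omega> \<and> lnorm 2 s1 (multisum k E \<omega>) \<le> ennreal C * (\<Prod>l=1..2*k+1. lnorm 2 s1 (\<omega> l))"
      unfolding estimate_def by (elim exE conjE)
    show ?thesis
      by (intro exI[of _ C] conjI C(1) allI impI SUP_least; use C(2) in \<open>unfold infinity_ennreal_def, blast\<close>)
  qed
  have B1': "\<exists>C > 0. \<forall>\<omega> :: nat \<Rightarrow> int ^ 'd \<Rightarrow> complex.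
        (\<Prod>l=1..2*k+1. lnorm 2 s2 (\<omega> l)) < \<infinity> \<longrightarrow>
          converges k UNIV \<omega> \<and>
          lnorm 2 s2 (multisum k UNIV \<omega>)
            \<le> ennreal C * (\<Prod>l=1..2*k+1. lnorm 2 s2 (\<omega> l))" if s2: "s2 > real d / 2" for s2
  proof -
    have "estimate k (UNIV :: (nat \<Rightarrow> int ^ 'd) set set) (lnorm 2 s2) (\<lambda>\<omega>. \<Prod>l=1..2*k+1. lnorm 2 s2 (\<omega> l))"
      by (rule estimate_transfer_lin(2)[of 1 k 0]) (use s2 d in auto)
    then show ?thesis unfolding estimate_def infinity_ennreal_def by blast
  qed
  show ?thesis
  proof (intro conjI allI impI crit)
    fix s
    assume s: "s > s_crit d k" and *: "(k = 1 \<and> d \<in> {2, 3} \<longrightarrow> s > (3 * real d - 2) / 10) \<and>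
        (k \<ge> 2 \<or> d \<ge> 4 \<longrightarrow> s \<ge> s_e d k)"
    obtain s1 r \<sigma> where e: "exponents d k s = (s1, r, \<sigma>)" "s_crit d k < s1" "s1 < s" "2 \<le> r" "- s \<le> \<sigma>" "\<sigma> \<le> 0"
      "multilinear_estimates TYPE('d) k s s1 (max (real d / 2) s + 1) r \<sigma>"
      unfolding d by (rule exponents_estimates[OF k dk', of s]) (use s * in \<open>auto simp: d\<close>)
    show "let s2 = max (real d / 2) s + 1; (s1, r, \<sigma>) = exponents d k s in
           s_crit d k < s1 \<and> s1 < s \<and> 2 \<le> r \<and> - s \<le> \<sigma> \<and> \<sigma> \<le> 0 \<and>
           (\<exists>C > 0. \<forall>(R :: (int ^ 'd) rel) (\<omega> :: nat \<Rightarrow> int ^ 'd \<Rightarrow> complex). size_order R \<longrightarrow>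
              ((\<Prod>l=1..2*k+1. lnorm 2 s (\<omega> l)) < \<infinity> \<longrightarrow>
                 converges k (res_set R k) \<omega> \<and>
                 lnorm 2 s (multisum k (res_set R k) \<omega>)
                   \<le> ennreal C * (\<Prod>l=1..2*k+1. lnorm 2 s (\<omega> l))) \<and>
              ((MIN q\<in>{1..2*k+1}. lnorm r \<sigma> (\<omega> q) * (\<Prod>l\<in>{1..2*k+1}-{q}. lnorm 2 s1 (\<omega> l))) < \<infinity> \<longrightarrow>
                 (\<forall>\<mu>. converges k (- res_set R k \<inter> phase_set k \<mu>) \<omega>) \<and>
                 (SUP \<mu>. lnorm r \<sigma> (multisum k (- res_set R k \<inter> phase_set k \<mu>) \<omega>))
                   \<le> ennreal C * (MIN q\<in>{1..2*k+1}.
                       lnorm r \<sigma> (\<omega> q) * (\<Prod>l\<in>{1..2*k+1}-{q}. lnorm 2 s1 (\<omega> l)))) \<and>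
              ((MIN q\<in>{1..2*k+1}. lnorm r \<sigma> (\<omega> q) * (\<Prod>l\<in>{1..2*k+1}-{q}. lnorm 2 s2 (\<omega> l))) < \<infinity> \<longrightarrow>
                 converges k (- res_set R k) \<omega> \<and>
                 lnorm r \<sigma> (multisum k (- res_set R k) \<omega>)
                   \<le> ennreal C * (MIN q\<in>{1..2*k+1}.
                       lnorm r \<sigma> (\<omega> q) * (\<Prod>l\<in>{1..2*k+1}-{q}. lnorm 2 s2 (\<omega> l)))) \<and>
              ((\<Prod>l=1..2*k+1. lnorm 2 s (\<omega> l)) < \<infinity> \<longrightarrow>
                 converges k (- res_set R k) \<omega> \<and>
                 lnorm r \<sigma> (multisum k (- res_set R k) \<omega>)
                   \<le> ennreal C * (\<Prod>l=1..2*k+1. lnorm 2 s (\<omega> l))))"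
      unfolding Let_def e(1) prod.case
      by (intro conjI e(2-6) multilinear_estimatesD[OF e(7)])
  qed (fact B1 B1')+
qed

end
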